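(* Let $n\geq 1$ and let $v$ be a valuation on the rational function field $F=K(x_1,\ldots,x_n)$ in $n$ variables over a field $K$. Set $\rho=\mathrm{rr}\,(vF/vK)$ and $\tau=\mathrm{trdeg}\,Fv|Kv$. Then $n\geq\rho+\tau$, $vF/vK$ is countable, and $Fv|Kv$ is countably generated. If $n=\rho+\tau$, then $vF/vK$ is finitely generated and $Fv|Kv$ is a finitely generated field extension, and moreover: (i) if $v$ is trivial on $K$ and $\rho=1$, then $Fv$ is a simple algebraic extension of a rational function field in $\tau$ variables over $Kv$ (or of $Kv$ itself if $\tau=0$), or a rational function field in one variable over a finitely generated field extension of $Kv$ of transcendence degree $\tau-1$; (ii) if $n=\tau$, then $Fv$ is a rational function field in one variable over a finitely generated field extension of $Kv$ of transcendence degree $\tau-1$. If $\rho=0=\tau$, then there is an immediate extension of $(\tilde{K},v)$ of transcendence degree $n$ (for any extension of $v$ from $K$ to $\tilde{K}$).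
   Context: For a valued field $(L,v)$, $vL$ denotes the value group and $Lv$ the residue field. The rational rank of an abelian group $A$ is $\mathrm{rr}\,A=\dim_{\mathbb{Q}}(\mathbb{Q}\otimes_{\mathbb{Z}}A)$. $\tilde{K}$ denotes the algebraic closure of $K$. An extension $(L'|L,v)$ of valued fields is immediate if $vL'=vL$ and $L'v=Lv$. *)

theory Defs
  imports
    "HOL-Algebra.Algebraic_Closure_Type"
    "HOL-Algebra.Generated_Fields"
    "HOL-Algebra.Free_Abelian_Groups"
    "HOL-Library.Extended_Nat"
    "HOL-Library.Poly_Mapping"
    "HOL-Library.Countable_Set"
begin

section \<open>Subfields of a field type\<close>

text \<open>
  Fields are subfields (as sets) of an ambient type of class \<open>field\<close>.  The ambient type seen
  as a ring record makes \<open>subfield\<close>, \<open>generate_field\<close>, \<open>ring_hom\<close>, ... applicable to them.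
\<close>

abbreviation amb :: "'a::field ring"
  where "amb \<equiv> ring_of_type_algebra"

definition adjoin :: "'a::field set \<Rightarrow> 'a set \<Rightarrow> 'a set"
  where "adjoin K S = generate_field amb (K \<union> S)"

definition finitely_generated_ext :: "'a::field set \<Rightarrow> 'a set \<Rightarrow> bool"
  where "finitely_generated_ext K L \<longleftrightarrow> (\<exists>S. finite S \<and> L = adjoin K S)"

definition countably_generated_ext :: "'a::field set \<Rightarrow> 'a set \<Rightarrow> bool"
  where "countably_generated_ext K L \<longleftrightarrow> (\<exists>S. countable S \<and> L = adjoin K S)"

text \<open>
  A polynomial in the variables with indices in \<open>nat\<close> is a finitely supported map from exponent
  vectors to coefficients.
\<close>

definition mpoly_eval :: "((nat \<Rightarrow>\<^sub>0 nat) \<Rightarrow>\<^sub>0 'a::field) \<Rightarrow> (nat \<Rightarrow> 'a) \<Rightarrow> 'a"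
  where "mpoly_eval p x =
    (\<Sum>m\<in>Poly_Mapping.keys p. Poly_Mapping.lookup p m *
       (\<Prod>i\<in>Poly_Mapping.keys m. x i ^ Poly_Mapping.lookup m i))"

definition alg_independent :: "'a::field set \<Rightarrow> nat \<Rightarrow> (nat \<Rightarrow> 'a) \<Rightarrow> bool"
  where "alg_independent K n x \<longleftrightarrow>
    (\<forall>p. range (Poly_Mapping.lookup p) \<subseteq> K \<longrightarrow>
         (\<forall>m\<in>Poly_Mapping.keys p. Poly_Mapping.keys m \<subseteq> {..<n}) \<longrightarrow>
         mpoly_eval p x = 0 \<longrightarrow> p = 0)"

definition trdeg :: "'a::field set \<Rightarrow> 'a set \<Rightarrow> enat"
  where "trdeg K L = Sup {enat n | n x. x ` {..<n} \<subseteq> L \<and> alg_independent K n x}"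

definition rational_function_field :: "'a::field set \<Rightarrow> nat \<Rightarrow> (nat \<Rightarrow> 'a) \<Rightarrow> 'a set \<Rightarrow> bool"
  where "rational_function_field K n x F \<longleftrightarrow>
    alg_independent K n x \<and> F = adjoin K (x ` {..<n})"


section \<open>Rational rank\<close>

text \<open>
  The tensor product of the rationals with an abelian group \<open>A\<close> over the integers: the free
  abelian group on the pairs \<open>(q, a)\<close> modulo the relations of biadditivity.
\<close>

definition tensor_free :: "('a, 'm) monoid_scheme \<Rightarrow> (rat \<times> 'a \<Rightarrow>\<^sub>0 int) monoid"
  where "tensor_free A = free_Abelian_group (UNIV \<times> carrier A)"

definition tensor_relations :: "('a, 'm) monoid_scheme \<Rightarrow> (rat \<times> 'a \<Rightarrow>\<^sub>0 int) set"
  where "tensor_relations A = generate (tensor_free A)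
    ({frag_of (q + r, a) - frag_of (q, a) - frag_of (r, a) | q r a. a \<in> carrier A} \<union>
     {frag_of (q, a \<otimes>\<^bsub>A\<^esub> b) - frag_of (q, a) - frag_of (q, b) | q a b.
        a \<in> carrier A \<and> b \<in> carrier A})"

definition rat_tensor :: "('a, 'm) monoid_scheme \<Rightarrow> (rat \<times> 'a \<Rightarrow>\<^sub>0 int) set monoid"
  where "rat_tensor A = tensor_free A Mod tensor_relations A"

text \<open>
  The scalar multiplication induced by \<open>q (r \<otimes> a) = (q r) \<otimes> a\<close>.  All members of the union are
  the same coset, since \<open>frag_extend (\<lambda>(r, a). frag_of (q * r, a))\<close> preserves the relations.
\<close>

definition rat_tensor_scale ::
    "('a, 'm) monoid_scheme \<Rightarrow> rat \<Rightarrow> (rat \<times> 'a \<Rightarrow>\<^sub>0 int) set \<Rightarrow> (rat \<times> 'a \<Rightarrow>\<^sub>0 int) set"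
  where "rat_tensor_scale A q C =
    (\<Union>x\<in>C. tensor_relations A #>\<^bsub>tensor_free A\<^esub> frag_extend (\<lambda>(r, a). frag_of (q * r, a)) x)"

definition rat_tensor_independent ::
    "('a, 'm) monoid_scheme \<Rightarrow> (rat \<times> 'a \<Rightarrow>\<^sub>0 int) set set \<Rightarrow> bool"
  where "rat_tensor_independent A B \<longleftrightarrow>
    (\<forall>c. finprod (rat_tensor A) (\<lambda>C. rat_tensor_scale A (c C) C) B = \<one>\<^bsub>rat_tensor A\<^esub> \<longrightarrow>
         (\<forall>C\<in>B. c C = 0))"

definition rational_rank :: "('a, 'm) monoid_scheme \<Rightarrow> enat"
  where "rational_rank A = Sup {enat (card B) | B.
    finite B \<and> B \<subseteq> carrier (rat_tensor A) \<and> rat_tensor_independent A B}"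


section \<open>Valued fields\<close>

text \<open>
  Valuations are written additively, with an arbitrary ordered abelian group as target.  The
  convention that the value of \<open>0\<close> is infinite is rendered by never using \<open>v 0\<close>.
\<close>

definition valued_field :: "'f::field set \<Rightarrow> ('f \<Rightarrow> 'g::linordered_ab_group_add) \<Rightarrow> bool"
  where "valued_field L v \<longleftrightarrow> subfield L amb \<and>
    (\<forall>a\<in>L - {0}. \<forall>b\<in>L - {0}. v (a * b) = v a + v b) \<and>
    (\<forall>a\<in>L - {0}. \<forall>b\<in>L - {0}. a + b \<noteq> 0 \<longrightarrow> min (v a) (v b) \<le> v (a + b))"

definition value_set :: "('f::field \<Rightarrow> 'g::linordered_ab_group_add) \<Rightarrow> 'f set \<Rightarrow> 'g set"
  where "value_set v L = v ` (L - {0})"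

definition value_group :: "('f::field \<Rightarrow> 'g::linordered_ab_group_add) \<Rightarrow> 'f set \<Rightarrow> 'g monoid"
  where "value_group v L = \<lparr>carrier = value_set v L, monoid.mult = (+), one = 0\<rparr>"

definition value_quotient ::
    "('f::field \<Rightarrow> 'g::linordered_ab_group_add) \<Rightarrow> 'f set \<Rightarrow> 'f set \<Rightarrow> 'g set monoid"
  where "value_quotient v F K = value_group v F Mod value_set v K"

definition finitely_generated_group :: "('a, 'm) monoid_scheme \<Rightarrow> bool"
  where "finitely_generated_group A \<longleftrightarrow>
    (\<exists>S. finite S \<and> S \<subseteq> carrier A \<and> generate A S = carrier A)"

definition valuation_ring :: "('f::field \<Rightarrow> 'g::linordered_ab_group_add) \<Rightarrow> 'f set \<Rightarrow> 'f set"
  where "valuation_ring v L = {a \<in> L. a = 0 \<or> 0 \<le> v a}"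

definition valuation_ideal :: "('f::field \<Rightarrow> 'g::linordered_ab_group_add) \<Rightarrow> 'f set \<Rightarrow> 'f set"
  where "valuation_ideal v L = {a \<in> L. a = 0 \<or> 0 < v a}"

text \<open>
  The residue field of \<open>(L, v)\<close> is the valuation ring modulo its maximal ideal.  To have it as a
  subfield of a field type, it is given by its residue map: a ring homomorphism \<open>\<pi>\<close> on the
  valuation ring whose kernel is the maximal ideal, so that the image of \<open>\<pi>\<close> is that quotient.
  The residue field of a subfield \<open>K\<close> of \<open>L\<close> is then the image under \<open>\<pi>\<close> of the valuation ring
  of \<open>K\<close>.
\<close>

definition residue_map ::
    "('f::field \<Rightarrow> 'g::linordered_ab_group_add) \<Rightarrow> 'f set \<Rightarrow> ('f \<Rightarrow> 'r::field) \<Rightarrow> bool"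
  where "residue_map v L \<pi> \<longleftrightarrow>
    \<pi> \<in> ring_hom (amb\<lparr>carrier := valuation_ring v L\<rparr>) amb \<and>
    a_kernel (amb\<lparr>carrier := valuation_ring v L\<rparr>) amb \<pi> = valuation_ideal v L"

definition residue_field ::
    "('f::field \<Rightarrow> 'g::linordered_ab_group_add) \<Rightarrow> ('f \<Rightarrow> 'r::field) \<Rightarrow> 'f set \<Rightarrow> 'r set"
  where "residue_field v \<pi> L = \<pi> ` valuation_ring v L"

lemma residue_field_iso_quotient:
  fixes L :: "'f::field set" and v :: "'f \<Rightarrow> 'g::linordered_ab_group_add" and \<pi> :: "'f \<Rightarrow> 'r::field"
  assumes "valued_field L v" and "residue_map v L \<pi>"
  shows "amb\<lparr>carrier := valuation_ring v L\<rparr> Quot valuation_ideal v L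
    \<simeq> amb\<lparr>carrier := residue_field v \<pi> L\<rparr>"
proof -
  let ?O = "valuation_ring v L"
  interpret A: field "amb :: 'f ring" by (rule field_from_type_algebra)
  interpret B: field "amb :: 'r ring" by (rule field_from_type_algebra)
  have "subring L amb"
    using assms(1) by (simp add: valued_field_def subfield_def subdomain_def subcring_def)
  note L = subringE[OF this]
  have add: "a + b \<in> L" if "a \<in> L" "b \<in> L" for a b
    using L(7)[OF that] by (simp add: ring_of_type_algebra_def)
  have mult: "a * b \<in> L" if "a \<in> L" "b \<in> L" for a b
    using L(6)[OF that] by (simp add: ring_of_type_algebra_def)
  have one: "1 \<in> L"
    using L(3) by (simp add: ring_of_type_algebra_def)
  have minus_amb: "\<ominus>\<^bsub>amb\<^esub> a = - a" for a :: 'f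
    by (rule A.minus_equality) (auto simp: ring_of_type_algebra_def)
  have minus: "- a \<in> L" if "a \<in> L" for a
    using L(5)[OF that] by (simp add: minus_amb)
  have vmult: "v (a * b) = v a + v b" if "a \<in> L" "b \<in> L" "a \<noteq> 0" "b \<noteq> 0" for a b
    using assms(1) that by (simp add: valued_field_def)
  have vadd: "min (v a) (v b) \<le> v (a + b)"
    if "a \<in> L" "b \<in> L" "a \<noteq> 0" "b \<noteq> 0" "a + b \<noteq> 0" for a b
    using assms(1) that by (simp add: valued_field_def)
  have v1: "v 1 = 0"
    using vmult[OF one one] by simp
  have "v (- 1) + v (- 1) = 0"
    using vmult[OF minus[OF one] minus[OF one]] v1 by simp
  then have "v (- 1) = 0"
    by (simp add: double_zero)
  then have vminus: "v (- a) = v a" if "a \<in> L" "a \<noteq> 0" for a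
    using vmult[OF minus[OF one], of a] that by simp
  have "subring ?O amb"
  proof (rule A.subringI)
    show "?O \<subseteq> carrier amb" by (simp add: ring_of_type_algebra_def)
    show "\<one>\<^bsub>amb\<^esub> \<in> ?O"
      using one v1 by (simp add: valuation_ring_def ring_of_type_algebra_def)
  next
    fix h assume "h \<in> ?O"
    then show "\<ominus>\<^bsub>amb\<^esub> h \<in> ?O"
      using minus[of h] vminus[of h] by (cases "h = 0") (auto simp: valuation_ring_def minus_amb)
  next
    fix a b assume ab: "a \<in> ?O" "b \<in> ?O"
    then show "a \<otimes>\<^bsub>amb\<^esub> b \<in> ?O"
      using mult[of a b] vmult[of a b] by (cases "a = 0 \<or> b = 0") (auto simp: valuation_ring_def ring_of_type_algebra_def)
    have "a + b \<in> ?O"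
    proof (cases "a = 0 \<or> b = 0 \<or> a + b = 0")
      case True
      then show ?thesis using ab add[of a b] by (auto simp: valuation_ring_def)
    next
      case False
      then have "0 \<le> min (v a) (v b)" "min (v a) (v b) \<le> v (a + b)"
        using ab vadd[of a b] by (auto simp: valuation_ring_def)
      then have "0 \<le> v (a + b)" by (rule order_trans)
      then show ?thesis using ab add[of a b] by (simp add: valuation_ring_def)
    qed
    then show "a \<oplus>\<^bsub>amb\<^esub> b \<in> ?O" by (simp add: ring_of_type_algebra_def)
  qed
  then interpret O: ring "amb\<lparr>carrier := ?O\<rparr>" by (rule A.subring_is_ring)
  interpret h: ring_hom_ring "amb\<lparr>carrier := ?O\<rparr>" amb \<pi>
    using assms(2) O.ring_axioms B.ring_axioms
    by (intro ring_hom_ringI2) (auto simp: residue_map_def)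
  show ?thesis
    using h.FactRing_iso_set_aux assms(2)
    unfolding is_ring_iso_def residue_map_def residue_field_def by auto
qed

text \<open>
  \<open>(L, w)\<close> extends \<open>(K, v)\<close> along the field embedding \<open>\<iota>\<close>; the value group of \<open>K\<close> is identified
  with a subgroup of that of \<open>L\<close> by an embedding \<open>e\<close> of ordered groups.
\<close>

definition extends_valuation ::
    "('f::field \<Rightarrow> 'l::field) \<Rightarrow> 'f set \<Rightarrow> ('f \<Rightarrow> 'g::linordered_ab_group_add) \<Rightarrow>
     ('l \<Rightarrow> 'h::linordered_ab_group_add) \<Rightarrow> bool"
  where "extends_valuation \<iota> K v w \<longleftrightarrow>
    (\<exists>e. (\<forall>g\<in>value_set v K. \<forall>h\<in>value_set v K. e (g + h) = e g + e h) \<and>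
         strict_mono_on (value_set v K) e \<and>
         (\<forall>a\<in>K - {0}. w (\<iota> a) = e (v a)))"

definition immediate ::
    "('f::field \<Rightarrow> 'g::linordered_ab_group_add) \<Rightarrow> ('f \<Rightarrow> 'r::field) \<Rightarrow> 'f set \<Rightarrow> 'f set \<Rightarrow> bool"
  where "immediate v \<pi> K L \<longleftrightarrow>
    value_set v L = value_set v K \<and> residue_field v \<pi> L = residue_field v \<pi> K"

text \<open>
  Some immediate extension of \<open>('a, w)\<close> has transcendence degree \<open>n\<close>.  In HOL the extension field
  has to be sought in a fixed type; the fraction field of the polynomials in countably many
  variables loses nothing, because an immediate extension of transcendence degree \<open>n\<close> contains
  a rational function field in \<open>n\<close> variables, on which the valuation is immediate as well.
\<close>

definition has_immediate_extension ::
    "('a::field \<Rightarrow> 'h::linordered_ab_group_add) \<Rightarrow> ('a \<Rightarrow> 's::field) \<Rightarrow> nat \<Rightarrow> bool"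
  where "has_immediate_extension w \<pi> n \<longleftrightarrow>
    (\<exists>(j :: 'a \<Rightarrow> ((nat \<Rightarrow>\<^sub>0 nat) \<Rightarrow>\<^sub>0 'a) fract) L (w' :: _ \<Rightarrow> 'h) (\<pi>' :: _ \<Rightarrow> 's).
       j \<in> ring_hom amb amb \<and> range j \<subseteq> L \<and>
       valued_field L w' \<and> (\<forall>a. a \<noteq> 0 \<longrightarrow> w' (j a) = w a) \<and>
       residue_map w' L \<pi>' \<and> (\<forall>a\<in>valuation_ring w UNIV. \<pi>' (j a) = \<pi> a) \<and>
       immediate w' \<pi>' (range j) L \<and>
       trdeg (range j) L = enat n)"

end

theory Submission
  imports Defs
    "HOL-Computational_Algebra.Polynomial_Factorial"
begin

text \<open>
  Elements with values independent modulo \<open>vK\<close> and lifts of algebraically independent residues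
  generate a Gauss extension of \<open>K\<close>, whose value group and residue field are as small as possible,
  and an algebraic extension by one element adds only finitely many cosets of values and finitely
  many generators of residues.  This gives the Abhyankar inequality, and finite generation in
  case of equality.

  For the structure of \<open>Fv\<close> put \<open>L = K(x\<^sub>0, \<dots>, x\<^sub>n\<^sub>-\<^sub>2)\<close>.  If \<open>Fv\<close> is transcendental over \<open>Lv\<close>, choose a
  polynomial \<open>f\<close> over \<open>L\<close> of least degree such that no multiple by an element of \<open>L\<close> of a power of
  \<open>f(x\<^sub>n\<^sub>-\<^sub>1)\<close> is a unit with residue algebraic over \<open>Lv\<close>.  Up to terms of higher value, the values at
  \<open>x\<^sub>n\<^sub>-\<^sub>1\<close> of the polynomials of smaller degree form a field, and \<open>Fv\<close> is a rational function field
  over its residue field.  The remaining case is that of a valuation trivial on \<open>L\<close>, which is discrete.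

  If \<open>\<rho> = 0 = \<tau>\<close>, the algebraic closure of \<open>K\<close> and \<open>F\<close> are linearly disjoint over \<open>K\<close> inside the field of
  rational functions over the closure.  Linear disjointness shows that the maximal ideals of both
  valuation rings do not generate the unit ideal of the ring generated by these, so some valuation
  ring dominates both.  Every element of the compositum then has the value of an element of the
  closure, by torsion of \<open>vF/vK\<close> and extraction of roots, and likewise for residues.
\<close>

section \<open>Subfields and polynomials over a subfield\<close>

text \<open>Values and residues of the algebraic closure and of \<open>F\<close> lie in unrelated
  types, and the two valuations are linked only on \<open>K\<close>, so neither can be evaluated on
  the compositum. What can be compared are valuation rings: an element of \<open>K\<close> is
  integral for one valuation iff it is for the other. Hence the passage through a ring dominating
  both; values and residues are then read off from elements of the closure, which lands in the given
  types and makes immediacy automatic.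

  In the case of equality \<open>n = r + t\<close> a count decides about the last variable. If
  \<open>r\<close> independent values occur already in \<open>L\<close>, the inequality over
  \<open>L\<close> gives \<open>r + trdeg Lv|Kv \<le> n - 1\<close>, so \<open>Lv\<close> cannot
  reach the transcendence degree \<open>t\<close> of \<open>Fv\<close> and \<open>Fv|Lv\<close> is
  transcendental. The ruled form of \<open>Fv\<close> then forces equality over \<open>L\<close>,
  whence \<open>Lv|Kv\<close> is finitely generated. For rank one and \<open>v\<close> trivial on
  \<open>K\<close>, a single nonzero value on \<open>L\<close> suffices for this; otherwise
  \<open>v\<close> is trivial on \<open>L\<close>. This is the origin of the two alternatives in
  (i).\<close>

lemma amb_simps [simp]:
  "carrier amb = UNIV" "x \<otimes>\<^bsub>amb\<^esub> y = x * y" "x \<oplus>\<^bsub>amb\<^esub> y = x + y"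
  "\<one>\<^bsub>amb\<^esub> = 1" "\<zero>\<^bsub>amb\<^esub> = 0"
  by (simp_all add: ring_of_type_algebra_def)

lemma amb_a_inv [simp]: "\<ominus>\<^bsub>amb\<^esub> (x::'a::field) = - x"
proof -
  interpret amb: field "amb :: 'a ring" by (rule field_from_type_algebra)
  show ?thesis by (rule amb.minus_equality) auto
qed

lemma amb_m_inv [simp]: "x \<noteq> 0 \<Longrightarrow> inv\<^bsub>amb\<^esub> (x::'a::field) = inverse x"
proof -
  interpret amb: field "amb :: 'a ring" by (rule field_from_type_algebra)
  show "x \<noteq> 0 \<Longrightarrow> ?thesis" by (rule amb.comm_inv_char) auto
qed

lemma amb_pow [simp]: "x [^]\<^bsub>amb\<^esub> (n::nat) = (x::'a::field) ^ n"
proof -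
  interpret amb: field "amb :: 'a ring" by (rule field_from_type_algebra)
  show ?thesis by (induction n) auto
qed

lemma subfield_ambI:
  assumes "1 \<in> K" "\<And>a b. a \<in> K \<Longrightarrow> b \<in> K \<Longrightarrow> a - b \<in> K" "\<And>a b. a \<in> K \<Longrightarrow> b \<in> K \<Longrightarrow> a * b \<in> K"
    "\<And>a. a \<in> K \<Longrightarrow> a \<noteq> 0 \<Longrightarrow> inverse a \<in> K"
  shows "subfield K (amb :: 'a::field ring)"
proof -
  interpret amb: field "amb :: 'a ring" by (rule field_from_type_algebra)
  have 0: "0 \<in> K" using assms(2)[OF assms(1) assms(1)] by simp
  have m: "- a \<in> K" if "a \<in> K" for a using assms(2)[OF 0 that] by simp
  have "a + b \<in> K" if "a \<in> K" "b \<in> K" for a b using assms(2)[OF that(1) m[OF that(2)]] by simp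
  then have "subring K amb"
    using assms m by (intro amb.subringI) auto
  then show ?thesis
    using assms by (intro amb.subfieldI') auto
qed

context
  fixes K :: "'a::field set"
  assumes K: "subfield K amb"
begin

lemma sf_1 [simp]: "1 \<in> K"
  using subringE(3)[OF subfieldE(1)[OF K]] by simp

lemma sf_add [simp]: "a \<in> K \<Longrightarrow> b \<in> K \<Longrightarrow> a + b \<in> K"
  using subringE(7)[OF subfieldE(1)[OF K]] by simp

lemma sf_mult [simp]: "a \<in> K \<Longrightarrow> b \<in> K \<Longrightarrow> a * b \<in> K"
  using subringE(6)[OF subfieldE(1)[OF K]] by simp

lemma sf_uminus [simp]: "a \<in> K \<Longrightarrow> - a \<in> K"
  using subringE(5)[OF subfieldE(1)[OF K]] by simp

lemma sf_0 [simp]: "0 \<in> K"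
  using sf_add[OF sf_1 sf_uminus[OF sf_1]] by simp

lemma sf_diff [simp]: "a \<in> K \<Longrightarrow> b \<in> K \<Longrightarrow> a - b \<in> K"
  using sf_add[of a "- b"] by simp

lemma sf_inverse [simp]: "a \<in> K \<Longrightarrow> inverse a \<in> K"
  using ring.subfield_m_inv(1)[OF ring_from_type_algebra K, of a] by (cases "a = 0") auto

lemma sf_divide [simp]: "a \<in> K \<Longrightarrow> b \<in> K \<Longrightarrow> a / b \<in> K"
  by (simp add: divide_inverse)

lemma sf_power [simp]: "a \<in> K \<Longrightarrow> a ^ n \<in> K"
  by (induction n) auto

lemma sf_sum [simp]: "(\<And>i. i \<in> I \<Longrightarrow> f i \<in> K) \<Longrightarrow> sum f I \<in> K"
  by (induction I rule: infinite_finite_induct) auto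

lemma sf_prod [simp]: "(\<And>i. i \<in> I \<Longrightarrow> f i \<in> K) \<Longrightarrow> prod f I \<in> K"
  by (induction I rule: infinite_finite_induct) auto

end

lemma adjoin_subfield [simp]: "subfield (adjoin K S) amb"
  unfolding adjoin_def using field.generate_field_is_subfield[OF field_from_type_algebra] by simp

lemma adjoin_base: "K \<subseteq> adjoin K S"
  and adjoin_gen: "S \<subseteq> adjoin K S"
  unfolding adjoin_def by (auto intro: generate_field.incl)

lemma adjoin_least: "subfield L amb \<Longrightarrow> K \<subseteq> L \<Longrightarrow> S \<subseteq> L \<Longrightarrow> adjoin K S \<subseteq> L"
  unfolding adjoin_def using field.generate_field_min_subfield1[OF field_from_type_algebra, of "K \<union> S" L] by simp

lemma adjoin_mono: "K \<subseteq> L \<Longrightarrow> S \<subseteq> T \<Longrightarrow> adjoin K S \<subseteq> adjoin L T"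
  by (rule adjoin_least) (use adjoin_base[of L T] adjoin_gen[of T L] in auto)

lemma adjoin_adjoin: "adjoin (adjoin K S) T = adjoin K (S \<union> T)"
proof
  show "adjoin (adjoin K S) T \<subseteq> adjoin K (S \<union> T)"
    using adjoin_gen[of "S \<union> T" K] adjoin_base[of K "S \<union> T"] by (intro adjoin_least adjoin_subfield) auto
  show "adjoin K (S \<union> T) \<subseteq> adjoin (adjoin K S) T"
    using adjoin_base[of K S] adjoin_gen[of S K] adjoin_base[of "adjoin K S" T] adjoin_gen[of T]
    by (intro adjoin_least) auto
qed

lemma adjoin_eq_base: "subfield K amb \<Longrightarrow> S \<subseteq> K \<Longrightarrow> adjoin K S = K"
  using adjoin_least[of K K S] adjoin_base[of K S] by auto

lemma adjoin_insert: "adjoin K (insert a S) = adjoin (adjoin K S) {a}"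
  by (simp add: adjoin_adjoin)

section \<open>Polynomials with coefficients in a subfield\<close>

definition polys :: "'a::field set \<Rightarrow> 'a poly set"
  where "polys K = {p. \<forall>i. poly.coeff p i \<in> K}"

lemma polys_mono: "K \<subseteq> L \<Longrightarrow> polys K \<subseteq> polys L"
  by (auto simp: polys_def)

lemma polys_coeff: "p \<in> polys K \<Longrightarrow> poly.coeff p i \<in> K"
  by (auto simp: polys_def)

context
  fixes K :: "'a::field set"
  assumes K: "subfield K amb"
begin

lemma polys_0 [simp]: "0 \<in> polys K" using K by (auto simp: polys_def)

lemma polys_pCons [simp]: "a \<in> K \<Longrightarrow> p \<in> polys K \<Longrightarrow> pCons a p \<in> polys K"
  using K by (auto simp: polys_def coeff_pCons split: nat.split)

lemma polys_1 [simp]: "1 \<in> polys K"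
  using K by (simp add: one_pCons)

lemma polys_add [simp]: "p \<in> polys K \<Longrightarrow> q \<in> polys K \<Longrightarrow> p + q \<in> polys K"
  and polys_diff [simp]: "p \<in> polys K \<Longrightarrow> q \<in> polys K \<Longrightarrow> p - q \<in> polys K"
  and polys_uminus [simp]: "p \<in> polys K \<Longrightarrow> - p \<in> polys K"
  and polys_smult [simp]: "a \<in> K \<Longrightarrow> p \<in> polys K \<Longrightarrow> smult a p \<in> polys K"
  using K by (simp_all add: polys_def)

lemma polys_mult [simp]: "p \<in> polys K \<Longrightarrow> q \<in> polys K \<Longrightarrow> p * q \<in> polys K"
  using K by (simp add: polys_def coeff_mult)

lemma polys_monom [simp]: "a \<in> K \<Longrightarrow> Polynomial.monom a n \<in> polys K"
  using K by (simp add: polys_def)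

lemma polys_sum [simp]: "(\<And>i. i \<in> I \<Longrightarrow> f i \<in> polys K) \<Longrightarrow> sum f I \<in> polys K"
  by (induction I rule: infinite_finite_induct) auto

lemma polys_prod [simp]: "(\<And>i. i \<in> I \<Longrightarrow> f i \<in> polys K) \<Longrightarrow> prod f I \<in> polys K"
  by (induction I rule: infinite_finite_induct) auto

lemma poly_in_subfield: "p \<in> polys K \<Longrightarrow> a \<in> K \<Longrightarrow> poly p a \<in> K"
  using K by (auto simp: poly_altdef polys_def intro!: sf_sum)

text \<open>Long division is done by induction on the degree of \<open>p\<close>, because quotient
  and remainder must again have coefficients in \<open>K\<close>. The degree bound is stated with
  \<open>max\<close> so that it also covers the quotient \<open>0\<close>; it keeps the quotients in
  expansions in powers of \<open>f\<close> under control.\<close>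

lemma polys_division:
  assumes "p \<in> polys K" "f \<in> polys K" "f \<noteq> 0"
  shows "\<exists>q r. q \<in> polys K \<and> r \<in> polys K \<and> p = q * f + r \<and> (r = 0 \<or> Polynomial.degree r < Polynomial.degree f)
    \<and> Polynomial.degree q + Polynomial.degree f \<le> max (Polynomial.degree p) (Polynomial.degree f)"
  using assms(1)
proof (induction "Polynomial.degree p" arbitrary: p rule: less_induct)
  case less
  let ?d = "Polynomial.degree"
  show ?case
  proof (cases "?d p < ?d f")
    case True
    then show ?thesis using less.prems by (intro exI[of _ 0] exI[of _ p]) auto
  next
    case False
    define c where "c = lead_coeff p / lead_coeff f"
    define g where "g = Polynomial.monom c (?d p - ?d f)"
    have cK: "c \<in> K" using less.prems assms K by (simp add: c_def polys_coeff)
    have gK: "g \<in> polys K" using cK by (simp add: g_def)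
    have dg: "?d g \<le> ?d p - ?d f" by (simp add: g_def degree_monom_le)
    \<comment> \<open>Cancelling the leading term of a constant does not lower its degree, so
      constants are treated apart.\<close>
    show ?thesis
    proof (cases "?d p = 0")
      case True
      then have "?d f = 0" using False by simp
      then obtain u w where uw: "f = [:u:]" "p = [:w:]"
        using degree_eq_zeroE \<open>?d p = 0\<close> by metis
      then have "p = g * f" using assms(3) \<open>?d p = 0\<close> by (simp add: g_def c_def monom_0)
      then show ?thesis using gK dg False by (intro exI[of _ g] exI[of _ 0]) auto
    next
      case dp: False
      define p' where "p' = p - g * f"
      have p'K: "p' \<in> polys K" using less.prems gK assms by (simp add: p'_def)
      have "?d p' < ?d p"
      proof -
        have le: "?d p' \<le> ?d p"
          unfolding p'_def using dg False degree_mult_le[of g f] by (intro degree_diff_le) auto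
        have "poly.coeff p' (?d p) = 0"
          using False assms(3) by (simp add: p'_def g_def c_def coeff_monom_mult)
        then show ?thesis using le dp
          by (metis leading_coeff_0_iff degree_0 le_neq_implies_less neq0_conv)
      qed
      from less.hyps[OF this p'K] obtain q r where qr: "q \<in> polys K" "r \<in> polys K" "p' = q * f + r"
        "r = 0 \<or> ?d r < ?d f" "?d q + ?d f \<le> max (?d p') (?d f)" by blast
      have "p = (q + g) * f + r" using qr(3) by (simp add: p'_def algebra_simps)
      moreover have "?d (q + g) + ?d f \<le> max (?d p) (?d f)"
        using degree_add_le_max[of q g] qr(5) dg False \<open>?d p' < ?d p\<close> by linarith
      ultimately show ?thesis using qr gK by (intro exI[of _ "q + g"] exI[of _ r]) auto
    qed
  qed
qed

end

lemma polys_iff_coeffs: "subfield K amb \<Longrightarrow> p \<in> polys K \<longleftrightarrow> set (coeffs p) \<subseteq> K"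
  by (auto simp: polys_def simp flip: nth_default_coeffs_eq)
    (auto simp: nth_default_def in_set_conv_nth subset_iff split: if_splits)

lemma adjoin_singleton:
  assumes K: "subfield K amb"
  shows "adjoin K {a} = {poly p a / poly q a | p q. p \<in> polys K \<and> q \<in> polys K \<and> poly q a \<noteq> 0}" (is "_ = ?R")
proof
  show "?R \<subseteq> adjoin K {a}"
  proof safe
    fix p q assume pq: "p \<in> polys K" "q \<in> polys K"
    have "polys K \<subseteq> polys (adjoin K {a})" using adjoin_base by (rule polys_mono)
    moreover have "a \<in> adjoin K {a}" using adjoin_gen by auto
    ultimately show "poly p a / poly q a \<in> adjoin K {a}"
      using pq by (intro sf_divide poly_in_subfield) auto
  qed
  have "subfield ?R amb"
  proof (rule subfield_ambI)
    show "1 \<in> ?R" using K by (intro CollectI exI[of _ 1]) auto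
  next
    fix x y assume "x \<in> ?R" "y \<in> ?R"
    then obtain p q p' q' where h: "x = poly p a / poly q a" "y = poly p' a / poly q' a"
      "p \<in> polys K" "q \<in> polys K" "poly q a \<noteq> 0" "p' \<in> polys K" "q' \<in> polys K" "poly q' a \<noteq> 0" by blast
    have "x - y = poly (p * q' - p' * q) a / poly (q * q') a"
      using h by (simp add: diff_frac_eq)
    then show "x - y \<in> ?R" using h K
      by (intro CollectI exI[of _ "p * q' - p' * q"] exI[of _ "q * q'"]) auto
    have "x * y = poly (p * p') a / poly (q * q') a"
      using h by simp
    then show "x * y \<in> ?R" using h K
      by (intro CollectI exI[of _ "p * p'"] exI[of _ "q * q'"]) auto
  next
    fix x assume "x \<in> ?R" "x \<noteq> 0"
    then obtain p q where "x = poly p a / poly q a" "p \<in> polys K" "q \<in> polys K" "poly q a \<noteq> 0" by blast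
    then show "inverse x \<in> ?R" using \<open>x \<noteq> 0\<close> by (intro CollectI exI[of _ q] exI[of _ p]) auto
  qed
  moreover have "K \<subseteq> ?R"
  proof
    fix k assume "k \<in> K"
    then show "k \<in> ?R" using K by (intro CollectI exI[of _ "[:k:]"] exI[of _ 1]) auto
  qed
  moreover have "a \<in> ?R" using K by (intro CollectI exI[of _ "[:0,1:]"] exI[of _ 1]) auto
  ultimately show "adjoin K {a} \<subseteq> ?R" by (intro adjoin_least) auto
qed

section \<open>Algebraic elements\<close>

text \<open>Phrased with the type \<open>'a poly\<close>; \<open>algebraic_amb_iff\<close>
  identifies it with the notion for ring records that occurs in the theorem.\<close>

definition alg :: "'a::field set \<Rightarrow> 'a \<Rightarrow> bool"
  where "alg K a \<longleftrightarrow> (\<exists>p\<in>polys K. p \<noteq> 0 \<and> poly p a = 0)"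

lemma algI: "p \<in> polys K \<Longrightarrow> p \<noteq> 0 \<Longrightarrow> poly p a = 0 \<Longrightarrow> alg K a"
  by (auto simp: alg_def)

lemma alg_mono: "alg K a \<Longrightarrow> K \<subseteq> L \<Longrightarrow> alg L a"
  using polys_mono[of K L] by (auto simp: alg_def)

text \<open>Coefficient lists over a ring record start with the leading coefficient, those of
  \<open>Poly\<close> with the constant one; hence \<open>rev\<close>.\<close>

lemma eval_amb: "ring.eval amb xs a = poly (Poly (rev xs)) (a::'a::field)"
proof -
  interpret amb: field "amb :: 'a ring" by (rule field_from_type_algebra)
  show ?thesis
proof (induction xs)
  case (Cons x xs)
  have "Poly (rev xs @ [x]) = Poly (rev xs) + Polynomial.monom x (length xs)"
    by (rule poly_eqI) (auto simp: coeff_Poly_eq nth_default_append nth_default_def nth_append coeff_monom)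
  then show ?case using Cons by (simp add: poly_monom)
qed auto
qed

lemma algebraic_amb_iff:
  assumes K: "subfield K (amb :: 'a::field ring)"
  shows "ring.algebraic amb K a \<longleftrightarrow> alg K a"
proof
  interpret amb: field "amb :: 'a ring" by (rule field_from_type_algebra)
  assume "ring.algebraic amb K a"
  then obtain p where p: "p \<in> carrier (K [X]\<^bsub>amb\<^esub>)" "p \<noteq> []" "amb.eval p a = 0"
    using amb.algebraicE[OF subfieldE(1)[OF K], of a] by (auto simp: over_def)
  then have "set p \<subseteq> K" "hd p \<noteq> 0" by (auto simp: univ_poly_def polynomial_def)
  then have "Poly (rev p) \<in> polys K"
    using K by (auto simp: polys_def coeff_Poly_eq nth_default_def rev_nth subset_iff)
  moreover have "poly.coeff (Poly (rev p)) (length p - 1) \<noteq> 0"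
    using \<open>hd p \<noteq> 0\<close> p(2) by (cases p) (auto simp: coeff_Poly_eq nth_default_append)
  then have "Poly (rev p) \<noteq> 0" by (metis Polynomial.coeff_0)
  ultimately show "alg K a" using p(3) by (auto simp: eval_amb alg_def)
next
  interpret amb: field "amb :: 'a ring" by (rule field_from_type_algebra)
  assume "alg K a"
  then obtain p where p: "p \<in> polys K" "p \<noteq> 0" "poly p a = 0" by (auto simp: alg_def)
  let ?xs = "rev (coeffs p)"
  have "set (coeffs p) \<subseteq> K" using p(1) K by (simp add: polys_iff_coeffs)
  moreover have "hd ?xs \<noteq> 0" using p(2) by (simp add: hd_rev last_coeffs_eq_coeff_degree)
  ultimately have "?xs \<in> carrier (K [X]\<^bsub>amb\<^esub>)" by (auto simp: univ_poly_def polynomial_def)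
  then show "ring.algebraic amb K a"
    using amb.algebraicI[of ?xs K a] p by (auto simp: eval_amb over_def)
qed

lemma alg_subfield: "subfield K amb \<Longrightarrow> subfield {a. alg K a} amb"
  using field.subfield_of_algebraics[OF field_from_type_algebra, of K] by (simp add: over_def algebraic_amb_iff)

lemma alg_base: "subfield K amb \<Longrightarrow> a \<in> K \<Longrightarrow> alg K a"
  by (rule algI[of "[:-a, 1:]"]) auto

text \<open>The coefficients of an equation of \<open>a\<close> over \<open>L\<close> generate a
  finite extension \<open>?E\<close> of \<open>K\<close>, and \<open>a\<close> generates a finite
  extension of \<open>?E\<close>; finite dimension is transitive and makes \<open>a\<close>
  algebraic over \<open>K\<close>.\<close>

lemma alg_trans:
  assumes K: "subfield K (amb :: 'a::field ring)" and L: "subfield L amb" "\<And>b. b \<in> L \<Longrightarrow> alg K b" and a: "alg L a"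
  shows "alg K a"
proof -
  interpret amb: field "amb :: 'a ring" by (rule field_from_type_algebra)
  obtain p where p: "p \<in> polys L" "p \<noteq> 0" "poly p a = 0" using a by (auto simp: alg_def)
  let ?E = "amb.finite_extension K (coeffs p)"
  have cL: "\<And>c. c \<in> set (coeffs p) \<Longrightarrow> c \<in> L" using p(1) L(1) by (auto simp: polys_iff_coeffs)
  have ac: "\<And>c. c \<in> set (coeffs p) \<Longrightarrow> (amb.algebraic over K) c"
    using cL L(2) by (simp add: over_def algebraic_amb_iff[OF K])
  have E: "subfield ?E amb" by (rule amb.finite_extension_is_subfield[OF K]) (use ac in auto)
  have fE: "amb.finite_dimension K ?E"
    by (rule amb.finite_extension_finite_dimension(1)[OF K]) (use ac in auto)
  have "p \<in> polys ?E"
    using amb.finite_extension_mem[OF subfieldE(1)[OF K], of "coeffs p"] E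
    by (simp add: polys_iff_coeffs)
  then have aE: "amb.algebraic ?E a" using p algebraic_amb_iff[OF E] by (auto simp: alg_def)
  let ?S = "amb.simple_extension ?E a"
  have S: "subfield ?S amb"
    using amb.simple_extension_is_subfield[OF E, of a] aE by (auto simp: over_def)
  have "amb.finite_dimension ?E ?S"
    using amb.finite_dimension_simple_extension[OF E, of a] aE by (auto simp: over_def)
  then have "amb.finite_dimension K ?S"
    by (rule amb.telescopic_base_dim(1)[OF K E fE])
  moreover have "a \<in> ?S" using amb.simple_extension_mem[OF subfieldE(1)[OF E], of a] by simp
  ultimately show ?thesis
    using amb.finite_dimension_imp_algebraic[OF K subfieldE(1)[OF S]] algebraic_amb_iff[OF K]
    by (auto simp: over_def)
qed

lemma alg_adjoin:
  assumes K: "subfield K amb" and S: "\<And>s. s \<in> S \<Longrightarrow> alg K s" and a: "a \<in> adjoin K S"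
  shows "alg K a"
  using adjoin_least[OF alg_subfield[OF K], of K S] alg_base[OF K] S a by blast

section \<open>Algebraic independence and transcendence degree\<close>

text \<open>Multiplying by the product of all denominators turns \<open>p\<close> into a polynomial
  in two variables over \<open>K\<close>, with \<open>P i\<close> as the coefficient of the
  \<open>i\<close>-th power of the second one.\<close>

lemma common_denominator:
  assumes K: "subfield K amb" and p: "p \<in> polys (adjoin K {a})"
  shows "\<exists>d P. d \<in> polys K \<and> poly d a \<noteq> 0 \<and> (\<forall>i. P i \<in> polys K \<and> poly.coeff p i * poly d a = poly (P i) a)"
proof -
  let ?D = "{..Polynomial.degree p}"
  have "\<forall>i. \<exists>N D. N \<in> polys K \<and> D \<in> polys K \<and> poly D a \<noteq> 0 \<and> poly.coeff p i = poly N a / poly D a"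
    using polys_coeff[OF p] unfolding adjoin_singleton[OF K] by blast
  then obtain N D where ND: "\<And>i. N i \<in> polys K" "\<And>i. D i \<in> polys K" "\<And>i. poly (D i) a \<noteq> 0"
    "\<And>i. poly.coeff p i = poly (N i) a / poly (D i) a" by metis
  let ?d = "\<Prod>i\<in>?D. D i"
  let ?P = "\<lambda>i. if i \<in> ?D then N i * (\<Prod>j\<in>?D - {i}. D j) else 0"
  have "poly.coeff p i * poly ?d a = poly (?P i) a" for i
  proof (cases "i \<in> ?D")
    case True
    then have "?d = D i * (\<Prod>j\<in>?D - {i}. D j)" by (intro prod.remove) auto
    then show ?thesis using ND True by simp
  next
    case False
    then show ?thesis by (simp add: coeff_eq_0)
  qed
  moreover have "poly ?d a \<noteq> 0" using ND(3) by (simp add: poly_prod)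
  ultimately show ?thesis using ND K by (intro exI[of _ ?d] exI[of _ ?P]) auto
qed

text \<open>An equation of \<open>b\<close> over \<open>K(a)\<close>, freed of denominators, is a
  polynomial relation between \<open>a\<close> and \<open>b\<close> over \<open>K\<close>; sorted by
  powers of \<open>a\<close> it is an equation of \<open>a\<close> over \<open>K(b)\<close>.\<close>

lemma alg_exchange:
  assumes K: "subfield K amb" and b: "alg (adjoin K {a}) b" and nb: "\<not> alg K b"
  shows "alg (adjoin K {b}) a"
proof -
  let ?d = "Polynomial.degree"
  obtain p where p: "p \<in> polys (adjoin K {a})" "p \<noteq> 0" "poly p b = 0" using b by (auto simp: alg_def)
  obtain d P where dP: "d \<in> polys K" "poly d a \<noteq> 0" "\<And>i. P i \<in> polys K"
    "\<And>i. poly.coeff p i * poly d a = poly (P i) a" using common_denominator[OF K p(1)] by blast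
  define q where "q = (\<Sum>i\<le>?d p. smult (b ^ i) (P i))"
  have "b \<in> adjoin K {b}" using adjoin_gen by auto
  moreover have "polys K \<subseteq> polys (adjoin K {b})" using adjoin_base by (rule polys_mono)
  ultimately have "q \<in> polys (adjoin K {b})" using dP(3) by (auto simp: q_def intro!: polys_sum polys_smult)
  moreover have "poly q a = (\<Sum>i\<le>?d p. b ^ i * (poly.coeff p i * poly d a))"
    by (simp add: q_def poly_sum dP(4))
  then have "poly q a = poly p b * poly d a"
    by (simp add: poly_altdef[of p b] sum_distrib_left mult_ac)
  then have "poly q a = 0" using p by simp
  moreover have "q \<noteq> 0"
  proof
    assume q0: "q = 0"
    \<comment> \<open>If \<open>q\<close> were zero, its \<open>j\<close>-th coefficient would
      provide a polynomial \<open>r\<close> over \<open>K\<close> with root \<open>b\<close>. Taking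
      \<open>j\<close> from the leading \<open>P\<close> makes \<open>r\<close> nonzero, against the
      transcendence of \<open>b\<close>.\<close>
    have "poly (P (?d p)) a \<noteq> 0" using dP(2) p(2) by (simp flip: dP(4))
    then obtain j where j: "poly.coeff (P (?d p)) j \<noteq> 0" by (metis leading_coeff_0_iff poly_0)
    define r where "r = (\<Sum>i\<le>?d p. Polynomial.monom (poly.coeff (P i) j) i)"
    have "r \<in> polys K" using K dP(3) by (auto simp: r_def intro!: polys_sum polys_monom polys_coeff)
    moreover have "poly.coeff r (?d p) = poly.coeff (P (?d p)) j"
      by (simp add: r_def coeff_sum)
    then have "r \<noteq> 0" using j by auto
    moreover have "poly r b = poly.coeff q j"
      by (simp add: r_def q_def poly_sum poly_monom coeff_sum mult.commute)
    ultimately show False using nb q0 by (auto simp: alg_def)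
  qed
  ultimately show ?thesis by (intro algI)
qed

text \<open>Algebraic independence in triangular form, which fits inductions that adjoin one element
  at a time; over a subfield it is the usual notion by
  \<open>alg_independent_iff_tind\<close>.\<close>

definition tind :: "'a::field set \<Rightarrow> nat \<Rightarrow> (nat \<Rightarrow> 'a) \<Rightarrow> bool"
  where "tind K n x \<longleftrightarrow> (\<forall>i<n. \<not> alg (adjoin K (x ` {..<i})) (x i))"

lemma tind_0 [simp]: "tind K 0 x"
  and tind_Suc: "tind K (Suc n) x \<longleftrightarrow> tind K n x \<and> \<not> alg (adjoin K (x ` {..<n})) (x n)"
  by (auto simp: tind_def less_Suc_eq)

lemma tind_cong: "(\<And>i. i < n \<Longrightarrow> x i = y i) \<Longrightarrow> tind K n x \<longleftrightarrow> tind K n y"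
proof (induction n)
  case (Suc n)
  have "x ` {..<n} = y ` {..<n}" using Suc.prems by (intro image_cong) auto
  then show ?case using Suc by (simp add: tind_Suc)
qed simp

lemma alg_adjoin_trans:
  assumes "\<And>s. s \<in> S \<Longrightarrow> alg (adjoin K T) s" and "alg (adjoin K S) a"
  shows "alg (adjoin K T) a"
proof (rule alg_trans[of "adjoin K T" "adjoin (adjoin K T) S"])
  show "alg (adjoin (adjoin K T) S) a"
    using assms(2) by (rule alg_mono) (metis adjoin_adjoin adjoin_mono subset_refl sup_ge2)
  show "alg (adjoin K T) b" if "b \<in> adjoin (adjoin K T) S" for b
    using alg_adjoin[OF _ assms(1) that] by simp
qed auto

lemma alg_gen: "a \<in> S \<Longrightarrow> alg (adjoin K S) a"
  using adjoin_gen[of S K] by (intro alg_base) auto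

text \<open>After \<open>k\<close> exchanges, \<open>k\<close> elements of \<open>S\<close> are
  replaced by the first \<open>k\<close> entries of \<open>y\<close>, and all of \<open>S\<close> is
  still algebraic over the mixed set. If \<open>S\<close> were used up while
  \<open>y (card S)\<close> is left, that entry would be algebraic over its predecessors.\<close>

lemma steinitz:
  assumes S: "finite S" and y: "tind K m y" "\<And>i. i < m \<Longrightarrow> alg (adjoin K S) (y i)"
  shows "m \<le> card S"
proof (rule ccontr)
  assume m: "\<not> m \<le> card S"
  have "\<exists>S'\<subseteq>S. card S' + k = card S \<and> (\<forall>s\<in>S. alg (adjoin K (y ` {..<k} \<union> S')) s)" if "k \<le> card S" for k
    using that
  proof (induction k)
    case 0
    have "alg (adjoin K S) s" if "s \<in> S" for s
      using adjoin_gen[of S K] that by (intro alg_base) auto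
    then show ?case by (intro exI[of _ S]) auto
  next
    case (Suc k)
    then obtain S' where S': "S' \<subseteq> S" "card S' + k = card S" "\<And>s. s \<in> S \<Longrightarrow> alg (adjoin K (y ` {..<k} \<union> S')) s"
      by auto
    let ?Y = "y ` {..<k}"
    have km: "k < m" using Suc.prems m by simp
    have fS': "finite S'" using S' S finite_subset by blast
    have "alg (adjoin K (?Y \<union> S')) (y k)"
      using alg_adjoin_trans[OF S'(3) y(2)[OF km]] by simp
    \<comment> \<open>A least \<open>U\<close> inside the remaining part of \<open>S\<close> on
      which \<open>y k\<close> depends is nonempty because \<open>y\<close> is independent; by
      minimality each of its elements can be exchanged for \<open>y k\<close>.\<close>
    then obtain U where "U \<subseteq> S' \<and> alg (adjoin K (?Y \<union> U)) (y k)"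
      and min: "\<And>V. V \<subseteq> S' \<and> alg (adjoin K (?Y \<union> V)) (y k) \<Longrightarrow> card U \<le> card V"
      using ex_has_least_nat[of "\<lambda>U. U \<subseteq> S' \<and> alg (adjoin K (?Y \<union> U)) (y k)" S' card] by blast
    then have U: "U \<subseteq> S'" "alg (adjoin K (?Y \<union> U)) (y k)" by auto
    have U3: "\<not> alg (adjoin K (?Y \<union> V)) (y k)" if "V \<subset> U" for V
      using min[of V] psubset_card_mono[OF _ that] that U(1) fS' finite_subset[OF U(1)]
      by (meson leD order.trans psubset_imp_subset)
    have "U \<noteq> {}" using U(2) y(1) km by (auto simp: tind_def)
    then obtain s where s: "s \<in> U" by auto
    let ?A = "?Y \<union> (U - {s})"
    have "?Y \<union> U = insert s ?A" using s by auto
    then have "alg (adjoin (adjoin K ?A) {s}) (y k)" using U(2) by (simp add: adjoin_insert[symmetric])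
    moreover have "\<not> alg (adjoin K ?A) (y k)" using s by (intro U3) auto
    ultimately have "alg (adjoin (adjoin K ?A) {y k}) s" by (rule alg_exchange[OF adjoin_subfield])
    then have "alg (adjoin K (insert (y k) ?A)) s" by (simp add: adjoin_insert[symmetric])
    moreover have sub: "insert (y k) ?A \<subseteq> y ` {..<Suc k} \<union> (S' - {s})"
      using U(1) by (auto simp: lessThan_Suc)
    ultimately have as: "alg (adjoin K (y ` {..<Suc k} \<union> (S' - {s}))) s"
      by (meson adjoin_mono alg_mono subset_refl)
    have "alg (adjoin K (y ` {..<Suc k} \<union> (S' - {s}))) t" if "t \<in> ?Y \<union> S'" for t
    proof (cases "t = s")
      case False
      then have "t \<in> y ` {..<Suc k} \<union> (S' - {s})" using that by (auto simp: lessThan_Suc)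
      then show ?thesis by (rule alg_gen)
    qed (use as in simp)
    then have "alg (adjoin K (y ` {..<Suc k} \<union> (S' - {s}))) t" if "t \<in> S" for t
      using alg_adjoin_trans[OF _ S'(3)[OF that]] by blast
    moreover have "card (S' - {s}) + Suc k = card S"
      using S'(2) card_Suc_Diff1[OF fS', of s] s U(1) by auto
    ultimately show ?case using S'(1) by (intro exI[of _ "S' - {s}"]) auto
  qed
  from this[OF order.refl] obtain S' where S': "S' \<subseteq> S" "card S' + card S = card S"
    "\<And>s. s \<in> S \<Longrightarrow> alg (adjoin K (y ` {..<card S} \<union> S')) s" by auto
  then have "S' = {}" using S finite_subset by fastforce
  then have "alg (adjoin K (y ` {..<card S})) (y (card S))"
    using alg_adjoin_trans[OF S'(3) y(2)] m by simp
  then show False using y(1) m by (auto simp: tind_def)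
qed

subsection \<open>Polynomials in several variables\<close>

abbreviation lookup where "lookup \<equiv> Poly_Mapping.lookup"
abbreviation keys where "keys \<equiv> Poly_Mapping.keys"
abbreviation single where "single \<equiv> Poly_Mapping.single"

definition monomial :: "(nat \<Rightarrow> 'a::field) \<Rightarrow> (nat \<Rightarrow>\<^sub>0 nat) \<Rightarrow> 'a"
  where "monomial x m = (\<Prod>i\<in>keys m. x i ^ lookup m i)"

lemma monomial_superset:
  assumes "finite A" "keys m \<subseteq> A"
  shows "monomial x m = (\<Prod>i\<in>A. x i ^ lookup m i)"
  unfolding monomial_def by (rule prod.mono_neutral_left) (use assms in \<open>auto simp: in_keys_iff\<close>)

lemma monomial_add: "monomial x (m + m') = monomial x m * monomial x m'"
proof -
  let ?A = "keys m \<union> keys m'"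
  have "keys (m + m') \<subseteq> ?A" by (rule Poly_Mapping.keys_add)
  then have "monomial x (m + m') = (\<Prod>i\<in>?A. x i ^ lookup (m + m') i)" by (intro monomial_superset) auto
  also have "\<dots> = (\<Prod>i\<in>?A. x i ^ lookup m i) * (\<Prod>i\<in>?A. x i ^ lookup m' i)"
    by (simp add: lookup_add power_add prod.distrib)
  also have "\<dots> = monomial x m * monomial x m'" by (simp add: monomial_superset[of ?A])
  finally show ?thesis .
qed

lemma monomial_0 [simp]: "monomial x 0 = 1" by (simp add: monomial_def)

lemma monomial_single [simp]: "monomial x (single i k) = x i ^ k"
  by (simp add: monomial_superset[of "{i}"])

lemma mpoly_eval_superset:
  assumes "finite A" "keys p \<subseteq> A"
  shows "mpoly_eval p x = (\<Sum>m\<in>A. lookup p m * monomial x m)"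
  unfolding mpoly_eval_def monomial_def by (rule sum.mono_neutral_left) (use assms in \<open>auto simp: in_keys_iff\<close>)

lemma mpoly_eval_0 [simp]: "mpoly_eval 0 x = 0"
  by (simp add: mpoly_eval_def)

lemma mpoly_eval_single [simp]: "mpoly_eval (single m c) x = c * monomial x m"
  by (simp add: mpoly_eval_superset[of "{m}"])

lemma mpoly_eval_add: "mpoly_eval (p + q) x = mpoly_eval p x + mpoly_eval q x"
proof -
  let ?A = "keys p \<union> keys q"
  have "keys (p + q) \<subseteq> ?A" by (rule Poly_Mapping.keys_add)
  then show ?thesis
    by (simp add: mpoly_eval_superset[of ?A] lookup_add distrib_right sum.distrib)
qed

lemma mpoly_eval_sum: "mpoly_eval (sum f I) x = (\<Sum>i\<in>I. mpoly_eval (f i) x)"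
  by (induction I rule: infinite_finite_induct) (auto simp: mpoly_eval_add)

definition mpolys :: "'a::field set \<Rightarrow> nat \<Rightarrow> ((nat \<Rightarrow>\<^sub>0 nat) \<Rightarrow>\<^sub>0 'a) set"
  where "mpolys K n = {p. range (lookup p) \<subseteq> K \<and> (\<forall>m\<in>keys p. keys m \<subseteq> {..<n})}"

lemma mpolys_lookup: "p \<in> mpolys K n \<Longrightarrow> lookup p m \<in> K"
  and mpolys_keys: "p \<in> mpolys K n \<Longrightarrow> m \<in> keys p \<Longrightarrow> keys m \<subseteq> {..<n}"
  unfolding mpolys_def by blast+

lemma alg_independent_iff: "alg_independent K n x \<longleftrightarrow> (\<forall>p\<in>mpolys K n. mpoly_eval p x = 0 \<longrightarrow> p = 0)"
  by (auto simp: alg_independent_def mpolys_def)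

lemma mpoly_as_sum: "p = (\<Sum>m\<in>keys p. single m (lookup p m))"
  by (rule poly_mapping_eqI)
    (auto simp: lookup_sum lookup_single when_def in_keys_iff sum.delta')

lemma lookup_sum_single:
  assumes "finite A" "inj_on h A" "a \<in> A"
  shows "lookup (\<Sum>b\<in>A. single (h b) (c b)) (h a) = c a"
proof -
  have "lookup (\<Sum>b\<in>A. single (h b) (c b)) (h a) = (\<Sum>b\<in>A. if b = a then c b else 0)"
    unfolding lookup_sum using assms
    by (intro sum.cong) (auto simp: lookup_single when_def inj_on_def)
  then show ?thesis using assms by simp
qed

context
  fixes K :: "'a::field set"
  assumes K: "subfield K amb"
begin

lemma mpolys_0 [simp]: "0 \<in> mpolys K n"
  using K by (auto simp: mpolys_def)

lemma mpolys_add [simp]: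
  assumes "p \<in> mpolys K n" "q \<in> mpolys K n" shows "p + q \<in> mpolys K n"
proof -
  have "lookup (p + q) m \<in> K" for m
    using assms K by (simp add: mpolys_lookup lookup_add)
  moreover have "\<forall>m\<in>keys (p + q). keys m \<subseteq> {..<n}"
    using assms Poly_Mapping.keys_add[of p q] unfolding mpolys_def by blast
  ultimately show ?thesis by (auto simp: mpolys_def)
qed

lemma mpolys_sum [simp]: "(\<And>i. i \<in> I \<Longrightarrow> f i \<in> mpolys K n) \<Longrightarrow> sum f I \<in> mpolys K n"
  by (induction I rule: infinite_finite_induct) auto

lemma mpolys_single [simp]: "c \<in> K \<Longrightarrow> keys m \<subseteq> {..<n} \<Longrightarrow> single m c \<in> mpolys K n"
  using K by (auto simp: mpolys_def lookup_single when_def split: if_splits)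

lemma mpoly_eval_in_adjoin:
  assumes "p \<in> mpolys K n" shows "mpoly_eval p x \<in> adjoin K (x ` {..<n})"
proof -
  have "monomial x m \<in> adjoin K (x ` {..<n})" if "m \<in> keys p" for m
    unfolding monomial_def using assms that adjoin_gen[of "x ` {..<n}" K]
    by (intro sf_prod sf_power) (auto simp: mpolys_def image_subset_iff subset_iff)
  moreover have "lookup p m \<in> adjoin K (x ` {..<n})" for m
    using mpolys_lookup[OF assms] adjoin_base[of K] by blast
  ultimately show ?thesis
    by (subst mpoly_eval_superset[OF _ order.refl]) auto
qed

text \<open>An existence statement suffices because only the ring formed by the values at
  \<open>x\<close> is used; the polynomial for a product is written down monomial by
  monomial.\<close>

lemma mpoly_values_mult:
  assumes "p \<in> mpolys K n" "q \<in> mpolys K n"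
  shows "\<exists>r\<in>mpolys K n. mpoly_eval r x = mpoly_eval p x * mpoly_eval q x"
proof
  let ?r = "\<Sum>m\<in>keys p. \<Sum>m'\<in>keys q. single (m + m') (lookup p m * lookup q m')"
  have "keys (m + m') \<subseteq> {..<n}" if "m \<in> keys p" "m' \<in> keys q" for m m'
    using assms that Poly_Mapping.keys_add[of m m'] unfolding mpolys_def by blast
  then show "?r \<in> mpolys K n"
    using assms K by (intro mpolys_sum mpolys_single sf_mult) (auto simp: mpolys_def)
  show "mpoly_eval ?r x = mpoly_eval p x * mpoly_eval q x"
    by (simp add: mpoly_eval_sum mpoly_eval_superset[OF _ order.refl] monomial_add sum_product mult_ac)
qed

lemma mpoly_values_diff:
  assumes "p \<in> mpolys K n" "q \<in> mpolys K n"
  shows "\<exists>r\<in>mpolys K n. mpoly_eval r x = mpoly_eval p x - mpoly_eval q x"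
proof
  let ?r = "p + (\<Sum>m'\<in>keys q. single m' (- lookup q m'))"
  show "?r \<in> mpolys K n"
    using assms K by (intro mpolys_add mpolys_sum mpolys_single sf_uminus) (auto simp: mpolys_def)
  show "mpoly_eval ?r x = mpoly_eval p x - mpoly_eval q x"
    by (simp add: mpoly_eval_add mpoly_eval_sum mpoly_eval_superset[OF _ order.refl] sum_negf)
qed

lemma mpoly_values_var:
  assumes "i < n" shows "\<exists>r\<in>mpolys K n. mpoly_eval r x = x i"
  using assms K by (intro bexI[of _ "single (single i 1) 1"]) auto

lemma mpoly_values_const:
  assumes "c \<in> K" shows "\<exists>r\<in>mpolys K n. mpoly_eval r x = c"
  using assms K by (intro bexI[of _ "single 0 c"]) auto

end

lemma adjoin_fractions:
  assumes R: "1 \<in> R" "\<And>a b. a \<in> R \<Longrightarrow> b \<in> R \<Longrightarrow> a - b \<in> R" "\<And>a b. a \<in> R \<Longrightarrow> b \<in> R \<Longrightarrow> a * b \<in> R"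
    and "K \<subseteq> R" "S \<subseteq> R"
  shows "adjoin K S \<subseteq> {a / b | a b. a \<in> R \<and> b \<in> R \<and> b \<noteq> (0::'a::field)}" (is "_ \<subseteq> ?F")
proof (rule adjoin_least)
  show "subfield ?F amb"
  proof (rule subfield_ambI)
    show "1 \<in> ?F" using R(1) by (intro CollectI exI[of _ 1]) auto
  next
    fix x y assume "x \<in> ?F" "y \<in> ?F"
    then obtain a b c d where h: "x = a / b" "y = c / d" "a \<in> R" "b \<in> R" "b \<noteq> 0" "c \<in> R" "d \<in> R" "d \<noteq> 0" by blast
    have "x - y = (a * d - c * b) / (b * d)" using h by (simp add: diff_frac_eq)
    then show "x - y \<in> ?F" using h R
      by (intro CollectI exI[of _ "a * d - c * b"] exI[of _ "b * d"]) auto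
    show "x * y \<in> ?F" using h R
      by (intro CollectI exI[of _ "a * c"] exI[of _ "b * d"]) auto
  next
    fix x assume "x \<in> ?F" "x \<noteq> 0"
    then obtain a b where "x = a / b" "a \<in> R" "b \<in> R" "b \<noteq> 0" by blast
    then show "inverse x \<in> ?F" using \<open>x \<noteq> 0\<close> by (intro CollectI exI[of _ b] exI[of _ a]) auto
  qed
  have "a \<in> ?F" if "a \<in> R" for a using that R(1) by (intro CollectI exI[of _ a] exI[of _ 1]) auto
  then show "K \<subseteq> ?F" "S \<subseteq> ?F" using assms(4,5) by blast+
qed

lemma adjoin_mpoly:
  assumes K: "subfield K amb"
  shows "adjoin K (x ` {..<n}) \<subseteq>
    {mpoly_eval p x / mpoly_eval q x | p q. p \<in> mpolys K n \<and> q \<in> mpolys K n \<and> mpoly_eval q x \<noteq> 0}"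
proof -
  let ?R = "(\<lambda>p. mpoly_eval p x) ` mpolys K n"
  have "adjoin K (x ` {..<n}) \<subseteq> {a / b | a b. a \<in> ?R \<and> b \<in> ?R \<and> b \<noteq> 0}"
  proof (rule adjoin_fractions)
    show "K \<subseteq> ?R" using mpoly_values_const[OF K] by (auto simp: image_def) metis
    then show "1 \<in> ?R" using K by auto
    show "x ` {..<n} \<subseteq> ?R" using mpoly_values_var[OF K] by (auto simp: image_def) metis
    show "a - b \<in> ?R" if "a \<in> ?R" "b \<in> ?R" for a b
      using that mpoly_values_diff[OF K] by (auto simp: image_def) metis
    show "a * b \<in> ?R" if "a \<in> ?R" "b \<in> ?R" for a b
      using that mpoly_values_mult[OF K] by (auto simp: image_def) metis
  qed
  then show ?thesis by blast
qed


text \<open>An equation of \<open>x i\<close> over its predecessors, multiplied by all denominators,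
  has coefficients that are values of polynomials \<open>R k\<close> not involving variable
  \<open>i\<close>. They assemble to one polynomial \<open>T\<close> vanishing at \<open>x\<close>,
  nonzero because its exponents record \<open>k\<close> and the exponents of \<open>R k\<close>
  separately.\<close>

lemma alg_independent_imp_tind:
  assumes K: "subfield K amb" and ind: "alg_independent K n x"
  shows "tind K n x"
  unfolding tind_def
proof (intro allI impI notI)
  fix i assume i: "i < n" and a: "alg (adjoin K (x ` {..<i})) (x i)"
  let ?A = "adjoin K (x ` {..<i})"
  obtain p where p: "p \<in> polys ?A" "p \<noteq> 0" "poly p (x i) = 0" using a by (auto simp: alg_def)
  let ?d = "Polynomial.degree p" and ?e = "\<lambda>q. mpoly_eval q x"
  have "\<forall>k. \<exists>P Q. P \<in> mpolys K i \<and> Q \<in> mpolys K i \<and> ?e Q \<noteq> 0 \<and> poly.coeff p k = ?e P / ?e Q"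
    using polys_coeff[OF p(1)] adjoin_mpoly[OF K, of x i] by blast
  then obtain P Q where PQ: "\<And>k. P k \<in> mpolys K i" "\<And>k. Q k \<in> mpolys K i" "\<And>k. ?e (Q k) \<noteq> 0"
    "\<And>k. poly.coeff p k = ?e (P k) / ?e (Q k)" by metis
  have prod: "\<exists>r\<in>mpolys K i. ?e r = (\<Prod>k\<in>A. ?e (Q k))" if "finite A" for A
    using that
  proof (induction A rule: finite_induct)
    case empty
    then show ?case using mpoly_values_const[OF K, of 1] K by auto
  next
    case (insert k A)
    then obtain r where "r \<in> mpolys K i" "?e r = (\<Prod>k\<in>A. ?e (Q k))" by auto
    then show ?case using mpoly_values_mult[OF K PQ(2)[of k], of r x] insert by auto
  qed
  have "\<exists>r\<in>mpolys K i. ?e r = poly.coeff p k * (\<Prod>k\<le>?d. ?e (Q k))" if "k \<le> ?d" for k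
  proof -
    obtain r where "r \<in> mpolys K i" "?e r = (\<Prod>k\<in>{..?d} - {k}. ?e (Q k))" using prod[of "{..?d} - {k}"] by auto
    moreover have "(\<Prod>k\<le>?d. ?e (Q k)) = ?e (Q k) * (\<Prod>k\<in>{..?d} - {k}. ?e (Q k))"
      using that by (intro prod.remove) auto
    ultimately show ?thesis
      using mpoly_values_mult[OF K PQ(1)[of k], of r x] PQ(3)[of k] by (simp add: PQ(4))
  qed
  then obtain R where R: "\<And>k. k \<le> ?d \<Longrightarrow> R k \<in> mpolys K i"
    "\<And>k. k \<le> ?d \<Longrightarrow> ?e (R k) = poly.coeff p k * (\<Prod>k\<le>?d. ?e (Q k))" by metis
  \<comment> \<open>The pairs \<open>(k, m)\<close> list the monomials of all \<open>R k\<close>;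
    \<open>?h\<close> gives the exponent of \<open>m\<close> times the \<open>k\<close>-th power of
    variable \<open>i\<close>.\<close>
  let ?S = "Sigma {..?d} (\<lambda>k. keys (R k))" and ?h = "\<lambda>(k, m). m + single i k"
  define T where "T = (\<Sum>z\<in>?S. single (?h z) (lookup (R (fst z)) (snd z)))"
  have keysR: "keys m \<subseteq> {..<i}" if "k \<le> ?d" "m \<in> keys (R k)" for k m
    using mpolys_keys[OF R(1)[OF that(1)] that(2)] .
  have "T \<in> mpolys K n" unfolding T_def
  proof (intro mpolys_sum[OF K] mpolys_single[OF K], goal_cases)
    case (1 z)
    then show ?case using mpolys_lookup[OF R(1)] by auto
  next
    case (2 z)
    then obtain k m where z: "z = (k, m)" "k \<le> ?d" "m \<in> keys (R k)" by auto
    have "keys (m + single i k) \<subseteq> keys m \<union> {i}"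
      using Poly_Mapping.keys_add[of m "single i k"] by (auto split: if_splits)
    then show ?case using keysR[OF z(2,3)] i z(1) by fastforce
  qed
  moreover have "?e T = (\<Sum>k\<le>?d. ?e (R k) * x i ^ k)"
    unfolding T_def by (simp add: mpoly_eval_sum sum.Sigma monomial_add case_prod_beta
        mpoly_eval_superset[OF _ order.refl] sum_distrib_left mult_ac)
  then have "?e T = (\<Prod>k\<le>?d. ?e (Q k)) * poly p (x i)"
    by (simp add: R(2) poly_altdef[of p] sum_distrib_left mult_ac)
  then have "?e T = 0" using p by simp
  ultimately have "T = 0" using ind by (auto simp: alg_independent_iff)
  have inj: "inj_on ?h ?S"
  proof (rule inj_onI)
    fix z z' assume zz: "z \<in> ?S" "z' \<in> ?S" "?h z = ?h z'"
    obtain k m k' m' where z: "z = (k, m)" "z' = (k', m')" by (cases z, cases z')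
    have "lookup m i = 0" "lookup m' i = 0"
      using keysR[of k m] keysR[of k' m'] zz z by (auto simp flip: not_in_keys_iff_lookup_eq_zero)
    then have "k = k'" using arg_cong[OF zz(3), of "\<lambda>m. lookup m i"] z by (simp add: lookup_add)
    then show "z = z'" using zz(3) z by simp
  qed
  have "?e (R ?d) \<noteq> 0" using PQ(3) p(2) by (simp add: R(2))
  then have "R ?d \<noteq> 0" by auto
  then obtain m where m: "m \<in> keys (R ?d)" by (meson equals0I keys_eq_empty)
  have "lookup T (?h (?d, m)) = lookup (R ?d) m"
    unfolding T_def using lookup_sum_single[OF _ inj, of "(?d, m)" "\<lambda>z. lookup (R (fst z)) (snd z)"] m by simp
  then show False using \<open>T = 0\<close> m by (simp add: in_keys_iff)
qed

text \<open>A relation is sorted by the exponent of the last variable. As \<open>x n\<close> is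
  transcendental over its predecessors, each collected coefficient vanishes, and by induction it is
  the zero polynomial.\<close>

lemma tind_imp_alg_independent:
  assumes K: "subfield K amb"
  shows "tind K n x \<Longrightarrow> alg_independent K n x"
proof (induction n)
  case 0
  show ?case unfolding alg_independent_iff
  proof safe
    fix p assume p: "p \<in> mpolys K 0" "mpoly_eval p x = 0"
    have "keys p \<subseteq> {0}" using mpolys_keys[OF p(1)] by auto
    then have "lookup p 0 = 0" using p(2) by (simp add: mpoly_eval_superset[of "{0}"])
    then show "p = 0" using \<open>keys p \<subseteq> {0}\<close>
      by (intro poly_mapping_eqI) (metis in_keys_iff lookup_zero singletonD subsetD)
  qed
next
  case (Suc n)
  have IH: "alg_independent K n x" and na: "\<not> alg (adjoin K (x ` {..<n})) (x n)"
    using Suc by (auto simp: tind_Suc)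
  show ?case unfolding alg_independent_iff
  proof safe
    fix p assume p: "p \<in> mpolys K (Suc n)" "mpoly_eval p x = 0"
    let ?e = "\<lambda>q. mpoly_eval q x"
    \<comment> \<open>\<open>g\<close> strips the exponent of the last variable, and
      \<open>M k\<close> collects the exponent vectors in which it equals \<open>k\<close>.\<close>
    define g where "g m = m - single n (lookup m n)" for m :: "nat \<Rightarrow>\<^sub>0 nat"
    have lg: "lookup (g m) i = (if i = n then 0 else lookup m i)" for m i
      by (simp add: g_def lookup_minus lookup_single when_def)
    have mg: "m = g m + single n (lookup m n)" for m
      by (rule poly_mapping_eqI) (simp add: lg lookup_add lookup_single when_def)
    define M where "M k = {m \<in> keys p. lookup m n = k}" for k
    define P where "P k = (\<Sum>m\<in>M k. single (g m) (lookup p m))" for k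
    have fM: "finite (M k)" for k by (simp add: M_def)
    have gk: "keys (g m) \<subseteq> {..<n}" if "m \<in> keys p" for m
      using mpolys_keys[OF p(1) that] by (auto simp: lg in_keys_iff less_Suc_eq subset_iff split: if_splits)
    have PK: "P k \<in> mpolys K n" for k
      unfolding P_def using K mpolys_lookup[OF p(1)] gk by (intro mpolys_sum mpolys_single) (auto simp: M_def)
    define D where "D = (\<lambda>m. lookup m n) ` keys p"
    define r where "r = (\<Sum>k\<in>D. Polynomial.monom (?e (P k)) k)"
    have "?e p = (\<Sum>m\<in>keys p. lookup p m * monomial x m)" by (simp add: mpoly_eval_superset)
    also have "\<dots> = (\<Sum>k\<in>D. \<Sum>m\<in>M k. lookup p m * monomial x m)"
      unfolding M_def D_def by (subst sum.image_gen[of _ _ "\<lambda>m. lookup m n"]) auto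
    also have "\<dots> = (\<Sum>k\<in>D. ?e (P k) * x n ^ k)"
    proof (rule sum.cong)
      fix k
      have "monomial x m = monomial x (g m) * x n ^ k" if "m \<in> M k" for m
        using that mg[of m] monomial_add[of x "g m" "single n k"] by (simp add: M_def)
      then show "(\<Sum>m\<in>M k. lookup p m * monomial x m) = ?e (P k) * x n ^ k"
        by (simp add: P_def mpoly_eval_sum sum_distrib_left mult_ac)
    qed simp
    finally have "poly r (x n) = 0" using p(2) by (simp add: r_def poly_sum poly_monom)
    moreover have "r \<in> polys (adjoin K (x ` {..<n}))"
      unfolding r_def using PK K by (intro polys_sum polys_monom mpoly_eval_in_adjoin) auto
    ultimately have "r = 0" using na by (auto simp: alg_def)
    have "?e (P k) = 0" if "k \<in> D" for k
    proof -
      have "poly.coeff r k = ?e (P k)"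
        unfolding r_def using that by (simp add: coeff_sum D_def)
      then show ?thesis using \<open>r = 0\<close> by simp
    qed
    then have P0: "P k = 0" if "k \<in> D" for k
      using IH PK that by (auto simp: alg_independent_iff)
    have "keys p = {}"
    proof (rule ccontr)
      assume "keys p \<noteq> {}"
      then obtain m where m: "m \<in> keys p" by blast
      let ?k = "lookup m n"
      have "inj_on g (M ?k)" by (rule inj_onI) (metis (mono_tags, lifting) M_def mem_Collect_eq mg)
      then have "lookup (P ?k) (g m) = lookup p m"
        unfolding P_def using m fM by (intro lookup_sum_single) (auto simp: M_def)
      then show False using P0[of ?k] m by (auto simp: D_def in_keys_iff)
    qed
    then show "p = 0" by simp
  qed
qed

lemma alg_independent_iff_tind:
  "subfield K amb \<Longrightarrow> alg_independent K n x \<longleftrightarrow> tind K n x"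
  using alg_independent_imp_tind tind_imp_alg_independent by blast

section \<open>Transcendence degree\<close>

lemma trdeg_tind:
  "subfield K amb \<Longrightarrow> trdeg K L = Sup {enat n | n x. x ` {..<n} \<subseteq> L \<and> tind K n x}"
  by (simp add: trdeg_def alg_independent_iff_tind)

lemma Sup_enat_attained:
  assumes "Sup A = enat n" "A \<noteq> {}" shows "enat n \<in> A"
proof -
  have "finite A" "Max A = enat n"
    using assms by (auto simp: Sup_enat_def split: if_splits)
  then show ?thesis using Max_in[of A] assms by auto
qed

lemma trdeg_le:
  assumes "subfield K amb" "\<And>m y. y ` {..<m} \<subseteq> L \<Longrightarrow> tind K m y \<Longrightarrow> m \<le> n"
  shows "trdeg K L \<le> enat n"
  unfolding trdeg_tind[OF assms(1)] by (rule Sup_least) (use assms(2) in auto)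

lemma trdeg_ge:
  assumes "subfield K amb" "y ` {..<m} \<subseteq> L" "tind K m y"
  shows "enat m \<le> trdeg K L"
  unfolding trdeg_tind[OF assms(1)] by (rule Sup_upper) (use assms(2,3) in auto)

lemma trdeg_attained:
  assumes "subfield K amb" "trdeg K L = enat n"
  obtains y where "y ` {..<n} \<subseteq> L" "tind K n y"
proof -
  have "enat n \<in> {enat n | n x. x ` {..<n} \<subseteq> L \<and> tind K n x}"
    using assms by (intro Sup_enat_attained) (auto simp: trdeg_tind intro!: exI[of _ 0])
  then show ?thesis using that by auto
qed

lemma trdeg_adjoin_le:
  assumes K: "subfield K amb" and S: "finite S" and L: "\<And>a. a \<in> L \<Longrightarrow> alg (adjoin K S) a"
  shows "trdeg K L \<le> enat (card S)"
proof (rule trdeg_le[OF K])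
  fix m y assume "y ` {..<m} \<subseteq> L" "tind K m y"
  then show "m \<le> card S" using L by (intro steinitz[OF S]) auto
qed

text \<open>An element transcendental over the \<open>n\<close> independent ones would give
  \<open>n + 1\<close> independent elements, more than \<open>S\<close> allows.\<close>

lemma tind_max_alg:
  assumes S: "finite S" "card S \<le> n" and L: "\<And>a. a \<in> L \<Longrightarrow> alg (adjoin K S) a"
    and z: "tind K n z" "z ` {..<n} \<subseteq> L" and a: "a \<in> L"
  shows "alg (adjoin K (z ` {..<n})) a"
proof (rule ccontr)
  assume na: "\<not> ?thesis"
  let ?z = "z(n := a)"
  have "tind K n ?z" using z(1) by (subst tind_cong[of n ?z z]) auto
  moreover have "?z ` {..<n} = z ` {..<n}" by auto
  ultimately have "tind K (Suc n) ?z" using na by (simp add: tind_Suc del: fun_upd_apply) simp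
  moreover have "alg (adjoin K S) (?z i)" if "i < Suc n" for i
    using that L a z(2) by (auto simp: less_Suc_eq)
  ultimately have "Suc n \<le> card S" by (rule steinitz[OF S(1)])
  then show False using S(2) by simp
qed

section \<open>Linear dependence over a subfield\<close>

definition lspan :: "'a::field set \<Rightarrow> 'a set \<Rightarrow> 'a set"
  where "lspan K A = {\<Sum>a\<in>A. c a * a | c. \<forall>a\<in>A. c a \<in> K}"

definition lindep :: "'a::field set \<Rightarrow> 'a set \<Rightarrow> bool"
  where "lindep K A \<longleftrightarrow> (\<exists>c. (\<forall>a\<in>A. c a \<in> K) \<and> (\<exists>a\<in>A. c a \<noteq> 0) \<and> (\<Sum>a\<in>A. c a * a) = 0)"

text \<open>Gaussian elimination: \<open>I\<close> indexes the unknowns and \<open>J\<close> the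
  equations, and the induction removes one equation together with one unknown.\<close>

lemma homogeneous_system:
  fixes c :: "'i \<Rightarrow> 'j \<Rightarrow> 'a::field"
  assumes K: "subfield K amb" and "finite J" "finite I" "card J < card I" "\<And>i j. i \<in> I \<Longrightarrow> j \<in> J \<Longrightarrow> c i j \<in> K"
  shows "\<exists>d. (\<forall>i\<in>I. d i \<in> K) \<and> (\<exists>i\<in>I. d i \<noteq> 0) \<and> (\<forall>j\<in>J. (\<Sum>i\<in>I. d i * c i j) = 0)"
  using assms(2-5)
proof (induction J arbitrary: I c rule: finite_induct)
  case empty
  then have "I \<noteq> {}" by auto
  then show ?case using K by (intro exI[of _ "\<lambda>_. 1"]) auto
next
  case (insert j J)
  show ?case
  proof (cases "\<forall>i\<in>I. c i j = 0")
    case True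
    have "card J < card I" using insert by auto
    from insert.IH[OF insert.prems(1) this, of c] insert.prems(3)
    obtain d where "\<forall>i\<in>I. d i \<in> K" "\<exists>i\<in>I. d i \<noteq> 0" "\<forall>j\<in>J. (\<Sum>i\<in>I. d i * c i j) = 0" by auto
    then show ?thesis using True by (intro exI[of _ d]) auto
  next
    case False
    then obtain i0 where i0: "i0 \<in> I" "c i0 j \<noteq> 0" by auto
    \<comment> \<open>Equation \<open>j\<close> expresses unknown \<open>i0\<close> by the others.
      \<open>?c\<close> holds the coefficients of the other equations after this substitution, and
      \<open>s\<close> below is the resulting value of unknown \<open>i0\<close>.\<close>
    let ?I = "I - {i0}" and ?c = "\<lambda>i k. c i k - c i j / c i0 j * c i0 k"
    have "card J < card ?I" using insert i0 by auto
    moreover have "?c i k \<in> K" if "i \<in> ?I" "k \<in> J" for i k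
      using insert.prems(3) that i0 K by (auto intro!: sf_diff sf_mult sf_divide)
    ultimately obtain d where d: "\<forall>i\<in>?I. d i \<in> K" "\<exists>i\<in>?I. d i \<noteq> 0" "\<forall>k\<in>J. (\<Sum>i\<in>?I. d i * ?c i k) = 0"
      using insert.IH[of ?I ?c] insert.prems(1) by auto
    define s where "s = - (\<Sum>i\<in>?I. d i * c i j) / c i0 j"
    have split: "(\<Sum>i\<in>I. (d(i0 := s)) i * c i k) = s * c i0 k + (\<Sum>i\<in>?I. d i * c i k)" for k
      using insert.prems(1) i0(1) by (simp add: sum.remove)
    show ?thesis
    proof (intro exI[of _ "d(i0 := s)"] conjI ballI)
      show "(d(i0 := s)) i \<in> K" if "i \<in> I" for i
        using that d(1) insert.prems(3) i0 K by (auto simp: s_def intro!: sf_divide sf_uminus sf_sum sf_mult)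
      show "\<exists>i\<in>I. (d(i0 := s)) i \<noteq> 0" using d(2) by auto
    next
      fix k assume k: "k \<in> insert j J"
      show "(\<Sum>i\<in>I. (d(i0 := s)) i * c i k) = 0"
      proof (cases "k = j")
        case True
        then show ?thesis unfolding split using i0 by (simp add: s_def)
      next
        case False
        then have "(\<Sum>i\<in>?I. d i * ?c i k) = 0" using k d(3) by auto
        then have "(\<Sum>i\<in>?I. d i * c i k) = (\<Sum>i\<in>?I. d i * (c i j / c i0 j * c i0 k))"
          by (simp add: right_diff_distrib sum_subtractf)
        also have "\<dots> = (\<Sum>i\<in>?I. d i * c i j) / c i0 j * c i0 k"
          by (simp add: sum_distrib_left sum_divide_distrib mult_ac)
        finally have "(\<Sum>i\<in>?I. d i * c i k) = (\<Sum>i\<in>?I. d i * c i j) / c i0 j * c i0 k" .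
        then show ?thesis unfolding split by (simp add: s_def)
      qed
    qed
  qed
qed

lemma lindep_of_card:
  assumes K: "subfield K amb" and A: "finite A" and B: "finite B" "B \<subseteq> lspan K A" "card A < card B"
  shows "lindep K B"
proof -
  have "\<forall>b\<in>B. \<exists>c. (\<forall>a\<in>A. c a \<in> K) \<and> b = (\<Sum>a\<in>A. c a * a)"
    using B(2) by (auto simp: lspan_def)
  then obtain c where c: "\<And>b a. b \<in> B \<Longrightarrow> a \<in> A \<Longrightarrow> c b a \<in> K" "\<And>b. b \<in> B \<Longrightarrow> b = (\<Sum>a\<in>A. c b a * a)"
    by metis
  obtain d where d: "\<forall>b\<in>B. d b \<in> K" "\<exists>b\<in>B. d b \<noteq> 0" "\<forall>a\<in>A. (\<Sum>b\<in>B. d b * c b a) = 0"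
    using homogeneous_system[OF K A B(1,3), of c] c(1) by auto
  have "(\<Sum>b\<in>B. d b * b) = (\<Sum>b\<in>B. \<Sum>a\<in>A. d b * c b a * a)"
  proof (rule sum.cong)
    fix b assume "b \<in> B"
    then have "d b * b = d b * (\<Sum>a\<in>A. c b a * a)" using c(2) by metis
    then show "d b * b = (\<Sum>a\<in>A. d b * c b a * a)" by (simp add: sum_distrib_left mult.assoc)
  qed simp
  also have "\<dots> = (\<Sum>a\<in>A. (\<Sum>b\<in>B. d b * c b a) * a)"
    by (subst sum.swap) (simp add: sum_distrib_right)
  also have "\<dots> = 0" using d(3) by simp
  finally show ?thesis using d by (auto simp: lindep_def)
qed

lemma lspan_base: 
  assumes "subfield K amb" "finite A" "a \<in> A" shows "a \<in> lspan K A"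
  using assms unfolding lspan_def
  by (intro CollectI exI[of _ "\<lambda>b. if b = a then 1 else 0"]) (auto simp: if_distrib[of "\<lambda>x. x * _"] cong: if_cong)

lemma max_bounded_card:
  assumes "P {}" "\<And>B. finite B \<Longrightarrow> P B \<Longrightarrow> card B \<le> d"
  shows "\<exists>B. finite B \<and> P B \<and> (\<forall>b. b \<notin> B \<longrightarrow> \<not> P (insert b B))"
proof -
  have "\<exists>B. (finite B \<and> P B) \<and> (\<forall>C. finite C \<and> P C \<longrightarrow> card C \<le> card B)"
    by (rule ex_has_greatest_nat[of _ "{}" _ "Suc d"]) (use assms in \<open>auto simp: less_Suc_eq_le\<close>)
  then obtain B where B: "finite B" "P B" "\<And>C. finite C \<Longrightarrow> P C \<Longrightarrow> card C \<le> card B" by blast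
  have "\<not> P (insert b B)" if "b \<notin> B" for b
    using B(3)[of "insert b B"] that B(1) by auto
  then show ?thesis using B by blast
qed

lemma max_independent_spans:
  assumes K: "subfield K amb" and S: "\<And>B. finite B \<Longrightarrow> B \<subseteq> S \<Longrightarrow> \<not> lindep K B \<Longrightarrow> card B \<le> d"
  shows "\<exists>B. finite B \<and> B \<subseteq> S \<and> S \<subseteq> lspan K B"
proof -
  have "\<exists>B. finite B \<and> (B \<subseteq> S \<and> \<not> lindep K B) \<and> (\<forall>b. b \<notin> B \<longrightarrow> \<not> (insert b B \<subseteq> S \<and> \<not> lindep K (insert b B)))"
    by (rule max_bounded_card) (use S in \<open>auto simp: lindep_def\<close>)
  then obtain B where B: "finite B" "B \<subseteq> S" "\<not> lindep K B"
    "\<And>b. b \<in> S \<Longrightarrow> b \<notin> B \<Longrightarrow> lindep K (insert b B)" by auto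
  have "s \<in> lspan K B" if s: "s \<in> S" for s
  proof (cases "s \<in> B")
    case True
    then show ?thesis using lspan_base[OF K B(1)] by simp
  next
    case False
    then obtain c where c: "\<forall>a\<in>insert s B. c a \<in> K" "\<exists>a\<in>insert s B. c a \<noteq> 0" "c s * s + (\<Sum>a\<in>B. c a * a) = 0"
      using B(4)[OF s False] B(1) unfolding lindep_def by (auto simp: sum.insert_if)
    have "c s \<noteq> 0"
    proof
      assume "c s = 0"
      then have "lindep K B" unfolding lindep_def using c by (intro exI[of _ c]) auto
      then show False using B(3) by simp
    qed
    then have "s = - (\<Sum>a\<in>B. c a * a) / c s" using c(3) by (simp add: field_simps eq_neg_iff_add_eq_0)
    also have "\<dots> = (\<Sum>a\<in>B. (- c a / c s) * a)" by (simp add: sum_divide_distrib sum_negf)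
    finally have "s = (\<Sum>a\<in>B. (- c a / c s) * a)" .
    then show ?thesis unfolding lspan_def using c(1) K
      by (intro CollectI exI[of _ "\<lambda>a. - c a / c s"]) (auto intro!: sf_divide sf_uminus)
  qed
  then show ?thesis using B by blast
qed

section \<open>Valued fields\<close>

locale valued =
  fixes F :: "'f::field set" and v :: "'f \<Rightarrow> 'g::linordered_ab_group_add" and \<pi> :: "'f \<Rightarrow> 'r::field"
  assumes vf: "valued_field F v" and rm: "residue_map v F \<pi>"
begin

abbreviation "R \<equiv> valuation_ring v F"

lemma F_sf [simp]: "subfield F amb" using vf by (simp add: valued_field_def)

lemmas F_closed [simp] = sf_1[OF F_sf] sf_0[OF F_sf] sf_add[OF F_sf] sf_diff[OF F_sf] sf_mult[OF F_sf] sf_uminus[OF F_sf]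
  sf_inverse[OF F_sf] sf_divide[OF F_sf] sf_power[OF F_sf] sf_sum[OF F_sf] sf_prod[OF F_sf]

lemma v_mult: "a \<in> F \<Longrightarrow> b \<in> F \<Longrightarrow> a \<noteq> 0 \<Longrightarrow> b \<noteq> 0 \<Longrightarrow> v (a * b) = v a + v b"
  using vf by (simp add: valued_field_def)

lemma v_add: "a \<in> F \<Longrightarrow> b \<in> F \<Longrightarrow> a \<noteq> 0 \<Longrightarrow> b \<noteq> 0 \<Longrightarrow> a + b \<noteq> 0 \<Longrightarrow> min (v a) (v b) \<le> v (a + b)"
  using vf by (simp add: valued_field_def)

lemma v_1 [simp]: "v 1 = 0" using v_mult[of 1 1] by simp

lemma v_minus [simp]: assumes "a \<in> F" "a \<noteq> 0" shows "v (- a) = v a"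
proof -
  have "v (- 1) + v (- 1) = 0" using v_mult[of "-1" "-1"] by simp
  then have "v (- 1) = 0" by (simp add: double_zero)
  then show ?thesis using v_mult[of "-1" a] assms by simp
qed

lemma v_inverse: assumes "a \<in> F" "a \<noteq> 0" shows "v (inverse a) = - v a"
  using v_mult[of a "inverse a"] assms by (simp add: eq_neg_iff_add_eq_0 add.commute)

lemma v_divide: "a \<in> F \<Longrightarrow> b \<in> F \<Longrightarrow> a \<noteq> 0 \<Longrightarrow> b \<noteq> 0 \<Longrightarrow> v (a / b) = v a - v b"
  by (simp add: divide_inverse v_mult v_inverse)

lemma R_iff: "a \<in> R \<longleftrightarrow> a \<in> F \<and> (a = 0 \<or> 0 \<le> v a)" by (auto simp: valuation_ring_def)

lemma RF: "a \<in> R \<Longrightarrow> a \<in> F" by (simp add: R_iff)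

lemma R_0 [simp]: "0 \<in> R" and R_1 [simp]: "1 \<in> R" by (simp_all add: R_iff)

lemma R_uminus [simp]: "a \<in> R \<Longrightarrow> - a \<in> R" by (cases "a = 0") (auto simp: R_iff)

lemma R_add [simp]: assumes "a \<in> R" "b \<in> R" shows "a + b \<in> R"
proof (cases "a = 0 \<or> b = 0 \<or> a + b = 0")
  case False
  then have "0 \<le> min (v a) (v b)" "min (v a) (v b) \<le> v (a + b)" using v_add assms by (auto simp: R_iff)
  then have "0 \<le> v (a + b)" by (rule order_trans)
  then show ?thesis using assms by (simp add: R_iff)
qed (use assms in auto)

lemma R_diff [simp]: "a \<in> R \<Longrightarrow> b \<in> R \<Longrightarrow> a - b \<in> R" using R_add[of a "- b"] by simp

lemma R_mult [simp]: "a \<in> R \<Longrightarrow> b \<in> R \<Longrightarrow> a * b \<in> R"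
  by (cases "a = 0 \<or> b = 0") (auto simp: R_iff v_mult)

lemma R_power [simp]: "a \<in> R \<Longrightarrow> a ^ n \<in> R" by (induction n) auto

lemma R_sum [simp]: "(\<And>i. i \<in> I \<Longrightarrow> f i \<in> R) \<Longrightarrow> sum f I \<in> R"
  by (induction I rule: infinite_finite_induct) auto

lemma pi_mult: "a \<in> R \<Longrightarrow> b \<in> R \<Longrightarrow> \<pi> (a * b) = \<pi> a * \<pi> b"
  and pi_add: "a \<in> R \<Longrightarrow> b \<in> R \<Longrightarrow> \<pi> (a + b) = \<pi> a + \<pi> b"
  and pi_1 [simp]: "\<pi> 1 = 1"
  using rm by (auto simp: residue_map_def ring_hom_def)

lemma pi_0 [simp]: "\<pi> 0 = 0"
proof -
  have "\<pi> 0 + \<pi> 0 = \<pi> 0 + 0" using pi_add[of 0 0] by (simp del: mult_2_right)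
  then show ?thesis by (rule add_left_imp_eq)
qed

lemma pi_uminus: "a \<in> R \<Longrightarrow> \<pi> (- a) = - \<pi> a"
  using pi_add[of a "- a"] by (simp add: eq_neg_iff_add_eq_0 add.commute)

lemma pi_diff: "a \<in> R \<Longrightarrow> b \<in> R \<Longrightarrow> \<pi> (a - b) = \<pi> a - \<pi> b"
  using pi_add[of a "- b"] by (simp add: pi_uminus)

lemma pi_power: "a \<in> R \<Longrightarrow> \<pi> (a ^ n) = \<pi> a ^ n"
  by (induction n) (auto simp: pi_mult)

lemma pi_sum: "(\<And>i. i \<in> I \<Longrightarrow> f i \<in> R) \<Longrightarrow> \<pi> (sum f I) = (\<Sum>i\<in>I. \<pi> (f i))"
  by (induction I rule: infinite_finite_induct) (auto simp: pi_add)

lemma pi_eq_0_iff: assumes "a \<in> R" shows "\<pi> a = 0 \<longleftrightarrow> a = 0 \<or> 0 < v a"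
proof -
  have "a_kernel (amb\<lparr>carrier := R\<rparr>) amb \<pi> = valuation_ideal v F"
    using rm unfolding residue_map_def by blast
  then have "a \<in> valuation_ideal v F \<longleftrightarrow> \<pi> a = 0"
    using assms by (auto simp: a_kernel_def kernel_def)
  then show ?thesis using RF[OF assms] by (simp add: valuation_ideal_def)
qed

lemma unit_iff: "a \<in> R \<and> \<pi> a \<noteq> 0 \<longleftrightarrow> a \<in> F \<and> a \<noteq> 0 \<and> v a = 0"
  using pi_eq_0_iff[of a] by (auto simp: R_iff)

lemma unitD: "a \<in> F \<Longrightarrow> a \<noteq> 0 \<Longrightarrow> v a = 0 \<Longrightarrow> a \<in> R"
  and unitD': "a \<in> F \<Longrightarrow> a \<noteq> 0 \<Longrightarrow> v a = 0 \<Longrightarrow> \<pi> a \<noteq> 0"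
  using unit_iff[of a] by auto

lemma pi_inverse: assumes "a \<in> F" "a \<noteq> 0" "v a = 0" shows "\<pi> (inverse a) = inverse (\<pi> a)"
proof -
  have "\<pi> (a * inverse a) = \<pi> a * \<pi> (inverse a)"
    using assms by (intro pi_mult) (auto simp: R_iff v_inverse)
  then show ?thesis using assms by (simp add: inverse_unique)
qed

lemma R_div: assumes "a \<in> R" "b \<in> F" "b \<noteq> 0" "v b = 0" shows "a / b \<in> R"
  using assms by (cases "a = 0") (auto simp: R_iff v_divide)

lemma pi_div: assumes "a \<in> R" "b \<in> F" "b \<noteq> 0" "v b = 0" shows "\<pi> (a / b) = \<pi> a / \<pi> b"
proof -
  have "\<pi> (a * inverse b) = \<pi> a * \<pi> (inverse b)"
    using assms by (intro pi_mult) (auto simp: R_iff v_inverse)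
  then show ?thesis using assms by (simp add: divide_inverse pi_inverse)
qed

abbreviation "res L \<equiv> residue_field v \<pi> L"

lemma resI: "a \<in> L \<Longrightarrow> a \<in> R \<Longrightarrow> \<pi> a \<in> res L"
  by (auto simp: residue_field_def valuation_ring_def)

lemma resE: assumes "x \<in> res L" "L \<subseteq> F" obtains a where "a \<in> L" "a \<in> R" "x = \<pi> a"
  using assms by (auto simp: residue_field_def valuation_ring_def)

lemma res_mono: "L \<subseteq> L' \<Longrightarrow> res L \<subseteq> res L'"
  by (auto simp: residue_field_def valuation_ring_def)

lemma res_subfield:
  assumes L: "subfield L amb" "L \<subseteq> F" shows "subfield (res L) amb"
proof (rule subfield_ambI)
  show "1 \<in> res L" using resI[of 1 L] L by simp
next
  fix a b assume "a \<in> res L" "b \<in> res L"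
  then obtain x y where xy: "x \<in> L" "x \<in> R" "a = \<pi> x" "y \<in> L" "y \<in> R" "b = \<pi> y" using L(2) by (metis resE)
  then show "a - b \<in> res L" "a * b \<in> res L"
    using resI[of "x - y" L] resI[of "x * y" L] L by (simp_all add: pi_diff pi_mult)
next
  fix a assume "a \<in> res L" "a \<noteq> 0"
  then obtain x where x: "x \<in> L" "x \<in> R" "a = \<pi> x" using L(2) by (metis resE)
  then have u: "x \<in> F" "x \<noteq> 0" "v x = 0" using unit_iff[of x] \<open>a \<noteq> 0\<close> by auto
  then have "inverse x \<in> R" using x by (simp add: R_iff v_inverse)
  then show "inverse a \<in> res L" using resI[of "inverse x" L] x L u by (simp add: pi_inverse)
qed

lemma ex_min_value:
  assumes "finite I" "I \<noteq> {}"
  shows "\<exists>j\<in>I. \<forall>i\<in>I. h j \<le> (h i :: 'g)"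
proof -
  have "Min (h ` I) \<in> h ` I" using assms by (intro Min_in) auto
  then obtain j where "j \<in> I" "h j = Min (h ` I)" by auto
  then show ?thesis using assms by (intro bexI[of _ j]) auto
qed

lemma ratio_R: "a \<in> F \<Longrightarrow> b \<in> F \<Longrightarrow> b \<noteq> 0 \<Longrightarrow> a = 0 \<or> v b \<le> v a \<Longrightarrow> a / b \<in> R"
  by (cases "a = 0") (auto simp: R_iff v_divide)

lemma ratio_unit:
  assumes "a \<in> F" "b \<in> F" "b \<noteq> 0" "a / b \<in> R" "\<pi> (a / b) \<noteq> 0"
  shows "a \<noteq> 0" "v a = v b"
proof -
  show a: "a \<noteq> 0" using assms by auto
  show "v a = v b" using assms a unit_iff[of "a / b"] by (simp add: v_divide)
qed

lemma pi_ratio_eq_0: "a \<in> F \<Longrightarrow> b \<in> F \<Longrightarrow> a \<noteq> 0 \<Longrightarrow> b \<noteq> 0 \<Longrightarrow> v b < v a \<Longrightarrow> \<pi> (a / b) = 0"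
  by (subst pi_eq_0_iff) (auto simp: R_iff v_divide)

text \<open>Sums are estimated by dividing by a reference element, usually a summand of least value,
  and taking residues term by term.\<close>

lemma sum_ratio:
  assumes "\<And>i. i \<in> I \<Longrightarrow> t i / g \<in> R"
  shows "sum t I / g \<in> R" "\<pi> (sum t I / g) = (\<Sum>i\<in>I. \<pi> (t i / g))"
  using assms by (auto simp: sum_divide_distrib pi_sum)

lemma lift_poly:
  assumes "L \<subseteq> F" "P \<in> polys (res L)" "0 \<in> L"
  shows "\<exists>Q. Q \<in> polys (L \<inter> R) \<and> map_poly \<pi> Q = P \<and> Polynomial.degree Q = Polynomial.degree P"
proof -
  have "\<forall>i. \<exists>c. c \<in> L \<and> c \<in> R \<and> \<pi> c = poly.coeff P i"
    using polys_coeff[OF assms(2)] resE[OF _ assms(1)] by metis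
  then obtain c where c: "\<And>i. c i \<in> L" "\<And>i. c i \<in> R" "\<And>i. \<pi> (c i) = poly.coeff P i" by metis
  let ?d = "Polynomial.degree P"
  \<comment> \<open>The sum stops at the degree of \<open>P\<close>, because vanishing coefficients
    of \<open>P\<close> may have been lifted to nonzero elements.\<close>
  define Q where "Q = (\<Sum>i\<le>?d. Polynomial.monom (c i) i)"
  have cQ: "poly.coeff Q i = (if i \<le> ?d then c i else 0)" for i
    by (simp add: Q_def coeff_sum)
  have Q1: "Q \<in> polys (L \<inter> R)" using c assms(3) by (auto simp: polys_def cQ)
  have Q2: "map_poly \<pi> Q = P"
    by (rule poly_eqI) (auto simp: coeff_map_poly cQ c coeff_eq_0)
  have "Polynomial.degree Q \<le> ?d" by (rule degree_le) (simp add: cQ)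
  moreover have "?d \<le> Polynomial.degree Q" unfolding Q2[symmetric] by (rule degree_le) (simp add: coeff_map_poly coeff_eq_0)
  ultimately show ?thesis using Q1 Q2 by auto
qed

lemma pi_poly:
  assumes "Q \<in> polys R" "a \<in> R"
  shows "poly Q a \<in> R" "\<pi> (poly Q a) = poly (map_poly \<pi> Q) (\<pi> a)"
proof -
  have c: "\<And>i. poly.coeff Q i \<in> R" using assms(1) by (simp add: polys_def)
  show "poly Q a \<in> R" unfolding poly_altdef using c assms(2) by (intro R_sum R_mult R_power)
  have "\<pi> (poly Q a) = (\<Sum>i\<le>Polynomial.degree Q. \<pi> (poly.coeff Q i) * \<pi> a ^ i)"
    unfolding poly_altdef using c assms(2) by (subst pi_sum) (auto simp: pi_mult pi_power)
  also have "\<dots> = poly (\<Sum>i\<le>Polynomial.degree Q. Polynomial.monom (\<pi> (poly.coeff Q i)) i) (\<pi> a)"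
    by (simp add: poly_sum poly_monom)
  also have "(\<Sum>i\<le>Polynomial.degree Q. Polynomial.monom (\<pi> (poly.coeff Q i)) i) = map_poly \<pi> Q"
    by (rule poly_eqI) (simp add: coeff_sum coeff_map_poly coeff_eq_0)
  finally show "\<pi> (poly Q a) = poly (map_poly \<pi> Q) (\<pi> a)" .
qed

text \<open>Division by a nonzero member of least value.\<close>

lemma scale_family:
  assumes L: "subfield L amb" "L \<subseteq> F" and I: "finite I" "\<And>i. i \<in> I \<Longrightarrow> c i \<in> L" "\<exists>i\<in>I. c i \<noteq> 0"
  shows "\<exists>j\<in>I. c j \<noteq> 0 \<and> (\<forall>i\<in>I. c i / c j \<in> L \<and> c i / c j \<in> R)"
proof -
  have "\<exists>j\<in>{i\<in>I. c i \<noteq> 0}. \<forall>i\<in>{i\<in>I. c i \<noteq> 0}. v (c j) \<le> v (c i)"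
    using I by (intro ex_min_value) auto
  then obtain j where j: "j \<in> I" "c j \<noteq> 0" "\<And>i. i \<in> I \<Longrightarrow> c i \<noteq> 0 \<Longrightarrow> v (c j) \<le> v (c i)" by auto
  have "c i / c j \<in> R" if "i \<in> I" for i
    using I j that L(2) by (intro ratio_R) auto
  then show ?thesis using j I(2) L(1) by (intro bexI[of _ j]) auto
qed

lemma scale_poly:
  assumes L: "subfield L amb" "L \<subseteq> F" and Q: "Q \<in> polys L" "Q \<noteq> 0"
  shows "\<exists>c\<in>L - {0}. smult c Q \<in> polys (L \<inter> R) \<and> map_poly \<pi> (smult c Q) \<noteq> 0"
proof -
  let ?d = "Polynomial.degree Q"
  have "\<exists>j\<in>{..?d}. poly.coeff Q j \<noteq> 0 \<and> (\<forall>i\<in>{..?d}. poly.coeff Q i / poly.coeff Q j \<in> L \<and> poly.coeff Q i / poly.coeff Q j \<in> R)"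
    using L Q by (intro scale_family) (auto simp: polys_def intro!: bexI[of _ ?d])
  then obtain j where j: "poly.coeff Q j \<noteq> 0"
    "\<And>i. i \<le> ?d \<Longrightarrow> poly.coeff Q i / poly.coeff Q j \<in> L \<and> poly.coeff Q i / poly.coeff Q j \<in> R" by auto
  let ?c = "inverse (poly.coeff Q j)"
  have "?c * poly.coeff Q i \<in> L \<inter> R" for i
    using j(2)[of i] L by (cases "i \<le> ?d") (auto simp: divide_inverse mult.commute coeff_eq_0)
  then have "smult ?c Q \<in> polys (L \<inter> R)" by (simp add: polys_def)
  moreover have "poly.coeff (map_poly \<pi> (smult ?c Q)) j = 1" using j(1) by (simp add: coeff_map_poly)
  then have "map_poly \<pi> (smult ?c Q) \<noteq> 0" by auto
  moreover have "?c \<in> L - {0}" using j(1) L Q by (simp add: polys_def)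
  ultimately show ?thesis by blast
qed

subsection \<open>Finitely many cosets and residues in a finite-dimensional space\<close>

definition same_coset :: "'f set \<Rightarrow> 'f \<Rightarrow> 'f \<Rightarrow> bool"
  where "same_coset L a b \<longleftrightarrow> (\<exists>c\<in>L - {0}. v a = v b + v c)"

text \<open>The nonzero terms of a relation over \<open>L\<close> would have pairwise distinct
  values; divided by the term of least value, the sum has residue \<open>1\<close> and so is not
  zero.\<close>

lemma distinct_cosets_independent:
  assumes L: "subfield L amb" "L \<subseteq> F" and B: "finite B" "B \<subseteq> F - {0}"
    "\<And>a b. a \<in> B \<Longrightarrow> b \<in> B \<Longrightarrow> a \<noteq> b \<Longrightarrow> \<not> same_coset L a b"
  shows "\<not> lindep L B"
proof
  assume "lindep L B"
  then obtain c where c: "\<And>b. b \<in> B \<Longrightarrow> c b \<in> L" "\<exists>b\<in>B. c b \<noteq> 0" "(\<Sum>b\<in>B. c b * b) = 0"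
    by (auto simp: lindep_def)
  let ?I = "{b \<in> B. c b \<noteq> 0}"
  have "\<exists>j\<in>?I. \<forall>i\<in>?I. v (c j * j) \<le> v (c i * i)" using c B by (intro ex_min_value) auto
  then obtain j where j: "j \<in> B" "c j \<noteq> 0" "\<And>i. i \<in> B \<Longrightarrow> c i \<noteq> 0 \<Longrightarrow> v (c j * j) \<le> v (c i * i)" by auto
  have F: "c b * b \<in> F" if "b \<in> B" for b
  proof -
    have "c b \<in> F" "b \<in> F" using c(1)[OF that] L(2) B(2) that by blast+
    then show ?thesis by simp
  qed
  have jg: "c j * j \<noteq> 0" "c j * j \<in> F" using j B F by auto
  have r: "c i * i / (c j * j) \<in> R" if "i \<in> B" for i
    using j(3)[OF that] F[OF that] jg by (intro ratio_R) auto
  have z: "\<pi> (c i * i / (c j * j)) = 0" if "i \<in> B - {j}" for i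
  proof (cases "c i = 0")
    case False
    have i: "i \<in> B" "i \<noteq> j" "i \<in> F" "i \<noteq> 0" using that B by auto
    have jF: "j \<in> F" "j \<noteq> 0" "c j \<in> F" "c i \<in> F" using j B c i L by auto
    have "v (c i * i) \<noteq> v (c j * j)"
    proof
      assume "v (c i * i) = v (c j * j)"
      then have "v i = v j + v (c j / c i)" using i jF False j(2) by (simp add: v_mult v_divide algebra_simps)
      then have "same_coset L i j" unfolding same_coset_def using c i j L False by (intro bexI[of _ "c j / c i"]) auto
      then show False using B(3) i j by blast
    qed
    then have "v (c j * j) < v (c i * i)" using j(3)[OF i(1) False] by simp
    then show ?thesis using F i jg False by (intro pi_ratio_eq_0) auto
  qed simp
  have "\<pi> ((\<Sum>b\<in>B. c b * b) / (c j * j)) = (\<Sum>b\<in>B. \<pi> (c b * b / (c j * j)))"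
    using r by (intro sum_ratio(2))
  also have "\<dots> = \<pi> (c j * j / (c j * j)) + (\<Sum>b\<in>B - {j}. \<pi> (c b * b / (c j * j)))"
    using B(1) j(1) by (rule sum.remove)
  also have "\<dots> = 1" using z jg by simp
  finally show False using c(3) by simp
qed

text \<open>Representatives of distinct cosets are linearly independent, so at most
  \<open>card A\<close> of them fit into the span, and a maximal system of them meets every coset
  that occurs.\<close>

lemma finitely_many_cosets:
  assumes L: "subfield L amb" "L \<subseteq> F" and A: "finite A" "lspan L A \<subseteq> F"
  shows "\<exists>C. finite C \<and> C \<subseteq> lspan L A - {0} \<and> (\<forall>a\<in>lspan L A - {0}. \<exists>c\<in>C. same_coset L a c)"
proof -
  let ?P = "\<lambda>C. C \<subseteq> lspan L A - {0} \<and> (\<forall>a\<in>C. \<forall>b\<in>C. a \<noteq> b \<longrightarrow> \<not> same_coset L a b)"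
  have "\<exists>C. finite C \<and> ?P C \<and> (\<forall>b. b \<notin> C \<longrightarrow> \<not> ?P (insert b C))"
  proof (rule max_bounded_card)
    fix B assume B: "finite B" "?P B"
    have "\<not> lindep L B" using B A by (intro distinct_cosets_independent[OF L]) auto
    then show "card B \<le> card A" using lindep_of_card[OF L(1) A(1) B(1)] B(2) by (meson Diff_subset leI order_trans)
  qed simp
  then obtain C where C: "finite C" "?P C" "\<And>b. b \<notin> C \<Longrightarrow> \<not> ?P (insert b C)" by blast
  have refl: "same_coset L a a" for a unfolding same_coset_def using L by (intro bexI[of _ 1]) auto
  have sym: "same_coset L b a" if ab: "same_coset L a b" for a b
  proof -
    obtain c where c: "c \<in> L - {0}" "v a = v b + v c" using ab by (auto simp: same_coset_def)
    then show ?thesis unfolding same_coset_def using L by (intro bexI[of _ "inverse c"]) (auto simp: v_inverse subset_iff)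
  qed
  have "\<exists>c\<in>C. same_coset L a c" if a: "a \<in> lspan L A - {0}" for a
  proof (cases "a \<in> C")
    case False
    then show ?thesis using C(2) C(3)[OF False] a sym by blast
  qed (use refl in blast)
  then show ?thesis using C by blast
qed

text \<open>A relation over \<open>L\<close>, scaled so that its coefficients are integral and one
  of them is \<open>1\<close>, reduces to a nontrivial relation among the residues.\<close>

lemma residues_independent:
  assumes L: "subfield L amb" "L \<subseteq> F" and B: "finite B" "B \<subseteq> R" "inj_on \<pi> B" "\<not> lindep (res L) (\<pi> ` B)"
  shows "\<not> lindep L B"
proof
  assume "lindep L B"
  then obtain c where c: "\<And>b. b \<in> B \<Longrightarrow> c b \<in> L" "\<exists>b\<in>B. c b \<noteq> 0" "(\<Sum>b\<in>B. c b * b) = 0"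
    by (auto simp: lindep_def)
  obtain j where j: "j \<in> B" "c j \<noteq> 0" "\<And>i. i \<in> B \<Longrightarrow> c i / c j \<in> L \<and> c i / c j \<in> R"
    using scale_family[OF L B(1), of c] c by auto
  let ?d = "\<lambda>y. \<pi> (c (the_inv_into B \<pi> y) / c j)"
  have d: "?d (\<pi> b) = \<pi> (c b / c j)" if "b \<in> B" for b using the_inv_into_f_f[OF B(3) that] by simp
  have "(\<Sum>y\<in>\<pi> ` B. ?d y * y) = (\<Sum>b\<in>B. \<pi> (c b / c j) * \<pi> b)"
    using d by (subst sum.reindex[OF B(3)]) auto
  also have "\<dots> = (\<Sum>b\<in>B. \<pi> (c b / c j * b))" using B(2) j(3) by (intro sum.cong refl pi_mult[symmetric]) auto
  also have "\<dots> = \<pi> (\<Sum>b\<in>B. c b / c j * b)" using B(2) j(3) by (intro pi_sum[symmetric] R_mult) auto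
  also have "(\<Sum>b\<in>B. c b / c j * b) = (\<Sum>b\<in>B. c b * b) / c j" by (simp add: sum_divide_distrib)
  finally have "(\<Sum>y\<in>\<pi> ` B. ?d y * y) = 0" using c(3) by simp
  moreover have "\<forall>y\<in>\<pi> ` B. ?d y \<in> res L" using d resI j(3) by auto
  moreover have "?d (\<pi> j) = 1" using d[OF j(1)] j(2) by simp
  then have "\<exists>y\<in>\<pi> ` B. ?d y \<noteq> 0" using j(1) by (intro bexI[of _ "\<pi> j"]) auto
  ultimately have "lindep (res L) (\<pi> ` B)" unfolding lindep_def by (intro exI[of _ ?d] conjI)
  then show False using B(4) by simp
qed

text \<open>Dividing by \<open>g\<close> brings elements of value \<open>v g\<close> to value
  \<open>0\<close>. Lifts of independent residues are independent over \<open>L\<close>, which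
  bounds the dimension over \<open>res L\<close> by \<open>card A\<close>.\<close>

lemma finitely_many_residues:
  assumes L: "subfield L amb" "L \<subseteq> F" and A: "finite A" and g: "g \<noteq> 0"
  shows "\<exists>B. finite B \<and> B \<subseteq> {\<pi> (a / g) | a. a \<in> lspan L A \<and> a / g \<in> R} \<and>
    {\<pi> (a / g) | a. a \<in> lspan L A \<and> a / g \<in> R} \<subseteq> lspan (res L) B"
proof (rule max_independent_spans[OF res_subfield[OF L]])
  fix B assume B: "finite B" "B \<subseteq> {\<pi> (a / g) | a. a \<in> lspan L A \<and> a / g \<in> R}" "\<not> lindep (res L) B"
  have "\<forall>b\<in>B. \<exists>a. a \<in> R \<and> a * g \<in> lspan L A \<and> b = \<pi> a"
  proof
    fix b assume "b \<in> B"
    then obtain a where "a \<in> lspan L A" "a / g \<in> R" "b = \<pi> (a / g)" using B(2) by blast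
    then show "\<exists>a. a \<in> R \<and> a * g \<in> lspan L A \<and> b = \<pi> a" using g by (intro exI[of _ "a / g"]) simp
  qed
  then obtain h where h: "\<And>b. b \<in> B \<Longrightarrow> h b \<in> R \<and> h b * g \<in> lspan L A \<and> b = \<pi> (h b)" by metis
  have inj: "inj_on h B" by (rule inj_onI) (metis h)
  have "\<pi> ` h ` B = B" using h by force
  moreover have "inj_on \<pi> (h ` B)" by (rule inj_onI) (metis h imageE)
  ultimately have nl: "\<not> lindep L (h ` B)" using B h by (intro residues_independent[OF L]) auto
  have injg: "inj_on (\<lambda>a. a * g) (h ` B)" using g by (auto simp: inj_on_def)
  let ?C = "(\<lambda>a. a * g) ` h ` B"
  show "card B \<le> card A"
  proof (rule ccontr)
    assume "\<not> card B \<le> card A"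
    then have "card A < card ?C" using card_image[OF inj] card_image[OF injg] by simp
    then have "lindep L ?C" using B(1) h by (intro lindep_of_card[OF L(1) A]) auto
    then obtain c where c: "\<forall>a\<in>?C. c a \<in> L" "\<exists>a\<in>?C. c a \<noteq> 0" "(\<Sum>a\<in>?C. c a * a) = 0"
      by (auto simp: lindep_def)
    have "(\<Sum>a\<in>?C. c a * a) = (\<Sum>a\<in>h ` B. c (a * g) * a) * g"
      by (subst sum.reindex[OF injg]) (simp add: sum_distrib_right mult.assoc)
    then have "lindep L (h ` B)" unfolding lindep_def using c g
      by (intro exI[of _ "\<lambda>a. c (a * g)"]) auto
    then show False using nl by simp
  qed
qed

end

section \<open>Generated subgroups and linear spans\<close>

inductive_set gspan :: "'g::ab_group_add set \<Rightarrow> 'g set" for S where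
  zero: "0 \<in> gspan S"
| incl: "a \<in> S \<Longrightarrow> a \<in> gspan S"
| diff: "a \<in> gspan S \<Longrightarrow> b \<in> gspan S \<Longrightarrow> a - b \<in> gspan S"

lemma gspan_uminus: "a \<in> gspan S \<Longrightarrow> - a \<in> gspan S"
  using gspan.diff[OF gspan.zero, of a S] by simp

lemma gspan_add: "a \<in> gspan S \<Longrightarrow> b \<in> gspan S \<Longrightarrow> a + b \<in> gspan S"
  using gspan.diff[OF _ gspan_uminus, of a S b] by simp

lemma gspan_least:
  assumes "S \<subseteq> gspan T" shows "gspan S \<subseteq> gspan T"
proof
  fix a assume "a \<in> gspan S"
  then show "a \<in> gspan T"
    by induction (use assms in \<open>auto intro: gspan.intros\<close>)
qed

lemma gspan_mono: "S \<subseteq> T \<Longrightarrow> gspan S \<subseteq> gspan T"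
  by (rule gspan_least) (auto intro: gspan.incl)

lemma lspan_in_subfield: "subfield L amb \<Longrightarrow> K \<subseteq> L \<Longrightarrow> A \<subseteq> L \<Longrightarrow> lspan K A \<subseteq> L"
  unfolding lspan_def by (auto intro!: sf_sum sf_mult)

lemma lspan_add: "subfield K amb \<Longrightarrow> a \<in> lspan K A \<Longrightarrow> b \<in> lspan K A \<Longrightarrow> a + b \<in> lspan K A"
proof -
  assume K: "subfield K amb" and "a \<in> lspan K A" "b \<in> lspan K A"
  then obtain c d where "\<forall>x\<in>A. c x \<in> K" "a = (\<Sum>x\<in>A. c x * x)" "\<forall>x\<in>A. d x \<in> K" "b = (\<Sum>x\<in>A. d x * x)"
    by (auto simp: lspan_def)
  then show ?thesis unfolding lspan_def using K
    by (intro CollectI exI[of _ "\<lambda>x. c x + d x"]) (auto simp: distrib_right sum.distrib)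
qed

lemma lspan_scale: "subfield K amb \<Longrightarrow> k \<in> K \<Longrightarrow> a \<in> lspan K A \<Longrightarrow> k * a \<in> lspan K A"
proof -
  assume K: "subfield K amb" "k \<in> K" and "a \<in> lspan K A"
  then obtain c where "\<forall>x\<in>A. c x \<in> K" "a = (\<Sum>x\<in>A. c x * x)"
    by (auto simp: lspan_def)
  then show ?thesis unfolding lspan_def using K
    by (intro CollectI exI[of _ "\<lambda>x. k * c x"]) (auto simp: sum_distrib_left mult_ac)
qed

lemma lspan_0: "subfield K amb \<Longrightarrow> 0 \<in> lspan K A"
  unfolding lspan_def by (intro CollectI exI[of _ "\<lambda>x. 0"]) auto

lemma lspan_sum:
  "subfield K amb \<Longrightarrow> (\<And>i. i \<in> I \<Longrightarrow> f i \<in> lspan K A) \<Longrightarrow> sum f I \<in> lspan K A"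
  by (induction I rule: infinite_finite_induct) (auto intro: lspan_add lspan_0)

lemma poly_in_lspan:
  assumes K: "subfield K amb" and p: "p \<in> polys K" "Polynomial.degree p \<le> d"
  shows "poly p a \<in> lspan K ((\<lambda>i. a ^ i) ` {..d})"
  unfolding poly_altdef using K p
  by (intro lspan_sum lspan_scale lspan_base) (auto simp: polys_coeff)

context valued
begin

section \<open>Approximation up to higher value\<close>

text \<open>Equality of initial forms in the graded ring of \<open>v\<close>: \<open>a\<close> and
  \<open>b\<close> differ by a factor congruent to \<open>1\<close> modulo the maximal
  ideal.\<close>

definition sim :: "'f \<Rightarrow> 'f \<Rightarrow> bool"
  where "sim a b \<longleftrightarrow> a \<in> F \<and> b \<in> F \<and> a \<noteq> 0 \<and> b \<noteq> 0 \<and> v a = v b \<and> \<pi> (a / b) = 1"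

lemma simD: "sim a b \<Longrightarrow> a \<in> F" "sim a b \<Longrightarrow> b \<in> F" "sim a b \<Longrightarrow> a \<noteq> 0" "sim a b \<Longrightarrow> b \<noteq> 0"
  "sim a b \<Longrightarrow> v a = v b" "sim a b \<Longrightarrow> a / b \<in> R" "sim a b \<Longrightarrow> \<pi> (a / b) = 1"
  by (auto simp: sim_def R_iff v_divide)

lemma sim_refl: "a \<in> F \<Longrightarrow> a \<noteq> 0 \<Longrightarrow> sim a a"
  by (simp add: sim_def)

lemma sim_sym: assumes "sim a b" shows "sim b a"
proof -
  have "\<pi> (inverse (a / b)) = inverse (\<pi> (a / b))"
    using simD[OF assms] by (intro pi_inverse) (auto simp: v_divide)
  then show ?thesis using assms by (simp add: sim_def)
qed

lemma sim_mult: assumes "sim a b" "sim c d" shows "sim (a * c) (b * d)"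
proof -
  have "\<pi> (a / b * (c / d)) = \<pi> (a / b) * \<pi> (c / d)"
    using simD[OF assms(1)] simD[OF assms(2)] by (intro pi_mult)
  then show ?thesis using assms by (simp add: sim_def v_mult)
qed

lemma sim_trans: assumes "sim a b" "sim b c" shows "sim a c"
proof -
  have "\<pi> (a / b * (b / c)) = \<pi> (a / b) * \<pi> (b / c)"
    using simD[OF assms(1)] simD[OF assms(2)] by (intro pi_mult)
  then show ?thesis using assms by (simp add: sim_def)
qed

lemma sim_pi: assumes "sim a b" "a \<in> R" shows "b \<in> R" "\<pi> a = \<pi> b"
proof -
  show b: "b \<in> R" using simD[OF assms(1)] assms(2) by (simp add: R_iff)
  have "\<pi> (a / b * b) = \<pi> (a / b) * \<pi> b" using simD[OF assms(1)] b by (intro pi_mult)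
  then show "\<pi> a = \<pi> b" using simD[OF assms(1)] by simp
qed

lemma sim_ratioI:
  assumes "a \<in> F" "b \<in> F" "b \<noteq> 0" "a / b \<in> R" "\<pi> (a / b) = 1" shows "sim a b"
  using assms ratio_unit[of a b] by (auto simp: sim_def)

lemma sim_diffI:
  assumes "a \<in> F" "b \<in> F" "a \<noteq> 0" "a - b = 0 \<or> v a < v (a - b)" shows "sim a b"
proof -
  have "(a - b) / a \<in> R \<and> \<pi> ((a - b) / a) = 0"
  proof (cases "a - b = 0")
    case False
    then show ?thesis using assms by (intro conjI ratio_R pi_ratio_eq_0) auto
  qed simp
  then have c: "(a - b) / a \<in> R" "\<pi> ((a - b) / a) = 0" by auto
  have e: "b / a = 1 - (a - b) / a" using assms by (simp add: field_simps)
  have "b / a \<in> R" "\<pi> (b / a) = 1" unfolding e using c by (simp_all only: R_diff R_1 pi_diff pi_1 diff_zero)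
  then have "sim b a" using assms by (intro sim_ratioI)
  then show ?thesis by (rule sim_sym)
qed

text \<open>A set that is a field up to terms of higher value: subfields, and polynomials of bounded
  degree evaluated at a suitable element.\<close>

definition res_closed :: "'f set \<Rightarrow> bool"
  where "res_closed V \<longleftrightarrow> V \<subseteq> F \<and> 1 \<in> V \<and> (\<forall>a\<in>V. \<forall>b\<in>V. a - b \<in> V) \<and>
    (\<forall>a\<in>V - {0}. \<forall>b\<in>V - {0}. \<exists>u\<in>V. sim (a * b) u) \<and> (\<forall>a\<in>V - {0}. \<exists>u\<in>V. sim (inverse a) u)"

lemma res_closed_subfield:
  assumes L: "subfield L amb" "L \<subseteq> F" shows "res_closed L"
  unfolding res_closed_def
proof (intro conjI ballI)
  show "\<exists>u\<in>L. sim (a * b) u" if "a \<in> L - {0}" "b \<in> L - {0}" for a b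
    using that L by (intro bexI[of _ "a * b"] sim_refl) auto
  show "\<exists>u\<in>L. sim (inverse a) u" if "a \<in> L - {0}" for a
    using that L by (intro bexI[of _ "inverse a"] sim_refl) auto
qed (use L in auto)

context
  fixes V assumes V: "res_closed V"
begin

lemma VF: "a \<in> V \<Longrightarrow> a \<in> F" and V1: "1 \<in> V" and V_diff: "a \<in> V \<Longrightarrow> b \<in> V \<Longrightarrow> a - b \<in> V"
  using V by (auto simp: res_closed_def)

lemma V_mult: assumes "a \<in> V" "b \<in> V" "a \<noteq> 0" "b \<noteq> 0" obtains u where "u \<in> V" "sim (a * b) u"
  using V assms unfolding res_closed_def by blast

lemma V_inv: assumes "a \<in> V" "a \<noteq> 0" obtains u where "u \<in> V" "sim (inverse a) u"
  using V assms unfolding res_closed_def by blast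

lemma V_div: assumes "a \<in> V" "b \<in> V" "a \<noteq> 0" "b \<noteq> 0" obtains u where "u \<in> V" "sim (a / b) u"
proof -
  obtain w where w: "w \<in> V" "sim (inverse b) w" using V_inv assms by blast
  obtain u where u: "u \<in> V" "sim (a * w) u" using V_mult[OF assms(1) w(1)] assms simD[OF w(2)] by blast
  have "sim (a * inverse b) (a * w)" using w(2) assms VF by (intro sim_mult sim_refl) auto
  then show ?thesis using that u sim_trans by (auto simp: divide_inverse)
qed

lemma V_power: assumes "a \<in> V" "a \<noteq> 0" obtains u where "u \<in> V" "sim (a ^ n) u"
proof (induction n arbitrary: thesis)
  case 0
  then show ?case using V1 sim_refl[of 1] by simp
next
  case (Suc n)
  then obtain w where w: "w \<in> V" "sim (a ^ n) w" by blast
  obtain u where u: "u \<in> V" "sim (a * w) u" using V_mult[OF assms(1) w(1)] assms simD[OF w(2)] by blast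
  have "sim (a * a ^ n) (a * w)" using w(2) assms VF by (intro sim_mult sim_refl) auto
  then show ?case using Suc.prems[OF u(1)] sim_trans[OF _ u(2)] by simp
qed

lemma res_V_subfield: "subfield (res V) amb"
proof (rule subfield_ambI)
  have VF': "V \<subseteq> F" using VF by blast
  have V0: "0 \<in> V" using V_diff[OF V1 V1] by simp
  show "1 \<in> res V" using resI[OF V1] by simp
  fix a b assume "a \<in> res V" "b \<in> res V"
  then obtain x y where xy: "x \<in> V" "x \<in> R" "a = \<pi> x" "y \<in> V" "y \<in> R" "b = \<pi> y" using VF' by (metis resE)
  show "a - b \<in> res V" using resI[OF V_diff[OF xy(1,4)]] xy by (simp add: pi_diff)
  show "a * b \<in> res V"
  proof (cases "x = 0 \<or> y = 0")
    case True
    then show ?thesis using xy resI[OF V0] by auto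
  next
    case False
    then obtain u where u: "u \<in> V" "sim (x * y) u" using V_mult xy by blast
    have "u \<in> R" "\<pi> (x * y) = \<pi> u" using sim_pi[OF u(2)] xy by auto
    then show ?thesis using resI[OF u(1)] xy by (simp add: pi_mult)
  qed
next
  fix a assume "a \<in> res V" "a \<noteq> 0"
  then obtain x where x: "x \<in> V" "x \<in> R" "a = \<pi> x" using VF by (metis resE subsetI)
  then have u: "x \<in> F" "x \<noteq> 0" "v x = 0" using unit_iff[of x] \<open>a \<noteq> 0\<close> by auto
  obtain w where w: "w \<in> V" "sim (inverse x) w" using V_inv x u by blast
  have "inverse x \<in> R" using u by (simp add: R_iff v_inverse)
  then have "w \<in> R" "\<pi> (inverse x) = \<pi> w" using sim_pi[OF w(2)] by auto
  then show "inverse a \<in> res V" using resI[OF w(1)] x u by (simp add: pi_inverse)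
qed

context
  fixes f E
  assumes f: "f \<in> F" "f \<noteq> 0" and E: "subfield E amb"
    and units: "\<And>u k. u \<in> V \<Longrightarrow> u \<noteq> 0 \<Longrightarrow> v (u * f ^ k) = 0 \<Longrightarrow> \<pi> (u * f ^ k) \<in> E"
begin

text \<open>Up to \<open>sim\<close> the set \<open>V\<close> is closed under division, so the
  quotient agrees with \<open>u f^(i - j)\<close> or with the inverse of \<open>u f^(j - i)\<close>,
  according to which exponent is larger. The field \<open>E\<close> receives the residues of such
  monomials of value \<open>0\<close>.\<close>

lemma quotient_of_terms:
  assumes p: "p \<in> V" "p \<noteq> 0" and q: "q \<in> V" "q \<noteq> 0"
  shows "\<exists>u\<in>V - {0}. \<exists>k. v (p * f ^ i / (q * f ^ j)) = v (u * f ^ k) \<or> v (p * f ^ i / (q * f ^ j)) = - v (u * f ^ k)"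
    and "v (p * f ^ i / (q * f ^ j)) = 0 \<Longrightarrow> \<pi> (p * f ^ i / (q * f ^ j)) \<in> E"
proof -
  have *: "\<exists>u\<in>V - {0}. sim (p * f ^ i / (q * f ^ j)) (u * f ^ (i - j))"
    if pq: "p \<in> V" "p \<noteq> 0" "q \<in> V" "q \<noteq> 0" and ij: "j \<le> i" for p q i j
  proof -
    obtain u where u: "u \<in> V" "sim (p / q) u" using V_div pq by metis
    have "sim (p / q * f ^ (i - j)) (u * f ^ (i - j))" using u f by (intro sim_mult sim_refl) auto
    moreover have "p / q * f ^ (i - j) = p * f ^ i / (q * f ^ j)" using f ij by (simp add: power_diff)
    ultimately show ?thesis using u simD[OF u(2)] by (intro bexI[of _ u]) auto
  qed
  let ?h = "p * f ^ i / (q * f ^ j)"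
  have hF: "?h \<in> F" "?h \<noteq> 0" using p q f VF by auto
  consider "j \<le> i" | "i \<le> j" by linarith
  then have "(\<exists>u\<in>V - {0}. \<exists>k. v ?h = v (u * f ^ k) \<or> v ?h = - v (u * f ^ k)) \<and> (v ?h = 0 \<longrightarrow> \<pi> ?h \<in> E)"
  proof cases
    case 1
    then obtain u where u: "u \<in> V - {0}" "sim ?h (u * f ^ (i - j))" using * p q by metis
    have "\<pi> ?h \<in> E" if h0: "v ?h = 0"
      using units[of u "i - j"] u simD(5)[OF u(2)] sim_pi[OF u(2) unitD[OF hF h0]] h0 by simp
    then show ?thesis using u simD(5)[OF u(2)] by blast
  next
    case 2
    then obtain u where u: "u \<in> V - {0}" "sim (q * f ^ j / (p * f ^ i)) (u * f ^ (j - i))" using * p q by metis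
    have ih: "q * f ^ j / (p * f ^ i) = inverse ?h" by simp
    have vh: "v ?h = - v (u * f ^ (j - i))" using simD(5)[OF u(2)] v_inverse[OF hF] unfolding ih by simp
    have "\<pi> ?h \<in> E" if h0: "v ?h = 0"
    proof -
      have "\<pi> (inverse ?h) = \<pi> (u * f ^ (j - i))"
        using sim_pi(2)[OF u(2)[unfolded ih]] hF h0 by (simp add: R_iff v_inverse del: inverse_divide)
      then have "\<pi> ?h = inverse (\<pi> (u * f ^ (j - i)))"
        using pi_inverse[OF hF h0] by (metis inverse_inverse_eq)
      then show ?thesis using units[of u "j - i"] u(1) vh h0 E by simp
    qed
    then show ?thesis using u vh by blast
  qed
  then show "\<exists>u\<in>V - {0}. \<exists>k. v ?h = v (u * f ^ k) \<or> v ?h = - v (u * f ^ k)" "v ?h = 0 \<Longrightarrow> \<pi> ?h \<in> E" by blast+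
qed

text \<open>Each of \<open>s\<close> and \<open>t\<close> is a monomial in \<open>f\<close> times a
  unit with residue in \<open>E\<close>, so only the quotient of the two monomials remains.\<close>

lemma quotient_of_sums:
  assumes s: "s \<in> F" "p \<in> V" "p \<noteq> 0" "s / (p * f ^ i) \<in> R" "\<pi> (s / (p * f ^ i)) \<in> E - {0}"
    and t: "t \<in> F" "q \<in> V" "q \<noteq> 0" "t / (q * f ^ j) \<in> R" "\<pi> (t / (q * f ^ j)) \<in> E - {0}"
  shows "\<exists>u\<in>V - {0}. \<exists>k. v (s / t) = v (u * f ^ k) \<or> v (s / t) = - v (u * f ^ k)"
    and "v (s / t) = 0 \<Longrightarrow> \<pi> (s / t) \<in> E"
proof -
  let ?p = "p * f ^ i" and ?q = "q * f ^ j"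
  have pq: "?p \<in> F" "?p \<noteq> 0" "?q \<in> F" "?q \<noteq> 0" using s t f VF by auto
  have vs: "s \<noteq> 0" "v s = v ?p" and vt: "t \<noteq> 0" "v t = v ?q"
    using ratio_unit[OF s(1) pq(1,2) s(4)] ratio_unit[OF t(1) pq(3,4) t(4)] s(5) t(5) by auto
  have vv: "v (s / t) = v (?p / ?q)"
    using v_divide[OF s(1) t(1) vs(1) vt(1)] v_divide[OF pq(1,3,2,4)] vs(2) vt(2) by simp
  show "\<exists>u\<in>V - {0}. \<exists>k. v (s / t) = v (u * f ^ k) \<or> v (s / t) = - v (u * f ^ k)"
    unfolding vv using quotient_of_terms(1)[OF s(2,3) t(2,3)] .
  assume h0: "v (s / t) = 0"
  have u: "s / ?p \<in> F" "s / ?p \<noteq> 0" "v (s / ?p) = 0" "t / ?q \<in> F" "t / ?q \<noteq> 0" "v (t / ?q) = 0"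
    using vs vt s(1) t(1) pq by (simp_all add: v_divide)
  have "s / t = (s / ?p) / (t / ?q) * (?p / ?q)" using vs vt pq by simp
  moreover have "(s / ?p) / (t / ?q) \<in> R" by (rule R_div[OF s(4) u(4-6)])
  moreover have "?p / ?q \<in> R" using pq vv h0 by (intro unitD) auto
  ultimately have "\<pi> (s / t) = \<pi> ((s / ?p) / (t / ?q)) * \<pi> (?p / ?q)" by (metis pi_mult)
  also have "\<pi> ((s / ?p) / (t / ?q)) = \<pi> (s / ?p) / \<pi> (t / ?q)" by (rule pi_div[OF s(4) u(4-6)])
  finally show "\<pi> (s / t) \<in> E"
    using s(5) t(5) quotient_of_terms(2)[OF s(2,3) t(2,3)] vv h0 E by simp
qed

end

text \<open>Two terms of equal value would yield some \<open>u f^k\<close> of value \<open>0\<close>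
  with \<open>k \<ge> 1\<close>. So all nonzero terms have distinct values and the sum agrees with
  its least term up to higher value.\<close>

lemma sum_value_transcendental:
  assumes f: "f \<in> F" "f \<noteq> 0" and indep: "\<And>u k. u \<in> V \<Longrightarrow> u \<noteq> 0 \<Longrightarrow> k \<ge> 1 \<Longrightarrow> v (u * f ^ k) \<noteq> 0"
    and p: "\<And>i. p i \<in> V" "\<exists>i\<le>(N::nat). p i \<noteq> 0"
  shows "\<exists>j\<le>N. p j \<noteq> 0 \<and> (\<Sum>i\<le>N. p i * f ^ i) / (p j * f ^ j) \<in> R \<and> \<pi> ((\<Sum>i\<le>N. p i * f ^ i) / (p j * f ^ j)) = 1"
proof -
  let ?I = "{i\<in>{..N}. p i \<noteq> 0}" and ?t = "\<lambda>i. p i * f ^ i"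
  have "\<exists>j\<in>?I. \<forall>i\<in>?I. v (?t j) \<le> v (?t i)" using p(2) by (intro ex_min_value) auto
  then obtain j where j: "j \<le> N" "p j \<noteq> 0" "\<And>i. i \<le> N \<Longrightarrow> p i \<noteq> 0 \<Longrightarrow> v (?t j) \<le> v (?t i)" by auto
  have pF: "p i \<in> F" for i using VF p(1) by blast
  have tj: "?t j \<in> F" "?t j \<noteq> 0" using j f pF by auto
  have r: "?t i / ?t j \<in> R" if "i \<le> N" for i
    using j(3)[OF that] tj f pF by (intro ratio_R) auto
  have ne: "v (?t i) \<noteq> v (?t k)" if ik: "i < k" "p i \<noteq> 0" "p k \<noteq> 0" for i k
  proof
    assume eq: "v (?t i) = v (?t k)"
    obtain u where u: "u \<in> V" "sim (p k / p i) u" using V_div[OF p(1) p(1) ik(3,2)] by blast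
    have "sim (p k / p i * f ^ (k - i)) (u * f ^ (k - i))" using u f by (intro sim_mult sim_refl) auto
    then have "v (p k / p i * f ^ (k - i)) = v (u * f ^ (k - i))" by (rule simD)
    moreover have "p k / p i * f ^ (k - i) = ?t k / ?t i" using f ik by (simp add: power_diff)
    moreover have "v (?t k / ?t i) = 0" using eq ik pF f by (subst v_divide) auto
    ultimately show False using indep[OF u(1) simD(4)[OF u(2)], of "k - i"] ik by simp
  qed
  have z: "\<pi> (?t i / ?t j) = 0" if i: "i \<in> {..N} - {j}" for i
  proof (cases "p i = 0")
    case False
    then have "v (?t j) < v (?t i)" using j ne[of i j] ne[of j i] i by (metis DiffD1 DiffD2 atMost_iff linorder_neqE_nat order_le_less singletonI)
    then show ?thesis using False tj f pF by (intro pi_ratio_eq_0) auto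
  qed simp
  have "\<pi> ((\<Sum>i\<le>N. ?t i) / ?t j) = (\<Sum>i\<le>N. \<pi> (?t i / ?t j))" using r by (intro sum_ratio(2)) auto
  also have "\<dots> = \<pi> (?t j / ?t j) + (\<Sum>i\<in>{..N} - {j}. \<pi> (?t i / ?t j))"
    using j(1) by (intro sum.remove) auto
  also have "\<dots> = 1" using z tj by simp
  finally show ?thesis using j r by (intro exI[of _ j]) (auto intro!: sum_ratio(1))
qed

context
  fixes f g e
  assumes f: "f \<in> F" "f \<noteq> 0" and e: "e \<ge> 1" and g: "g \<in> V" "g \<noteq> 0" "v (f ^ e) = v g"
    and minimal: "\<And>u k. u \<in> V \<Longrightarrow> u \<noteq> 0 \<Longrightarrow> 1 \<le> k \<Longrightarrow> k < e \<Longrightarrow> v (u * f ^ k) \<noteq> 0"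
begin

text \<open>With \<open>q = k div e\<close> and \<open>r = k mod e\<close> one has
  \<open>u f^k = (f^e / g)^q (u g^q f^r)\<close>. Replacing \<open>u g^q\<close> by an element of
  \<open>V\<close>, the minimality of \<open>e\<close> forces \<open>r = 0\<close>.\<close>

lemma unit_residue:
  assumes u: "u \<in> V" "u \<noteq> 0" "v (u * f ^ k) = 0"
  shows "e dvd k" "\<exists>w\<in>res V - {0}. \<pi> (u * f ^ k) = w * \<pi> (f ^ e / g) ^ (k div e)"
proof -
  let ?q = "k div e" and ?r = "k mod e" and ?T = "f ^ e / g"
  have gF: "g \<in> F" "u \<in> F" using g u VF by auto
  have T: "?T \<in> F" "?T \<noteq> 0" "v ?T = 0" using f g gF by (auto simp: v_divide)
  obtain w1 where w1: "w1 \<in> V" "sim (g ^ ?q) w1" using V_power[OF g(1,2)] by blast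
  obtain w where w: "w \<in> V" "sim (u * w1) w" using V_mult[OF u(1) w1(1)] u simD[OF w1(2)] by blast
  have "sim (u * g ^ ?q) (u * w1)" using u w1 gF by (intro sim_mult sim_refl) auto
  then have sw: "sim (u * g ^ ?q) w" using w(2) sim_trans by blast
  have Tq: "?T ^ ?q \<in> F" "?T ^ ?q \<noteq> 0" "?T ^ ?q \<in> R" using T by (auto simp: unitD)
  have "v (?T ^ ?q) = 0"
    using Tq pi_eq_0_iff[OF Tq(3)] unitD[OF T] unitD'[OF T] by (auto simp: pi_power R_iff)
  moreover have dec: "u * f ^ k = ?T ^ ?q * (u * g ^ ?q * f ^ ?r)"
  proof -
    have "f ^ k = (f ^ e) ^ ?q * f ^ ?r" by (simp flip: power_mult power_add)
    then show ?thesis using g by (simp add: power_divide)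
  qed
  ultimately have v0: "v (u * g ^ ?q * f ^ ?r) = 0"
    using u(3)[unfolded dec] Tq gF f u(2) g(2) v_mult[of "?T ^ ?q" "u * g ^ ?q * f ^ ?r"] by simp
  have "sim (u * g ^ ?q * f ^ ?r) (w * f ^ ?r)" using sw f by (intro sim_mult sim_refl) auto
  then have "v (w * f ^ ?r) = 0" using v0 simD(5) by metis
  then have r0: "?r = 0" using minimal[OF w(1) simD(4)[OF w(2)], of ?r] e by (metis One_nat_def Suc_leI mod_less_divisor neq0_conv order_less_le_trans zero_less_one)
  then show "e dvd k" by auto
  have U: "u * g ^ ?q \<in> F" "u * g ^ ?q \<noteq> 0" "v (u * g ^ ?q) = 0" using v0 r0 gF u g by auto
  have "\<pi> (u * f ^ k) = \<pi> (?T ^ ?q) * \<pi> (u * g ^ ?q)"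
    unfolding dec using r0 Tq unitD[OF U] by (simp add: pi_mult)
  moreover have "\<pi> (u * g ^ ?q) = \<pi> w" "w \<in> R" using sim_pi[OF sw unitD[OF U]] by auto
  moreover have "\<pi> w \<noteq> 0" using unitD'[OF U] calculation by simp
  ultimately show "\<exists>w\<in>res V - {0}. \<pi> (u * f ^ k) = w * \<pi> ?T ^ ?q"
    using resI[OF w(1)] unitD[OF T] by (intro bexI[of _ "\<pi> w"]) (auto simp: pi_power mult.commute)
qed

text \<open>Exponents of terms sharing the least value differ by multiples of \<open>e\<close>, so
  the sum divided by such a term has as residue a polynomial in the residue of
  \<open>f^e / g\<close>. The transcendence of the latter keeps it nonzero.\<close>

lemma sum_residue_transcendental:
  assumes T: "\<not> alg (res V) (\<pi> (f ^ e / g))" and p: "\<And>i. p i \<in> V" "\<exists>i\<le>(N::nat). p i \<noteq> 0"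
  shows "\<exists>j\<le>N. p j \<noteq> 0 \<and> (\<Sum>i\<le>N. p i * f ^ i) / (p j * f ^ j) \<in> R \<and>
    \<pi> ((\<Sum>i\<le>N. p i * f ^ i) / (p j * f ^ j)) \<in> adjoin (res V) {\<pi> (f ^ e / g)} - {0}"
proof -
  let ?I = "{i\<in>{..N}. p i \<noteq> 0}" and ?t = "\<lambda>i. p i * f ^ i" and ?T = "\<pi> (f ^ e / g)"
  have "\<exists>j\<in>?I. \<forall>i\<in>?I. v (?t j) \<le> v (?t i)" using p(2) by (intro ex_min_value) auto
  then have ex: "\<exists>j. j \<in> ?I \<and> (\<forall>i\<in>?I. v (?t j) \<le> v (?t i))" by blast
  \<comment> \<open>The least index among the terms of least value makes every \<open>i - j\<close>
    a true difference and gives \<open>P\<close> below the nonzero constant coefficient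
    \<open>w j\<close>.\<close>
  define j where "j = (LEAST j. j \<in> ?I \<and> (\<forall>i\<in>?I. v (?t j) \<le> v (?t i)))"
  have j: "j \<in> ?I" "\<And>i. i \<in> ?I \<Longrightarrow> v (?t j) \<le> v (?t i)"
    using LeastI_ex[OF ex] unfolding j_def[symmetric] by blast+
  have jleast: "j \<le> i" if "i \<in> ?I" "v (?t i) = v (?t j)" for i
    unfolding j_def using that j(2) by (intro Least_le) (auto simp: j_def[symmetric])
  have pF: "p i \<in> F" for i using VF p(1) by blast
  have tj: "?t j \<in> F" "?t j \<noteq> 0" using j f pF by auto
  have r: "?t i / ?t j \<in> R" if "i \<le> N" for i
    using j(2)[of i] that tj f pF by (intro ratio_R) auto
  let ?J = "{i\<in>?I. v (?t i) = v (?t j)}"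
  have "\<exists>w\<in>res V - {0}. \<pi> (?t i / ?t j) = w * ?T ^ ((i - j) div e) \<and> e dvd i - j" if i: "i \<in> ?J" for i
  proof -
    have ji: "j \<le> i" using jleast i by blast
    obtain u where u: "u \<in> V" "sim (p i / p j) u" using V_div[OF p(1) p(1), of i j] i j(1) by blast
    have "sim (p i / p j * f ^ (i - j)) (u * f ^ (i - j))" using u f by (intro sim_mult sim_refl) auto
    moreover have eq: "p i / p j * f ^ (i - j) = ?t i / ?t j" using f ji by (simp add: power_diff)
    ultimately have s: "sim (?t i / ?t j) (u * f ^ (i - j))" by simp
    have "v (?t i / ?t j) = 0" using i tj pF f by (subst v_divide) auto
    then have "v (u * f ^ (i - j)) = 0" using simD(5)[OF s] by simp
    from unit_residue[OF u(1) simD(4)[OF u(2)] this] show ?thesis using sim_pi(2)[OF s] r i by auto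
  qed
  then have "\<forall>i\<in>?J. \<exists>w. w \<in> res V - {0} \<and> \<pi> (?t i / ?t j) = w * ?T ^ ((i - j) div e) \<and> e dvd i - j" by blast
  from bchoice[OF this] obtain w
    where w: "\<And>i. i \<in> ?J \<Longrightarrow> w i \<in> res V - {0} \<and> \<pi> (?t i / ?t j) = w i * ?T ^ ((i - j) div e) \<and> e dvd i - j"
    by blast
  define P where "P = (\<Sum>i\<in>?J. Polynomial.monom (w i) ((i - j) div e))"
  have sV: "subfield (res V) amb" by (rule res_V_subfield)
  have "P \<in> polys (res V)" unfolding P_def using w sV by (intro polys_sum polys_monom) auto
  have "poly.coeff P 0 = (\<Sum>i\<in>?J. if i = j then w i else 0)"
    unfolding P_def coeff_sum
  proof (rule sum.cong)
    fix i assume i: "i \<in> ?J"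
    have "(i - j) div e = 0 \<longleftrightarrow> i = j" using w[OF i] jleast[of i] i e by (auto elim!: dvdE)
    then show "poly.coeff (Polynomial.monom (w i) ((i - j) div e)) 0 = (if i = j then w i else 0)" by auto
  qed simp
  also have "\<dots> = w j" using j by simp
  also have "w j \<noteq> 0" using w[of j] j by blast
  finally have "P \<noteq> 0" by auto
  have "\<pi> ((\<Sum>i\<le>N. ?t i) / ?t j) = (\<Sum>i\<le>N. \<pi> (?t i / ?t j))" using r by (intro sum_ratio(2)) auto
  also have "\<dots> = (\<Sum>i\<in>?J. \<pi> (?t i / ?t j))"
  proof (rule sum.mono_neutral_right)
    show "\<forall>i\<in>{..N} - ?J. \<pi> (?t i / ?t j) = 0"
    proof
      fix i assume i: "i \<in> {..N} - ?J"
      show "\<pi> (?t i / ?t j) = 0"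
      proof (cases "p i = 0")
        case False
        then have "v (?t j) < v (?t i)" using j(2)[of i] i by (auto simp: order_le_less)
        then show ?thesis using False tj f pF by (intro pi_ratio_eq_0) auto
      qed simp
    qed
  qed auto
  also have "\<dots> = poly P ?T" unfolding P_def using w by (simp add: poly_sum poly_monom)
  finally have eq: "\<pi> ((\<Sum>i\<le>N. ?t i) / ?t j) = poly P ?T" .
  have "poly P ?T \<noteq> 0" using T \<open>P \<in> polys (res V)\<close> \<open>P \<noteq> 0\<close> by (auto simp: alg_def)
  moreover have "poly P ?T \<in> adjoin (res V) {?T}"
  proof (rule poly_in_subfield)
    show "P \<in> polys (adjoin (res V) {?T})" using \<open>P \<in> polys (res V)\<close> polys_mono[OF adjoin_base] by blast
    show "?T \<in> adjoin (res V) {?T}" using adjoin_gen by blast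
  qed simp
  ultimately show ?thesis using j r eq by (intro exI[of _ j]) (auto intro!: sum_ratio(1))
qed

end

end

text \<open>With \<open>V = low L m x\<close> and \<open>f\<close> the value at \<open>x\<close> of
  a polynomial of degree \<open>m\<close>, these are the expansions of the nonzero polynomials at
  \<open>x\<close> in powers of \<open>f\<close>; see \<open>poly_in_fsums\<close>.\<close>

definition fsums :: "'f set \<Rightarrow> 'f \<Rightarrow> 'f set"
  where "fsums V f = {\<Sum>i\<le>N. p i * f ^ i | p N. (\<forall>i. p i \<in> V) \<and> (\<exists>i\<le>(N::nat). p i \<noteq> 0)}"

lemma fsums_F: "V \<subseteq> F \<Longrightarrow> f \<in> F \<Longrightarrow> fsums V f \<subseteq> F"
  by (auto simp: fsums_def intro!: F_closed(10) F_closed(5) F_closed(9))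

text \<open>Here \<open>E\<close> is \<open>res V\<close>: a monomial \<open>u f^k\<close> of value
  \<open>0\<close> has \<open>k = 0\<close> by hypothesis.\<close>

lemma value_transcendental_quotients:
  assumes V: "res_closed V" and f: "f \<in> F" "f \<noteq> 0"
    and indep: "\<And>u k. u \<in> V \<Longrightarrow> u \<noteq> 0 \<Longrightarrow> k \<ge> 1 \<Longrightarrow> v (u * f ^ k) \<noteq> 0"
    and st: "s \<in> fsums V f" "t \<in> fsums V f"
  shows "s \<noteq> 0" "\<exists>u\<in>V - {0}. \<exists>k. v (s / t) = v (u * f ^ k) \<or> v (s / t) = - v (u * f ^ k)"
    "v (s / t) = 0 \<Longrightarrow> \<pi> (s / t) \<in> res V"
proof -
  have F: "V \<subseteq> F" using V by (simp add: res_closed_def)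
  have u: "\<pi> (u * f ^ k) \<in> res V" if "u \<in> V" "u \<noteq> 0" "v (u * f ^ k) = 0" for u k
  proof -
    have "k = 0" using indep[OF that(1,2), of k] that(3) by (cases k) auto
    then show ?thesis using that resI[of u V] F by (auto simp: R_iff)
  qed
  have h: "\<exists>p j. s \<in> F \<and> p \<in> V \<and> p \<noteq> 0 \<and> s / (p * f ^ j) \<in> R \<and> \<pi> (s / (p * f ^ j)) = 1" if s: "s \<in> fsums V f" for s
  proof -
    obtain p N where p: "s = (\<Sum>i\<le>(N::nat). p i * f ^ i)" "\<And>i. p i \<in> V" "\<exists>i\<le>N. p i \<noteq> 0"
      using s by (auto simp: fsums_def)
    show ?thesis using sum_value_transcendental[OF V f indep p(2,3)] p fsums_F[OF F f(1)] s by blast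
  qed
  have sV: "subfield (res V) amb" by (rule res_V_subfield[OF V])
  obtain p i where p: "s \<in> F" "p \<in> V" "p \<noteq> 0" "s / (p * f ^ i) \<in> R" "\<pi> (s / (p * f ^ i)) = 1" using h[OF st(1)] by blast
  obtain q j where q: "t \<in> F" "q \<in> V" "q \<noteq> 0" "t / (q * f ^ j) \<in> R" "\<pi> (t / (q * f ^ j)) = 1" using h[OF st(2)] by blast
  show "s \<noteq> 0" using p by auto
  have 1: "\<pi> (s / (p * f ^ i)) \<in> res V - {0}" "\<pi> (t / (q * f ^ j)) \<in> res V - {0}" using p q sV by auto
  note Q = quotient_of_sums[OF V f sV u p(1-4) 1(1) q(1-4) 1(2)]
  show "\<exists>u\<in>V - {0}. \<exists>k. v (s / t) = v (u * f ^ k) \<or> v (s / t) = - v (u * f ^ k)" using Q(1) by blast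
  show "v (s / t) = 0 \<Longrightarrow> \<pi> (s / t) \<in> res V" using Q(2) by blast
qed

text \<open>Here \<open>E\<close> is \<open>res V\<close> with the residue of \<open>f^e / g\<close>
  adjoined; \<open>unit_residue\<close> places the residues of all unit monomials in it.\<close>

lemma residue_transcendental_quotients:
  assumes V: "res_closed V" and f: "f \<in> F" "f \<noteq> 0" and e: "e \<ge> 1" and g: "g \<in> V" "g \<noteq> 0" "v (f ^ e) = v g"
    and minimal: "\<And>u k. u \<in> V \<Longrightarrow> u \<noteq> 0 \<Longrightarrow> 1 \<le> k \<Longrightarrow> k < e \<Longrightarrow> v (u * f ^ k) \<noteq> 0"
    and T: "\<not> alg (res V) (\<pi> (f ^ e / g))" and st: "s \<in> fsums V f" "t \<in> fsums V f"
  shows "s \<noteq> 0" "\<exists>u\<in>V - {0}. \<exists>k. v (s / t) = v (u * f ^ k) \<or> v (s / t) = - v (u * f ^ k)"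
    "v (s / t) = 0 \<Longrightarrow> \<pi> (s / t) \<in> adjoin (res V) {\<pi> (f ^ e / g)}"
proof -
  let ?E = "adjoin (res V) {\<pi> (f ^ e / g)}"
  have F: "V \<subseteq> F" using V by (simp add: res_closed_def)
  have u: "\<pi> (u * f ^ k) \<in> ?E" if uk: "u \<in> V" "u \<noteq> 0" "v (u * f ^ k) = 0" for u k
  proof -
    obtain w where "w \<in> res V" "\<pi> (u * f ^ k) = w * \<pi> (f ^ e / g) ^ (k div e)"
      using unit_residue(2)[OF V f e g minimal uk] by blast
    then show ?thesis using adjoin_base[of "res V"] adjoin_gen[of "{\<pi> (f ^ e / g)}"]
      by (auto intro!: sf_mult[OF adjoin_subfield] sf_power[OF adjoin_subfield])
  qed
  have h: "\<exists>p j. s \<in> F \<and> p \<in> V \<and> p \<noteq> 0 \<and> s / (p * f ^ j) \<in> R \<and> \<pi> (s / (p * f ^ j)) \<in> ?E - {0}" if s: "s \<in> fsums V f" for s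
  proof -
    obtain p N where p: "s = (\<Sum>i\<le>(N::nat). p i * f ^ i)" "\<And>i. p i \<in> V" "\<exists>i\<le>N. p i \<noteq> 0"
      using s by (auto simp: fsums_def)
    show ?thesis using sum_residue_transcendental[OF V f e g minimal T p(2,3)] p fsums_F[OF F f(1)] s by blast
  qed
  obtain p i where p: "s \<in> F" "p \<in> V" "p \<noteq> 0" "s / (p * f ^ i) \<in> R" "\<pi> (s / (p * f ^ i)) \<in> ?E - {0}" using h[OF st(1)] by blast
  obtain q j where q: "t \<in> F" "q \<in> V" "q \<noteq> 0" "t / (q * f ^ j) \<in> R" "\<pi> (t / (q * f ^ j)) \<in> ?E - {0}" using h[OF st(2)] by blast
  show "s \<noteq> 0" using p by auto
  note Q = quotient_of_sums[OF V f adjoin_subfield u p q]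
  show "\<exists>u\<in>V - {0}. \<exists>k. v (s / t) = v (u * f ^ k) \<or> v (s / t) = - v (u * f ^ k)" using Q(1) by blast
  show "v (s / t) = 0 \<Longrightarrow> \<pi> (s / t) \<in> ?E" using Q(2) by blast
qed

end

context valued
begin

section \<open>Gauss extensions and the Abhyankar inequality\<close>

lemma poly_fsums:
  assumes "p \<in> polys L" "p \<noteq> 0" shows "poly p z \<in> fsums L z"
  unfolding fsums_def poly_altdef using assms
  by (intro CollectI exI[of _ "poly.coeff p"] exI[of _ "Polynomial.degree p"]) (auto simp: polys_coeff intro!: exI[of _ "Polynomial.degree p"])

lemma v_power_gspan: "z \<in> F \<Longrightarrow> z \<noteq> 0 \<Longrightarrow> v z \<in> gspan S \<Longrightarrow> v (z ^ k) \<in> gspan S"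
  by (induction k) (auto simp: v_mult gspan.zero intro: gspan_add)

lemma adjoin_in_F: "L \<subseteq> F \<Longrightarrow> S \<subseteq> F \<Longrightarrow> adjoin L S \<subseteq> F"
  by (rule adjoin_least) auto

lemma value_setI: "a \<in> L \<Longrightarrow> a \<noteq> 0 \<Longrightarrow> v a \<in> value_set v L"
  by (auto simp: value_set_def)

text \<open>The case \<open>V = L\<close>, \<open>f = z\<close>: a nonzero polynomial in
  \<open>z\<close> has the value of one of its terms, so \<open>z\<close> contributes its own value
  and no residue.\<close>

lemma gauss_value:
  assumes L: "subfield L amb" "L \<subseteq> F" and z: "z \<in> F" "z \<noteq> 0"
    and indep: "\<And>c k. c \<in> L \<Longrightarrow> c \<noteq> 0 \<Longrightarrow> k \<ge> 1 \<Longrightarrow> v (c * z ^ k) \<noteq> 0"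
  shows "\<not> alg L z" "res (adjoin L {z}) = res L"
    "value_set v (adjoin L {z}) \<subseteq> gspan (value_set v L \<union> {v z})"
proof -
  have Q: "poly p z \<noteq> 0"
    "\<exists>u\<in>L - {0}. \<exists>k. v (poly p z / poly q z) = v (u * z ^ k) \<or> v (poly p z / poly q z) = - v (u * z ^ k)"
    "v (poly p z / poly q z) = 0 \<Longrightarrow> \<pi> (poly p z / poly q z) \<in> res L"
    if "p \<in> polys L" "p \<noteq> 0" "q \<in> polys L" "q \<noteq> 0" for p q
    using value_transcendental_quotients[OF res_closed_subfield[OF L] z indep poly_fsums[OF that(1,2)] poly_fsums[OF that(3,4)]]
    by blast+
  have nz: "poly p z \<noteq> 0" if "p \<in> polys L" "p \<noteq> 0" for p using Q(1)[OF that that] .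
  then show "\<not> alg L z" by (auto simp: alg_def)
  show "res (adjoin L {z}) = res L"
  proof
    show "res (adjoin L {z}) \<subseteq> res L"
    proof
      fix x assume "x \<in> res (adjoin L {z})"
      then obtain h where h: "h \<in> adjoin L {z}" "h \<in> R" "x = \<pi> h"
        using adjoin_in_F[OF L(2), of "{z}"] z by (elim resE) auto
      show "x \<in> res L"
      proof (cases "x = 0")
        case True
        then show ?thesis using res_subfield[OF L] by simp
      next
        case False
        then have "h \<noteq> 0" "v h = 0" using h unit_iff[of h] by auto
        moreover obtain p q where "h = poly p z / poly q z" "p \<in> polys L" "q \<in> polys L" "poly q z \<noteq> 0"
          using h(1) unfolding adjoin_singleton[OF L(1)] by blast
        ultimately show ?thesis using Q(3)[of p q] h(3) by (cases "p = 0"; cases "q = 0") auto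
      qed
    qed
  qed (intro res_mono adjoin_base)
  show "value_set v (adjoin L {z}) \<subseteq> gspan (value_set v L \<union> {v z})"
  proof
    fix x assume "x \<in> value_set v (adjoin L {z})"
    then obtain p q where pq: "x = v (poly p z / poly q z)" "p \<in> polys L" "q \<in> polys L" "p \<noteq> 0" "q \<noteq> 0"
      unfolding adjoin_singleton[OF L(1)] value_set_def by fastforce
    obtain u k where u: "u \<in> L" "u \<noteq> 0" "x = v (u * z ^ k) \<or> x = - v (u * z ^ k)"
      using Q(2)[OF pq(2,4,3,5)] pq(1) by auto
    have "v z \<in> gspan (value_set v L \<union> {v z})" "v u \<in> gspan (value_set v L \<union> {v z})"
      using u value_setI by (auto intro: gspan.incl)
    then have "v (u * z ^ k) \<in> gspan (value_set v L \<union> {v z})"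
      using v_power_gspan[OF z] u L z by (subst v_mult) (auto intro!: gspan_add)
    then show "x \<in> gspan (value_set v L \<union> {v z})" using u gspan_uminus by auto
  qed
qed

text \<open>The case \<open>V = L\<close>, \<open>f = z\<close>, \<open>e = 1\<close>,
  \<open>g = 1\<close>: no value is added, and the residue of \<open>z\<close> generates all new
  residues.\<close>

lemma gauss_residue:
  assumes L: "subfield L amb" "L \<subseteq> F" and z: "z \<in> R" "\<not> alg (res L) (\<pi> z)"
  shows "\<not> alg L z" "res (adjoin L {z}) = adjoin (res L) {\<pi> z}"
    "value_set v (adjoin L {z}) \<subseteq> gspan (value_set v L)"
proof -
  have "\<pi> z \<noteq> 0"
    using z(2) alg_base[OF res_subfield[OF L], of 0] res_subfield[OF L] by auto
  then have zF: "z \<in> F" "z \<noteq> 0" "v z = 0" using z unit_iff[of z] by auto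
  have min: "v (u * z ^ k) \<noteq> 0" if "u \<in> L" "u \<noteq> 0" "1 \<le> k" "k < 1" for u k
    using that by simp
  have 1: "1 \<in> L" "v (z ^ 1) = v 1" "\<not> alg (res L) (\<pi> (z ^ 1 / 1))" using L zF z by auto
  have Q: "poly p z \<noteq> 0"
    "\<exists>u\<in>L - {0}. \<exists>k. v (poly p z / poly q z) = v (u * z ^ k) \<or> v (poly p z / poly q z) = - v (u * z ^ k)"
    "v (poly p z / poly q z) = 0 \<Longrightarrow> \<pi> (poly p z / poly q z) \<in> adjoin (res L) {\<pi> z}"
    if "p \<in> polys L" "p \<noteq> 0" "q \<in> polys L" "q \<noteq> 0" for p q
    using residue_transcendental_quotients[OF res_closed_subfield[OF L] zF(1,2) order.refl 1(1) one_neq_zero 1(2)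
      min 1(3) poly_fsums[OF that(1,2)] poly_fsums[OF that(3,4)]]
    by simp_all
  have nz: "poly p z \<noteq> 0" if "p \<in> polys L" "p \<noteq> 0" for p using Q(1)[OF that that] .
  then show "\<not> alg L z" by (auto simp: alg_def)
  show "res (adjoin L {z}) = adjoin (res L) {\<pi> z}"
  proof
    show "res (adjoin L {z}) \<subseteq> adjoin (res L) {\<pi> z}"
    proof
      fix x assume "x \<in> res (adjoin L {z})"
      then obtain h where h: "h \<in> adjoin L {z}" "h \<in> R" "x = \<pi> h"
        using adjoin_in_F[OF L(2), of "{z}"] zF by (elim resE) auto
      show "x \<in> adjoin (res L) {\<pi> z}"
      proof (cases "x = 0")
        case False
        then have "h \<noteq> 0" "v h = 0" using h unit_iff[of h] by auto
        moreover obtain p q where "h = poly p z / poly q z" "p \<in> polys L" "q \<in> polys L" "poly q z \<noteq> 0"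
          using h(1) unfolding adjoin_singleton[OF L(1)] by blast
        ultimately show ?thesis using Q(3)[of p q] h(3) by (cases "p = 0"; cases "q = 0") auto
      qed simp
    qed
    have "z \<in> adjoin L {z}" using adjoin_gen by auto
    then have "\<pi> z \<in> res (adjoin L {z})" using z(1) by (rule resI)
    moreover have "adjoin L {z} \<subseteq> F" using adjoin_in_F[OF L(2), of "{z}"] zF by simp
    ultimately show "adjoin (res L) {\<pi> z} \<subseteq> res (adjoin L {z})"
      by (intro adjoin_least[OF res_subfield res_mono[OF adjoin_base]]) simp_all
  qed
  show "value_set v (adjoin L {z}) \<subseteq> gspan (value_set v L)"
  proof
    fix x assume "x \<in> value_set v (adjoin L {z})"
    then obtain p q where pq: "x = v (poly p z / poly q z)" "p \<in> polys L" "q \<in> polys L" "p \<noteq> 0" "q \<noteq> 0"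
      unfolding adjoin_singleton[OF L(1)] value_set_def by fastforce
    obtain u k where u: "u \<in> L" "u \<noteq> 0" "x = v (u * z ^ k) \<or> x = - v (u * z ^ k)"
      using Q(2)[OF pq(2,4,3,5)] pq(1) by auto
    have "v z \<in> gspan (value_set v L)" "v u \<in> gspan (value_set v L)"
      using u value_setI zF by (auto intro: gspan.incl gspan.zero)
    then have "v (u * z ^ k) \<in> gspan (value_set v L)"
      using v_power_gspan[OF zF(1,2)] u L zF by (subst v_mult) (auto intro!: gspan_add)
    then show "x \<in> gspan (value_set v L)" using u gspan_uminus by auto
  qed
qed

text \<open>The extension of value groups and the extension of residue fields are finitely generated
  if \<open>fin\<close> holds, and countably generated otherwise.\<close>

definition small :: "bool \<Rightarrow> 'a set \<Rightarrow> bool"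
  where "small fin S \<longleftrightarrow> countable S \<and> (fin \<longrightarrow> finite S)"

definition gen_ext :: "bool \<Rightarrow> 'f set \<Rightarrow> 'f set \<Rightarrow> bool"
  where "gen_ext fin L L' \<longleftrightarrow>
    (\<exists>C. small fin C \<and> C \<subseteq> value_set v L' \<and> value_set v L' \<subseteq> gspan (value_set v L \<union> C)) \<and>
    (\<exists>B. small fin B \<and> res L' = adjoin (res L) B)"

lemma small_finite: "finite S \<Longrightarrow> small fin S"
  by (simp add: small_def countable_finite)

lemma small_Un: "small fin S \<Longrightarrow> small fin T \<Longrightarrow> small fin (S \<union> T)"
  by (auto simp: small_def)

lemma small_UN: "small fin D \<Longrightarrow> (\<And>d. d \<in> D \<Longrightarrow> finite (Y d)) \<Longrightarrow> small fin (\<Union>d\<in>D. Y d)"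
  unfolding small_def by (simp add: countable_finite)

lemma gen_extI:
  assumes "small fin C" "C \<subseteq> value_set v L'" "value_set v L' \<subseteq> gspan (value_set v L \<union> C)"
    "small fin B" "res L' = adjoin (res L) B"
  shows "gen_ext fin L L'"
  unfolding gen_ext_def using assms by blast

lemma gen_ext_refl: "subfield L amb \<Longrightarrow> L \<subseteq> F \<Longrightarrow> gen_ext fin L L"
  by (rule gen_extI[of _ "{}" _ _ "{}"])
    (auto simp: small_def adjoin_eq_base res_subfield intro: gspan.incl)

lemma gen_ext_trans:
  assumes 1: "gen_ext fin L L'" and 2: "gen_ext fin L' L''" and "L' \<subseteq> L''"
  shows "gen_ext fin L L''"
proof -
  obtain C B where CB: "small fin C" "C \<subseteq> value_set v L'" "value_set v L' \<subseteq> gspan (value_set v L \<union> C)"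
    "small fin B" "res L' = adjoin (res L) B" using 1 unfolding gen_ext_def by blast
  obtain C' B' where CB': "small fin C'" "C' \<subseteq> value_set v L''" "value_set v L'' \<subseteq> gspan (value_set v L' \<union> C')"
    "small fin B'" "res L'' = adjoin (res L') B'" using 2 unfolding gen_ext_def by blast
  have "value_set v L' \<union> C' \<subseteq> gspan (value_set v L \<union> (C \<union> C'))"
    using CB(3) gspan_mono[of "value_set v L \<union> C" "value_set v L \<union> (C \<union> C')"] by (auto intro: gspan.incl)
  then have g: "value_set v L'' \<subseteq> gspan (value_set v L \<union> (C \<union> C'))"
    using CB'(3) gspan_least by blast
  have "value_set v L' \<subseteq> value_set v L''" using assms(3) by (auto simp: value_set_def)
  then show ?thesis using CB CB' g
    by (intro gen_extI[of _ "C \<union> C'" _ _ "B \<union> B'"] small_Un) (auto simp: adjoin_adjoin)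
qed

text \<open>Numerator and denominator of an element of \<open>L'\<close> share a finite-dimensional
  space \<open>lspan L (A d)\<close>. Each such space contributes finitely many cosets of values
  and, for each coset representative \<open>g\<close>, a finite-dimensional space of residues of
  quotients \<open>a / g\<close>.\<close>

lemma gen_ext_quotients:
  assumes L: "subfield L amb" "L \<subseteq> F" and L': "subfield L' amb" "L \<subseteq> L'" "L' \<subseteq> F"
    and D: "small fin D" and A: "\<And>d. d \<in> D \<Longrightarrow> finite (A d)" "\<And>d. d \<in> D \<Longrightarrow> A d \<subseteq> L'"
    and quot: "\<And>h. h \<in> L' \<Longrightarrow> \<exists>d\<in>D. \<exists>s\<in>lspan L (A d). \<exists>t\<in>lspan L (A d). t \<noteq> 0 \<and> h = s / t"
  shows "gen_ext fin L L'"
proof -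
  have W: "lspan L (A d) \<subseteq> L'" if "d \<in> D" for d using lspan_in_subfield[OF L'(1,2) A(2)[OF that]] .
  have "\<exists>C. finite C \<and> C \<subseteq> lspan L (A d) - {0} \<and> (\<forall>a\<in>lspan L (A d) - {0}. \<exists>c\<in>C. same_coset L a c)" if "d \<in> D" for d
    using W[OF that] L'(3) A(1)[OF that] by (intro finitely_many_cosets[OF L]) auto
  then obtain C where C: "\<And>d. d \<in> D \<Longrightarrow> finite (C d)" "\<And>d. d \<in> D \<Longrightarrow> C d \<subseteq> lspan L (A d) - {0}"
    "\<And>d a. d \<in> D \<Longrightarrow> a \<in> lspan L (A d) - {0} \<Longrightarrow> \<exists>c\<in>C d. same_coset L a c" by metis
  let ?S = "\<lambda>d g. {\<pi> (a / g) | a. a \<in> lspan L (A d) \<and> a / g \<in> R}"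
  define B where "B d g = (SOME B. finite B \<and> B \<subseteq> ?S d g \<and> ?S d g \<subseteq> lspan (res L) B)" for d g
  have exB: "\<exists>B. finite B \<and> B \<subseteq> ?S d g \<and> ?S d g \<subseteq> lspan (res L) B" if "d \<in> D" "g \<in> C d" for d g
    using C(2)[OF that(1)] that(2) by (intro finitely_many_residues[OF L A(1)[OF that(1)]]) auto
  have B: "finite (B d g)" "B d g \<subseteq> ?S d g" "?S d g \<subseteq> lspan (res L) (B d g)" if "d \<in> D" "g \<in> C d" for d g
    using someI_ex[OF exB[OF that]] unfolding B_def[symmetric] by simp_all
  let ?C = "v ` (\<Union>d\<in>D. C d)" and ?B = "\<Union>d\<in>D. \<Union>g\<in>C d. B d g"
  have CL: "g \<in> L' \<and> g \<noteq> 0" if "d \<in> D" "g \<in> C d" for d g using C(2) W that by blast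
  have sC: "small fin (\<Union>d\<in>D. C d)" "small fin ?B"
    using C(1) B(1) by (simp_all add: small_UN[OF D])
  show ?thesis
  proof (rule gen_extI)
    show "small fin ?C" using sC(1) by (auto simp: small_def)
    show "?C \<subseteq> value_set v L'" using CL by (auto simp: value_set_def)
    show "small fin ?B" by (rule sC)
    have vs: "v s \<in> gspan (value_set v L \<union> ?C)" if s: "s \<in> lspan L (A d) - {0}" "d \<in> D" for s d
    proof -
      obtain g c where gc: "g \<in> C d" "c \<in> L - {0}" "v s = v g + v c" using C(3)[OF s(2,1)] by (auto simp: same_coset_def)
      have "v g \<in> gspan (value_set v L \<union> ?C)" using gc s by (intro gspan.incl) blast
      moreover have "v c \<in> gspan (value_set v L \<union> ?C)" using gc by (intro gspan.incl) (auto simp: value_set_def)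
      ultimately show ?thesis using gc(3) gspan_add by metis
    qed
    show "value_set v L' \<subseteq> gspan (value_set v L \<union> ?C)"
    proof
      fix x assume "x \<in> value_set v L'"
      then obtain h where h: "h \<in> L'" "h \<noteq> 0" "x = v h" by (auto simp: value_set_def)
      obtain d s t where st: "d \<in> D" "s \<in> lspan L (A d)" "t \<in> lspan L (A d)" "t \<noteq> 0" "h = s / t" using quot[OF h(1)] by blast
      have "s \<noteq> 0" "s \<in> F" "t \<in> F" using st h W L'(3) by auto
      then have "x = v s - v t" using h st by (simp add: v_divide)
      then show "x \<in> gspan (value_set v L \<union> ?C)" using vs[of s d] vs[of t d] st \<open>s \<noteq> 0\<close> gspan.diff by auto
    qed
    show "res L' = adjoin (res L) ?B"
    proof
      have "B d g \<subseteq> res L'" if dg: "d \<in> D" "g \<in> C d" for d g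
      proof
        fix b assume "b \<in> B d g"
        then obtain a where a: "b = \<pi> (a / g)" "a \<in> lspan L (A d)" "a / g \<in> R" using B(2)[OF dg] by blast
        have "a / g \<in> L'" using a W[OF dg(1)] CL[OF dg] L'(1) by auto
        then show "b \<in> res L'" using a resI by blast
      qed
      then show "adjoin (res L) ?B \<subseteq> res L'"
        using L' by (intro adjoin_least res_subfield res_mono) auto
      show "res L' \<subseteq> adjoin (res L) ?B"
      proof
        fix x assume "x \<in> res L'"
        then obtain h where h: "h \<in> L'" "h \<in> R" "x = \<pi> h" using L'(3) by (elim resE)
        show "x \<in> adjoin (res L) ?B"
        proof (cases "x = 0")
          case False
          then have hu: "h \<noteq> 0" "v h = 0" using h unit_iff[of h] by auto
          obtain d s t where st: "d \<in> D" "s \<in> lspan L (A d)" "t \<in> lspan L (A d)" "t \<noteq> 0" "h = s / t" using quot[OF h(1)] by blast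
          have stF: "s \<noteq> 0" "s \<in> F" "t \<in> F" using st hu W L'(3) by auto
          then have vv: "v s = v t" using hu st by (simp add: v_divide)
          \<comment> \<open>The unit \<open>s / t\<close> need not be a quotient of units. As
            \<open>c * g\<close> has the common value of \<open>s\<close> and \<open>t\<close>,
            dividing both by it makes them units whose residues are spanned by
            \<open>B d g\<close>.\<close>
          obtain g c where gc: "g \<in> C d" "c \<in> L - {0}" "v t = v g + v c" using C(3)[OF st(1), of t] st by (auto simp: same_coset_def)
          have gF: "g \<in> F" "g \<noteq> 0" "c \<in> F" "c \<noteq> 0" using CL[OF st(1) gc(1)] gc L L' by auto
          have u: "\<pi> (a / c / g) \<in> adjoin (res L) ?B \<and> a / c / g \<in> F \<and> a / c / g \<noteq> 0 \<and> v (a / c / g) = 0"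
            if a: "a \<in> lspan L (A d)" "a \<noteq> 0" "a \<in> F" "v a = v g + v c" for a
          proof -
            have U: "a / c / g \<in> F" "a / c / g \<noteq> 0" "v (a / c / g) = 0" using a gF by (auto simp: v_divide v_mult add.commute)
            have "a / c \<in> lspan L (A d)" using lspan_scale[OF L(1) _ a(1), of "inverse c"] gc L by (simp add: divide_inverse mult.commute)
            then have "\<pi> (a / c / g) \<in> ?S d g" using unitD[OF U] by blast
            then have "\<pi> (a / c / g) \<in> lspan (res L) (B d g)" using B(3)[OF st(1) gc(1)] by blast
            moreover have "B d g \<subseteq> adjoin (res L) ?B" using adjoin_gen[of ?B "res L"] st(1) gc(1) by blast
            then have "lspan (res L) (B d g) \<subseteq> adjoin (res L) ?B"
              by (intro lspan_in_subfield adjoin_base) simp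
            ultimately show ?thesis using U by blast
          qed
          note us = u[OF st(2) stF(1,2)] and ut = u[OF st(3,4) stF(3) gc(3)]
          have us': "\<pi> (s / c / g) \<in> adjoin (res L) ?B" "s / c / g \<in> R" using us vv gc(3) unitD by auto
          have ut': "\<pi> (t / c / g) \<in> adjoin (res L) ?B" "t / c / g \<in> F" "t / c / g \<noteq> 0" "v (t / c / g) = 0"
            using ut by blast+
          have "h = (s / c / g) / (t / c / g)" using st gF by simp
          then have "x = \<pi> (s / c / g) / \<pi> (t / c / g)" using h(3) pi_div[OF us'(2) ut'(2-4)] by metis
          then show ?thesis using sf_divide[OF adjoin_subfield us'(1) ut'(1)] by metis
        qed simp
      qed
    qed
  qed
qed

text \<open>For algebraic \<open>a\<close>, division by an equation puts all polynomials in
  \<open>a\<close> into one space of bounded degree; in general the spaces for all degree bounds are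
  used, which are countably many.\<close>

lemma gen_ext_simple:
  assumes L: "subfield L amb" "L \<subseteq> F" and a: "a \<in> F" and fin: "fin \<longrightarrow> alg L a"
  shows "gen_ext fin L (adjoin L {a})"
proof -
  let ?A = "\<lambda>d. (\<lambda>i. a ^ i) ` {..d::nat}"
  have D: "\<exists>D. small fin D \<and> (\<forall>p\<in>polys L. \<forall>q\<in>polys L. \<exists>d\<in>D. poly p a \<in> lspan L (?A d) \<and> poly q a \<in> lspan L (?A d))"
  proof (cases fin)
    case True
    then obtain f where f: "f \<in> polys L" "f \<noteq> 0" "poly f a = 0" using fin by (auto simp: alg_def)
    have "poly p a \<in> lspan L (?A (Polynomial.degree f))" if p: "p \<in> polys L" for p
    proof -
      obtain q r where qr: "q \<in> polys L" "r \<in> polys L" "p = q * f + r" "r = 0 \<or> Polynomial.degree r < Polynomial.degree f"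
        using polys_division[OF L(1) p f(1,2)] by blast
      then have "poly p a = poly r a" using f(3) by simp
      then show ?thesis using poly_in_lspan[OF L(1) qr(2), of "Polynomial.degree f"] qr(4) by auto
    qed
    then show ?thesis by (intro exI[of _ "{Polynomial.degree f}"]) (auto simp: small_def)
  next
    case False
    have "\<exists>d. poly p a \<in> lspan L (?A d) \<and> poly q a \<in> lspan L (?A d)" if "p \<in> polys L" "q \<in> polys L" for p q
      using poly_in_lspan[OF L(1)] that
      by (intro exI[of _ "max (Polynomial.degree p) (Polynomial.degree q)"]) auto
    then show ?thesis using False by (intro exI[of _ UNIV]) (auto simp: small_def)
  qed
  then obtain D where D: "small fin D"
    "\<And>p q. p \<in> polys L \<Longrightarrow> q \<in> polys L \<Longrightarrow> \<exists>d\<in>D. poly p a \<in> lspan L (?A d) \<and> poly q a \<in> lspan L (?A d)" by blast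
  show ?thesis
  proof (rule gen_ext_quotients[OF L adjoin_subfield adjoin_base _ D(1), of _ ?A])
    show "adjoin L {a} \<subseteq> F" using adjoin_in_F[OF L(2)] a by simp
    show "?A d \<subseteq> adjoin L {a}" for d using adjoin_gen[of "{a}" L] by auto
    show "\<exists>d\<in>D. \<exists>s\<in>lspan L (?A d). \<exists>t\<in>lspan L (?A d). t \<noteq> 0 \<and> h = s / t" if h: "h \<in> adjoin L {a}" for h
    proof -
      obtain p q where "h = poly p a / poly q a" "p \<in> polys L" "q \<in> polys L" "poly q a \<noteq> 0"
        using h unfolding adjoin_singleton[OF L(1)] by blast
      then show ?thesis using D(2)[of p q] by blast
    qed
  qed simp
qed

lemma gen_ext_adjoin:
  assumes L: "subfield L amb" "L \<subseteq> F" and a: "\<And>i. i < n \<Longrightarrow> a i \<in> F \<and> (fin \<longrightarrow> alg L (a i))"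
  shows "gen_ext fin L (adjoin L (a ` {..<n::nat}))"
  using a
proof (induction n)
  case 0
  then show ?case using gen_ext_refl[OF L] L by (simp add: adjoin_eq_base)
next
  case (Suc n)
  let ?L = "adjoin L (a ` {..<n})"
  have "?L \<subseteq> F" using Suc.prems by (intro adjoin_in_F L) auto
  moreover have "fin \<longrightarrow> alg ?L (a n)" using Suc.prems[of n] adjoin_base[of L] alg_mono by blast
  ultimately have "gen_ext fin ?L (adjoin ?L {a n})" using Suc.prems by (intro gen_ext_simple) auto
  then have "gen_ext fin L (adjoin ?L {a n})" using Suc adjoin_base by (intro gen_ext_trans[OF Suc.IH]) auto
  then show ?case by (simp add: lessThan_Suc adjoin_insert[symmetric])
qed

text \<open>Rational independence of values modulo \<open>vK\<close>, in a triangular form parallel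
  to \<open>tind\<close>; multiples of a value appear as values of powers.\<close>

definition vind :: "'f set \<Rightarrow> nat \<Rightarrow> (nat \<Rightarrow> 'f) \<Rightarrow> bool"
  where "vind K r z \<longleftrightarrow> (\<forall>i<r. z i \<in> F - {0} \<and> (\<forall>k\<ge>1. v (z i ^ k) \<notin> gspan (value_set v K \<union> v ` z ` {..<i})))"

text \<open>The lifts \<open>y\<close> are adjoined before \<open>x\<close>: they bring residues but
  no values, after which \<open>x\<close> brings values but no residues. The values of
  \<open>x\<close> and the residues of \<open>y\<close> therefore generate everything.\<close>

lemma abhyankar:
  assumes K: "subfield K amb" "K \<subseteq> F" and x: "vind K r x"
    and y: "\<And>i. i < t \<Longrightarrow> y i \<in> R" "tind (res K) t (\<pi> \<circ> y)"
  shows "\<exists>z. tind K (t + r) z \<and> z ` {..<t + r} \<subseteq> F \<and> gen_ext True K (adjoin K (z ` {..<t + r}))"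
proof -
  have 1: "tind K t y \<and> res (adjoin K (y ` {..<t})) = adjoin (res K) ((\<pi> \<circ> y) ` {..<t}) \<and>
    value_set v (adjoin K (y ` {..<t})) \<subseteq> gspan (value_set v K)"
    using y
  proof (induction t)
    case 0
    then show ?case using K res_subfield[OF K] by (auto simp: adjoin_eq_base intro: gspan.incl)
  next
    case (Suc t)
    let ?L = "adjoin K (y ` {..<t})"
    have IH: "tind K t y" "res ?L = adjoin (res K) ((\<pi> \<circ> y) ` {..<t})" "value_set v ?L \<subseteq> gspan (value_set v K)"
      using Suc by (auto simp: tind_Suc)
    have L: "?L \<subseteq> F" using Suc.prems(1) RF by (intro adjoin_in_F K) auto
    have "y t \<in> R" "\<not> alg (res ?L) (\<pi> (y t))" using Suc.prems IH(2) by (auto simp: tind_Suc)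
    note G = gauss_residue[OF adjoin_subfield L this]
    have "adjoin ?L {y t} = adjoin K (y ` {..<Suc t})" by (simp add: lessThan_Suc adjoin_insert[symmetric])
    moreover have "adjoin (res ?L) {\<pi> (y t)} = adjoin (res K) ((\<pi> \<circ> y) ` {..<Suc t})"
      unfolding IH(2) by (simp add: lessThan_Suc adjoin_insert[symmetric])
    moreover have "gspan (value_set v ?L) \<subseteq> gspan (value_set v K)" by (rule gspan_least[OF IH(3)])
    ultimately show ?case using G IH by (auto simp: tind_Suc)
  qed
  define z where "z i = (if i < t then y i else x (i - t))" for i
  have zt: "z ` {..<t} = y ` {..<t}" by (auto simp: z_def)
  have zx: "z ` {..<t + s} = y ` {..<t} \<union> x ` {..<s}" for s
  proof -
    have "{..<t + s} = {..<t} \<union> (\<lambda>i. t + i) ` {..<s}"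
      using image_add_atLeastLessThan[of t 0 s] ivl_disj_un_two(3)[of 0 t "t + s"]
      by (simp add: lessThan_atLeast0 add.commute)
    then have "z ` {..<t + s} = z ` {..<t} \<union> (\<lambda>i. z (t + i)) ` {..<s}" by (simp only: image_Un image_image)
    moreover have "z (t + i) = x i" for i by (simp add: z_def)
    ultimately show ?thesis by (simp only: zt)
  qed
  have 2: "tind K (t + s) z \<and> res (adjoin K (z ` {..<t + s})) = adjoin (res K) ((\<pi> \<circ> y) ` {..<t}) \<and>
    value_set v (adjoin K (z ` {..<t + s})) \<subseteq> gspan (value_set v K \<union> v ` x ` {..<s})" if "s \<le> r" for s
    using that
  proof (induction s)
    case 0
    have "tind K t z" using 1 tind_cong[of t z y K] by (simp add: z_def)
    then show ?case using 1 zt by simp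
  next
    case (Suc s)
    let ?L = "adjoin K (z ` {..<t + s})" and ?G = "gspan (value_set v K \<union> v ` x ` {..<s})"
    have IH: "tind K (t + s) z" "res ?L = adjoin (res K) ((\<pi> \<circ> y) ` {..<t})" "value_set v ?L \<subseteq> ?G"
      using Suc by auto
    have xs: "x s \<in> F" "x s \<noteq> 0" "\<And>k. k \<ge> 1 \<Longrightarrow> v (x s ^ k) \<notin> ?G" using x Suc.prems by (auto simp: vind_def)
    have "x ` {..<s} \<subseteq> F" using x Suc.prems by (auto simp: vind_def)
    then have L: "?L \<subseteq> F" unfolding zx using y(1) RF by (intro adjoin_in_F K) auto
    have "v (c * x s ^ k) \<noteq> 0" if c: "c \<in> ?L" "c \<noteq> 0" "k \<ge> 1" for c k
    proof
      assume "v (c * x s ^ k) = 0"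
      then have "v (x s ^ k) = - v c" using c L xs by (subst (asm) v_mult) (auto simp: eq_neg_iff_add_eq_0 add.commute)
      moreover have "v c \<in> ?G" using IH(3) value_setI[OF c(1,2)] by blast
      ultimately show False using xs(3)[OF c(3)] gspan_uminus by metis
    qed
    note G = gauss_value[OF adjoin_subfield L xs(1,2) this]
    have zs: "z (t + s) = x s" by (simp add: z_def)
    have "adjoin ?L {x s} = adjoin K (z ` {..<t + Suc s})" by (simp add: zs lessThan_Suc adjoin_insert[symmetric])
    moreover have "gspan (value_set v ?L \<union> {v (x s)}) \<subseteq> gspan (value_set v K \<union> v ` x ` {..<Suc s})"
    proof (rule gspan_least)
      have "?G \<subseteq> gspan (value_set v K \<union> v ` x ` {..<Suc s})" by (rule gspan_mono) auto
      then show "value_set v ?L \<union> {v (x s)} \<subseteq> gspan (value_set v K \<union> v ` x ` {..<Suc s})"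
        using IH(3) by (auto intro: gspan.incl)
    qed
    ultimately show ?case using G IH by (auto simp: tind_Suc zs)
  qed
  have "x ` {..<r} \<subseteq> F" using x by (auto simp: vind_def)
  then have zF: "z ` {..<t + r} \<subseteq> F" unfolding zx using y(1) RF by auto
  have "v ` x ` {..<r} \<subseteq> value_set v (adjoin K (z ` {..<t + r}))"
    using adjoin_gen[of "z ` {..<t + r}" K] x unfolding zx by (auto simp: vind_def intro!: value_setI)
  then have "gen_ext True K (adjoin K (z ` {..<t + r}))"
    using 2[of r] by (intro gen_extI[of _ "v ` x ` {..<r}" _ _ "(\<pi> \<circ> y) ` {..<t}"] small_finite) auto
  then show ?thesis using 2[of r] zF by blast
qed

lemma abhyankar_inequality:
  assumes K: "subfield K amb" "K \<subseteq> F" and S: "finite S" "\<And>a. a \<in> F \<Longrightarrow> alg (adjoin K S) a"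
    and x: "vind K r x" and y: "\<And>i. i < t \<Longrightarrow> y i \<in> R" "tind (res K) t (\<pi> \<circ> y)"
  shows "r + t \<le> card S"
proof -
  obtain z where z: "tind K (t + r) z" "z ` {..<t + r} \<subseteq> F" using abhyankar[OF K x y] by blast
  have "t + r \<le> card S" using z(2) by (intro steinitz[OF S(1) z(1)] S(2)) auto
  then show ?thesis by simp
qed

text \<open>As \<open>F\<close> is generated by \<open>n\<close> elements, the \<open>n\<close>
  independent elements of the Gauss extension form a transcendence basis; the generators of
  \<open>F\<close> are algebraic over it and preserve finite generation.\<close>

lemma abhyankar_equality:
  assumes K: "subfield K amb" "K \<subseteq> F" and F: "F = adjoin K (a ` {..<n})"
    and x: "vind K r x" and y: "\<And>i. i < t \<Longrightarrow> y i \<in> R" "tind (res K) t (\<pi> \<circ> y)" and n: "n = r + t"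
  shows "gen_ext True K F"
proof -
  obtain z where z: "tind K (t + r) z" "z ` {..<t + r} \<subseteq> F" "gen_ext True K (adjoin K (z ` {..<t + r}))"
    using abhyankar[OF K x y] by blast
  let ?L = "adjoin K (z ` {..<t + r})"
  have L: "?L \<subseteq> F" using z(2) K by (intro adjoin_in_F)
  have "alg ?L b" if "b \<in> F" for b
  proof (rule tind_max_alg[OF _ _ _ z(1,2) that])
    show "card (a ` {..<n}) \<le> t + r" using card_image_le[of "{..<n}" a] n by simp
    show "alg (adjoin K (a ` {..<n})) c" if "c \<in> F" for c using that F by (intro alg_base) auto
  qed simp
  moreover have aF: "a ` {..<n} \<subseteq> F" using adjoin_gen[of "a ` {..<n}" K] F by simp
  ultimately have "gen_ext True ?L (adjoin ?L (a ` {..<n}))" using L by (intro gen_ext_adjoin) auto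
  moreover have "adjoin ?L (a ` {..<n}) = F"
  proof
    show "adjoin ?L (a ` {..<n}) \<subseteq> F" by (rule adjoin_in_F[OF L aF])
    show "F \<subseteq> adjoin ?L (a ` {..<n})" by (subst F) (intro adjoin_mono adjoin_base order.refl)
  qed
  ultimately show ?thesis using gen_ext_trans[OF z(3)] L by simp
qed

end

section \<open>The Ruled Residue Theorem\<close>

text \<open>Repeated division by \<open>f\<close>; the remainders are the coefficients.\<close>

lemma adic_expansion:
  assumes K: "subfield K amb" and f: "f \<in> polys K" "Polynomial.degree f = m" "m \<ge> 1" and p: "p \<in> polys K" "p \<noteq> 0"
  shows "\<exists>q N. (\<forall>i. q i \<in> polys K \<and> Polynomial.degree (q i) < m) \<and> p = (\<Sum>i\<le>(N::nat). q i * f ^ i) \<and> (\<exists>i\<le>N. q i \<noteq> 0)"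
  using p
proof (induction "Polynomial.degree p" arbitrary: p rule: less_induct)
  case less
  show ?case
  proof (cases "Polynomial.degree p < m")
    case True
    then show ?thesis using less.prems K f(3)
      by (intro exI[of _ "\<lambda>i. if i = 0 then p else 0"] exI[of _ 0]) auto
  next
    case False
    have "f \<noteq> 0" using f by auto
    then obtain s r where sr: "s \<in> polys K" "r \<in> polys K" "p = s * f + r" "r = 0 \<or> Polynomial.degree r < m"
      "Polynomial.degree s + m \<le> max (Polynomial.degree p) m"
      using polys_division[OF K less.prems(1) f(1)] f(2) by blast
    have "s \<noteq> 0" using sr False less.prems by auto
    moreover have "Polynomial.degree s < Polynomial.degree p" using sr(5) False f(3) by linarith
    ultimately obtain q N where q: "\<And>i. q i \<in> polys K \<and> Polynomial.degree (q i) < m"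
      "s = (\<Sum>i\<le>(N::nat). q i * f ^ i)" "\<exists>i\<le>N. q i \<noteq> 0" using less.hyps[of s] sr(1) by blast
    let ?q = "\<lambda>i. case i of 0 \<Rightarrow> r | Suc i \<Rightarrow> q i"
    have "p = (\<Sum>i\<le>Suc N. ?q i * f ^ i)"
      unfolding sum.atMost_Suc_shift using sr(3) q(2) by (simp add: sum_distrib_left sum_distrib_right mult_ac)
    moreover have "\<exists>i\<le>Suc N. ?q i \<noteq> 0" using q(3) by force
    moreover have "\<forall>i. ?q i \<in> polys K \<and> Polynomial.degree (?q i) < m"
      using q(1) sr f(3) by (auto split: nat.split)
    ultimately show ?thesis by blast
  qed
qed

text \<open>An equation of least degree has a nonzero constant coefficient \<open>c\<close>, and
  \<open>p = c + X q\<close> gives the inverse of \<open>a\<close> as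
  \<open>- q(a) / c\<close>.\<close>

lemma alg_inverse_poly:
  assumes K: "subfield K amb" and a: "alg K a" "a \<noteq> 0"
  shows "\<exists>g\<in>polys K. poly g a = inverse a"
proof -
  let ?P = "\<lambda>p. p \<in> polys K \<and> p \<noteq> 0 \<and> poly p a = 0"
  obtain p where p: "?P p" "\<And>q. ?P q \<Longrightarrow> Polynomial.degree p \<le> Polynomial.degree q"
    using a(1) ex_has_least_nat[of ?P _ Polynomial.degree] unfolding alg_def by blast
  obtain c q where cq: "p = pCons c q" by (cases p)
  have "poly.coeff q i \<in> K" for i using p(1) polys_coeff[of p K "Suc i"] by (simp add: cq)
  then have q: "q \<in> polys K" "c \<in> K" using p(1) polys_coeff[of p K 0] by (auto simp: polys_def cq)
  have "c \<noteq> 0"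
  proof
    assume "c = 0"
    then have "?P q" using p(1) q a(2) by (auto simp: cq)
    moreover have "Polynomial.degree q < Polynomial.degree p" using \<open>?P q\<close> by (simp add: cq)
    ultimately show False using p(2) by fastforce
  qed
  then have "poly (smult (- inverse c) q) a = inverse a"
    using p(1) a(2) by (simp add: cq field_simps add_eq_0_iff)
  then show ?thesis using q K by (intro bexI[of _ "smult (- inverse c) q"]) auto
qed

lemma alg_root:
  assumes K: "subfield K amb" and a: "alg K (a ^ e)" "e \<ge> 1"
  shows "alg K a"
proof (rule alg_trans[OF K, of "adjoin K {a ^ e}"])
  let ?L = "adjoin K {a ^ e}" and ?p = "Polynomial.monom 1 e - [:a ^ e:]"
  have "a ^ e \<in> ?L" using adjoin_gen by blast
  then have "?p \<in> polys ?L" by (intro polys_diff polys_monom polys_pCons polys_0) auto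
  moreover have "poly.coeff ?p e = 1" using a(2) by (cases e) (auto simp: coeff_pCons)
  then have "?p \<noteq> 0" by (metis Polynomial.coeff_0 zero_neq_one)
  ultimately show "alg ?L a" by (intro algI[of ?p]) (auto simp: poly_monom)
  show "alg K b" if "b \<in> ?L" for b using alg_adjoin[OF K _ that] a(1) by blast
qed simp

context valued
begin

definition low :: "'f set \<Rightarrow> nat \<Rightarrow> 'f \<Rightarrow> 'f set"
  where "low L m x = {poly q x | q. q \<in> polys L \<and> Polynomial.degree q < m}"

text \<open>Tame elements form a multiplicative group containing the nonzero elements of
  \<open>L\<close> and closed under roots in \<open>F\<close> and under \<open>sim\<close>; among
  the units they are exactly those with residue algebraic over \<open>res L\<close>. The power and
  the scaling make sense of algebraic residue for elements that are not units.\<close>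

definition tame :: "'f set \<Rightarrow> 'f \<Rightarrow> bool"
  where "tame L a \<longleftrightarrow> a \<in> F \<and> a \<noteq> 0 \<and> (\<exists>e\<ge>1. \<exists>c\<in>L - {0}. v (c * a ^ e) = 0 \<and> alg (res L) (\<pi> (c * a ^ e)))"

context
  fixes L assumes L: "subfield L amb" "L \<subseteq> F"
begin

lemma tame_unit_power:
  assumes "a \<in> F" "a \<noteq> 0" "v a = 0" "alg (res L) (\<pi> a)"
  shows "a ^ k \<in> F" "a ^ k \<noteq> 0" "v (a ^ k) = 0" "alg (res L) (\<pi> (a ^ k))"
proof -
  show "a ^ k \<in> F" "a ^ k \<noteq> 0" using assms by auto
  show "v (a ^ k) = 0" using assms by (induction k) (auto simp: v_mult)
  show "alg (res L) (\<pi> (a ^ k))"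
    using sf_power[OF alg_subfield[OF res_subfield[OF L]], of "\<pi> a" k] assms by (simp add: pi_power unitD)
qed

lemma tame_mult:
  assumes "tame L a" "tame L b" shows "tame L (a * b)"
proof -
  obtain c e where a: "a \<in> F" "a \<noteq> 0" "e \<ge> 1" "c \<in> L" "c \<noteq> 0" "v (c * a ^ e) = 0" "alg (res L) (\<pi> (c * a ^ e))"
    using assms(1) by (auto simp: tame_def)
  obtain d k where b: "b \<in> F" "b \<noteq> 0" "k \<ge> 1" "d \<in> L" "d \<noteq> 0" "v (d * b ^ k) = 0" "alg (res L) (\<pi> (d * b ^ k))"
    using assms(2) by (auto simp: tame_def)
  have cd: "c \<in> F" "d \<in> F" using a b L by auto
  have 1: "c * a ^ e \<in> F" "c * a ^ e \<noteq> 0" and 2: "d * b ^ k \<in> F" "d * b ^ k \<noteq> 0" using a b cd by auto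
  note A = tame_unit_power[OF 1 a(6,7), of k] and B = tame_unit_power[OF 2 b(6,7), of e]
  have eq: "c ^ k * d ^ e * (a * b) ^ (e * k) = (c * a ^ e) ^ k * (d * b ^ k) ^ e"
    by (simp add: power_mult_distrib mult_ac flip: power_mult)
  have "v (c ^ k * d ^ e * (a * b) ^ (e * k)) = 0" unfolding eq using A B by (subst v_mult) auto
  moreover have "alg (res L) (\<pi> (c ^ k * d ^ e * (a * b) ^ (e * k)))"
    unfolding eq using A B sf_mult[OF alg_subfield[OF res_subfield[OF L]], of "\<pi> ((c * a ^ e) ^ k)" "\<pi> ((d * b ^ k) ^ e)"]
    by (subst pi_mult) (auto intro: unitD simp del: power_mult_distrib)
  moreover have "c ^ k * d ^ e \<in> L - {0}" using a b L by auto
  moreover have "1 \<le> e * k" using a b by simp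
  ultimately show ?thesis unfolding tame_def using a b by (intro conjI exI[of _ "e * k"] bexI[of _ "c ^ k * d ^ e"]) auto
qed

lemma tame_inverse:
  assumes "tame L a" shows "tame L (inverse a)"
proof -
  obtain c e where a: "a \<in> F" "a \<noteq> 0" "e \<ge> 1" "c \<in> L" "c \<noteq> 0" "v (c * a ^ e) = 0" "alg (res L) (\<pi> (c * a ^ e))"
    using assms(1) by (auto simp: tame_def)
  have u: "c * a ^ e \<in> F" "c * a ^ e \<noteq> 0" using a L by auto
  have eq: "inverse c * inverse a ^ e = inverse (c * a ^ e)" by (simp add: power_inverse)
  have "v (inverse c * inverse a ^ e) = 0" unfolding eq using u a by (simp add: v_inverse del: inverse_mult_distrib)
  moreover have "alg (res L) (\<pi> (inverse c * inverse a ^ e))"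
    unfolding eq pi_inverse[OF u a(6)] using sf_inverse[OF alg_subfield[OF res_subfield[OF L]], of "\<pi> (c * a ^ e)"] a by simp
  ultimately show ?thesis unfolding tame_def using a L
    by (intro conjI exI[of _ e] bexI[of _ "inverse c"]) auto
qed

lemma tame_root:
  assumes "tame L (a ^ k)" "a \<in> F" "k \<ge> 1" shows "tame L a"
proof -
  obtain c e where a: "a ^ k \<noteq> 0" "e \<ge> 1" "c \<in> L" "c \<noteq> 0" "v (c * (a ^ k) ^ e) = 0" "alg (res L) (\<pi> (c * (a ^ k) ^ e))"
    using assms(1) by (auto simp: tame_def)
  then have "1 \<le> k * e" "a \<noteq> 0" using assms(3) by (auto simp: power_0_left)
  then show ?thesis unfolding tame_def using a assms by (auto simp flip: power_mult intro!: exI[of _ "k * e"] bexI[of _ c])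
qed

lemma tame_sim:
  assumes "tame L a" "sim a b" shows "tame L b"
proof -
  obtain c e where a: "a \<in> F" "a \<noteq> 0" "e \<ge> 1" "c \<in> L" "c \<noteq> 0" "v (c * a ^ e) = 0" "alg (res L) (\<pi> (c * a ^ e))"
    using assms(1) by (auto simp: tame_def)
  have "sim (a ^ k) (b ^ k)" for k
    using assms(2) sim_refl[of 1] by (induction k) (auto intro: sim_mult)
  then have s: "sim (c * a ^ e) (c * b ^ e)" using a L by (intro sim_mult sim_refl) auto
  then have "v (c * b ^ e) = 0" "\<pi> (c * b ^ e) = \<pi> (c * a ^ e)"
    using simD(5)[OF s] sim_pi(2)[OF s] unitD[OF simD(1,3)[OF s]] a by auto
  then show ?thesis unfolding tame_def using a simD[OF assms(2)]
    by (intro conjI exI[of _ e] bexI[of _ c]) auto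
qed

lemma tame_base: assumes "c \<in> L" "c \<noteq> 0" shows "tame L c"
  unfolding tame_def using assms L alg_base[OF res_subfield[OF L], of 1] res_subfield[OF L]
  by (intro conjI exI[of _ 1] bexI[of _ "inverse c"]) auto

lemma tame_unit:
  assumes "a \<in> F" "a \<noteq> 0" "v a = 0" shows "tame L a \<longleftrightarrow> alg (res L) (\<pi> a)"
proof
  assume "alg (res L) (\<pi> a)"
  then show "tame L a" unfolding tame_def using assms L by (intro conjI exI[of _ 1] bexI[of _ 1]) auto
next
  assume "tame L a"
  then obtain c e where a: "e \<ge> 1" "c \<in> L" "c \<noteq> 0" "v (c * a ^ e) = 0" "alg (res L) (\<pi> (c * a ^ e))"
    by (auto simp: tame_def)
  have cF: "c \<in> F" using a L by auto
  have "v (a ^ e) = 0" using assms by (induction e) (auto simp: v_mult)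
  then have vc: "v c = 0" using a cF assms by (simp add: v_mult)
  have "\<pi> (c * a ^ e) = \<pi> c * \<pi> a ^ e"
    using unitD[OF cF a(3) vc] unitD[OF assms] by (simp add: pi_mult pi_power)
  then have eq: "\<pi> a ^ e = \<pi> (c * a ^ e) / \<pi> c" using unitD'[OF cF a(3) vc] by simp
  have "\<pi> c \<in> res L" using resI[OF a(2)] unitD[OF cF a(3) vc] by simp
  then have "alg (res L) (\<pi> a ^ e)"
    unfolding eq using sf_divide[OF alg_subfield[OF res_subfield[OF L]], of "\<pi> (c * a ^ e)" "\<pi> c"] a(5)
      alg_base[OF res_subfield[OF L]] by simp
  then show "alg (res L) (\<pi> a)" by (rule alg_root[OF res_subfield[OF L] _ a(1)])
qed

lemma low_F: "x \<in> F \<Longrightarrow> low L m x \<subseteq> F"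
proof -
  assume x: "x \<in> F"
  have "polys L \<subseteq> polys F" by (rule polys_mono[OF L(2)])
  then show ?thesis using x poly_in_subfield[OF F_sf] by (auto simp: low_def)
qed

lemma low_base: "m \<ge> 1 \<Longrightarrow> L \<subseteq> low L m x"
  unfolding low_def using L by (auto intro!: exI[of _ "[:c:]" for c])

lemma low_diff: "a \<in> low L m x \<Longrightarrow> b \<in> low L m x \<Longrightarrow> a - b \<in> low L m x"
  unfolding low_def using L by (force intro!: degree_diff_less simp flip: poly_diff)

lemma low_scale: "c \<in> L \<Longrightarrow> a \<in> low L m x \<Longrightarrow> c * a \<in> low L m x"
  unfolding low_def using L by (force intro: le_less_trans[OF degree_smult_le] simp flip: poly_smult)

lemma low_add: "a \<in> low L m x \<Longrightarrow> b \<in> low L m x \<Longrightarrow> a + b \<in> low L m x"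
  using low_diff[of a m x "(- 1) * b"] low_scale[of "- 1" b m x] L by simp

lemma low_sum:
  "m \<ge> 1 \<Longrightarrow> (\<And>i. i \<in> I \<Longrightarrow> f i \<in> low L m x) \<Longrightarrow> sum f I \<in> low L m x"
proof (induction I rule: infinite_finite_induct)
  case (insert i I)
  then show ?case by (simp add: low_add)
qed (use low_base[of m x] L in auto)

lemma lspan_low:
  assumes "m \<ge> 1" shows "lspan L ((\<lambda>i. x ^ i) ` {..m - 1}) = low L m x"
proof
  show "low L m x \<subseteq> lspan L ((\<lambda>i. x ^ i) ` {..m - 1})"
    using poly_in_lspan[OF L(1), of _ "m - 1" x] by (auto simp: low_def)
  have "x ^ i \<in> low L m x" if "i \<le> m - 1" for i
    unfolding low_def using L that assms
    by (intro CollectI exI[of _ "Polynomial.monom 1 i"]) (auto simp: poly_monom degree_monom_eq)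
  then show "lspan L ((\<lambda>i. x ^ i) ` {..m - 1}) \<subseteq> low L m x"
    unfolding lspan_def using assms by (auto intro!: low_sum low_scale)
qed

text \<open>Tameness gives approximate inverses: if \<open>A = c a^e\<close> is a unit with algebraic residue, then
  the inverse of its residue is a polynomial in the residue.\<close>

lemma low_res_closed:
  assumes x: "x \<in> F" and m: "m \<ge> 1"
    and mult: "\<And>a b. a \<in> low L m x \<Longrightarrow> b \<in> low L m x \<Longrightarrow> a \<noteq> 0 \<Longrightarrow> b \<noteq> 0 \<Longrightarrow> \<exists>u\<in>low L m x. sim (a * b) u"
    and tame: "\<And>a. a \<in> low L m x \<Longrightarrow> a \<noteq> 0 \<Longrightarrow> tame L a"
  shows "res_closed (low L m x)"
  unfolding res_closed_def
proof (intro conjI ballI)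
  let ?V = "low L m x"
  have VF: "?V \<subseteq> F" by (rule low_F[OF x])
  show "?V \<subseteq> F" by fact
  show V1: "1 \<in> ?V" using low_base[OF m, of x] sf_1[OF L(1)] by blast
  show "a - b \<in> ?V" if "a \<in> ?V" "b \<in> ?V" for a b using that by (rule low_diff)
  show "\<exists>u\<in>?V. sim (a * b) u" if "a \<in> ?V - {0}" "b \<in> ?V - {0}" for a b using mult that by auto
  fix a assume "a \<in> ?V - {0}"
  then have a: "a \<in> ?V" "a \<noteq> 0" "a \<in> F" using VF by auto
  have pow: "\<exists>u\<in>?V. sim (b ^ k) u" if b: "b \<in> ?V" "b \<noteq> 0" for b k
  proof (induction k)
    case 0
    then show ?case using V1 sim_refl[of 1] by auto
  next
    case (Suc k)
    then obtain w where w: "w \<in> ?V" "sim (b ^ k) w" by auto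
    obtain u where u: "u \<in> ?V" "sim (b * w) u" using mult[OF b(1) w(1) b(2) simD(4)[OF w(2)]] by auto
    have "sim (b * b ^ k) (b * w)" using w(2) b VF by (intro sim_mult sim_refl) auto
    then show ?case using u sim_trans by auto
  qed
  obtain c e where ce: "e \<ge> 1" "c \<in> L" "c \<noteq> 0" "v (c * a ^ e) = 0" "alg (res L) (\<pi> (c * a ^ e))"
    using tame[OF a(1,2)] by (auto simp: tame_def)
  let ?A = "c * a ^ e"
  have cF: "c \<in> F" using ce L by auto
  have A: "?A \<in> F" "?A \<noteq> 0" "v ?A = 0" using a ce cF by auto
  obtain g where g: "g \<in> polys (res L)" "poly g (\<pi> ?A) = inverse (\<pi> ?A)"
    using alg_inverse_poly[OF res_subfield[OF L] ce(5) unitD'[OF A]] by blast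
  obtain Q where Q: "Q \<in> polys (L \<inter> R)" "map_poly \<pi> Q = g"
    using lift_poly[OF L(2) g(1)] L by auto
  have Qc: "poly.coeff Q i \<in> L" "poly.coeff Q i \<in> R" for i using polys_coeff[OF Q(1), of i] by auto
  have "\<exists>u\<in>?V. sim (?A ^ k) u" for k
  proof -
    obtain u where u: "u \<in> ?V" "sim (a ^ (e * k)) u" using pow a by blast
    have "sim (c ^ k * a ^ (e * k)) (c ^ k * u)" using u(2) ce cF by (intro sim_mult sim_refl) auto
    then show ?thesis using low_scale[OF _ u(1), of "c ^ k"] ce L by (auto simp: power_mult_distrib power_mult)
  qed
  then obtain u where u: "\<And>k. u k \<in> ?V" "\<And>k. sim (?A ^ k) (u k)" by metis
  \<comment> \<open>\<open>w\<close> lifts the inverse of the residue of \<open>?A\<close>: the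
    coefficients of \<open>g\<close> are lifted to \<open>L\<close>, and the powers of
    \<open>?A\<close> are replaced by elements of \<open>?V\<close> that agree with them up to
    higher value.\<close>
  define w where "w = (\<Sum>k\<le>Polynomial.degree Q. poly.coeff Q k * u k)"
  have uR: "u k \<in> R" "\<pi> (u k) = \<pi> ?A ^ k" for k
    using sim_pi[OF u(2), of k] unitD[OF A] by (auto simp: pi_power)
  have wV: "w \<in> ?V" unfolding w_def using u Qc by (intro low_sum[OF m] low_scale) auto
  have wR: "w \<in> R" unfolding w_def using uR Qc by (intro R_sum R_mult)
  have "poly g (\<pi> ?A) = (\<Sum>k\<le>Polynomial.degree Q. \<pi> (poly.coeff Q k) * \<pi> ?A ^ k)"
  proof -
    have "Polynomial.degree g \<le> Polynomial.degree Q" unfolding Q(2)[symmetric]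
      by (rule degree_le) (simp add: coeff_map_poly coeff_eq_0)
    then have "poly g (\<pi> ?A) = (\<Sum>k\<le>Polynomial.degree Q. poly.coeff g k * \<pi> ?A ^ k)"
      unfolding poly_altdef by (intro sum.mono_neutral_left) (auto simp: coeff_eq_0)
    then show ?thesis by (simp add: Q(2)[symmetric] coeff_map_poly)
  qed
  also have "\<dots> = \<pi> w" unfolding w_def using uR Qc by (subst pi_sum) (auto simp: pi_mult)
  finally have pw: "\<pi> w = inverse (\<pi> ?A)" using g(2) by simp
  then have wu: "w \<in> F" "w \<noteq> 0" "v w = 0" using unit_iff[of w] wR unitD'[OF A] by auto
  have iA: "inverse ?A \<in> R" "\<pi> (inverse ?A) = \<pi> w"
    using A pw pi_inverse[OF A] by (auto simp: R_iff v_inverse simp del: inverse_mult_distrib)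
  have s1: "sim (inverse ?A) w"
  proof (rule sim_ratioI)
    show "inverse ?A / w \<in> R" by (rule R_div[OF iA(1) wu])
    show "\<pi> (inverse ?A / w) = 1" using pi_div[OF iA(1) wu] iA(2) unitD'[OF wu] by simp
    show "inverse ?A \<in> F" using A(1) by (rule F_closed(7))
  qed (use wu in auto)
  \<comment> \<open>Since \<open>inverse a = c a^(e - 1) inverse ?A\<close>, the approximate inverse
    \<open>w\<close> of \<open>?A\<close> yields one of \<open>a\<close>.\<close>
  obtain u0 where u0: "u0 \<in> ?V" "sim (a ^ (e - 1)) u0" using pow a by blast
  have s2: "sim (c * a ^ (e - 1)) (c * u0)" using u0 ce cF by (intro sim_mult sim_refl) auto
  obtain u1 where u1: "u1 \<in> ?V" "sim (c * u0 * w) u1"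
    using mult[OF low_scale[OF ce(2) u0(1)] wV simD(4)[OF s2] wu(2)] by auto
  have "c * a ^ (e - 1) * inverse ?A = inverse a" using a ce by (cases e) (auto simp: field_simps)
  then have "sim (inverse a) u1" using sim_trans[OF sim_mult[OF s2 s1] u1(2)] by simp
  then show "\<exists>u\<in>?V. sim (inverse a) u" using u1(1) by blast
qed

lemma poly_in_fsums:
  assumes nx: "\<not> alg L x" and f: "f \<in> polys L" "Polynomial.degree f = m" "m \<ge> 1" and p: "p \<in> polys L" "p \<noteq> 0"
  shows "poly p x \<in> fsums (low L m x) (poly f x)"
proof -
  obtain q N where q: "\<And>i. q i \<in> polys L \<and> Polynomial.degree (q i) < m" "p = (\<Sum>i\<le>(N::nat). q i * f ^ i)" "\<exists>i\<le>N. q i \<noteq> 0"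
    using adic_expansion[OF L(1) f p] by blast
  have "poly p x = (\<Sum>i\<le>N. poly (q i) x * poly f x ^ i)" unfolding q(2) by (simp add: poly_sum)
  moreover have "poly (q i) x \<in> low L m x" for i using q(1) by (auto simp: low_def)
  moreover have "\<exists>i\<le>N. poly (q i) x \<noteq> 0" using q nx by (auto simp: alg_def)
  ultimately show ?thesis unfolding fsums_def
    by (intro CollectI exI[of _ "\<lambda>i. poly (q i) x"] exI[of _ N]) auto
qed

lemma value_set_gspan: "gspan (value_set v L) = value_set v L"
proof
  show "gspan (value_set v L) \<subseteq> value_set v L"
  proof
    fix g assume "g \<in> gspan (value_set v L)"
    then show "g \<in> value_set v L"
    proof induction
      case zero
      show ?case using value_setI[of 1 L] L by simp
    next
      case (diff a b)
      then obtain c d where "a = v c" "c \<in> L" "c \<noteq> 0" "b = v d" "d \<in> L" "d \<noteq> 0" by (auto simp: value_set_def)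
      then show ?case using value_setI[of "c / d" L] L by (auto simp: v_divide subset_iff)
    qed
  qed
qed (auto intro: gspan.incl)

text \<open>Otherwise \<open>a\<close> would be value-transcendental over \<open>L(h)\<close>, whose
  value group is that of \<open>L\<close>; then \<open>h\<close> and \<open>a\<close> would be
  independent over \<open>L\<close> inside \<open>L(x)\<close>, which is generated by one
  element.\<close>

lemma torsion_over_base:
  assumes F: "F = adjoin L {x}" and h: "h \<in> R" "\<not> alg (res L) (\<pi> h)" and a: "a \<in> F" "a \<noteq> 0"
  shows "\<exists>e\<ge>1. \<exists>c\<in>L - {0}. v (c * a ^ e) = 0"
proof (rule ccontr)
  assume no: "\<not> ?thesis"
  let ?L = "adjoin L {h}"
  note G = gauss_residue[OF L h]
  have LF: "?L \<subseteq> F" using h RF by (intro adjoin_in_F L) auto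
  have "v (c * a ^ k) \<noteq> 0" if c: "c \<in> ?L" "c \<noteq> 0" "k \<ge> 1" for c k
  proof
    assume v0: "v (c * a ^ k) = 0"
    have "v c \<in> value_set v L" using G(3) value_setI[OF c(1,2)] value_set_gspan by auto
    then obtain d where d: "d \<in> L" "d \<noteq> 0" "v c = v d" by (auto simp: value_set_def)
    have "v (d * a ^ k) = 0" using v0 c d a LF L by (simp add: v_mult subset_iff)
    then show False using no d c(3) by blast
  qed
  then have na: "\<not> alg ?L a" using LF a by (intro gauss_value) auto
  define z where "z i = (if i = 0 then h else a)" for i :: nat
  have "tind L 2 z" using G(1) na L by (simp add: numeral_2_eq_2 tind_Suc z_def lessThan_Suc adjoin_eq_base)
  moreover have "alg (adjoin L {x}) (z i)" for i using h RF a F by (intro alg_base) (auto simp: z_def)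
  ultimately show False using steinitz[of "{x}" L 2 z] by simp
qed

text \<open>For a polynomial \<open>f\<close> of least degree with \<open>f(x)\<close> not tame,
  some power \<open>f(x)^e\<close> has the value of an element \<open>g\<close> of
  \<open>V = low L m x\<close>, because \<open>vF/vL\<close> is torsion. That \<open>f(x)\<close> is
  not tame makes the residue of \<open>f(x)^e / g\<close> transcendental, and it generates
  \<open>Fv\<close> over the residue field of \<open>V\<close>, all of whose elements are algebraic
  over \<open>res L\<close>.\<close>

lemma ruled_residue:
  assumes F: "F = adjoin L {x}" and nx: "\<not> alg L x" and h: "h \<in> R" "\<not> alg (res L) (\<pi> h)"
  shows "\<exists>B y. finite B \<and> (\<forall>b\<in>adjoin (res L) B. alg (res L) b) \<and> \<not> alg (adjoin (res L) B) y \<and>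
    res F = adjoin (adjoin (res L) B) {y}"
proof -
  have sL: "subfield (res L) amb" by (rule res_subfield[OF L])
  have xF: "x \<in> F" using adjoin_gen[of "{x}" L] F by auto
  have polyF: "poly p x \<in> F" if "p \<in> polys L" for p
    using poly_in_subfield[OF F_sf _ xF] polys_mono[OF L(2)] that by blast
  have nz: "poly p x \<noteq> 0" if "p \<in> polys L" "p \<noteq> 0" for p using nx that by (auto simp: alg_def)
  have hu: "h \<in> F" "h \<noteq> 0" "v h = 0"
  proof -
    have "\<pi> h \<noteq> 0" using h alg_base[OF sL, of 0] sL by auto
    then show "h \<in> F" "h \<noteq> 0" "v h = 0" using h unit_iff[of h] by auto
  qed
  \<comment> \<open>The unit \<open>h\<close> has transcendental residue and so is not tame. Being a
    quotient of polynomials in \<open>x\<close>, it forces one of these not to be tame.\<close>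
  let ?P = "\<lambda>p. p \<in> polys L \<and> p \<noteq> 0 \<and> \<not> tame L (poly p x)"
  have "\<exists>p. ?P p"
  proof (rule ccontr)
    assume "\<nexists>p. ?P p"
    then have t: "tame L (poly p x)" if "p \<in> polys L" "p \<noteq> 0" for p using that by blast
    obtain p q where pq: "h = poly p x / poly q x" "p \<in> polys L" "q \<in> polys L" "poly q x \<noteq> 0"
      using hu(1) unfolding F adjoin_singleton[OF L(1)] by blast
    have "tame L h" unfolding pq(1) divide_inverse using pq hu(2) by (intro tame_mult tame_inverse t) auto
    then show False using tame_unit[OF hu] h by simp
  qed
  then obtain f where f: "?P f" "\<And>p. ?P p \<Longrightarrow> Polynomial.degree f \<le> Polynomial.degree p"
    using ex_has_least_nat[of ?P _ Polynomial.degree] by blast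
  define m where "m = Polynomial.degree f"
  have m: "m \<ge> 1"
  proof (rule ccontr)
    assume "\<not> m \<ge> 1"
    then obtain c where c: "f = [:c:]" using degree_eq_zeroE[of f] by (auto simp: m_def)
    then have "c \<in> L" "c \<noteq> 0" using f(1) polys_coeff[of f L 0] by auto
    then show False using f(1) tame_base c by simp
  qed
  let ?V = "low L m x" and ?f = "poly f x"
  have fF: "?f \<in> F" "?f \<noteq> 0" using f polyF nz by auto
  have VF: "?V \<subseteq> F" by (rule low_F[OF xF])
  have tV: "tame L a" if a: "a \<in> ?V" "a \<noteq> 0" for a
  proof -
    obtain q where q: "a = poly q x" "q \<in> polys L" "Polynomial.degree q < m" using a by (auto simp: low_def)
    then have "q \<noteq> 0" using a by auto
    then show ?thesis using f(2)[of q] q unfolding m_def by fastforce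
  qed
  have V: "res_closed ?V"
  proof (rule low_res_closed[OF xF m _ tV])
    fix a b assume ab: "a \<in> ?V" "b \<in> ?V" "a \<noteq> 0" "b \<noteq> 0"
    obtain q r where qr: "a = poly q x" "q \<in> polys L" "Polynomial.degree q < m"
      "b = poly r x" "r \<in> polys L" "Polynomial.degree r < m" using ab by (auto simp: low_def)
    have "q * r \<in> polys L" "f \<noteq> 0" using qr L f by auto
    then obtain s u where su: "s \<in> polys L" "u \<in> polys L" "q * r = s * f + u" "u = 0 \<or> Polynomial.degree u < m"
      "Polynomial.degree s + m \<le> max (Polynomial.degree (q * r)) m"
      using polys_division[OF L(1), of "q * r" f] f(1) by (auto simp: m_def)
    have ds: "Polynomial.degree s < m" using su(5) degree_mult_le[of q r] qr m by linarith
    let ?C = "poly u x" and ?s = "poly s x"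
    have CV: "?C \<in> ?V" "?s \<in> ?V" using su ds m by (auto simp: low_def)
    then have CF: "?C \<in> F" "?s \<in> F" "a \<in> F" "b \<in> F" using VF ab by auto
    have eq: "a * b = ?s * ?f + ?C" using arg_cong[OF su(3), of "\<lambda>p. poly p x"] qr by simp
    have tab: "tame L (a * b)" using tV ab by (intro tame_mult)
    have ab0: "a * b \<in> F" "a * b \<noteq> 0" using ab CF by auto
    \<comment> \<open>The product \<open>a * b\<close> should agree with the remainder
      \<open>?C\<close> of \<open>q * r\<close> modulo \<open>f\<close>, so the discarded term
      \<open>?s * ?f\<close> must have higher value unless it vanishes. When nonzero it is not tame,
      whereas \<open>a * b\<close> and a nonzero \<open>?C\<close> are.\<close>
    have "sim (a * b) ?C"
    proof (cases "?s = 0")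
      case True
      then show ?thesis using eq ab0 sim_refl by simp
    next
      case False
      let ?B = "?s * ?f"
      have B: "?B \<in> F" "?B \<noteq> 0" using False fF CF by auto
      have nB: "\<not> tame L ?B"
      proof
        assume "tame L ?B"
        then have "tame L (?B * inverse ?s)" by (rule tame_mult) (intro tame_inverse tV CV False)
        moreover have "?B * inverse ?s = ?f" using False by simp
        ultimately show False using f(1) by simp
      qed
      have "v (a * b) < v ?B"
      proof (rule ccontr)
        assume "\<not> v (a * b) < v ?B"
        then have le: "v ?B \<le> v (a * b)" by simp
        \<comment> \<open>If \<open>v ?B \<le> v (a * b)\<close>, then \<open>?al\<close> and
          \<open>?ga = ?al - 1\<close> are integral. If moreover \<open>?al\<close> has residue
          \<open>0\<close>, then \<open>?B\<close> agrees with the tame element \<open>- ?C\<close>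
          up to higher value.\<close>
        let ?al = "a * b / ?B" and ?ga = "?C / ?B"
        have al: "?al \<in> R" using le ab0 B by (intro ratio_R) auto
        have ga: "?ga = ?al - 1" using eq B by (simp add: field_simps)
        have gR: "?ga \<in> R" "\<pi> ?ga = \<pi> ?al - 1" unfolding ga using al by (auto simp: pi_diff)
        have nal: "\<not> tame L ?al"
        proof
          assume "tame L ?al"
          then have "tame L (a * b * inverse ?al)" using tame_mult[OF tab tame_inverse] by blast
          moreover have "a * b * inverse ?al = ?B" using ab0 by simp
          ultimately show False using nB by metis
        qed
        show False
        proof (cases "\<pi> ?al = 0")
          case True
          then have pg: "\<pi> (- ?ga) = 1" using gR by (simp add: pi_uminus)
          have "sim (- ?C) ?B" using gR(1) pg B CF by (intro sim_ratioI) auto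
          moreover have "?C \<noteq> 0" using pg by auto
          then have "tame L (- ?C)" using tame_mult[OF tame_base[of "- 1"] tV[OF CV(1)]] L by simp
          ultimately show False using nB tame_sim by blast
        next
          \<comment> \<open>Now \<open>?al\<close> is a unit that is not tame, so its residue
            \<open>A\<close> is transcendental. But \<open>?al / ?ga = a b / ?C\<close> is tame, so
            \<open>d = A / (A - 1)\<close> is algebraic, and with it
            \<open>A = d / (d - 1)\<close>.\<close>
          case alnz: False
          then have alu: "?al \<in> F" "?al \<noteq> 0" "v ?al = 0" using unit_iff[of ?al] al by auto
          then have nalg: "\<not> alg (res L) (\<pi> ?al)" using tame_unit nal by blast
          have "\<pi> ?ga \<noteq> 0"
          proof
            assume "\<pi> ?ga = 0"
            then have "\<pi> ?al = 1" using gR by simp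
            then show False using nalg alg_base[OF sL, of 1] sL by simp
          qed
          then have gu: "?ga \<in> F" "?ga \<noteq> 0" "v ?ga = 0" using unit_iff[of ?ga] gR by auto
          then have C0: "?C \<noteq> 0" by auto
          have d: "?al / ?ga = a * b * inverse ?C" using B C0 by (simp add: field_simps)
          have "tame L (?al / ?ga)" unfolding d by (rule tame_mult[OF tab tame_inverse[OF tV[OF CV(1) C0]]])
          moreover have "?al / ?ga \<in> F" by (rule F_closed(8)[OF alu(1) gu(1)])
          moreover have "?al / ?ga \<noteq> 0" using alu(2) gu(2) by simp
          moreover have "v (?al / ?ga) = 0"
            using v_divide[OF alu(1) gu(1) alu(2) gu(2)] alu(3) gu(3) by simp
          ultimately have "alg (res L) (\<pi> (?al / ?ga))" using tame_unit by blast
          then have de: "alg (res L) (\<pi> ?al / \<pi> ?ga)" using pi_div[OF al gu] by simp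
          let ?d = "\<pi> ?al / \<pi> ?ga"
          have e: "\<pi> ?al = ?d * (\<pi> ?al - 1)" using \<open>\<pi> ?ga \<noteq> 0\<close> gR(2) by simp
          have "?d \<noteq> 1"
          proof
            assume "?d = 1"
            then show False using e by simp
          qed
          moreover have gen: "A = d / (d - 1)" if "A = d * (A - 1)" "d \<noteq> 1" for A d :: 'r
            using that by (simp add: eq_divide_eq algebra_simps)
          ultimately have "\<pi> ?al = ?d / (?d - 1)" using e by blast
          moreover have "d / (d - 1) \<in> {a. alg (res L) a}" if "alg (res L) d" for d
            using that alg_subfield[OF sL] sf_1[OF alg_subfield[OF sL]] by (intro sf_divide sf_diff) simp_all
          from this[OF de] have "?d / (?d - 1) \<in> {a. alg (res L) a}" .
          ultimately show False using nalg by simp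
        qed
      qed
      then show ?thesis using eq ab0 CF by (intro sim_diffI) auto
    qed
    then show "\<exists>u\<in>?V. sim (a * b) u" using CV by blast
  qed
  let ?Q = "\<lambda>k. k \<ge> 1 \<and> (\<exists>u\<in>?V - {0}. v (u * ?f ^ k) = 0)"
  have "\<exists>k. ?Q k" using torsion_over_base[OF F h fF] low_base[OF m] by blast
  \<comment> \<open>The order of the value of \<open>f(x)\<close> modulo the values of
    \<open>?V\<close>.\<close>
  define e where "e = (LEAST k. ?Q k)"
  have e: "?Q e" "\<And>k. ?Q k \<Longrightarrow> e \<le> k" using LeastI_ex[OF \<open>\<exists>k. ?Q k\<close>] Least_le[of ?Q] by (auto simp: e_def)
  obtain u where u: "u \<in> ?V" "u \<noteq> 0" "v (u * ?f ^ e) = 0" using e(1) by blast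
  obtain g where g: "g \<in> ?V" "sim (inverse u) g" using V_inv[OF V u(1,2)] by blast
  have uF: "u \<in> F" using u VF by auto
  have "v u + v (?f ^ e) = 0" using u uF fF v_mult[of u "?f ^ e"] by simp
  moreover have "v g = - v u" using simD(5)[OF g(2)] v_inverse[OF uF u(2)] by simp
  ultimately have vg: "v (?f ^ e) = v g" by (simp add: add_eq_0_iff)
  have min: "v (w * ?f ^ k) \<noteq> 0" if "w \<in> ?V" "w \<noteq> 0" "1 \<le> k" "k < e" for w k
    using e(2)[of k] that by auto
  have resV: "alg (res L) b" if "b \<in> res ?V" for b
  proof -
    obtain a where a: "a \<in> ?V" "a \<in> R" "b = \<pi> a" using resE[OF \<open>b \<in> res ?V\<close> VF] by blast
    show ?thesis
    proof (cases "b = 0")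
      case True
      then show ?thesis using alg_base[OF sL, of 0] sL by simp
    next
      case False
      then have "a \<in> F" "a \<noteq> 0" "v a = 0" using a unit_iff[of a] by auto
      then show ?thesis using tame_unit tV a by blast
    qed
  qed
  let ?T = "?f ^ e / g"
  have gF: "g \<in> F" "g \<noteq> 0" using simD[OF g(2)] by auto
  have Tu: "?T \<in> F" "?T \<noteq> 0" "v ?T = 0" using gF fF vg by (auto simp: v_divide)
  have sV: "subfield (res ?V) amb" by (rule res_V_subfield[OF V])
  \<comment> \<open>With an algebraic residue, \<open>?T\<close> and then
    \<open>?f ^ e = ?T * g\<close> would be tame, hence also the root \<open>?f\<close>.\<close>
  have T: "\<not> alg (res ?V) (\<pi> ?T)"
  proof
    assume "alg (res ?V) (\<pi> ?T)"
    then have "alg (res L) (\<pi> ?T)" using alg_trans[OF sL sV resV] by blast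
    then have "tame L ?T" using tame_unit[OF Tu] by simp
    then have "tame L (?T * g)" using tV[OF g(1) gF(2)] by (intro tame_mult)
    then have "tame L (?f ^ e)" using gF by simp
    then show False using tame_root[OF _ fF(1)] e(1) f(1) by blast
  qed
  have resF: "res F = adjoin (res ?V) {\<pi> ?T}"
  proof
    have "\<pi> ?T \<in> res F" using resI[OF Tu(1)] unitD[OF Tu] by simp
    then show "adjoin (res ?V) {\<pi> ?T} \<subseteq> res F"
      using VF by (intro adjoin_least res_subfield res_mono) auto
    show "res F \<subseteq> adjoin (res ?V) {\<pi> ?T}"
    proof
      fix b assume "b \<in> res F"
      then obtain a where a: "a \<in> F" "a \<in> R" "b = \<pi> a" by (rule resE) auto
      show "b \<in> adjoin (res ?V) {\<pi> ?T}"
      proof (cases "b = 0")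
        case False
        then have va: "a \<noteq> 0" "v a = 0" using a unit_iff[of a] by auto
        obtain p q where pq: "a = poly p x / poly q x" "p \<in> polys L" "q \<in> polys L" "poly q x \<noteq> 0"
          using a(1) unfolding F adjoin_singleton[OF L(1)] by blast
        have "p \<noteq> 0" "q \<noteq> 0" using pq va by auto
        have ef: "e \<ge> 1" using e(1) by simp
        have "f \<in> polys L" using f(1) by simp
        note S = poly_in_fsums[OF nx \<open>f \<in> polys L\<close> m_def[symmetric] m]
        show ?thesis
          using residue_transcendental_quotients(3)[OF V fF ef g(1) gF(2) vg min T S[OF pq(2) \<open>p \<noteq> 0\<close>] S[OF pq(3) \<open>q \<noteq> 0\<close>]] va(2)
          unfolding a(3) pq(1) by blast
      qed simp
    qed
  qed
  \<comment> \<open>The residues of \<open>?V\<close> are those of the quotients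
    \<open>a / 1\<close> for \<open>a\<close> in the span of the powers of \<open>x\<close> below
    \<open>m\<close>; finitely many of them span \<open>res ?V\<close> over \<open>res L\<close>,
    which makes it finitely generated.\<close>
  have "\<exists>B. finite B \<and> B \<subseteq> {\<pi> (a / 1) | a. a \<in> ?V \<and> a / 1 \<in> R} \<and>
    {\<pi> (a / 1) | a. a \<in> ?V \<and> a / 1 \<in> R} \<subseteq> lspan (res L) B"
    using finitely_many_residues[OF L, of "(\<lambda>i. x ^ i) ` {..m - 1}" 1] unfolding lspan_low[OF m] by simp
  moreover have "{\<pi> (a / 1) | a. a \<in> ?V \<and> a / 1 \<in> R} = res ?V"
    using VF by (auto simp: resI elim!: resE)
  ultimately obtain B where B: "finite B" "B \<subseteq> res ?V" "res ?V \<subseteq> lspan (res L) B" by auto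
  have "res ?V = adjoin (res L) B"
  proof
    show "adjoin (res L) B \<subseteq> res ?V" using B(2) low_base[OF m] by (intro adjoin_least sV res_mono)
    have "lspan (res L) B \<subseteq> adjoin (res L) B"
      by (intro lspan_in_subfield adjoin_subfield adjoin_base adjoin_gen)
    then show "res ?V \<subseteq> adjoin (res L) B" using B(3) by blast
  qed
  then show ?thesis using B(1) resV T resF by (intro exI[of _ B] exI[of _ "\<pi> ?T"]) auto
qed

end

end

section \<open>Rational rank and independence over the integers\<close>

definition int_indep :: "('a, 'm) monoid_scheme \<Rightarrow> 'i set \<Rightarrow> ('i \<Rightarrow> 'a) \<Rightarrow> bool"
  where "int_indep A I a \<longleftrightarrow>
    (\<forall>k::'i \<Rightarrow> int. finprod A (\<lambda>i. a i [^]\<^bsub>A\<^esub> k i) I = \<one>\<^bsub>A\<^esub> \<longrightarrow> (\<forall>i\<in>I. k i = 0))"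

context comm_group
begin

interpretation FT: comm_group "tensor_free G"
  unfolding tensor_free_def by (rule abelian_free_Abelian_group)

lemma FT_simps [simp]: "x \<in> carrier (tensor_free G) \<longleftrightarrow> Poly_Mapping.keys x \<subseteq> UNIV \<times> carrier G"
  "x \<otimes>\<^bsub>tensor_free G\<^esub> y = x + y" "\<one>\<^bsub>tensor_free G\<^esub> = 0"
  by (simp_all add: tensor_free_def)

lemma FT_inv: "x \<in> carrier (tensor_free G) \<Longrightarrow> inv\<^bsub>tensor_free G\<^esub> x = - x"
  by (simp add: tensor_free_def)

abbreviation tensor_rels :: "(rat \<times> 'a \<Rightarrow>\<^sub>0 int) set"
  where "tensor_rels \<equiv> {frag_of (q + r, a) - frag_of (q, a) - frag_of (r, a) | q r a. a \<in> carrier G} \<union>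
     {frag_of (q, a \<otimes> b) - frag_of (q, a) - frag_of (q, b) | q a b. a \<in> carrier G \<and> b \<in> carrier G}"

lemma tensor_rels_carrier: "tensor_rels \<subseteq> carrier (tensor_free G)"
proof -
  have diff: "x - y \<in> carrier (tensor_free G)" if "x \<in> carrier (tensor_free G)" "y \<in> carrier (tensor_free G)" for x y
    using that keys_diff[of x y] by auto
  show ?thesis by (intro Un_least subsetI; elim CollectE exE conjE; hypsubst; intro diff) auto
qed

lemma tensor_relations_subgroup: "subgroup (tensor_relations G) (tensor_free G)"
  unfolding tensor_relations_def by (rule FT.generate_is_subgroup[OF tensor_rels_carrier])

interpretation TN: normal "tensor_relations G" "tensor_free G"
  by (rule FT.subgroup_imp_normal[OF tensor_relations_subgroup])

lemma rat_tensor_comm_group: "comm_group (rat_tensor G)"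
  unfolding rat_tensor_def by (rule FT.abelian_FactGroup[OF tensor_relations_subgroup])

interpretation T: comm_group "rat_tensor G"
  by (rule rat_tensor_comm_group)

definition tclass :: "(rat \<times> 'a \<Rightarrow>\<^sub>0 int) \<Rightarrow> (rat \<times> 'a \<Rightarrow>\<^sub>0 int) set"
  where "tclass x = tensor_relations G #>\<^bsub>tensor_free G\<^esub> x"

lemma tclass_hom: "tclass \<in> hom (tensor_free G) (rat_tensor G)"
  using TN.r_coset_hom_Mod by (simp add: rat_tensor_def tclass_def[abs_def])

lemma tclass_add: "x \<in> carrier (tensor_free G) \<Longrightarrow> y \<in> carrier (tensor_free G) \<Longrightarrow>
  tclass (x + y) = tclass x \<otimes>\<^bsub>rat_tensor G\<^esub> tclass y"
  using hom_mult[OF tclass_hom, of x y] by simp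

lemma tclass_closed: "x \<in> carrier (tensor_free G) \<Longrightarrow> tclass x \<in> carrier (rat_tensor G)"
  using hom_in_carrier[OF tclass_hom] by blast

lemma tclass_eq:
  assumes "x \<in> carrier (tensor_free G)" "y \<in> carrier (tensor_free G)" "x - y \<in> tensor_relations G"
  shows "tclass x = tclass y"
proof -
  have "(x - y) \<otimes>\<^bsub>tensor_free G\<^esub> y \<in> tensor_relations G #>\<^bsub>tensor_free G\<^esub> y"
    using assms TN.subset by (intro FT.rcosI) auto
  then show ?thesis
    unfolding tclass_def using FT.repr_independence[OF _ assms(2) tensor_relations_subgroup, of x] by simp
qed

lemma tclass_one: "x \<in> carrier (tensor_free G) \<Longrightarrow> tclass x = \<one>\<^bsub>rat_tensor G\<^esub> \<Longrightarrow> x \<in> tensor_relations G"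
  using FT.rcos_self[OF _ tensor_relations_subgroup, of x] by (simp add: tclass_def rat_tensor_def)

definition tensor :: "rat \<Rightarrow> 'a \<Rightarrow> (rat \<times> 'a \<Rightarrow>\<^sub>0 int) set"
  where "tensor q a = tclass (frag_of (q, a))"

lemma tensor_closed [simp]: "a \<in> carrier G \<Longrightarrow> tensor q a \<in> carrier (rat_tensor G)"
  unfolding tensor_def by (intro tclass_closed) simp

lemma keys_add_carrier: "x \<in> carrier (tensor_free G) \<Longrightarrow> y \<in> carrier (tensor_free G) \<Longrightarrow> x + y \<in> carrier (tensor_free G)"
  using FT.m_closed[of x y] by simp

lemma tensor_add: assumes "a \<in> carrier G" shows "tensor (q + r) a = tensor q a \<otimes>\<^bsub>rat_tensor G\<^esub> tensor r a"
proof -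
  have c: "frag_of (s, a) \<in> carrier (tensor_free G)" for s using assms by simp
  have "frag_of (q + r, a) - (frag_of (q, a) + frag_of (r, a)) \<in> tensor_relations G"
    unfolding tensor_relations_def using assms by (intro generate.incl UnI1) (auto simp: diff_diff_eq)
  then have "tclass (frag_of (q + r, a)) = tclass (frag_of (q, a) + frag_of (r, a))"
    using c by (intro tclass_eq keys_add_carrier)
  then show ?thesis unfolding tensor_def using tclass_add[OF c c] by simp
qed

lemma tensor_mult:
  assumes "a \<in> carrier G" "b \<in> carrier G"
  shows "tensor q (a \<otimes> b) = tensor q a \<otimes>\<^bsub>rat_tensor G\<^esub> tensor q b"
proof -
  have c: "frag_of (q, a) \<in> carrier (tensor_free G)" if "a \<in> carrier G" for a using that by simp
  have "frag_of (q, a \<otimes> b) - (frag_of (q, a) + frag_of (q, b)) \<in> tensor_relations G"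
    unfolding tensor_relations_def using assms by (intro generate.incl UnI2) (auto simp: diff_diff_eq)
  then have "tclass (frag_of (q, a \<otimes> b)) = tclass (frag_of (q, a) + frag_of (q, b))"
    using assms by (intro tclass_eq keys_add_carrier c) auto
  then show ?thesis unfolding tensor_def using tclass_add[OF c[OF assms(1)] c[OF assms(2)]] by simp
qed

lemma tensor_hom: "tensor q \<in> hom G (rat_tensor G)"
  by (rule homI) (auto simp: tensor_mult)

lemma tensor_pow_right: "a \<in> carrier G \<Longrightarrow> tensor q (a [^] (m::int)) = tensor q a [^]\<^bsub>rat_tensor G\<^esub> m"
  using hom_int_pow[OF tensor_hom] is_group T.is_group by blast

lemma tensor_0: assumes a: "a \<in> carrier G" shows "tensor 0 a = \<one>\<^bsub>rat_tensor G\<^esub>"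
  using tensor_add[OF a, of 0 0] T.l_cancel_one[of "tensor 0 a" "tensor 0 a"] a by simp

lemma tensor_nat: assumes a: "a \<in> carrier G"
  shows "tensor (of_nat n * q) a = tensor q a [^]\<^bsub>rat_tensor G\<^esub> (n::nat)"
  by (induction n) (use a in \<open>auto simp: tensor_0 tensor_add ring_distribs T.m_comm\<close>)

lemma tensor_int: assumes a: "a \<in> carrier G"
  shows "tensor (of_int m * q) a = tensor q a [^]\<^bsub>rat_tensor G\<^esub> (m::int)"
proof (cases m rule: int_cases2)
  case (nonneg n)
  then show ?thesis using tensor_nat[OF a, of n q] by (simp add: int_pow_int)
next
  case (nonpos n)
  have "tensor (of_int m * q) a \<otimes>\<^bsub>rat_tensor G\<^esub> tensor (of_nat n * q) a = \<one>\<^bsub>rat_tensor G\<^esub>"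
    using tensor_add[OF a, of "of_int m * q" "of_nat n * q"] nonpos tensor_0[OF a] by simp
  then have "tensor (of_int m * q) a = inv\<^bsub>rat_tensor G\<^esub> tensor (of_nat n * q) a"
    using a by (intro T.inv_equality[symmetric]) auto
  then show ?thesis using tensor_nat[OF a, of n q] nonpos a by (simp add: T.int_pow_neg_int)
qed

lemma tensor_move: "a \<in> carrier G \<Longrightarrow> tensor (of_int m * q) a = tensor q (a [^] (m::int))"
  by (simp add: tensor_int tensor_pow_right)

lemma tensor_one: "tensor q \<one> = \<one>\<^bsub>rat_tensor G\<^esub>"
  using hom_one[OF tensor_hom is_group T.is_group] .

text \<open>Common denominators: \<open>m/n\<close> tensor \<open>a\<close> equals
  \<open>1/n\<close> tensor the \<open>m\<close>-th power of \<open>a\<close>, and two such tensors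
  are brought to the denominator \<open>N * M\<close>.\<close>

lemma tensor_all:
  assumes "C \<in> carrier (rat_tensor G)"
  shows "\<exists>N a. N > 0 \<and> a \<in> carrier G \<and> C = tensor (1 / of_nat N) a"
proof -
  have "\<exists>x\<in>carrier (tensor_free G). C = tclass x"
    using assms by (auto simp: rat_tensor_def carrier_FactGroup tclass_def)
  then obtain x where x: "Poly_Mapping.keys x \<subseteq> UNIV \<times> carrier G" "C = tclass x" by auto
  have "\<exists>N a. N > 0 \<and> a \<in> carrier G \<and> tclass x = tensor (1 / of_nat N) a" using x(1)
  proof (rule free_Abelian_group_induct)
    have "tclass 0 = \<one>\<^bsub>rat_tensor G\<^esub>" using hom_one[OF tclass_hom FT.is_group T.is_group] by simp
    then show "\<exists>N a. N > 0 \<and> a \<in> carrier G \<and> tclass 0 = tensor (1 / of_nat N) a"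
      by (intro exI[of _ 1] exI[of _ \<one>]) (simp add: tensor_one)
  next
    fix z :: "rat \<times> 'a" assume "z \<in> UNIV \<times> carrier G"
    then obtain q a where z: "z = (q, a)" "a \<in> carrier G" by auto
    obtain m n where mn: "q = of_int m / of_int n" "n > 0" using Rat_cases[of q] by (metis Fract_of_int_quotient)
    have "q = of_int m * (1 / of_nat (nat n))" using mn by simp
    then have "tensor q a = tensor (1 / of_nat (nat n)) (a [^] m)"
      using tensor_move[OF z(2), of m "1 / of_nat (nat n)"] by (simp only:)
    then have "tclass (frag_of z) = tensor (1 / of_nat (nat n)) (a [^] m)"
      by (simp only: z(1) tensor_def)
    then show "\<exists>N a. N > 0 \<and> a \<in> carrier G \<and> tclass (frag_of z) = tensor (1 / of_nat N) a"
      using mn z(2) by (intro exI[of _ "nat n"] exI[of _ "a [^] m"]) auto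
  next
    fix x y :: "rat \<times> 'a \<Rightarrow>\<^sub>0 int" assume xy: "Poly_Mapping.keys x \<subseteq> UNIV \<times> carrier G" "Poly_Mapping.keys y \<subseteq> UNIV \<times> carrier G"
    assume "\<exists>N a. N > 0 \<and> a \<in> carrier G \<and> tclass x = tensor (1 / of_nat N) a"
      "\<exists>N a. N > 0 \<and> a \<in> carrier G \<and> tclass y = tensor (1 / of_nat N) a"
    then obtain N a M b where Na: "N > 0" "a \<in> carrier G" "tclass x = tensor (1 / of_nat N) a"
      and Mb: "M > 0" "b \<in> carrier G" "tclass y = tensor (1 / of_nat M) b" by blast
    let ?q = "1 / of_nat (N * M)" and ?a = "a [^] int M" and ?b = "b [^] int N"
    have e1: "tclass x = tensor ?q ?a" unfolding Na(3) using tensor_move[OF Na(2), of "int M" ?q] Mb(1) by simp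
    have e2: "tclass y = tensor ?q ?b" unfolding Mb(3) using tensor_move[OF Mb(2), of "int N" ?q] Na(1) by simp
    have e3: "tclass (x - y) \<otimes>\<^bsub>rat_tensor G\<^esub> tclass y = tclass x"
      using tclass_add[of "x - y" y] xy keys_diff[of x y] by auto
    have e4: "tensor ?q (?a \<otimes> inv ?b) \<otimes>\<^bsub>rat_tensor G\<^esub> tensor ?q ?b = tensor ?q ?a"
      using Na Mb by (subst tensor_mult[symmetric]) (auto simp: m_assoc)
    have cl: "tclass (x - y) \<in> carrier (rat_tensor G)" using xy keys_diff[of x y] by (intro tclass_closed) auto
    have "?a \<otimes> inv ?b \<in> carrier G" "?b \<in> carrier G" using Na(2) Mb(2) by auto
    then have "tclass (x - y) = tensor ?q (?a \<otimes> inv ?b)"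
      using T.right_cancel[OF tensor_closed[of ?b ?q] cl tensor_closed[of "?a \<otimes> inv ?b" ?q]] e1 e2 e3 e4 by metis
    then show "\<exists>N a. N > 0 \<and> a \<in> carrier G \<and> tclass (x - y) = tensor (1 / of_nat N) a"
      using Na Mb by (intro exI[of _ "N * M"] exI[of _ "?a \<otimes> inv ?b"]) auto
  qed
  then show ?thesis using x(2) by simp
qed

text \<open>Multiplying all first components by \<open>q\<close> sends each generating relation to
  one of the same kind, which makes scalar multiplication well defined on cosets.\<close>

lemma scale_relations:
  assumes "h \<in> tensor_relations G"
  shows "frag_extend (\<lambda>(r, a). frag_of (q * r, a)) h \<in> tensor_relations G"
proof -
  let ?f = "frag_extend (\<lambda>(r, a). frag_of (q * r, a)) :: (rat \<times> 'a \<Rightarrow>\<^sub>0 int) \<Rightarrow> _"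
  have rel: "?f x \<in> tensor_rels" if "x \<in> tensor_rels" for x
    using that by (auto simp: frag_extend_diff distrib_left; blast)
  show ?thesis using assms unfolding tensor_relations_def
  proof induction
    case one
    show ?case using generate.one[of "tensor_free G"] by simp
  next
    case (incl x)
    then show ?case using rel by (blast intro: generate.incl)
  next
    case (inv x)
    have fx: "?f x \<in> tensor_rels" by (rule rel[OF inv])
    have c: "x \<in> carrier (tensor_free G)" "?f x \<in> carrier (tensor_free G)"
      using inv fx tensor_rels_carrier by blast+
    show ?case using generate.inv[OF fx, of "tensor_free G"]
      unfolding FT_inv[OF c(1)] FT_inv[OF c(2)] by (simp only: frag_extend_minus)
  next
    case (eng x y)
    then show ?case using generate.eng[OF eng(3,4)] by (simp add: frag_extend_add)
  qed
qed

lemma scale_tensor: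
  assumes a: "a \<in> carrier G"
  shows "rat_tensor_scale G q (tensor r a) = tensor (q * r) a"
proof -
  let ?f = "frag_extend (\<lambda>(r, a). frag_of (q * r, a)) :: (rat \<times> 'a \<Rightarrow>\<^sub>0 int) \<Rightarrow> _"
  have c: "frag_of (s, a) \<in> carrier (tensor_free G)" for s using a by simp
  have "tclass (?f x) = tensor (q * r) a" if x: "x \<in> tensor r a" for x
  proof -
    obtain h where h: "h \<in> tensor_relations G" "x = h + frag_of (r, a)"
      using x by (auto simp: tensor_def tclass_def r_coset_def)
    have e: "?f x = ?f h + frag_of (q * r, a)" by (simp add: h(2) frag_extend_add)
    have fh: "?f h \<in> tensor_relations G" by (rule scale_relations[OF h(1)])
    then have "?f h \<in> carrier (tensor_free G)" using TN.subset by blast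
    then show ?thesis unfolding tensor_def e
      using fh c by (intro tclass_eq keys_add_carrier) auto
  qed
  moreover have "frag_of (r, a) \<in> tensor r a"
    unfolding tensor_def tclass_def using FT.rcos_self[OF c tensor_relations_subgroup] by simp
  ultimately show ?thesis unfolding rat_tensor_scale_def tclass_def[symmetric] by blast
qed

text \<open>Each \<open>C\<close> is \<open>1/N\<close> tensor an element \<open>a\<close> of the
  group. An integer relation with exponents \<open>k\<close> among these elements is a relation in
  the tensor product with coefficients \<open>k N\<close>, so every \<open>k\<close>
  vanishes.\<close>

lemma independent_of_tensor:
  assumes B: "finite B" "B \<subseteq> carrier (rat_tensor G)" "rat_tensor_independent G B"
  shows "\<exists>a. (\<forall>C\<in>B. a C \<in> carrier G) \<and> int_indep G B a"
proof -
  have "\<forall>C\<in>B. \<exists>N a. N > 0 \<and> a \<in> carrier G \<and> C = tensor (1 / of_nat N) a" using tensor_all B(2) by blast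
  then obtain N a where Na: "\<And>C. C \<in> B \<Longrightarrow> N C > (0::nat) \<and> a C \<in> carrier G \<and> C = tensor (1 / of_nat (N C)) (a C)"
    by metis
  have "int_indep G B a" unfolding int_indep_def
  proof (intro allI impI)
    fix k :: "_ \<Rightarrow> int" assume k: "finprod G (\<lambda>C. a C [^] k C) B = \<one>"
    let ?c = "\<lambda>C. rat_of_int (k C) * of_nat (N C)"
    have sc: "rat_tensor_scale G (?c C) C = tensor 1 (a C [^] k C)" if C: "C \<in> B" for C
    proof -
      have "rat_tensor_scale G (?c C) C = rat_tensor_scale G (?c C) (tensor (1 / of_nat (N C)) (a C))"
        by (rule arg_cong[of C "tensor (1 / of_nat (N C)) (a C)"]) (use Na[OF C] in blast)
      also have "\<dots> = tensor (?c C * (1 / of_nat (N C))) (a C)" by (rule scale_tensor) (use Na[OF C] in blast)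
      also have "?c C * (1 / of_nat (N C)) = of_int (k C) * 1" using Na[OF C] by simp
      finally show ?thesis using tensor_move[of "a C" "k C" 1] Na[OF C] by simp
    qed
    have fin: "finprod (rat_tensor G) (\<lambda>C. tensor 1 (a C [^] k C)) B' = tensor 1 (finprod G (\<lambda>C. a C [^] k C) B')"
      if "finite B'" "B' \<subseteq> B" for B'
      using that
    proof (induction B' rule: finite_induct)
      case empty
      then show ?case by (simp add: tensor_one)
    next
      case (insert C B')
      have c: "\<And>D. D \<in> insert C B' \<Longrightarrow> a D [^] k D \<in> carrier G" using insert.prems Na by auto
      then have "(\<lambda>D. a D [^] k D) \<in> B' \<rightarrow> carrier G" "(\<lambda>D. tensor 1 (a D [^] k D)) \<in> B' \<rightarrow> carrier (rat_tensor G)"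
        by auto
      then show ?case using insert c by (simp add: tensor_mult)
    qed
    have "finprod (rat_tensor G) (\<lambda>C. rat_tensor_scale G (?c C) C) B = finprod (rat_tensor G) (\<lambda>C. tensor 1 (a C [^] k C)) B"
      using sc Na by (intro T.finprod_cong') auto
    also have "\<dots> = \<one>\<^bsub>rat_tensor G\<^esub>" using fin[OF B(1)] k by (simp add: tensor_one)
    finally have "\<forall>C\<in>B. ?c C = 0" using B(3) unfolding rat_tensor_independent_def by (elim allE[of _ ?c]) simp
    then show "\<forall>C\<in>B. k C = 0" using Na by fastforce
  qed
  then show ?thesis using Na by blast
qed

text \<open>Clearing denominators by a fixed integer \<open>M\<close> and rounding is additive on the free group, and
  it kills a given relation as soon as \<open>M\<close> is a common multiple of the denominators involved.\<close>

lemma relation_torsion: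
  assumes a: "a \<in> carrier G" and r: "frag_of (c, a) \<in> tensor_relations G" and c: "c \<noteq> 0"
  shows "\<exists>k::int. k \<noteq> 0 \<and> a [^] k = \<one>"
proof -
  have "\<exists>h. h \<in> hom (tensor_free G) G \<and> (\<forall>z\<in>UNIV \<times> carrier G. h (frag_of z) = snd z [^] \<lfloor>of_nat M * fst z\<rfloor>)" for M :: nat
  proof -
    have "(\<lambda>z. snd z [^] \<lfloor>of_nat M * fst z\<rfloor>) ` (UNIV \<times> carrier G) \<subseteq> carrier G" by auto
    from free_Abelian_group_universal[OF this] show ?thesis unfolding tensor_free_def by metis
  qed
  then obtain h where h: "\<And>M. h M \<in> hom (tensor_free G) G"
    "\<And>M q a. a \<in> carrier G \<Longrightarrow> h M (frag_of (q, a)) = a [^] \<lfloor>of_nat M * q\<rfloor>" by (metis SigmaI UNIV_I fst_conv snd_conv)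
  have hadd: "h M (x + y) = h M x \<otimes> h M y" if "x \<in> carrier (tensor_free G)" "y \<in> carrier (tensor_free G)" for M x y
    using hom_mult[OF h(1) that] by simp
  have hcl: "h M x \<in> carrier G" if "x \<in> carrier (tensor_free G)" for M x
    using hom_in_carrier[OF h(1) that] .
  have hdiff: "h M (x - y) = h M x \<otimes> inv (h M y)" if xy: "x \<in> carrier (tensor_free G)" "y \<in> carrier (tensor_free G)" for M x y
  proof -
    have d: "x - y \<in> carrier (tensor_free G)" using xy keys_diff[of x y] by auto
    have "h M (x - y) \<otimes> h M y = h M x" using hadd[OF d xy(2)] by simp
    then show ?thesis using hcl[OF d] hcl[OF xy(2)] hcl[OF xy(1)] by (metis inv_solve_right)
  qed
  have den: "\<exists>N>0. \<forall>M. N dvd M \<longrightarrow> rat_of_nat M * q = of_int \<lfloor>of_nat M * q\<rfloor>" for q :: rat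
  proof -
    obtain m n where mn: "q = of_int m / of_int n" "n > 0" using Rat_cases[of q] by (metis Fract_of_int_quotient)
    have "rat_of_nat M * q = of_int \<lfloor>of_nat M * q\<rfloor>" if M: "nat n dvd M" for M
    proof -
      obtain l where "M = nat n * l" using M by (elim dvdE)
      then have "rat_of_nat M * q = of_int (int l * m)" using mn by simp
      then show ?thesis by (metis floor_of_int)
    qed
    then show ?thesis using mn(2) by (intro exI[of _ "nat n"]) auto
  qed
  \<comment> \<open>The relation \<open>x\<close> is killed for all multiples \<open>M\<close> of
    some \<open>N\<close>. This holds for the generators, and for a sum the product of the two
    moduli serves.\<close>
  let ?P = "\<lambda>x. \<exists>N>0. \<forall>M. N dvd M \<longrightarrow> h M x = \<one>"
  have rels: "?P x" if x: "x \<in> tensor_rels" for x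
    using x
  proof (elim UnE CollectE exE conjE)
    fix q r b assume b: "x = frag_of (q + r, b) - frag_of (q, b) - frag_of (r, b)" "b \<in> carrier G"
    \<comment> \<open>The floor is additive once one summand is an integer, so a denominator of
      \<open>q\<close> serves as the modulus.\<close>
    obtain N where N: "N > 0" "\<And>M. N dvd M \<Longrightarrow> rat_of_nat M * q = of_int \<lfloor>of_nat M * q\<rfloor>" using den[of q] by blast
    have "h M x = \<one>" if "N dvd M" for M
    proof -
      have c1: "frag_of (s, b) \<in> carrier (tensor_free G)" for s using b by simp
      have c2: "frag_of (q + r, b) - frag_of (q, b) \<in> carrier (tensor_free G)"
        using c1 keys_diff[of "frag_of (q + r, b)" "frag_of (q, b)"] by auto
      have "of_nat M * (q + r) = of_int \<lfloor>of_nat M * q\<rfloor> + of_nat M * r" using N(2)[OF that] by (simp add: distrib_left)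
      then have "\<lfloor>of_nat M * (q + r)\<rfloor> = \<lfloor>of_nat M * q\<rfloor> + \<lfloor>of_nat M * r\<rfloor>" by (metis floor_add_int add.commute)
      then show ?thesis
        unfolding b(1) hdiff[OF c2 c1] hdiff[OF c1 c1] h(2)[OF b(2)] using b(2)
        by (simp add: int_pow_mult m_assoc m_comm[of "b [^] \<lfloor>of_nat M * q\<rfloor>"])
    qed
    then show ?thesis using N(1) by blast
  next
    fix q b d assume b: "x = frag_of (q, b \<otimes> d) - frag_of (q, b) - frag_of (q, d)" "b \<in> carrier G" "d \<in> carrier G"
    have comm: "u \<otimes> w \<otimes> inv u \<otimes> inv w = \<one>" if "u \<in> carrier G" "w \<in> carrier G" for u w
    proof -
      have "u \<otimes> w \<otimes> inv u \<otimes> inv w = (w \<otimes> u) \<otimes> (inv u \<otimes> inv w)"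
        unfolding m_comm[OF that] using that by (intro m_assoc) auto
      also have "inv u \<otimes> inv w = inv (w \<otimes> u)" using that by (simp add: inv_mult_group)
      finally show ?thesis using that by simp
    qed
    have "h M x = \<one>" for M
    proof -
      have c1: "frag_of (q, s) \<in> carrier (tensor_free G)" if "s \<in> carrier G" for s using that by simp
      have c2: "frag_of (q, b \<otimes> d) - frag_of (q, b) \<in> carrier (tensor_free G)"
        using c1 b keys_diff[of "frag_of (q, b \<otimes> d)" "frag_of (q, b)"] by auto
      have bd: "b \<otimes> d \<in> carrier G" using b by simp
      show ?thesis
        unfolding b(1) hdiff[OF c2 c1[OF b(3)]] hdiff[OF c1[OF bd] c1[OF b(2)]] h(2)[OF b(2)] h(2)[OF b(3)] h(2)[OF bd]
          int_pow_distrib[OF b(2,3)] using b(2,3) by (intro comm) auto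
    qed
    then show ?thesis by (intro exI[of _ 1]) auto
  qed
  have "?P x" if "x \<in> generate (tensor_free G) tensor_rels" for x
    using that
  proof induction
    case one
    have "h M 0 = \<one>" for M using hom_one[OF h(1) FT.is_group is_group] by simp
    then show ?case by (intro exI[of _ 1]) auto
  next
    case (incl x)
    then show ?case by (rule rels)
  next
    case (inv x)
    have xc: "x \<in> carrier (tensor_free G)" using inv tensor_rels_carrier by blast
    have zc: "(0 :: rat \<times> 'a \<Rightarrow>\<^sub>0 int) \<in> carrier (tensor_free G)" by simp
    have "h M (0 - x) = inv (h M x)" for M
      unfolding hdiff[OF zc xc] using hom_one[OF h(1)[of M] FT.is_group is_group] hcl[OF xc] by simp
    then show ?case using rels[OF inv] FT_inv[OF xc] by (metis diff_0 inv_one)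
  next
    case (eng x y)
    have xy: "x \<in> carrier (tensor_free G)" "y \<in> carrier (tensor_free G)"
      using FT.generate_incl[OF tensor_rels_carrier] eng(1,2) by blast+
    obtain N N' where N: "N > 0" "\<And>M. N dvd M \<Longrightarrow> h M x = \<one>" "N' > 0" "\<And>M. N' dvd M \<Longrightarrow> h M y = \<one>" using eng(3,4) by blast
    have "h M (x + y) = \<one>" if "N * N' dvd M" for M
      using hadd[OF xy, of M] N(2)[of M] N(4)[of M] that by (metis dvd_mult_left dvd_mult_right l_one one_closed)
    then show ?case using N(1,3) by (intro exI[of _ "N * N'"]) auto
  qed
  then obtain N where N: "N > 0" "\<And>M. N dvd M \<Longrightarrow> h M (frag_of (c, a)) = \<one>" using r unfolding tensor_relations_def by blast
  obtain N' where N': "N' > 0" "\<And>M. N' dvd M \<Longrightarrow> rat_of_nat M * c = of_int \<lfloor>of_nat M * c\<rfloor>" using den[of c] by blast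
  \<comment> \<open>For \<open>M = N * N'\<close> the given relation is killed, while
    \<open>M c\<close> is a nonzero integer.\<close>
  have "a [^] \<lfloor>of_nat (N * N') * c\<rfloor> = \<one>" using N(2)[of "N * N'"] h(2)[OF a] by simp
  moreover have "\<lfloor>of_nat (N * N') * c\<rfloor> \<noteq> 0" using N'(2)[of "N * N'"] N(1) N'(1) c by auto
  ultimately show ?thesis by blast
qed

text \<open>If \<open>a\<close> had infinite order, \<open>1\<close> tensor \<open>a\<close> would
  be an independent set with one element, since \<open>c\<close> tensor \<open>a\<close> vanishes
  only for \<open>c = 0\<close> by \<open>relation_torsion\<close>.\<close>

lemma rational_rank_0_torsion:
  assumes "rational_rank G = 0" and a: "a \<in> carrier G"
  shows "\<exists>k::int. k \<noteq> 0 \<and> a [^] k = \<one>"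
proof (rule ccontr)
  assume no: "\<not> ?thesis"
  let ?C = "tensor 1 a"
  have "rat_tensor_independent G {?C}" unfolding rat_tensor_independent_def
  proof (intro allI impI)
    fix c assume "finprod (rat_tensor G) (\<lambda>C. rat_tensor_scale G (c C) C) {?C} = \<one>\<^bsub>rat_tensor G\<^esub>"
    moreover have "rat_tensor_scale G (c ?C) ?C = tensor (c ?C) a" using scale_tensor[OF a] by simp
    ultimately have "tensor (c ?C) a = \<one>\<^bsub>rat_tensor G\<^esub>"
      using a T.finprod_insert[of "{}" ?C "\<lambda>C. rat_tensor_scale G (c C) C"] by simp
    then have "frag_of (c ?C, a) \<in> tensor_relations G" unfolding tensor_def using a by (intro tclass_one) auto
    then have "c ?C = 0" using relation_torsion[OF a] no by blast
    then show "\<forall>C\<in>{?C}. c C = 0" by simp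
  qed
  then have "enat (card {?C}) \<le> rational_rank G" unfolding rational_rank_def
    using a by (intro Sup_upper CollectI exI[of _ "{?C}"]) auto
  then show False using assms(1) by (simp add: zero_enat_def)
qed

text \<open>Independent sets of tensors become integrally independent families of \<open>G\<close>
  of the same size, indexed by an initial segment of the naturals; a finite supremum of sizes is
  attained.\<close>

lemma rational_rank_le:
  assumes "\<And>r (a :: nat \<Rightarrow> 'a). a ` {..<r} \<subseteq> carrier G \<Longrightarrow> int_indep G {..<r} a \<Longrightarrow> r \<le> n"
  shows "rational_rank G \<le> enat n"
    and "rational_rank G = enat m \<Longrightarrow> \<exists>a :: nat \<Rightarrow> 'a. a ` {..<m} \<subseteq> carrier G \<and> int_indep G {..<m} a"
proof -
  have ex: "\<exists>a :: nat \<Rightarrow> 'a. a ` {..<card B} \<subseteq> carrier G \<and> int_indep G {..<card B} a"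
    if B: "finite B" "B \<subseteq> carrier (rat_tensor G)" "rat_tensor_independent G B" for B
  proof -
    obtain a where a: "\<And>C. C \<in> B \<Longrightarrow> a C \<in> carrier G" "int_indep G B a" using independent_of_tensor[OF B] by blast
    obtain f where f: "bij_betw f {..<card B} B" using ex_bij_betw_nat_finite[OF B(1)] by (auto simp: lessThan_atLeast0)
    let ?g = "the_inv_into {..<card B} f"
    have inj: "inj_on f {..<card B}" "f ` {..<card B} = B" using f by (auto simp: bij_betw_def)
    have "int_indep G {..<card B} (a \<circ> f)" unfolding int_indep_def
    proof (intro allI impI)
      fix k :: "nat \<Rightarrow> int" assume k: "(\<Otimes>i\<in>{..<card B}. (a \<circ> f) i [^] k i) = \<one>"
      have "(\<Otimes>C\<in>f ` {..<card B}. a C [^] k (?g C)) = (\<Otimes>i\<in>{..<card B}. a (f i) [^] k (?g (f i)))"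
        using a(1) inj by (intro finprod_reindex) auto
      also have "\<dots> = (\<Otimes>i\<in>{..<card B}. (a \<circ> f) i [^] k i)"
        using a(1) inj by (intro finprod_cong') (auto simp: the_inv_into_f_f[OF inj(1)])
      finally have "(\<Otimes>C\<in>B. a C [^] k (?g C)) = \<one>" using k inj(2) by simp
      then have "\<forall>C\<in>B. k (?g C) = 0" using a(2) unfolding int_indep_def by (elim allE[of _ "\<lambda>C. k (?g C)"]) simp
      then show "\<forall>i\<in>{..<card B}. k i = 0" using inj the_inv_into_f_f[OF inj(1)] by (metis imageI)
    qed
    moreover have "(a \<circ> f) ` {..<card B} \<subseteq> carrier G" using a(1) inj(2) by auto
    ultimately show ?thesis by blast
  qed
  show "rational_rank G \<le> enat n" unfolding rational_rank_def
  proof (rule Sup_least)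
    fix x assume "x \<in> {enat (card B) | B. finite B \<and> B \<subseteq> carrier (rat_tensor G) \<and> rat_tensor_independent G B}"
    then obtain B where B: "finite B" "B \<subseteq> carrier (rat_tensor G)" "rat_tensor_independent G B" "x = enat (card B)" by blast
    obtain a :: "nat \<Rightarrow> 'a" where "a ` {..<card B} \<subseteq> carrier G" "int_indep G {..<card B} a" using ex[OF B(1-3)] by blast
    then show "x \<le> enat n" using assms B(4) by simp
  qed
  assume m: "rational_rank G = enat m"
  have "enat m \<in> {enat (card B) | B. finite B \<and> B \<subseteq> carrier (rat_tensor G) \<and> rat_tensor_independent G B}"
    using m unfolding rational_rank_def by (intro Sup_enat_attained) (auto simp: rat_tensor_independent_def intro!: exI[of _ "{}"])
  then show "\<exists>a :: nat \<Rightarrow> 'a. a ` {..<m} \<subseteq> carrier G \<and> int_indep G {..<m} a" using ex by auto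
qed

end

text \<open>Every element is a signed sum over a finite list from \<open>S\<close>.\<close>

lemma countable_gspan: assumes "countable S" shows "countable (gspan S)"
proof -
  let ?f = "\<lambda>l. sum_list (map (\<lambda>(b, c). if b then c else - c) l)"
  have "gspan S \<subseteq> ?f ` lists (UNIV \<times> S)"
  proof
    fix a assume "a \<in> gspan S"
    then show "a \<in> ?f ` lists (UNIV \<times> S)"
    proof induction
      case zero
      show ?case by (intro image_eqI[of _ _ "[]"]) auto
    next
      case (incl a)
      then show ?case by (intro image_eqI[of _ _ "[(True, a)]"]) auto
    next
      case (diff a b)
      then obtain l l' where l: "a = ?f l" "l \<in> lists (UNIV \<times> S)" "b = ?f l'" "l' \<in> lists (UNIV \<times> S)" by blast
      have "?f (map (\<lambda>(b, c). (\<not> b, c)) l') = - ?f l'" by (induction l') auto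
      then show ?case using l
        by (intro image_eqI[of _ _ "l @ map (\<lambda>(b, c). (\<not> b, c)) l'"]) (auto simp: in_lists_conv_set)
    qed
  qed
  moreover have "countable (lists (UNIV \<times> S :: (bool \<times> 'a) set))"
    using assms by (intro countable_lists countable_SIGMA countableI_type)
  ultimately show ?thesis by (rule countable_subset[OF _ countable_image])
qed

context valued
begin

section \<open>The value group modulo the value group of a subfield\<close>

context
  fixes K assumes K: "subfield K amb" "K \<subseteq> F"
begin

lemma value_group_simps [simp]:
  "carrier (value_group v L) = value_set v L" "g \<otimes>\<^bsub>value_group v L\<^esub> h = g + h" "\<one>\<^bsub>value_group v L\<^esub> = 0"
  by (simp_all add: value_group_def)

lemma value_set_closed:
  assumes L: "subfield L amb" "L \<subseteq> F"
  shows "0 \<in> value_set v L" "g \<in> value_set v L \<Longrightarrow> h \<in> value_set v L \<Longrightarrow> g + h \<in> value_set v L"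
    "g \<in> value_set v L \<Longrightarrow> - g \<in> value_set v L"
  using gspan.zero[of "value_set v L"] gspan_add[of g "value_set v L" h] gspan_uminus[of g "value_set v L"]
  unfolding value_set_gspan[OF L] by auto

lemma value_group_comm: "comm_group (value_group v F)"
proof (rule comm_groupI)
  fix g assume "g \<in> carrier (value_group v F)"
  then show "\<exists>h\<in>carrier (value_group v F). h \<otimes>\<^bsub>value_group v F\<^esub> g = \<one>\<^bsub>value_group v F\<^esub>"
    using value_set_closed(3)[OF F_sf order.refl, of g] by (intro bexI[of _ "- g"]) auto
qed (use value_set_closed[OF F_sf order.refl] in \<open>auto simp: algebra_simps\<close>)

interpretation VG: comm_group "value_group v F" by (rule value_group_comm)

lemma value_subgroup: "subgroup (value_set v K) (value_group v F)"
proof (rule VG.subgroupI)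
  show "value_set v K \<subseteq> carrier (value_group v F)" using K(2) by (auto simp: value_set_def)
  show "value_set v K \<noteq> {}" using value_set_closed(1)[OF K] by auto
  fix g assume g: "g \<in> value_set v K"
  then have "inv\<^bsub>value_group v F\<^esub> g = - g"
    using value_set_closed(3)[OF K g] K(2) by (intro VG.inv_equality) (auto simp: value_set_def)
  then show "inv\<^bsub>value_group v F\<^esub> g \<in> value_set v K" using value_set_closed(3)[OF K g] by simp
qed (use value_set_closed(2)[OF K] in auto)

interpretation VN: normal "value_set v K" "value_group v F"
  by (rule VG.subgroup_imp_normal[OF value_subgroup])

lemma value_quotient_comm: "comm_group (value_quotient v F K)"
  unfolding value_quotient_def by (rule VG.abelian_FactGroup[OF value_subgroup])

interpretation A: comm_group "value_quotient v F K" by (rule value_quotient_comm)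

definition coset_of :: "'g \<Rightarrow> 'g set" where "coset_of g = value_set v K #>\<^bsub>value_group v F\<^esub> g"

lemma coset_of_hom: "coset_of \<in> hom (value_group v F) (value_quotient v F K)"
  using VN.r_coset_hom_Mod by (simp add: value_quotient_def coset_of_def[abs_def])

lemma coset_of_closed: "g \<in> value_set v F \<Longrightarrow> coset_of g \<in> carrier (value_quotient v F K)"
  using hom_in_carrier[OF coset_of_hom, of g] by simp

lemma coset_of_add: "g \<in> value_set v F \<Longrightarrow> h \<in> value_set v F \<Longrightarrow>
    coset_of (g + h) = coset_of g \<otimes>\<^bsub>value_quotient v F K\<^esub> coset_of h"
  using hom_mult[OF coset_of_hom, of g h] by simp

lemma coset_of_one_iff: assumes "g \<in> value_set v F"
  shows "coset_of g = \<one>\<^bsub>value_quotient v F K\<^esub> \<longleftrightarrow> g \<in> value_set v K"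
  using VG.rcos_self[OF _ value_subgroup, of g] VG.coset_join2[OF _ value_subgroup, of g] assms
  by (auto simp: coset_of_def value_quotient_def)

lemma carrier_value_quotient: "carrier (value_quotient v F K) = coset_of ` value_set v F"
  by (simp add: value_quotient_def carrier_FactGroup coset_of_def[abs_def])

lemma v_power_value_set: "a \<in> F \<Longrightarrow> a \<noteq> 0 \<Longrightarrow> v (a ^ n) \<in> value_set v F"
  by (intro value_setI) auto

lemma coset_of_power: assumes "a \<in> F" "a \<noteq> 0"
  shows "coset_of (v (a ^ n)) = coset_of (v a) [^]\<^bsub>value_quotient v F K\<^esub> n"
proof (induction n)
  case 0
  then show ?case using coset_of_one_iff[of 0] value_set_closed(1)[OF K] value_set_closed(1)[OF F_sf] by simp
next
  case (Suc n)
  have "coset_of (v (a ^ n * a)) = coset_of (v (a ^ n)) \<otimes>\<^bsub>value_quotient v F K\<^esub> coset_of (v a)"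
    using assms v_mult[of "a ^ n" a] v_power_value_set[OF assms, of n] value_setI[OF assms] coset_of_add by simp
  then show ?case using Suc by (simp add: mult.commute)
qed

lemma torsion_of_rank_0:
  assumes "rational_rank (value_quotient v F K) = 0" and a: "a \<in> F" "a \<noteq> 0"
  shows "\<exists>e\<ge>1. \<exists>c\<in>K - {0}. v (c * a ^ e) = 0"
proof -
  have c: "coset_of (v a) \<in> carrier (value_quotient v F K)" using coset_of_closed value_setI[OF a] .
  obtain k :: int where k: "k \<noteq> 0" "coset_of (v a) [^]\<^bsub>value_quotient v F K\<^esub> k = \<one>\<^bsub>value_quotient v F K\<^esub>"
    using A.rational_rank_0_torsion[OF assms(1) c] by blast
  \<comment> \<open>The exponent that the group provides may be negative; its absolute value serves
    as \<open>e\<close>.\<close>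
  let ?n = "nat \<bar>k\<bar>"
  have "coset_of (v a) [^]\<^bsub>value_quotient v F K\<^esub> ?n = \<one>\<^bsub>value_quotient v F K\<^esub>"
  proof (cases "k \<ge> 0")
    case True
    then show ?thesis using k by (simp flip: int_pow_int)
  next
    case False
    then have "coset_of (v a) [^]\<^bsub>value_quotient v F K\<^esub> (int ?n) = coset_of (v a) [^]\<^bsub>value_quotient v F K\<^esub> (- k)" by simp
    also have "\<dots> = \<one>\<^bsub>value_quotient v F K\<^esub>" using k(2) A.int_pow_neg[OF c, of k] by simp
    finally show ?thesis by (simp only: int_pow_int)
  qed
  then have "v (a ^ ?n) \<in> value_set v K"
    using coset_of_power[OF a, of ?n] coset_of_one_iff v_power_value_set[OF a] by simp
  then obtain c where c: "c \<in> K" "c \<noteq> 0" "v (a ^ ?n) = v c" by (auto simp: value_set_def)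
  have "v (inverse c * a ^ ?n) = 0" using c a K by (simp add: v_mult v_inverse subset_iff)
  then show ?thesis using c k K by (intro exI[of _ ?n] conjI bexI[of _ "inverse c"]) auto
qed

text \<open>Modulo \<open>vK\<close> the group generated by \<open>vK\<close> and the preceding
  values consists of integer combinations of their cosets. If it contained
  \<open>v (z i ^ k)\<close>, moving this to the other side would give a relation with exponent
  \<open>-k\<close> at \<open>i\<close>.\<close>

lemma vind_of_int_indep:
  assumes a: "a ` {..<r} \<subseteq> carrier (value_quotient v F K)" and ind: "int_indep (value_quotient v F K) {..<r::nat} a"
  shows "\<exists>z. vind K r z"
proof -
  let ?A = "value_quotient v F K"
  have "\<forall>i\<in>{..<r}. \<exists>z. z \<in> F \<and> z \<noteq> 0 \<and> a i = coset_of (v z)"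
    using a unfolding carrier_value_quotient value_set_def by blast
  from bchoice[OF this] obtain z where z: "\<And>i. i < r \<Longrightarrow> z i \<in> F \<and> z i \<noteq> 0 \<and> a i = coset_of (v (z i))" by auto
  have ac: "a i \<in> carrier ?A" if "i < r" for i using a that by auto
  have fc: "(\<lambda>j. a j [^]\<^bsub>?A\<^esub> (m j :: int)) \<in> {..<i} \<rightarrow> carrier ?A" if "i \<le> r" for i m using ac that by auto
  have span: "g \<in> value_set v F \<and> (\<exists>m::nat \<Rightarrow> int. coset_of g = finprod ?A (\<lambda>j. a j [^]\<^bsub>?A\<^esub> m j) {..<i})"
    if i: "i \<le> r" and g: "g \<in> gspan (value_set v K \<union> v ` z ` {..<i})" for g i
    using g
  proof induction
    case zero
    then show ?case using value_set_closed(1)[OF F_sf] coset_of_one_iff[of 0] value_set_closed(1)[OF K]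
      by (intro conjI exI[of _ "\<lambda>_. 0"]) auto
  next
    case (incl g)
    then consider "g \<in> value_set v K" | j where "j < i" "g = v (z j)" by auto
    then show ?case
    proof cases
      case 1
      then have "g \<in> value_set v F" using K(2) by (auto simp: value_set_def)
      then show ?thesis using coset_of_one_iff[of g] 1 by (intro conjI exI[of _ "\<lambda>_. 0"]) auto
    next
      case 2
      have j: "j < r" using 2 i by simp
      have "finprod ?A (\<lambda>k. if j = k then a k else \<one>\<^bsub>?A\<^esub>) {..<i} = a j"
        using 2 i ac by (intro A.finprod_singleton) auto
      moreover have "finprod ?A (\<lambda>k. a k [^]\<^bsub>?A\<^esub> (if j = k then 1 else 0 :: int)) {..<i} = finprod ?A (\<lambda>k. if j = k then a k else \<one>\<^bsub>?A\<^esub>) {..<i}"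
        using ac i by (intro A.finprod_cong') auto
      ultimately show ?thesis using z[OF j] 2 value_setI by (intro conjI exI[of _ "\<lambda>k. if j = k then 1 else 0"]) auto
    qed
  next
    case (diff g h)
    then obtain m m' :: "nat \<Rightarrow> int" where m: "coset_of g = finprod ?A (\<lambda>j. a j [^]\<^bsub>?A\<^esub> m j) {..<i}" "g \<in> value_set v F"
      "coset_of h = finprod ?A (\<lambda>j. a j [^]\<^bsub>?A\<^esub> m' j) {..<i}" "h \<in> value_set v F" by blast
    let ?P = "\<lambda>m :: nat \<Rightarrow> int. finprod ?A (\<lambda>j. a j [^]\<^bsub>?A\<^esub> m j) {..<i}"
    have gh: "g - h \<in> value_set v F" using value_set_closed(2,3)[OF F_sf order.refl] m by (metis diff_conv_add_uminus)
    have "?P (\<lambda>j. m j - m' j) \<otimes>\<^bsub>?A\<^esub> ?P m' = finprod ?A (\<lambda>j. a j [^]\<^bsub>?A\<^esub> (m j - m' j) \<otimes>\<^bsub>?A\<^esub> a j [^]\<^bsub>?A\<^esub> m' j) {..<i}"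
      by (rule A.finprod_multf[symmetric]) (use fc[OF i] in auto)
    also have "\<dots> = ?P m" using ac i by (intro A.finprod_cong') (auto simp: A.int_pow_mult[symmetric])
    also have "\<dots> = coset_of (g - h) \<otimes>\<^bsub>?A\<^esub> ?P m'" using coset_of_add[OF gh m(4)] m by simp
    finally have E: "?P (\<lambda>j. m j - m' j) \<otimes>\<^bsub>?A\<^esub> ?P m' = coset_of (g - h) \<otimes>\<^bsub>?A\<^esub> ?P m'" .
    have P: "?P m \<in> carrier ?A" for m by (rule A.finprod_closed[OF fc[OF i]])
    have "?P (\<lambda>j. m j - m' j) = coset_of (g - h)"
      using A.right_cancel[OF P P coset_of_closed[OF gh]] E by (rule iffD1)
    then show ?case using gh by (intro conjI exI[of _ "\<lambda>j. m j - m' j"]) auto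
  qed
  have "v (z i ^ k) \<notin> gspan (value_set v K \<union> v ` z ` {..<i})" if i: "i < r" and k: "k \<ge> 1" for i k
  proof
    assume "v (z i ^ k) \<in> gspan (value_set v K \<union> v ` z ` {..<i})"
    then obtain m :: "nat \<Rightarrow> int" where m: "coset_of (v (z i ^ k)) = finprod ?A (\<lambda>j. a j [^]\<^bsub>?A\<^esub> m j) {..<i}"
      using span[of i] i by auto
    have zi: "z i \<in> F" "z i \<noteq> 0" "a i = coset_of (v (z i))" using z[OF i] by auto
    define m' where "m' j = (if j < i then m j else if j = i then - int k else 0)" for j
    have fc': "(\<lambda>j. a j [^]\<^bsub>?A\<^esub> m' j) \<in> {..<i} \<rightarrow> carrier ?A" using fc[of i] i by auto
    have "finprod ?A (\<lambda>j. a j [^]\<^bsub>?A\<^esub> m' j) {..<r} = finprod ?A (\<lambda>j. a j [^]\<^bsub>?A\<^esub> m' j) {..<Suc i}"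
      using i ac by (intro A.finprod_mono_neutral_cong_right) (auto simp: m'_def)
    also have "\<dots> = a i [^]\<^bsub>?A\<^esub> m' i \<otimes>\<^bsub>?A\<^esub> finprod ?A (\<lambda>j. a j [^]\<^bsub>?A\<^esub> m' j) {..<i}"
      unfolding lessThan_Suc using fc' ac[OF i] by (intro A.finprod_insert) auto
    also have "finprod ?A (\<lambda>j. a j [^]\<^bsub>?A\<^esub> m' j) {..<i} = finprod ?A (\<lambda>j. a j [^]\<^bsub>?A\<^esub> m j) {..<i}"
      using fc[of i m] i by (intro A.finprod_cong') (auto simp: m'_def)
    also have "\<dots> = a i [^]\<^bsub>?A\<^esub> k" using m coset_of_power[OF zi(1,2), of k] zi(3) by simp
    also have "a i [^]\<^bsub>?A\<^esub> m' i \<otimes>\<^bsub>?A\<^esub> a i [^]\<^bsub>?A\<^esub> k = \<one>\<^bsub>?A\<^esub>"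
      using ac[OF i] by (simp add: m'_def A.int_pow_neg_int)
    finally have "\<forall>j\<in>{..<r}. m' j = 0" using ind unfolding int_indep_def by blast
    then have "m' i = 0" using i by blast
    then show False using k by (simp add: m'_def)
  qed
  then show ?thesis unfolding vind_def using z by (intro exI[of _ z]) auto
qed

text \<open>One induction serves both claims: modulo \<open>vK\<close> every value equals one from
  the countable group \<open>gspan C\<close>, and its coset is generated by the cosets of
  \<open>C\<close>.\<close>

lemma value_quotient_generated:
  assumes "gen_ext fin K F"
  shows "countable (carrier (value_quotient v F K))" "fin \<Longrightarrow> finitely_generated_group (value_quotient v F K)"
proof -
  let ?A = "value_quotient v F K"
  obtain C where C: "small fin C" "C \<subseteq> value_set v F" "value_set v F \<subseteq> gspan (value_set v K \<union> C)"
    using assms unfolding gen_ext_def by blast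
  have dec: "g \<in> value_set v F \<and> (\<exists>h\<in>gspan C. h \<in> value_set v F \<and> coset_of g = coset_of h) \<and> coset_of g \<in> generate ?A (coset_of ` C)"
    if "g \<in> gspan (value_set v K \<union> C)" for g
    using that
  proof induction
    case zero
    have "coset_of 0 = \<one>\<^bsub>?A\<^esub>" using coset_of_one_iff[of 0] value_set_closed(1)[OF K] value_set_closed(1)[OF F_sf] by simp
    then show ?case using value_set_closed(1)[OF F_sf] gspan.zero generate.one[of ?A] by auto
  next
    case (incl g)
    then show ?case
    proof
      assume g: "g \<in> value_set v K"
      then have gF: "g \<in> value_set v F" using K(2) by (auto simp: value_set_def)
      have 0: "coset_of 0 = \<one>\<^bsub>?A\<^esub>" using coset_of_one_iff[of 0] value_set_closed(1)[OF K] value_set_closed(1)[OF F_sf] by simp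
      have "coset_of g = \<one>\<^bsub>?A\<^esub>" using coset_of_one_iff[OF gF] g by simp
      then show ?thesis using gF 0 value_set_closed(1)[OF F_sf] gspan.zero[of C] generate.one[of ?A] by auto
    next
      assume "g \<in> C"
      then show ?thesis using C(2) by (auto intro: gspan.incl generate.incl)
    qed
  next
    case (diff g h)
    then obtain g' h' where gh: "g' \<in> gspan C" "g' \<in> value_set v F" "coset_of g = coset_of g'"
      "h' \<in> gspan C" "h' \<in> value_set v F" "coset_of h = coset_of h'" by blast
    have minus: "coset_of (x - y) = coset_of x \<otimes>\<^bsub>?A\<^esub> inv\<^bsub>?A\<^esub> coset_of y" "x - y \<in> value_set v F"
      if xy: "x \<in> value_set v F" "y \<in> value_set v F" for x y
    proof -
      show d: "x - y \<in> value_set v F" using value_set_closed(2,3)[OF F_sf order.refl] xy by (metis diff_conv_add_uminus)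
      have "coset_of x = coset_of (x - y) \<otimes>\<^bsub>?A\<^esub> coset_of y" using coset_of_add[OF d xy(2)] by simp
      then show "coset_of (x - y) = coset_of x \<otimes>\<^bsub>?A\<^esub> inv\<^bsub>?A\<^esub> coset_of y"
        using coset_of_closed[OF d] coset_of_closed[OF xy(1)] coset_of_closed[OF xy(2)] A.inv_solve_right by metis
    qed
    have gF: "g \<in> value_set v F" "h \<in> value_set v F" using diff by auto
    have Cc: "coset_of ` C \<subseteq> carrier ?A" using C(2) coset_of_closed by auto
    have "coset_of g \<in> generate ?A (coset_of ` C)" "coset_of h \<in> generate ?A (coset_of ` C)" using diff by auto
    then have "coset_of g \<otimes>\<^bsub>?A\<^esub> inv\<^bsub>?A\<^esub> coset_of h \<in> generate ?A (coset_of ` C)"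
      using A.generate_m_inv_closed[OF Cc] generate.eng by metis
    moreover have "g' - h' \<in> gspan C" using gh gspan.diff by blast
    ultimately show ?case using minus[OF gF] minus[OF gh(2,5)] gh by auto
  qed
  have "carrier ?A \<subseteq> coset_of ` gspan C" unfolding carrier_value_quotient using dec C(3) by blast
  moreover have "countable (gspan C)" using C(1) by (intro countable_gspan) (simp add: small_def)
  ultimately show "countable (carrier ?A)" by (rule countable_subset[OF _ countable_image])
  have Cc: "coset_of ` C \<subseteq> carrier ?A" using C(2) coset_of_closed by auto
  assume fin
  then have "finite (coset_of ` C)" using C(1) by (simp add: small_def)
  moreover have "generate ?A (coset_of ` C) = carrier ?A"
  proof
    show "generate ?A (coset_of ` C) \<subseteq> carrier ?A" by (rule A.generate_incl[OF Cc])
    show "carrier ?A \<subseteq> generate ?A (coset_of ` C)" unfolding carrier_value_quotient using dec C(3) by blast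
  qed
  ultimately show "finitely_generated_group ?A" unfolding finitely_generated_group_def using Cc by blast
qed

end

section \<open>Discrete valuations of a simple transcendental extension\<close>

lemma trivial_poly:
  assumes L: "subfield L amb" "L \<subseteq> F" and triv: "\<And>c. c \<in> L \<Longrightarrow> c \<noteq> 0 \<Longrightarrow> v c = 0"
    and x: "x \<in> R" and p: "p \<in> polys L"
  shows "poly p x \<in> R" "\<pi> (poly p x) = poly (map_poly \<pi> p) (\<pi> x)" "map_poly \<pi> p \<in> polys (res L)"
    "p \<noteq> 0 \<Longrightarrow> map_poly \<pi> p \<noteq> 0"
proof -
  have LR: "c \<in> R" if "c \<in> L" for c using triv[OF that] that L(2) by (cases "c = 0") (auto simp: R_iff)
  have "p \<in> polys R" using p LR by (auto simp: polys_def)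
  then show "poly p x \<in> R" "\<pi> (poly p x) = poly (map_poly \<pi> p) (\<pi> x)" using pi_poly x by auto
  show "map_poly \<pi> p \<in> polys (res L)"
    using p LR resI unfolding polys_def by (auto simp: coeff_map_poly)
  assume "p \<noteq> 0"
  then have c: "lead_coeff p \<in> L" "lead_coeff p \<noteq> 0" using p by (auto simp: polys_def)
  then have "\<pi> (lead_coeff p) \<noteq> 0" using unitD' triv L by blast
  then have "poly.coeff (map_poly \<pi> p) (Polynomial.degree p) \<noteq> 0" by (simp add: coeff_map_poly)
  then show "map_poly \<pi> p \<noteq> 0" by auto
qed

text \<open>Take \<open>f\<close> of least degree with \<open>f(x)\<close> of positive value.
  Nonzero polynomials of smaller degree give units with residues in \<open>res L\<close> extended by
  the residue of \<open>x\<close>, which is a root of the reduction of \<open>f\<close>. Since no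
  \<open>u f(x)^k\<close> with \<open>k \<ge> 1\<close> has value \<open>0\<close>, expansions in
  powers of \<open>f(x)\<close> bring no further residues.\<close>

lemma discrete_residue_integral:
  assumes L: "subfield L amb" "L \<subseteq> F" and F: "F = adjoin L {x}" and nx: "\<not> alg L x"
    and triv: "\<And>c. c \<in> L \<Longrightarrow> c \<noteq> 0 \<Longrightarrow> v c = 0" and a: "a \<in> F" "a \<noteq> 0" "v a \<noteq> 0" and x: "x \<in> R"
  shows "\<exists>\<zeta>. alg (res L) \<zeta> \<and> res F = adjoin (res L) {\<zeta>}"
proof -
  have sL: "subfield (res L) amb" by (rule res_subfield[OF L])
  have tp: "poly p x \<in> R" "\<pi> (poly p x) = poly (map_poly \<pi> p) (\<pi> x)" "map_poly \<pi> p \<in> polys (res L)"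
    "p \<noteq> 0 \<Longrightarrow> map_poly \<pi> p \<noteq> 0" if "p \<in> polys L" for p
    using trivial_poly[OF L triv x that] by blast+
  have xF: "x \<in> F" using x RF by simp
  have nz: "poly p x \<noteq> 0" if "p \<in> polys L" "p \<noteq> 0" for p using nx that by (auto simp: alg_def)
  have pF: "poly p x \<in> F" if "p \<in> polys L" for p using tp(1)[OF that] RF by simp
  have nneg: "0 \<le> v (poly p x)" if "p \<in> polys L" "p \<noteq> 0" for p using tp(1)[OF that(1)] nz[OF that] by (simp add: R_iff)
  let ?P = "\<lambda>p. p \<in> polys L \<and> p \<noteq> 0 \<and> 0 < v (poly p x)"
  have "\<exists>p. ?P p"
  proof (rule ccontr)
    assume "\<nexists>p. ?P p"
    then have 0: "v (poly p x) = 0" if "p \<in> polys L" "p \<noteq> 0" for p using nneg[OF that] that by force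
    obtain p q where pq: "a = poly p x / poly q x" "p \<in> polys L" "q \<in> polys L" "poly q x \<noteq> 0"
      using a(1) unfolding F adjoin_singleton[OF L(1)] by blast
    then have "p \<noteq> 0" "q \<noteq> 0" using a by auto
    then have "v a = 0" unfolding pq(1) using v_divide[OF pF pF nz nz] 0 pq by simp
    then show False using a by simp
  qed
  then obtain f where f: "?P f" "\<And>p. ?P p \<Longrightarrow> Polynomial.degree f \<le> Polynomial.degree p"
    using ex_has_least_nat[of ?P _ Polynomial.degree] by blast
  define m where "m = Polynomial.degree f"
  have m: "m \<ge> 1"
  proof (rule ccontr)
    assume "\<not> m \<ge> 1"
    then obtain c where c: "f = [:c:]" using degree_eq_zeroE[of f] by (auto simp: m_def)
    then have "c \<in> L" "c \<noteq> 0" using f(1) polys_coeff[of f L 0] by auto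
    then show False using f(1) triv c by simp
  qed
  have v0: "v (poly q x) = 0" if "q \<in> polys L" "q \<noteq> 0" "Polynomial.degree q < m" for q
    using f(2)[of q] nneg[OF that(1,2)] that unfolding m_def by fastforce
  let ?z = "\<pi> x" and ?V = "low L m x" and ?f = "poly f x"
  have fF: "?f \<in> F" "?f \<noteq> 0" "0 < v ?f" using f nz pF by auto
  have "\<pi> ?f = 0" using tp(1)[of f] f(1) pi_eq_0_iff by simp
  then have az: "alg (res L) ?z"
    using tp(2,3,4)[of f] f(1) by (intro algI[of "map_poly \<pi> f"]) auto
  have inz: "\<pi> (poly q x) \<in> adjoin (res L) {?z}" if q: "q \<in> polys L" for q
    unfolding tp(2)[OF q] using polys_mono[OF adjoin_base] tp(3)[OF q] adjoin_gen[of "{?z}" "res L"]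
    by (intro poly_in_subfield) auto
  have uV: "a \<in> F \<and> v a = 0 \<and> \<pi> a \<in> adjoin (res L) {?z}" if "a \<in> ?V" "a \<noteq> 0" for a
    using that v0 pF inz by (auto simp: low_def) (metis poly_0)
  have V: "res_closed ?V"
  proof (rule low_res_closed[OF L xF m])
    fix a b assume ab: "a \<in> ?V" "b \<in> ?V" "a \<noteq> 0" "b \<noteq> 0"
    obtain q r where qr: "a = poly q x" "q \<in> polys L" "b = poly r x" "r \<in> polys L" using ab by (auto simp: low_def)
    have "q * r \<in> polys L" "f \<noteq> 0" using qr L f by auto
    then obtain s u where su: "s \<in> polys L" "u \<in> polys L" "q * r = s * f + u" "u = 0 \<or> Polynomial.degree u < m"
      using polys_division[OF L(1), of "q * r" f] f(1) by (auto simp: m_def)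
    have uV': "poly u x \<in> ?V" using su m by (auto simp: low_def)
    have e: "a * b - poly u x = poly s x * ?f" using arg_cong[OF su(3), of "\<lambda>p. poly p x"] qr by simp
    have ab0: "a * b \<in> F" "a * b \<noteq> 0" "v (a * b) = 0" using uV[OF ab(1,3)] uV[OF ab(2,4)] ab by (auto simp: v_mult)
    have "poly s x * ?f = 0 \<or> 0 < v (poly s x * ?f)"
      using fF nneg[OF su(1)] pF[OF su(1)] nz[OF su(1)] by (cases "s = 0") (auto simp: v_mult add_nonneg_pos)
    then have "sim (a * b) (poly u x)" using e ab0 pF[OF su(2)] by (intro sim_diffI) auto
    then show "\<exists>u\<in>?V. sim (a * b) u" using uV' by blast
  next
    fix a assume a: "a \<in> ?V" "a \<noteq> 0"
    have "alg (res L) (\<pi> a)" using alg_adjoin[OF sL, of "{?z}"] az uV[OF a] by blast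
    then show "tame L a" using tame_unit[OF L, of a] uV[OF a] a by blast
  qed
  have indep: "v (u * ?f ^ k) \<noteq> 0" if "u \<in> ?V" "u \<noteq> 0" "k \<ge> 1" for u k
  proof -
    have "0 < v (?f ^ k)" using that(3)
    proof (induction k rule: dec_induct)
      case (step k)
      then show ?case using fF by (simp add: v_mult add_pos_pos)
    qed (use fF in simp)
    then show ?thesis using uV[OF that(1,2)] fF that by (simp add: v_mult)
  qed
  have "res F \<subseteq> adjoin (res L) {?z}"
  proof
    fix b assume "b \<in> res F"
    then obtain a where a: "a \<in> F" "a \<in> R" "b = \<pi> a" by (rule resE) auto
    show "b \<in> adjoin (res L) {?z}"
    proof (cases "b = 0")
      case False
      then have va: "a \<noteq> 0" "v a = 0" using a unit_iff[of a] by auto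
      obtain p q where pq: "a = poly p x / poly q x" "p \<in> polys L" "q \<in> polys L" "poly q x \<noteq> 0"
        using a(1) unfolding F adjoin_singleton[OF L(1)] by blast
      have "p \<noteq> 0" "q \<noteq> 0" using pq va by auto
      have "f \<in> polys L" using f(1) by simp
      note S = poly_in_fsums[OF L nx \<open>f \<in> polys L\<close> m_def[symmetric] m]
      have "b \<in> res ?V"
        using value_transcendental_quotients(3)[OF V fF(1,2) indep S[OF pq(2) \<open>p \<noteq> 0\<close>] S[OF pq(3) \<open>q \<noteq> 0\<close>]] va(2)
        unfolding a(3) pq(1) by blast
      then obtain c where c: "c \<in> ?V" "b = \<pi> c" using low_F[OF L xF] by (elim resE)
      then show ?thesis using uV[OF c(1)] by (cases "c = 0") auto
    qed simp
  qed
  moreover have "?z \<in> res F" using resI[OF xF x] .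
  then have "adjoin (res L) {?z} \<subseteq> res F"
    using L by (intro adjoin_least res_subfield res_mono) auto
  ultimately show ?thesis using az by blast
qed

text \<open>If \<open>x\<close> is not integral, its inverse is, and it generates the same
  field.\<close>

lemma discrete_residue:
  assumes L: "subfield L amb" "L \<subseteq> F" and F: "F = adjoin L {x}" and nx: "\<not> alg L x"
    and triv: "\<And>c. c \<in> L \<Longrightarrow> c \<noteq> 0 \<Longrightarrow> v c = 0" and a: "a \<in> F" "a \<noteq> 0" "v a \<noteq> 0"
  shows "\<exists>\<zeta>. alg (res L) \<zeta> \<and> res F = adjoin (res L) {\<zeta>}"
proof (cases "x \<in> R")
  case True
  then show ?thesis using discrete_residue_integral[OF assms] by blast
next
  case False
  let ?y = "inverse x"
  have x: "x \<in> F" using F adjoin_gen[of "{x}" L] by auto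
  have "?y \<in> adjoin L {x}" "x \<in> adjoin L {?y}"
    using adjoin_gen[of "{x}" L] adjoin_gen[of "{?y}" L] sf_inverse[OF adjoin_subfield, of ?y L "{?y}"] by auto
  then have e: "adjoin L {?y} = adjoin L {x}"
    using adjoin_least[of "adjoin L {x}" L "{?y}"] adjoin_least[of "adjoin L {?y}" L "{x}"] adjoin_base by auto
  have "\<not> alg L ?y" using nx sf_inverse[OF alg_subfield[OF L(1)], of ?y] by auto
  moreover have "?y \<in> R" using False x by (auto simp: R_iff v_inverse)
  ultimately show ?thesis using discrete_residue_integral[OF L _ _ triv a, of ?y] F e by simp
qed

text \<open>Where \<open>v\<close> is trivial the residue map is injective, so it carries
  independent generators over \<open>K\<close> to independent generators over
  \<open>res K\<close>.\<close>

lemma trivial_tower: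
  assumes K: "subfield K amb" "K \<subseteq> F" and x: "tind K n x" "x ` {..<n} \<subseteq> R"
    and triv: "\<And>c. c \<in> adjoin K (x ` {..<n}) \<Longrightarrow> c \<noteq> 0 \<Longrightarrow> v c = 0"
  shows "tind (res K) n (\<pi> \<circ> x) \<and> res (adjoin K (x ` {..<n})) = adjoin (res K) ((\<pi> \<circ> x) ` {..<n})"
  using x triv
proof (induction n)
  case 0
  then show ?case using K res_subfield[OF K] by (simp add: adjoin_eq_base)
next
  case (Suc n)
  let ?L = "adjoin K (x ` {..<n})"
  have sub: "?L \<subseteq> adjoin K (x ` {..<Suc n})" by (rule adjoin_mono) auto
  have IH: "tind (res K) n (\<pi> \<circ> x)" "res ?L = adjoin (res K) ((\<pi> \<circ> x) ` {..<n})"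
  proof -
    have "tind K n x" "x ` {..<n} \<subseteq> R" using Suc.prems by (auto simp: tind_Suc)
    moreover have "v c = 0" if "c \<in> ?L" "c \<noteq> 0" for c using Suc.prems(3) that sub by blast
    ultimately have "tind (res K) n (\<pi> \<circ> x) \<and> res ?L = adjoin (res K) ((\<pi> \<circ> x) ` {..<n})" by (rule Suc.IH)
    then show "tind (res K) n (\<pi> \<circ> x)" "res ?L = adjoin (res K) ((\<pi> \<circ> x) ` {..<n})" by blast+
  qed
  have L: "?L \<subseteq> F" using Suc.prems(2) RF by (intro adjoin_in_F K) (auto simp: image_subset_iff)
  have xn: "x n \<in> R" "\<not> alg ?L (x n)" using Suc.prems by (auto simp: tind_Suc)
  have na: "\<not> alg (res ?L) (\<pi> (x n))"
  proof
    assume "alg (res ?L) (\<pi> (x n))"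
    then obtain P where P: "P \<in> polys (res ?L)" "P \<noteq> 0" "poly P (\<pi> (x n)) = 0" by (auto simp: alg_def)
    obtain Q where Q: "Q \<in> polys (?L \<inter> R)" "map_poly \<pi> Q = P" using lift_poly[OF L P(1)] by auto
    then have QL: "Q \<in> polys ?L" "Q \<in> polys R" by (auto simp: polys_def)
    let ?c = "poly Q (x n)"
    have c: "?c \<in> R" "\<pi> ?c = 0" using pi_poly[OF QL(2) xn(1)] Q(2) P(3) by auto
    have "Q \<noteq> 0" using Q(2) P(2) by auto
    then have "?c \<noteq> 0" using xn(2) QL(1) by (auto simp: alg_def)
    moreover have "?c \<in> adjoin K (x ` {..<Suc n})"
      using QL(1) polys_mono[OF sub] adjoin_gen[of "x ` {..<Suc n}" K] by (intro poly_in_subfield) auto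
    ultimately have "v ?c = 0" using Suc.prems(3) by blast
    then show False using c \<open>?c \<noteq> 0\<close> pi_eq_0_iff by simp
  qed
  note G = gauss_residue[OF adjoin_subfield L xn(1) na]
  have "adjoin ?L {x n} = adjoin K (x ` {..<Suc n})" by (simp add: lessThan_Suc adjoin_insert[symmetric])
  moreover have "adjoin (res ?L) {\<pi> (x n)} = adjoin (res K) ((\<pi> \<circ> x) ` {..<Suc n})"
    unfolding IH(2) by (simp add: lessThan_Suc adjoin_insert[symmetric])
  ultimately show ?case using G(2) IH na by (simp add: tind_Suc o_def)
qed

end

section \<open>Transcendence bases, restriction to subfields and lifting of residues\<close>

lemma transcendence_basis:
  assumes bound: "\<And>m y. y ` {..<m} \<subseteq> L \<Longrightarrow> tind K m y \<Longrightarrow> m \<le> (N::nat)"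
  shows "\<exists>s y. s \<le> N \<and> tind K s y \<and> y ` {..<s} \<subseteq> L \<and> (\<forall>b\<in>L. alg (adjoin K (y ` {..<s})) b)"
proof -
  let ?P = "\<lambda>s. \<exists>y. tind K s y \<and> y ` {..<s} \<subseteq> L"
  have "\<exists>s. ?P s \<and> (\<forall>m. ?P m \<longrightarrow> m \<le> s)"
    by (rule ex_has_greatest_nat[of ?P 0 "\<lambda>s. s" "Suc N"]) (use bound in \<open>auto simp: less_Suc_eq_le\<close>)
  then obtain s y where s: "tind K s y" "y ` {..<s} \<subseteq> L" and max: "\<And>m. ?P m \<Longrightarrow> m \<le> s" by blast
  have "alg (adjoin K (y ` {..<s})) b" if b: "b \<in> L" for b
  proof (rule ccontr)
    assume nb: "\<not> ?thesis"
    let ?y = "\<lambda>i. if i = s then b else y i"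
    have "?y ` {..<s} = y ` {..<s}" by auto
    moreover have "tind K s ?y" using s(1) tind_cong[of s ?y y K] by simp
    ultimately have "tind K (Suc s) ?y" using nb by (simp add: tind_Suc)
    moreover have "?y ` {..<Suc s} \<subseteq> L" using s(2) b by auto
    ultimately have "Suc s \<le> s" using max by blast
    then show False by simp
  qed
  then show ?thesis using s bound by blast
qed

context valued
begin

lemma valued_restrict: assumes "subfield L amb" "L \<subseteq> F" shows "valued L v \<pi>"
proof
  show "valued_field L v" unfolding valued_field_def
    by (intro conjI ballI impI assms(1)) (use assms(2) in \<open>auto intro!: v_mult v_add\<close>)
  have "valuation_ring v L = L \<inter> R" "valuation_ideal v L = L \<inter> valuation_ideal v F"
    using assms by (auto simp: valuation_ring_def valuation_ideal_def)
  moreover have "a_kernel (amb\<lparr>carrier := R\<rparr>) amb \<pi> = valuation_ideal v F"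
    using rm unfolding residue_map_def by blast
  then have "{a \<in> R. \<pi> a = 0} = valuation_ideal v F" by (simp add: a_kernel_def kernel_def)
  ultimately show "residue_map v L \<pi>"
    unfolding residue_map_def by (auto simp: ring_hom_def a_kernel_def kernel_def pi_mult pi_add)
qed

lemma lift_residues:
  assumes "y ` {..<t} \<subseteq> res L" "tind k t y" "L \<subseteq> F"
  shows "\<exists>y'. (\<forall>i<t. y' i \<in> L \<and> y' i \<in> R) \<and> tind k t (\<pi> \<circ> y') \<and> (\<pi> \<circ> y') ` {..<t} = y ` {..<t}"
proof -
  have "\<forall>i\<in>{..<t}. \<exists>a. a \<in> L \<and> a \<in> R \<and> y i = \<pi> a" using assms(1) resE[OF _ assms(3)] by blast
  from bchoice[OF this] obtain y' where y': "\<And>i. i < t \<Longrightarrow> y' i \<in> L \<and> y' i \<in> R \<and> y i = \<pi> (y' i)" by auto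
  then have "tind k t (\<pi> \<circ> y')" using assms(2) tind_cong[of t y "\<pi> \<circ> y'" k] by simp
  moreover have "(\<pi> \<circ> y') ` {..<t} = y ` {..<t}" using y' by (intro image_cong) auto
  ultimately show ?thesis using y' by blast
qed

lemma v_power_ne_0: assumes "a \<in> F" "a \<noteq> 0" "v a \<noteq> 0" "k \<ge> 1" shows "v (a ^ k) \<noteq> 0"
proof -
  have pos: "0 < v (b ^ k)" if "b \<in> F" "b \<noteq> 0" "0 < v b" for b
    using assms(4)
  proof (induction k rule: dec_induct)
    case (step k)
    then show ?case using that by (simp add: v_mult add_pos_pos)
  qed (use that in simp)
  show ?thesis
  proof (cases "0 < v a")
    case True
    then show ?thesis using pos assms by fastforce
  next
    case False
    then have "0 < v (inverse a)" using assms by (simp add: v_inverse)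
    then have "0 < v (inverse a ^ k)" using pos[of "inverse a"] assms by simp
    then show ?thesis using assms v_inverse[of "a ^ k"] by (auto simp: power_inverse)
  qed
qed

section \<open>Value group and residue field of a rational function field\<close>

context
  fixes K n x
  assumes n: "n \<ge> 1" and K: "subfield K amb" and rff: "rational_function_field K n x F"
begin

lemma FK: "F = adjoin K (x ` {..<n})" and tx: "tind K n x" and KF: "K \<subseteq> F"
  using rff alg_independent_iff_tind[OF K] adjoin_base[of K "x ` {..<n}"] by (auto simp: rational_function_field_def)

lemma sK: "subfield (res K) amb" by (rule res_subfield[OF K KF])

lemma rank_bound:
  assumes "vind K r z" "\<And>i. i < t \<Longrightarrow> y i \<in> R" "tind (res K) t (\<pi> \<circ> y)"
  shows "r + t \<le> n"
proof -
  have "alg (adjoin K (x ` {..<n})) a" if "a \<in> F" for a using that FK by (intro alg_base) auto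
  then have "r + t \<le> card (x ` {..<n})" using assms by (intro abhyankar_inequality[OF K KF]) auto
  then show ?thesis using card_image_le[of "{..<n}" x] by simp
qed

lemma vind_0: "vind K 0 z" by (simp add: vind_def)

text \<open>Independent families of the quotient group and of the residue field lift to elements of
  \<open>F\<close>, so the Abhyankar inequality bounds both invariants by \<open>n\<close>. Being
  finite they are attained, and the inequality for both families at once gives
  \<open>r + t \<le> n\<close>.\<close>

lemma invariants_attained:
  obtains r t z y where "rational_rank (value_quotient v F K) = enat r" "trdeg (res K) (res F) = enat t"
    "vind K r z" "\<And>i. i < t \<Longrightarrow> y i \<in> R" "tind (res K) t (\<pi> \<circ> y)" "r + t \<le> n"
proof -
  interpret A: comm_group "value_quotient v F K" by (rule value_quotient_comm[OF K KF])
  have b: "r \<le> n" if ra: "a ` {..<r} \<subseteq> carrier (value_quotient v F K)" "int_indep (value_quotient v F K) {..<r} a" for r a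
  proof -
    obtain z where "vind K r z" using vind_of_int_indep[OF K KF ra] by blast
    then show ?thesis using rank_bound[of r z 0] by simp
  qed
  have "rational_rank (value_quotient v F K) \<le> enat n" by (rule A.rational_rank_le(1)[OF b])
  then obtain r where r: "rational_rank (value_quotient v F K) = enat r" by (metis enat_ile)
  have "\<exists>a :: nat \<Rightarrow> 'g set. a ` {..<r} \<subseteq> carrier (value_quotient v F K) \<and> int_indep (value_quotient v F K) {..<r} a"
    by (rule A.rational_rank_le(2)[OF _ r]) (rule b)
  then obtain a :: "nat \<Rightarrow> 'g set"
    where "a ` {..<r} \<subseteq> carrier (value_quotient v F K)" "int_indep (value_quotient v F K) {..<r} a" by blast
  then obtain z where z: "vind K r z" using vind_of_int_indep[OF K KF] by blast
  have "trdeg (res K) (res F) \<le> enat n"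
  proof (rule trdeg_le[OF sK])
    fix m y assume ym: "y ` {..<m} \<subseteq> res F" "tind (res K) m y"
    obtain y' where "\<forall>i<m. y' i \<in> R" "tind (res K) m (\<pi> \<circ> y')" using lift_residues[OF ym order.refl] by blast
    then show "m \<le> n" using rank_bound[OF vind_0, of m y'] by simp
  qed
  then obtain t where t: "trdeg (res K) (res F) = enat t" by (metis enat_ile)
  obtain y where yt: "y ` {..<t} \<subseteq> res F" "tind (res K) t y" using trdeg_attained[OF sK t] .
  obtain y' where y': "\<forall>i<t. y' i \<in> R" "tind (res K) t (\<pi> \<circ> y')" using lift_residues[OF yt order.refl] by blast
  show ?thesis by (rule that[OF r t z _ y'(2)]) (use y' rank_bound[OF z, of t y'] in auto)
qed

lemma last_step:
  defines "L \<equiv> adjoin K (x ` {..<n - 1})"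
  shows "subfield L amb" "K \<subseteq> L" "L \<subseteq> F" "F = adjoin L {x (n - 1)}" "\<not> alg L (x (n - 1))" "tind K (n - 1) x"
proof -
  have n': "n = Suc (n - 1)" using n by simp
  show "subfield L amb" "K \<subseteq> L" unfolding L_def by (simp_all add: adjoin_base)
  show "L \<subseteq> F" unfolding L_def FK by (intro adjoin_mono) auto
  have "{..<n} = insert (n - 1) {..<n - 1}" by (subst n') (rule lessThan_Suc)
  then have "x ` {..<n} = insert (x (n - 1)) (x ` {..<n - 1})" by (simp only: image_insert)
  then show "F = adjoin L {x (n - 1)}" unfolding L_def adjoin_insert[symmetric] using FK by (simp only:)
  have "tind K (Suc (n - 1)) x" using tx n by simp
  then show "\<not> alg L (x (n - 1))" "tind K (n - 1) x" unfolding tind_Suc L_def by blast+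
qed

lemma gen_ext_ground: "gen_ext False K F"
proof -
  have "x ` {..<n} \<subseteq> F" using adjoin_gen[of "x ` {..<n}" K] FK by simp
  then have "gen_ext False K (adjoin K (x ` {..<n}))" by (intro gen_ext_adjoin[OF K KF]) auto
  then show ?thesis using FK by simp
qed

text \<open>If the values of \<open>L = K(x\<^sub>0, \<dots>, x\<^sub>n\<^sub>-\<^sub>2)\<close> already attain the rational rank, the last
  variable contributes to the residue field and the Ruled Residue Theorem applies.\<close>

lemma ruled_last_step:
  assumes rt: "n = r + t" and t: "trdeg (res K) (res F) = enat t"
    and z: "vind K r z" "z ` {..<r} \<subseteq> adjoin K (x ` {..<n - 1})"
  shows "\<exists>E y. finitely_generated_ext (res K) E \<and> trdeg (res K) E + 1 = enat t \<and> rational_function_field E 1 y (res F)"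
proof -
  let ?L = "adjoin K (x ` {..<n - 1})"
  note L = last_step(1-3) and FL = last_step(4,5)
  interpret Lv: valued ?L v \<pi> by (rule valued_restrict[OF L(1,3)])
  have zL: "Lv.vind K r z" using z unfolding vind_def Lv.vind_def by auto
  \<comment> \<open>The Abhyankar inequality over \<open>?L\<close>, which is generated by
    \<open>n - 1\<close> elements and contains the \<open>r\<close> elements with independent
    values.\<close>
  have bL: "r + s \<le> n - 1" if s: "y ` {..<s} \<subseteq> res ?L" "tind (res K) s y" for s y
  proof -
    obtain y' where y': "\<forall>i<s. y' i \<in> valuation_ring v ?L" "tind (res K) s (\<pi> \<circ> y')"
      using Lv.lift_residues[OF s order.refl] by blast
    have "alg (adjoin K (x ` {..<n - 1})) a" if "a \<in> ?L" for a using that by (intro alg_base) auto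
    then have "r + s \<le> card (x ` {..<n - 1})"
      using y' by (intro Lv.abhyankar_inequality[OF K L(2) _ _ zL]) auto
    then show ?thesis using card_image_le[of "{..<n - 1}" x] by simp
  qed
  have bnd: "m \<le> n - 1" if "y ` {..<m} \<subseteq> res ?L" "tind (res K) m y" for m y using bL[OF that] by linarith
  have "\<exists>s y. s \<le> n - 1 \<and> tind (res K) s y \<and> y ` {..<s} \<subseteq> res ?L \<and> (\<forall>b\<in>res ?L. alg (adjoin (res K) (y ` {..<s})) b)"
    by (rule transcendence_basis) (rule bnd)
  then obtain s y where y: "tind (res K) s y" "y ` {..<s} \<subseteq> res ?L" "\<And>b. b \<in> res ?L \<Longrightarrow> alg (adjoin (res K) (y ` {..<s})) b"
    by blast
  have rs: "r + s \<le> n - 1" by (rule bL[OF y(2,1)])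
  obtain w where w: "w ` {..<t} \<subseteq> res F" "tind (res K) t w" using trdeg_attained[OF sK t] .
  have sL: "subfield (res ?L) amb" by (rule res_subfield[OF L(1,3)])
  have KL: "res K \<subseteq> res ?L" by (rule res_mono[OF L(2)])
  have algL: "alg (adjoin (res K) (y ` {..<s} \<union> S)) b" if b: "alg (adjoin (res ?L) S) b" for b S
  proof (rule alg_trans[OF adjoin_subfield _ _ b])
    fix c assume c: "c \<in> adjoin (res ?L) S"
    show "alg (adjoin (res K) (y ` {..<s} \<union> S)) c"
    proof (rule alg_adjoin[where S = "res ?L \<union> S", OF adjoin_subfield])
      show "alg (adjoin (res K) (y ` {..<s} \<union> S)) d" if "d \<in> res ?L \<union> S" for d
        using that alg_mono[OF y(3) adjoin_mono[of "res K" "res K" "y ` {..<s}" "y ` {..<s} \<union> S"]] alg_gen by blast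
      have "adjoin (res ?L) S \<subseteq> adjoin (adjoin (res K) (y ` {..<s} \<union> S)) (res ?L \<union> S)"
        using adjoin_gen[of "res ?L \<union> S"] by (intro adjoin_least) auto
      then show "c \<in> adjoin (adjoin (res K) (y ` {..<s} \<union> S)) (res ?L \<union> S)" using c by blast
    qed
  qed simp
  \<comment> \<open>From \<open>r + s \<le> n - 1\<close> and \<open>n = r + t\<close> one gets
    \<open>s < t\<close>, so \<open>res F\<close> cannot be algebraic over
    \<open>res ?L\<close>.\<close>
  have "\<exists>h\<in>R. \<not> alg (res ?L) (\<pi> h)"
  proof (rule ccontr)
    assume no: "\<not> ?thesis"
    have "t \<le> card (y ` {..<s})"
    proof (rule steinitz[OF _ w(2)])
      fix i assume "i < t"
      then have "w i \<in> res F" using w(1) by auto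
      then have "alg (res ?L) (w i)" using no by (elim resE) auto
      then show "alg (adjoin (res K) (y ` {..<s})) (w i)" using algL[of "{}" "w i"] sL by (simp add: adjoin_eq_base)
    qed simp
    then have "t \<le> s" using card_image_le[of "{..<s}" y] by simp
    then show False using rs rt n by simp
  qed
  then obtain h where h: "h \<in> R" "\<not> alg (res ?L) (\<pi> h)" by blast
  obtain B u where B: "finite B" "\<And>b. b \<in> adjoin (res ?L) B \<Longrightarrow> alg (res ?L) b" "\<not> alg (adjoin (res ?L) B) u"
    "res F = adjoin (adjoin (res ?L) B) {u}" using ruled_residue[OF L(1,3) FL h] by blast
  let ?E = "adjoin (res ?L) B"
  \<comment> \<open>As \<open>res F\<close> is algebraic over \<open>res ?L\<close> with
    \<open>u\<close> adjoined, \<open>t \<le> s + 1\<close>. Together with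
    \<open>r + s \<le> n - 1\<close> this yields equality over \<open>?L\<close> and thus the finite
    generation of \<open>res ?L\<close>.\<close>
  have "t \<le> card (y ` {..<s} \<union> {u})"
  proof (rule steinitz[OF _ w(2)])
    fix i assume "i < t"
    then have "w i \<in> adjoin ?E {u}" using w(1) B(4) by auto
    moreover have "?E \<union> {u} \<subseteq> adjoin (adjoin (res ?L) {u}) (?E \<union> {u})" by (rule adjoin_gen)
    then have "adjoin ?E {u} \<subseteq> adjoin (adjoin (res ?L) {u}) (?E \<union> {u})"
      by (intro adjoin_least[OF adjoin_subfield, of "adjoin (res ?L) B"]) blast+
    ultimately have wE: "w i \<in> adjoin (adjoin (res ?L) {u}) (?E \<union> {u})" by blast
    have "alg (adjoin (res ?L) {u}) c" if c: "c \<in> ?E \<union> {u}" for c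
      using c
    proof
      assume "c \<in> ?E"
      then show ?thesis using alg_mono[OF B(2) adjoin_base] by blast
    next
      assume "c \<in> {u}"
      then show ?thesis by (rule alg_gen)
    qed
    then have "alg (adjoin (res ?L) {u}) (w i)" by (rule alg_adjoin[OF adjoin_subfield _ wE])
    then show "alg (adjoin (res K) (y ` {..<s} \<union> {u})) (w i)" by (rule algL)
  qed simp
  also have "\<dots> \<le> s + 1" using card_Un_le[of "y ` {..<s}" "{u}"] card_image_le[of "{..<s}" y] by simp
  finally have s: "t = s + 1" "n - 1 = r + s" using rs rt n by auto
  obtain y' where y': "\<And>i. i < s \<Longrightarrow> y' i \<in> valuation_ring v ?L" "tind (res K) s (\<pi> \<circ> y')"
    using Lv.lift_residues[OF y(2,1) order.refl] by blast
  have "Lv.gen_ext True K ?L" by (rule Lv.abhyankar_equality[OF K L(2) refl zL y' s(2)])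
  then obtain B1 where B1: "finite B1" "res ?L = adjoin (res K) B1"
    unfolding Lv.gen_ext_def small_def by blast
  have "finitely_generated_ext (res K) ?E"
    unfolding finitely_generated_ext_def using B(1) B1 by (intro exI[of _ "B1 \<union> B"]) (auto simp: adjoin_adjoin)
  moreover have "trdeg (res K) ?E = enat s"
  proof (rule antisym)
    have "alg (adjoin (res K) (y ` {..<s})) b" if "b \<in> ?E" for b
      using algL[of "{}" b] B(2)[OF that] sL by (simp add: adjoin_eq_base)
    then have "trdeg (res K) ?E \<le> enat (card (y ` {..<s}))" by (intro trdeg_adjoin_le[OF sK]) auto
    also have "\<dots> \<le> enat s" using card_image_le[of "{..<s}" y] by simp
    finally show "trdeg (res K) ?E \<le> enat s" .
    show "enat s \<le> trdeg (res K) ?E"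
      using y(1,2) adjoin_base[of "res ?L" B] by (intro trdeg_ge[OF sK, of y]) auto
  qed
  then have "trdeg (res K) ?E + 1 = enat t" using s(1) by (simp add: one_enat_def)
  moreover have "rational_function_field ?E 1 (\<lambda>_. u) (res F)"
    unfolding rational_function_field_def alg_independent_iff_tind[OF adjoin_subfield]
    using B(3,4) by (simp add: tind_def adjoin_eq_base lessThan_Suc)
  ultimately show ?thesis by blast
qed

lemma structure_of_extension:
  defines "\<rho> \<equiv> rational_rank (value_quotient v F K)" and "\<tau> \<equiv> trdeg (res K) (res F)"
  shows "enat n \<ge> \<rho> + \<tau>"
    "countable (carrier (value_quotient v F K))"
    "countably_generated_ext (res K) (res F)"
    "enat n = \<rho> + \<tau> \<Longrightarrow> finitely_generated_group (value_quotient v F K)"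
    "enat n = \<rho> + \<tau> \<Longrightarrow> finitely_generated_ext (res K) (res F)"
    "enat n = \<rho> + \<tau> \<Longrightarrow> (\<forall>a\<in>K - {0}. v a = 0) \<Longrightarrow> \<rho> = 1 \<Longrightarrow>
      (\<exists>t y R a. \<tau> = enat t \<and> rational_function_field (res K) t y R \<and>
             ring.algebraic amb R a \<and> res F = adjoin R {a}) \<or>
      (\<exists>E y. finitely_generated_ext (res K) E \<and> trdeg (res K) E + 1 = \<tau> \<and> rational_function_field E 1 y (res F))"
    "enat n = \<rho> + \<tau> \<Longrightarrow> enat n = \<tau> \<Longrightarrow>
      \<exists>E y. finitely_generated_ext (res K) E \<and> trdeg (res K) E + 1 = \<tau> \<and> rational_function_field E 1 y (res F)"
proof -
  obtain r t z y where r: "\<rho> = enat r" and t: "\<tau> = enat t" and z: "vind K r z"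
    and y: "\<And>i. i < t \<Longrightarrow> y i \<in> R" "tind (res K) t (\<pi> \<circ> y)" and rt: "r + t \<le> n"
    unfolding \<rho>_def \<tau>_def using invariants_attained by metis
  show "enat n \<ge> \<rho> + \<tau>" using r t rt by simp
  show "countable (carrier (value_quotient v F K))" by (rule value_quotient_generated(1)[OF K KF gen_ext_ground])
  show "countably_generated_ext (res K) (res F)"
    using gen_ext_ground unfolding gen_ext_def small_def countably_generated_ext_def by blast
  assume "enat n = \<rho> + \<tau>"
  then have n_eq: "n = r + t" using r t by simp
  have gen: "gen_ext True K F" by (rule abhyankar_equality[OF K KF FK z y n_eq])
  show "finitely_generated_group (value_quotient v F K)" using value_quotient_generated(2)[OF K KF gen] by simp
  show "finitely_generated_ext (res K) (res F)"
    using gen unfolding gen_ext_def small_def finitely_generated_ext_def by blast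
  note RL = ruled_last_step[OF _ t[unfolded \<tau>_def], folded \<tau>_def]
  show "\<exists>E y. finitely_generated_ext (res K) E \<and> trdeg (res K) E + 1 = \<tau> \<and> rational_function_field E 1 y (res F)"
    if "enat n = \<tau>"
  proof -
    have "n = 0 + t" using that t by simp
    then show ?thesis using RL[of 0] t vind_0 by simp
  qed
  assume triv: "\<forall>a\<in>K - {0}. v a = 0" and "\<rho> = 1"
  then have r1: "r = 1" using r by (simp add: one_enat_def)
  let ?L = "adjoin K (x ` {..<n - 1})"
  note L = last_step(1-3) and FL = last_step(4,5)
  show "(\<exists>t y R a. \<tau> = enat t \<and> rational_function_field (res K) t y R \<and>
             ring.algebraic amb R a \<and> res F = adjoin R {a}) \<or>
      (\<exists>E y. finitely_generated_ext (res K) E \<and> trdeg (res K) E + 1 = \<tau> \<and> rational_function_field E 1 y (res F))"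
  \<comment> \<open>Since \<open>vK\<close> is trivial, one element of \<open>?L\<close> with
    nonzero value already attains rank one. Otherwise \<open>?L\<close> is mapped isomorphically to
    its residue field, which accounts for the whole transcendence degree \<open>n - 1\<close>, and
    the last variable adds one algebraic element.\<close>
  proof (cases "\<exists>c\<in>?L - {0}. v c \<noteq> 0")
    case True
    then obtain c where c: "c \<in> ?L" "c \<noteq> 0" "v c \<noteq> 0" by blast
    have cF: "c \<in> F" using c L by blast
    have "value_set v K = {0}" using triv sf_1[OF K] unfolding value_set_def by force
    then have "gspan (value_set v K) = {0}" using value_set_gspan[OF K KF] by simp
    then have "vind K 1 (\<lambda>_. c)" unfolding vind_def using v_power_ne_0[OF cF c(2,3)] cF c(2) by auto
    then show ?thesis using RL[of 1 "\<lambda>_. c"] c(1) n_eq r1 t by auto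
  next
    case False
    then have trL: "\<And>c. c \<in> ?L \<Longrightarrow> c \<noteq> 0 \<Longrightarrow> v c = 0" by blast
    have xR: "x ` {..<n - 1} \<subseteq> R"
    proof
      fix a assume "a \<in> x ` {..<n - 1}"
      then have "a \<in> ?L" using adjoin_gen[of "x ` {..<n - 1}" K] by blast
      then show "a \<in> R" using trL[of a] L(3) by (cases "a = 0") (auto simp: R_iff)
    qed
    have T: "tind (res K) (n - 1) (\<pi> \<circ> x)" "res ?L = adjoin (res K) ((\<pi> \<circ> x) ` {..<n - 1})"
      using trivial_tower[OF K KF last_step(6) xR trL] by blast+
    have z0: "z 0 \<in> F" "z 0 \<noteq> 0" "v (z 0 ^ 1) \<notin> gspan (value_set v K)" using z r1 unfolding vind_def by force+
    then have "v (z 0) \<noteq> 0" using gspan.zero[of "value_set v K"] by auto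
    then obtain c where c: "alg (res ?L) c" "res F = adjoin (res ?L) {c}"
      using discrete_residue[OF L(1,3) FL trL z0(1,2)] by blast
    have "rational_function_field (res K) (n - 1) (\<pi> \<circ> x) (res ?L)"
      unfolding rational_function_field_def alg_independent_iff_tind[OF sK] using T by blast
    moreover have "ring.algebraic amb (res ?L) c" using c(1) algebraic_amb_iff[OF res_subfield[OF L(1,3)]] by blast
    moreover have "\<tau> = enat (n - 1)" using t n_eq r1 by simp
    ultimately show ?thesis using c(2) by blast
  qed
qed

end

end

section \<open>Extension of valuation rings\<close>

lemma subring_amb_iff: "subring R amb \<longleftrightarrow> 1 \<in> R \<and> (\<forall>a\<in>R. \<forall>b\<in>R. a - b \<in> R \<and> a * b \<in> R)"
  (is "?l \<longleftrightarrow> ?r") for R :: "'a::field set"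
proof
  interpret amb: field "amb :: 'a ring" by (rule field_from_type_algebra)
  assume R: ?l
  have "a + - b \<in> R" if "a \<in> R" "b \<in> R" for a b
    using subringE(7)[OF R that(1), of "- b"] subringE(5)[OF R that(2)] by simp
  then show ?r using subringE(3,6)[OF R] by simp
next
  interpret amb: field "amb :: 'a ring" by (rule field_from_type_algebra)
  assume R: ?r
  then have "0 \<in> R" by (metis diff_self)
  with R have m: "- a \<in> R" if "a \<in> R" for a using that by (metis diff_0)
  with R have "a + b \<in> R" if "a \<in> R" "b \<in> R" for a b using that by (metis diff_minus_eq_add)
  with R m show ?l by (intro amb.subringI) auto
qed

context
  fixes R :: "'a::field set"
  assumes R: "subring R amb"
begin

lemma sr_1 [simp]: "1 \<in> R" and sr_diff [simp]: "a \<in> R \<Longrightarrow> b \<in> R \<Longrightarrow> a - b \<in> R"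
  and sr_mult [simp]: "a \<in> R \<Longrightarrow> b \<in> R \<Longrightarrow> a * b \<in> R"
  using R by (auto simp: subring_amb_iff)

lemma sr_0 [simp]: "0 \<in> R" using sr_diff[of 1 1] by simp

lemma sr_uminus [simp]: "a \<in> R \<Longrightarrow> - a \<in> R" using sr_diff[of 0 a] by simp

lemma sr_add [simp]: "a \<in> R \<Longrightarrow> b \<in> R \<Longrightarrow> a + b \<in> R" using sr_diff[of a "- b"] by simp

lemma sr_power [simp]: "a \<in> R \<Longrightarrow> a ^ n \<in> R" by (induction n) auto

lemma sr_sum [simp]: "(\<And>i. i \<in> I \<Longrightarrow> f i \<in> R) \<Longrightarrow> sum f I \<in> R"
  by (induction I rule: infinite_finite_induct) auto

end

text \<open>The \<open>R\<close>-linear combinations of elements of \<open>Y\<close>: for a subset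
  \<open>Y\<close> of a ring \<open>R\<close> the ideal it generates, and for two rings the ring
  generated by both (\<open>idl_subring\<close>).\<close>

inductive_set idl :: "'a::field set \<Rightarrow> 'a set \<Rightarrow> 'a set" for R Y where
  idl_0 [simp]: "0 \<in> idl R Y"
| idl_step: "r \<in> R \<Longrightarrow> y \<in> Y \<Longrightarrow> s \<in> idl R Y \<Longrightarrow> r * y + s \<in> idl R Y"

lemma idl_add: "a \<in> idl R Y \<Longrightarrow> b \<in> idl R Y \<Longrightarrow> a + b \<in> idl R Y"
  by (induction rule: idl.induct) (auto simp: add.assoc intro: idl_step)

lemma idl_mult:
  assumes "subring R amb" "a \<in> idl R Y" "c \<in> R"
  shows "c * a \<in> idl R Y"
  using assms(2)
proof (induction rule: idl.induct)
  case (idl_step r y s)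
  then have "(c * r) * y + c * s \<in> idl R Y" using assms by (intro idl.idl_step) auto
  then show ?case by (simp add: algebra_simps)
qed auto

lemma idl_mono: "a \<in> idl R Y \<Longrightarrow> R \<subseteq> S \<Longrightarrow> a \<in> idl S Y"
  by (induction rule: idl.induct) (auto intro: idl_step)

lemma idl_subset:
  assumes "subring R amb" "Y \<subseteq> R"
  shows "idl R Y \<subseteq> R"
proof
  show "a \<in> R" if "a \<in> idl R Y" for a
    using that by (induction rule: idl.induct) (use assms in auto)
qed

text \<open>A combination involves finitely many coefficients, and these lie in one member of the
  chain.\<close>

lemma idl_chain:
  assumes "subset.chain A C" "C \<noteq> {}" "a \<in> idl (\<Union>C) Y"
  shows "\<exists>R\<in>C. a \<in> idl R Y"
  using assms(3)
proof (induction rule: idl.induct)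
  case idl_0
  then show ?case using assms(2) by auto
next
  case (idl_step r y s)
  then obtain R S where RS: "R \<in> C" "S \<in> C" "r \<in> R" "s \<in> idl S Y" by blast
  then have "R \<subseteq> S \<or> S \<subseteq> R" using assms(1) by (auto simp: subset_chain_def)
  then show ?case
  proof
    assume "R \<subseteq> S"
    then show ?thesis using RS idl_step.hyps by (intro bexI[of _ S] idl.idl_step) auto
  next
    assume "S \<subseteq> R"
    then show ?thesis using RS idl_step.hyps idl_mono[OF RS(4)] by (intro bexI[of _ R] idl.idl_step) auto
  qed
qed

definition ring_adjoin :: "'a::field set \<Rightarrow> 'a \<Rightarrow> 'a set"
  where "ring_adjoin R u = (\<lambda>p. poly p u) ` polys R"

lemma ring_adjoin_subring:
  assumes R: "subring R amb"
  shows "subring (ring_adjoin R u) amb" "R \<subseteq> ring_adjoin R u" "u \<in> ring_adjoin R u"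
proof -
  have c: "[:a:] \<in> polys R" if "a \<in> R" for a
    using R that by (auto simp: polys_def coeff_pCons split: nat.split)
  have "a - b \<in> ring_adjoin R u \<and> a * b \<in> ring_adjoin R u" if ab: "a \<in> ring_adjoin R u" "b \<in> ring_adjoin R u" for a b
  proof -
    obtain p q where pq: "p \<in> polys R" "q \<in> polys R" "a = poly p u" "b = poly q u"
      using ab by (auto simp: ring_adjoin_def)
    then have "p - q \<in> polys R" "p * q \<in> polys R" using R by (auto simp: polys_def coeff_mult)
    then show ?thesis using pq by (metis ring_adjoin_def image_eqI poly_diff poly_mult)
  qed
  moreover show sub: "R \<subseteq> ring_adjoin R u"
  proof
    fix a assume "a \<in> R"
    then have "poly [:a:] u \<in> ring_adjoin R u" unfolding ring_adjoin_def by (intro imageI c)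
    then show "a \<in> ring_adjoin R u" by simp
  qed
  moreover have "1 \<in> ring_adjoin R u" using sub sr_1[OF R] by blast
  ultimately show "subring (ring_adjoin R u) amb" unfolding subring_amb_iff by blast
  have "[:0, 1:] \<in> polys R" using R by (auto simp: polys_def coeff_pCons split: nat.split)
  then have "poly [:0, 1:] u \<in> ring_adjoin R u" unfolding ring_adjoin_def by (rule imageI)
  then show "u \<in> ring_adjoin R u" by simp
qed

lemma idl_ring_adjoin:
  assumes R: "subring R amb" and a: "a \<in> idl (ring_adjoin R u) Y"
  shows "\<exists>p\<in>polys (idl R Y). poly p u = a"
  using a
proof (induction rule: idl.induct)
  case idl_0
  show ?case by (intro bexI[of _ 0]) (auto simp: polys_def)
next
  case (idl_step r y s)
  then obtain p q where p: "p \<in> polys (idl R Y)" "poly p u = s" and q: "q \<in> polys R" "r = poly q u"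
    by (auto simp: ring_adjoin_def)
  have "poly.coeff q i * y + poly.coeff p i \<in> idl R Y" for i
    using p(1) q(1) idl_step.hyps by (intro idl.idl_step) (auto simp: polys_def)
  then have "smult y q + p \<in> polys (idl R Y)" by (simp add: polys_def mult.commute)
  then show ?case using p(2) q(2) by (intro bexI[of _ "smult y q + p"]) (auto simp: mult.commute)
qed

text \<open>The relation for \<open>inverse u\<close>, multiplied by a power of \<open>u\<close>, eliminates the leading term of the
  relation for \<open>u\<close>; multiplying the latter by one minus the constant coefficient first makes
  divisions unnecessary.\<close>

lemma relation_degree_reduce:
  assumes R: "subring R amb" and A: "A = idl R Y" "A \<subseteq> R" "1 \<notin> A" and u: "u \<noteq> 0"
    and p: "p \<in> polys A" "poly p u = 1" and q: "q \<in> polys A" "poly q (inverse u) = 1"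
    and le: "Polynomial.degree q \<le> Polynomial.degree p"
  shows "\<exists>p'\<in>polys A. poly p' u = 1 \<and> Polynomial.degree p' < Polynomial.degree p"
proof -
  let ?m = "Polynomial.degree p" and ?l = "Polynomial.degree q" and ?a = "poly.coeff p" and ?b = "poly.coeff q"
  have aA: "?a i \<in> A" "?b i \<in> A" for i using p q by (auto simp: polys_def)
  have addA: "a + b \<in> A" if "a \<in> A" "b \<in> A" for a b
    using that idl_add unfolding A(1) by blast
  have multA: "c * a \<in> A" if "c \<in> R" "a \<in> A" for a c
    using that idl_mult[OF R] unfolding A(1) by blast
  have A0: "0 \<in> A" by (simp add: A(1))
  have sumA: "(\<And>i. i \<in> I \<Longrightarrow> f i \<in> A) \<Longrightarrow> sum f I \<in> A" for f and I :: "nat set"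
    by (induction I rule: infinite_finite_induct) (auto intro: A0 addA)
  have "?l \<noteq> 0"
  proof
    assume "?l = 0"
    then have "poly q (inverse u) = ?b 0" by (simp add: poly_altdef)
    then show False using q(2) aA(2)[of 0] A(3) by simp
  qed
  then have l: "1 \<le> ?l" "1 \<le> ?m" using le by auto
  define S where "S = (\<Sum>j=1..?l. Polynomial.monom (?a ?m * ?b j) (?m - j))"
  \<comment> \<open>In \<open>1 - b 0\<close> times the relation for \<open>u\<close>, the leading
    term \<open>(1 - b 0) a u^m\<close> is replaced by \<open>a u^m\<close> times the sum of the
    \<open>b j u^(-j)\<close> with \<open>j \<ge> 1\<close>, which has the same value by the
    relation for \<open>inverse u\<close>. Adding \<open>b 0\<close> restores the total
    \<open>1\<close>.\<close>
  define p' where "p' = [:?b 0:] + smult (1 - ?b 0) (p - Polynomial.monom (?a ?m) ?m) + S"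
  have cS: "poly.coeff S i \<in> A" for i
    unfolding S_def coeff_sum
  proof (rule sumA)
    show "poly.coeff (Polynomial.monom (?a ?m * ?b j) (?m - j)) i \<in> A" for j
      using aA A0 A(2) multA[of "?a ?m" "?b j"] by (auto simp: coeff_monom)
  qed
  have b1: "1 - ?b 0 \<in> R" using aA A(2) R by (meson sr_1 sr_diff subsetD)
  have "poly.coeff p' i \<in> A" for i
  proof -
    have "poly.coeff [:?b 0:] i \<in> A" using aA A0 by (simp add: coeff_pCons split: nat.split)
    moreover have "poly.coeff (p - Polynomial.monom (?a ?m) ?m) i \<in> A" using aA A0 by (simp add: coeff_monom)
    then have "(1 - ?b 0) * poly.coeff (p - Polynomial.monom (?a ?m) ?m) i \<in> A" by (rule multA[OF b1])
    ultimately show ?thesis unfolding p'_def coeff_add coeff_smult by (intro addA cS)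
  qed
  then have "p' \<in> polys A" by (simp add: polys_def)
  moreover have "poly p' u = 1"
  proof -
    have "poly q (inverse u) = ?b 0 + (\<Sum>j=1..?l. ?b j * inverse u ^ j)"
      unfolding poly_altdef using sum.atLeast_Suc_atMost[of 0 ?l "\<lambda>j. ?b j * inverse u ^ j"]
      by (simp add: atLeast0AtMost)
    then have s: "(\<Sum>j=1..?l. ?b j * inverse u ^ j) = 1 - ?b 0" using q(2) by (simp add: algebra_simps)
    have "poly S u = (\<Sum>j=1..?l. ?a ?m * u ^ ?m * (?b j * inverse u ^ j))"
      unfolding S_def poly_sum
    proof (rule sum.cong[OF refl])
      fix j assume "j \<in> {1..?l}"
      then have "j \<le> ?m" using le by simp
      then have "u ^ (?m - j) = u ^ ?m * inverse u ^ j" using u by (simp add: power_diff power_inverse divide_inverse)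
      then show "poly (Polynomial.monom (?a ?m * ?b j) (?m - j)) u = ?a ?m * u ^ ?m * (?b j * inverse u ^ j)"
        by (simp add: poly_monom)
    qed
    also have "\<dots> = ?a ?m * u ^ ?m * (1 - ?b 0)" using s by (simp flip: sum_distrib_left)
    finally show ?thesis using p(2) by (simp add: p'_def poly_monom algebra_simps)
  qed
  moreover have "Polynomial.degree p' < ?m"
  proof -
    have "Polynomial.degree p' \<le> ?m - 1"
    proof (rule degree_le, intro allI impI)
      fix i assume "?m - 1 < i"
      then have i: "?m \<le> i" "i \<noteq> 0" using l by auto
      have "poly.coeff S i = 0" unfolding S_def coeff_sum
        using i l by (intro sum.neutral) (auto simp: coeff_monom)
      moreover have "poly.coeff (p - Polynomial.monom (?a ?m) ?m) i = 0"
        using i by (cases "i = ?m") (auto simp: coeff_eq_0)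
      ultimately show "poly.coeff p' i = 0" using i unfolding p'_def by (simp add: coeff_pCons split: nat.split)
    qed
    then show ?thesis using l by linarith
  qed
  ultimately show ?thesis by blast
qed

text \<open>Descent on the sum of the degrees: the relation of larger degree is shortened, with
  \<open>u\<close> and \<open>inverse u\<close> exchanging roles where necessary.\<close>

lemma no_two_relations:
  assumes R: "subring R amb" and A: "A = idl R Y" "A \<subseteq> R" "1 \<notin> A" and u: "u \<noteq> 0"
    and p: "p \<in> polys A" "poly p u = 1" and q: "q \<in> polys A" "poly q (inverse u) = 1"
  shows False
  using p q
proof (induction "Polynomial.degree p + Polynomial.degree q" arbitrary: p q rule: less_induct)
  case less
  show False
  proof (cases "Polynomial.degree q \<le> Polynomial.degree p")
    case True
    obtain p' where "p' \<in> polys A" "poly p' u = 1" "Polynomial.degree p' < Polynomial.degree p"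
      using relation_degree_reduce[OF R A u less.prems True] by blast
    then show False using less.hyps[of p' q] less.prems by simp
  next
    case False
    have "inverse u \<noteq> 0" "poly p (inverse (inverse u)) = 1" "Polynomial.degree p \<le> Polynomial.degree q"
      using u less.prems False by auto
    then obtain q' where "q' \<in> polys A" "poly q' (inverse u) = 1" "Polynomial.degree q' < Polynomial.degree q"
      using relation_degree_reduce[OF R A, of "inverse u" q p] less.prems by blast
    then show False using less.hyps[of p q'] less.prems by simp
  qed
qed

text \<open>By Zorn's lemma there is a ring \<open>V\<close> maximal among those in which
  \<open>Y\<close> does not generate the unit ideal. If \<open>u\<close> lies outside
  \<open>V\<close>, maximality gives a relation \<open>p(u) = 1\<close> with coefficients in the
  ideal, and such relations cannot hold for both \<open>u\<close> and \<open>inverse u\<close>. The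
  condition on \<open>idl V Y\<close> keeps the elements of \<open>Y\<close> non-units.\<close>

lemma exists_valuation_ring:
  assumes R: "subring R amb" "Y \<subseteq> R" "1 \<notin> idl R Y"
  obtains V where "subring V amb" "R \<subseteq> V" "1 \<notin> idl V Y" "\<And>u. u \<noteq> 0 \<Longrightarrow> u \<in> V \<or> inverse u \<in> V"
proof -
  let ?A = "{V. subring V amb \<and> R \<subseteq> V \<and> 1 \<notin> idl V Y}"
  have "\<exists>V\<in>?A. \<forall>W\<in>?A. V \<subseteq> W \<longrightarrow> W = V"
  proof (rule subset_Zorn_nonempty)
    show "?A \<noteq> {}" using R by blast
    fix C assume C: "C \<noteq> {}" "subset.chain ?A C"
    have CA: "C \<subseteq> ?A" using C(2) by (simp add: subset_chain_def)
    have "a - b \<in> \<Union>C \<and> a * b \<in> \<Union>C" if ab: "a \<in> \<Union>C" "b \<in> \<Union>C" for a b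
    proof -
      obtain S T where ST: "S \<in> C" "T \<in> C" "a \<in> S" "b \<in> T" using ab by blast
      then have "S \<subseteq> T \<or> T \<subseteq> S" using C(2) by (auto simp: subset_chain_def)
      then obtain W where W: "W \<in> C" "a \<in> W" "b \<in> W" using ST by blast
      then have "subring W amb" using CA by blast
      then have "a - b \<in> W \<and> a * b \<in> W" using W by simp
      then show ?thesis using W(1) by blast
    qed
    moreover obtain S where S: "S \<in> C" "subring S amb" "R \<subseteq> S" using C(1) CA by blast
    then have "1 \<in> \<Union>C" using sr_1 by blast
    ultimately have "subring (\<Union>C) amb" unfolding subring_amb_iff by blast
    moreover have "R \<subseteq> \<Union>C" using S by blast
    moreover have "1 \<notin> idl (\<Union>C) Y"
    proof
      assume "1 \<in> idl (\<Union>C) Y"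
      then obtain W where "W \<in> C" "1 \<in> idl W Y" using idl_chain[OF C(2,1)] by blast
      then show False using CA by blast
    qed
    ultimately show "\<Union>C \<in> ?A" by blast
  qed
  then obtain V where VA: "V \<in> ?A" and V_max: "\<forall>W\<in>?A. V \<subseteq> W \<longrightarrow> W = V" by (elim bexE)
  have V: "subring V amb" "R \<subseteq> V" "1 \<notin> idl V Y" using VA by simp_all
  have max: "W = V" if "subring W amb" "R \<subseteq> W" "1 \<notin> idl W Y" "V \<subseteq> W" for W
    using bspec[OF V_max, of W] that by simp
  have rel: "\<exists>p\<in>polys (idl V Y). poly p u = 1" if u: "u \<notin> V" for u
  proof (rule idl_ring_adjoin[OF V(1)], rule ccontr)
    assume "1 \<notin> idl (ring_adjoin V u) Y"
    then have "ring_adjoin V u = V"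
      using ring_adjoin_subring[OF V(1), of u] V(2) by (intro max) auto
    then show False using ring_adjoin_subring(3)[OF V(1), of u] u by blast
  qed
  have "u \<in> V \<or> inverse u \<in> V" if u: "u \<noteq> 0" for u
  proof (rule ccontr)
    assume n: "\<not> ?thesis"
    have "idl V Y \<subseteq> V" using idl_subset[OF V(1)] R(2) V(2) by blast
    moreover obtain p q where "p \<in> polys (idl V Y)" "poly p u = 1" "q \<in> polys (idl V Y)" "poly q (inverse u) = 1"
      using rel[of u] rel[of "inverse u"] n by blast
    ultimately show False by (rule no_two_relations[OF V(1) refl _ V(3) u])
  qed
  then show thesis using that[OF V] by blast
qed

section \<open>Immediate extensions\<close>

text \<open>\<open>K\<close> is the ground field, \<open>C\<close> its algebraic closure and \<open>D\<close> the given extension, all inside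
  \<open>L\<close>; the condition \<open>lin_disjoint\<close> says that \<open>C\<close> and \<open>D\<close> are linearly disjoint over \<open>K\<close>.\<close>

locale compositum = C: valued C w \<sigma> + D: valued D v \<pi>
  for C D :: "'o::field set" and w :: "'o \<Rightarrow> 'h::linordered_ab_group_add" and v :: "'o \<Rightarrow> 'g::linordered_ab_group_add"
    and \<sigma> :: "'o \<Rightarrow> 's::field" and \<pi> :: "'o \<Rightarrow> 'r::field" +
  fixes K L :: "'o set"
  assumes K: "subfield K amb" "K \<subseteq> C" "K \<subseteq> D"
    and compat: "a \<in> K \<Longrightarrow> a \<noteq> 0 \<Longrightarrow> 0 \<le> w a \<longleftrightarrow> 0 \<le> v a"
    and lin_disjoint: "\<And>(I :: nat set) c b. finite I \<Longrightarrow> (\<And>i. i \<in> I \<Longrightarrow> c i \<in> C) \<Longrightarrow> (\<And>i. i \<in> I \<Longrightarrow> b i \<in> D) \<Longrightarrow>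
      (\<Sum>i\<in>I. c i * b i) = 0 \<Longrightarrow> \<exists>i\<in>I. b i \<noteq> 0 \<Longrightarrow>
      \<exists>k. (\<forall>i\<in>I. k i \<in> K) \<and> (\<exists>i\<in>I. k i \<noteq> 0) \<and> (\<Sum>i\<in>I. k i * c i) = 0"
    and torsion: "a \<in> D \<Longrightarrow> a \<noteq> 0 \<Longrightarrow> \<exists>e\<ge>1. \<exists>c\<in>K - {0}. v (c * a ^ e) = 0"
    and residue_alg: "b \<in> D.R \<Longrightarrow> alg (D.res K) (\<pi> b)"
    and closed: "p \<in> polys C \<Longrightarrow> 1 \<le> Polynomial.degree p \<Longrightarrow> \<exists>a\<in>C. poly p a = 0"
    and L: "subfield L amb" "C \<subseteq> L" "D \<subseteq> L" "\<And>f. f \<in> L \<Longrightarrow> alg D f"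
begin

lemma K_closed: "a \<in> K \<Longrightarrow> a \<in> C" "a \<in> K \<Longrightarrow> a \<in> D" using K by auto

lemma K_R_iff: "a \<in> K \<Longrightarrow> a \<in> C.R \<longleftrightarrow> a \<in> D.R"
  using compat[of a] K_closed[of a] by (auto simp: C.R_iff D.R_iff)

lemma K_unit_iff:
  assumes a: "a \<in> K" "a \<in> C.R"
  shows "\<sigma> a = 0 \<longleftrightarrow> \<pi> a = 0"
proof (cases "a = 0")
  case False
  have i: "inverse a \<in> K" "inverse a \<noteq> 0" using a K(1) False by auto
  have "w a = 0 \<longleftrightarrow> 0 \<le> w a \<and> 0 \<le> w (inverse a)" using K_closed[OF a(1)] False by (auto simp: C.v_inverse)
  also have "\<dots> \<longleftrightarrow> 0 \<le> v a \<and> 0 \<le> v (inverse a)" using compat[OF a(1) False] compat[OF i] by simp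
  also have "\<dots> \<longleftrightarrow> v a = 0" using K_closed[OF a(1)] False by (auto simp: D.v_inverse)
  finally have "w a = 0 \<longleftrightarrow> v a = 0" .
  then show ?thesis
    using C.pi_eq_0_iff[OF a(2)] D.pi_eq_0_iff[of a] K_R_iff[OF a(1)] a False by (auto simp: C.R_iff D.R_iff)
qed simp

text \<open>Linear independence of the residues of the \<open>e g\<close> over the residue field of
  \<open>K\<close>. It is stated through lifts of the coefficients because their reductions by
  \<open>\<sigma>\<close> and \<open>\<pi>\<close> have different types, and only the lifts can be
  reduced both ways.\<close>

definition indep_residues :: "nat set \<Rightarrow> (nat \<Rightarrow> 'o) \<Rightarrow> bool"
  where "indep_residues G e \<longleftrightarrow> (\<forall>k. (\<forall>g\<in>G. k g \<in> K \<inter> C.R) \<longrightarrow> \<sigma> (\<Sum>g\<in>G. k g * e g) = 0 \<longrightarrow> (\<forall>g\<in>G. \<sigma> (k g) = 0))"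

lemma indep_residuesD:
  "indep_residues G e \<Longrightarrow> (\<And>g. g \<in> G \<Longrightarrow> k g \<in> K) \<Longrightarrow> (\<And>g. g \<in> G \<Longrightarrow> k g \<in> C.R) \<Longrightarrow>
    \<sigma> (\<Sum>g\<in>G. k g * e g) = 0 \<Longrightarrow> g \<in> G \<Longrightarrow> \<sigma> (k g) = 0"
  unfolding indep_residues_def by blast

text \<open>A relation over \<open>C\<close> among elements of \<open>D\<close> descends to one over \<open>K\<close> among the \<open>e i\<close>; scaled to
  have a coefficient \<open>1\<close>, that coefficient lies outside \<open>G\<close>, so \<open>e i\<close> can be eliminated there.\<close>

lemma indep_residues_coeffs:
  assumes "finite J" "G \<subseteq> J" "\<And>i. i \<in> J \<Longrightarrow> e i \<in> C.R" "\<And>i. i \<in> J - G \<Longrightarrow> \<sigma> (e i) = 0"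
    and "indep_residues G e" "\<And>i. i \<in> J \<Longrightarrow> b i \<in> D.R" "(\<Sum>i\<in>J. e i * b i) = 0" "g \<in> G"
  shows "\<pi> (b g) = 0"
  using assms
proof (induction "card (J - G)" arbitrary: J b rule: less_induct)
  case less
  note eR = less.prems(3) and bR = less.prems(6)
  show ?case
  proof (cases "\<exists>i\<in>J. b i \<noteq> 0")
    case False
    then show ?thesis using less.prems by auto
  next
    case True
    have "\<exists>k. (\<forall>i\<in>J. k i \<in> K) \<and> (\<exists>i\<in>J. k i \<noteq> 0) \<and> (\<Sum>i\<in>J. k i * e i) = 0"
      using less.prems True by (intro lin_disjoint[of J e b]) (auto simp: C.RF D.RF)
    then obtain k where k: "\<And>i. i \<in> J \<Longrightarrow> k i \<in> K" "\<exists>i\<in>J. k i \<noteq> 0" "(\<Sum>i\<in>J. k i * e i) = 0" by blast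
    obtain j where j: "j \<in> J" "k j \<noteq> 0" "\<And>i. i \<in> J \<Longrightarrow> k i / k j \<in> K \<and> k i / k j \<in> C.R"
      using C.scale_family[OF K(1,2) less.prems(1) k(1,2)] by blast
    define \<kappa> where "\<kappa> i = k i / k j" for i
    have \<kappa>: "\<kappa> i \<in> K" "\<kappa> i \<in> C.R" if "i \<in> J" for i using j(3)[OF that] by (auto simp: \<kappa>_def)
    have \<kappa>j: "\<kappa> j = 1" using j by (simp add: \<kappa>_def)
    have "(\<Sum>i\<in>J. \<kappa> i * e i) = (\<Sum>i\<in>J. k i * e i) / k j" by (simp add: \<kappa>_def sum_divide_distrib)
    then have rel: "(\<Sum>i\<in>J. \<kappa> i * e i) = 0" using k(3) by simp
    have GJ: "(\<Sum>i\<in>J. \<kappa> i * e i) = (\<Sum>i\<in>J - G. \<kappa> i * e i) + (\<Sum>i\<in>G. \<kappa> i * e i)"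
      by (rule sum.subset_diff[OF less.prems(2,1)])
    have GR: "(\<Sum>i\<in>G. \<kappa> i * e i) \<in> C.R" using less.prems(2) \<kappa> eR by (intro C.R_sum C.R_mult) auto
    have "\<sigma> (\<Sum>i\<in>J - G. \<kappa> i * e i) = (\<Sum>i\<in>J - G. \<sigma> (\<kappa> i * e i))" using \<kappa> eR by (intro C.pi_sum C.R_mult) auto
    also have "\<dots> = 0" using \<kappa> eR less.prems(4) by (intro sum.neutral) (auto simp: C.pi_mult)
    finally have "\<sigma> (\<Sum>i\<in>J - G. \<kappa> i * e i) = 0" .
    moreover have "(\<Sum>i\<in>J - G. \<kappa> i * e i) = - (\<Sum>i\<in>G. \<kappa> i * e i)" using rel GJ by (simp add: eq_neg_iff_add_eq_0)
    ultimately have "\<sigma> (\<Sum>i\<in>G. \<kappa> i * e i) = 0" using C.pi_uminus[OF GR] by simp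
    then have \<kappa>0: "\<sigma> (\<kappa> h) = 0" if "h \<in> G" for h
      using less.prems(2) \<kappa> that by (intro indep_residuesD[OF less.prems(5), of \<kappa>]) auto
    have jG: "j \<notin> G" using \<kappa>0[of j] \<kappa>j by (auto simp: C.pi_1)
    define b' where "b' i = b i - \<kappa> i * b j" for i
    have "(\<Sum>i\<in>J. e i * b' i) = (\<Sum>i\<in>J. e i * b i) - (\<Sum>i\<in>J. \<kappa> i * e i) * b j"
      by (simp add: b'_def sum_distrib_left algebra_simps sum_subtractf)
    then have "(\<Sum>i\<in>J. e i * b' i) = 0" using rel less.prems(7) by simp
    moreover have "b' j = 0" using \<kappa>j by (simp add: b'_def)
    ultimately have s: "(\<Sum>i\<in>J - {j}. e i * b' i) = 0"
      using sum.remove[OF less.prems(1) j(1), of "\<lambda>i. e i * b' i"] by simp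
    have b'R: "b' i \<in> D.R" if "i \<in> J" for i
      using bR[OF that] bR[OF j(1)] \<kappa>[OF that] K_R_iff[of "\<kappa> i"] by (simp add: b'_def)
    have "card (J - {j} - G) < card (J - G)"
      using less.prems(1) j(1) jG by (intro psubset_card_mono) auto
    then have "\<pi> (b' g) = 0"
      using less.prems jG s b'R by (intro less.hyps[of "J - {j}" b']) auto
    moreover have "g \<in> J" using less.prems by auto
    then have "\<pi> (\<kappa> g * b j) = 0"
      using \<kappa>[of g] \<kappa>0[OF less.prems(8)] K_unit_iff[of "\<kappa> g"] K_R_iff[of "\<kappa> g"] bR[OF j(1)] by (simp add: D.pi_mult)
    moreover have "b g = b' g + \<kappa> g * b j" by (simp add: b'_def)
    moreover have "\<kappa> g * b j \<in> D.R" "b' g \<in> D.R"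
      using \<open>g \<in> J\<close> \<kappa>[of g] K_R_iff[of "\<kappa> g"] bR[OF j(1)] b'R by auto
    ultimately show ?thesis by (simp add: D.pi_add)
  qed
qed

text \<open>A sum equal to \<open>1\<close> becomes a relation by adding the pair \<open>1\<close>,
  \<open>-1\<close>. A change of basis over the valuation ring of \<open>K\<close> makes the
  residues of the left factors independent on \<open>G\<close> and zero elsewhere, so the right
  factors on \<open>G\<close> have residue \<open>0\<close>. Yet the right factor of the added pair
  keeps residue \<open>-1\<close>, since each given product has a factor of residue
  \<open>0\<close>.\<close>

lemma sum_products_neq_1:
  fixes I :: "nat set"
  assumes I: "finite I" and R: "\<And>i. i \<in> I \<Longrightarrow> c i \<in> C.R" "\<And>i. i \<in> I \<Longrightarrow> d i \<in> D.R"
    and z: "\<And>i. i \<in> I \<Longrightarrow> \<sigma> (c i) = 0 \<or> \<pi> (d i) = 0"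
  shows "(\<Sum>i\<in>I. c i * d i) \<noteq> 1"
proof
  assume one: "(\<Sum>i\<in>I. c i * d i) = 1"
  define J where "J = insert 0 (Suc ` I)"
  \<comment> \<open>Index \<open>0\<close> carries the added pair; the given pairs are shifted by
    one.\<close>
  define e b where "e i = (case i of 0 \<Rightarrow> 1 | Suc j \<Rightarrow> c j)" and "b i = (case i of 0 \<Rightarrow> - 1 | Suc j \<Rightarrow> d j)" for i
  have J: "finite J" "0 \<in> J" using I by (auto simp: J_def)
  have eR: "e i \<in> C.R" and bR: "b i \<in> D.R" if "i \<in> J" for i using that R by (auto simp: J_def e_def b_def)
  have eb: "\<sigma> (e i) = 0 \<or> \<pi> (b i) = 0" if "i \<in> J" "i \<noteq> 0" for i using that z by (fastforce simp: J_def e_def b_def)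
  have "(\<Sum>i\<in>J. e i * b i) = e 0 * b 0 + (\<Sum>i\<in>Suc ` I. e i * b i)" using I by (simp add: J_def)
  also have "(\<Sum>i\<in>Suc ` I. e i * b i) = (\<Sum>i\<in>I. c i * d i)" by (simp add: sum.reindex e_def b_def)
  finally have s0: "(\<Sum>i\<in>J. e i * b i) = 0" using one by (simp add: e_def b_def)
  \<comment> \<open>By maximality of \<open>G\<close> the residues of the remaining
    \<open>e i\<close> are combinations of those on \<open>G\<close> over the residue field of
    \<open>K\<close>; the lifted coefficients are the \<open>l i g\<close> below.\<close>
  let ?P = "\<lambda>G. G \<subseteq> J \<and> 0 \<in> G \<and> indep_residues G e"
  have "?P {0}" using J by (simp add: indep_residues_def e_def)
  then have "\<exists>G. ?P G \<and> (\<forall>H. ?P H \<longrightarrow> card H \<le> card G)"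
    using card_mono[OF J(1)] by (intro ex_has_greatest_nat[of ?P "{0}" card "Suc (card J)"]) (auto simp: less_Suc_eq_le)
  then obtain G where G: "G \<subseteq> J" "0 \<in> G" "indep_residues G e" and max: "\<And>H. ?P H \<Longrightarrow> card H \<le> card G" by blast
  have fG: "finite G" using G(1) J(1) by (rule finite_subset)
  have sR: "(\<Sum>g\<in>G. k g * e g) \<in> C.R" if "\<And>g. g \<in> G \<Longrightarrow> k g \<in> C.R" for k
    using that eR G(1) by (intro C.R_sum C.R_mult) auto
  have "\<exists>l. (\<forall>g\<in>G. l g \<in> K \<and> l g \<in> C.R) \<and> \<sigma> (e i - (\<Sum>g\<in>G. l g * e g)) = 0" if i: "i \<in> J - G" for i
  proof -
    have "card (insert i G) = Suc (card G)" using i fG by simp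
    then have "\<not> ?P (insert i G)" using max[of "insert i G"] by linarith
    then have "\<not> indep_residues (insert i G) e" using i G by blast
    then obtain k where k: "\<And>g. g \<in> insert i G \<Longrightarrow> k g \<in> K \<and> k g \<in> C.R" "\<sigma> (\<Sum>g\<in>insert i G. k g * e g) = 0"
      "\<exists>g\<in>insert i G. \<sigma> (k g) \<noteq> 0" unfolding indep_residues_def by blast
    have ki: "k i \<in> K" "k i \<in> C.R" using k(1)[of i] by auto
    have kG: "k g \<in> K" "k g \<in> C.R" if "g \<in> G" for g using k(1)[of g] that by auto
    have iR: "e i \<in> C.R" using i eR by blast
    have "(\<Sum>g\<in>insert i G. k g * e g) = k i * e i + (\<Sum>g\<in>G. k g * e g)" using i fG by simp
    then have s: "\<sigma> (k i) * \<sigma> (e i) + \<sigma> (\<Sum>g\<in>G. k g * e g) = 0"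
      using k(2) C.pi_add[OF C.R_mult[OF ki(2) iR] sR[of k]] kG C.pi_mult[OF ki(2) iR] by simp
    have n: "\<sigma> (k i) \<noteq> 0"
    proof
      assume 0: "\<sigma> (k i) = 0"
      then have "\<sigma> (\<Sum>g\<in>G. k g * e g) = 0" using s by simp
      then have "\<sigma> (k g) = 0" if "g \<in> G" for g using kG that by (intro indep_residuesD[OF G(3), of k]) auto
      then show False using k(3) 0 by blast
    qed
    then have u: "k i \<in> C" "k i \<noteq> 0" "w (k i) = 0" using C.unit_iff[of "k i"] ki by auto
    define l where "l g = - (k g / k i)" for g
    have l: "l g \<in> K \<and> l g \<in> C.R" if "g \<in> G" for g
      using kG[OF that] ki K(1) C.R_div[OF kG(2)[OF that] u] by (auto simp: l_def)
    have "(\<Sum>g\<in>G. l g * e g) = - ((\<Sum>g\<in>G. k g * e g) / k i)"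
      by (simp add: l_def sum_negf sum_divide_distrib)
    then have "\<sigma> (\<Sum>g\<in>G. l g * e g) = - (\<sigma> (\<Sum>g\<in>G. k g * e g) / \<sigma> (k i))"
      using C.pi_div[OF sR u, of k] C.R_div[OF sR u, of k] kG by (simp add: C.pi_uminus)
    also have "\<sigma> (\<Sum>g\<in>G. k g * e g) = - (\<sigma> (k i) * \<sigma> (e i))"
      using s by (simp only: eq_neg_iff_add_eq_0 add.commute)
    also have "- (- (\<sigma> (k i) * \<sigma> (e i)) / \<sigma> (k i)) = \<sigma> (e i)" using n by simp
    finally have "\<sigma> (e i - (\<Sum>g\<in>G. l g * e g)) = 0" using sR[of l] l iR by (simp add: C.pi_diff)
    then show ?thesis using l by blast
  qed
  then have "\<forall>i\<in>J - G. \<exists>l. (\<forall>g\<in>G. l g \<in> K \<and> l g \<in> C.R) \<and> \<sigma> (e i - (\<Sum>g\<in>G. l g * e g)) = 0" by blast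
  from bchoice[OF this] obtain l where
    l: "\<And>i g. i \<in> J - G \<Longrightarrow> g \<in> G \<Longrightarrow> l i g \<in> K" "\<And>i g. i \<in> J - G \<Longrightarrow> g \<in> G \<Longrightarrow> l i g \<in> C.R"
    "\<And>i. i \<in> J - G \<Longrightarrow> \<sigma> (e i - (\<Sum>g\<in>G. l i g * e g)) = 0" by blast
  \<comment> \<open>Subtracting these combinations from the \<open>e i\<close> outside
    \<open>G\<close> is compensated by adding multiples of the \<open>b i\<close> to the right
    factors on \<open>G\<close>, so the sum of products is unchanged.\<close>
  define e' where "e' i = (if i \<in> G then e i else e i - (\<Sum>g\<in>G. l i g * e g))" for i
  define b' where "b' i = (if i \<in> G then b i + (\<Sum>k\<in>J - G. l k i * b k) else b i)" for i
  have lD: "l i g \<in> D.R" if "i \<in> J - G" "g \<in> G" for i g using l(1,2)[OF that] K_R_iff by blast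
  have e'R: "e' i \<in> C.R" if "i \<in> J" for i
    using that eR[OF that] sR[of "l i"] l(2)[of i] by (auto simp: e'_def)
  have bsR: "(\<Sum>k\<in>J - G. l k i * b k) \<in> D.R" if "i \<in> G" for i
    using that lD bR by (intro D.R_sum D.R_mult) auto
  have b'R: "b' i \<in> D.R" if "i \<in> J" for i
    using that bR[OF that] bsR[of i] by (auto simp: b'_def)
  have ind: "indep_residues G e'"
    using G(3) unfolding indep_residues_def e'_def by (simp cong: sum.cong)
  have "(\<Sum>i\<in>J. e' i * b' i) = (\<Sum>i\<in>J - G. e' i * b' i) + (\<Sum>i\<in>G. e' i * b' i)"
    by (rule sum.subset_diff[OF G(1) J(1)])
  also have "(\<Sum>i\<in>J - G. e' i * b' i) = (\<Sum>i\<in>J - G. e i * b i) - (\<Sum>i\<in>J - G. \<Sum>g\<in>G. l i g * e g * b i)"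
    by (simp add: e'_def b'_def algebra_simps sum_subtractf sum_distrib_left sum_distrib_right)
  also have "(\<Sum>i\<in>G. e' i * b' i) = (\<Sum>i\<in>G. e i * b i) + (\<Sum>g\<in>G. \<Sum>i\<in>J - G. l i g * e g * b i)"
    by (simp add: e'_def b'_def algebra_simps sum.distrib sum_distrib_left)
  also have "(\<Sum>g\<in>G. \<Sum>i\<in>J - G. l i g * e g * b i) = (\<Sum>i\<in>J - G. \<Sum>g\<in>G. l i g * e g * b i)"
    by (rule sum.swap)
  finally have "(\<Sum>i\<in>J. e' i * b' i) = (\<Sum>i\<in>J - G. e i * b i) + (\<Sum>i\<in>G. e i * b i)" by simp
  then have "(\<Sum>i\<in>J. e' i * b' i) = 0" using sum.subset_diff[OF G(1) J(1), of "\<lambda>i. e i * b i"] s0 by simp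
  then have "\<pi> (b' 0) = 0"
    using J(1) G(1,2) e'R b'R l(3) ind by (intro indep_residues_coeffs[of J G e']) (auto simp: e'_def)
  moreover have "\<pi> (l i 0 * b i) = 0" if i: "i \<in> J - G" for i
  proof -
    have "i \<noteq> 0" using i G(2) by (metis DiffD2)
    then consider "\<sigma> (e i) = 0" | "\<pi> (b i) = 0" using eb i by blast
    then have "\<pi> (l i 0) = 0 \<or> \<pi> (b i) = 0"
    proof cases
      case 1
      \<comment> \<open>If \<open>e i\<close> has residue \<open>0\<close>, so has the combination
        subtracted from it, and independence makes the residues of all its coefficients
        vanish.\<close>
      have "\<sigma> (\<Sum>g\<in>G. l i g * e g) = 0"
        using l(3)[OF i] 1 i eR sR[of "l i"] l(2)[OF i] by (simp add: C.pi_diff)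
      then have "\<sigma> (l i 0) = 0" using l(1,2)[OF i] G(2) by (intro indep_residuesD[OF G(3), of "l i"]) auto
      then show ?thesis using K_unit_iff[OF l(1,2)[OF i G(2)]] by blast
    qed blast
    then show ?thesis using D.pi_mult[OF lD[OF i G(2)], of "b i"] bR i by auto
  qed
  then have "\<pi> (\<Sum>i\<in>J - G. l i 0 * b i) = 0"
    using lD[OF _ G(2)] bR by (subst D.pi_sum) auto
  ultimately have "\<pi> (b 0) = 0"
    using G(2) D.pi_add[OF bR[OF J(2)] bsR[OF G(2)]] by (simp add: b'_def)
  then show False by (simp add: b_def D.pi_uminus D.pi_1)
qed

end

section \<open>The valuation given by a ring that dominates both valuation rings\<close>

lemma split_over_closed:
  assumes C: "subfield C amb" and closed: "\<And>p. p \<in> polys C \<Longrightarrow> 1 \<le> Polynomial.degree p \<Longrightarrow> \<exists>a\<in>C. poly p a = 0"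
    and p: "p \<in> polys C" "p \<noteq> 0"
  shows "\<exists>c as. c \<in> C - {0} \<and> set as \<subseteq> C \<and> p = smult c (\<Prod>a\<leftarrow>as. [:-a, 1:])"
  using p
proof (induction "Polynomial.degree p" arbitrary: p rule: less_induct)
  case less
  show ?case
  proof (cases "Polynomial.degree p = 0")
    case True
    then have "p = [:poly.coeff p 0:]" by (rule degree_eq_zeroE) simp
    moreover have "poly.coeff p 0 \<in> C" using less.prems(1) by (rule polys_coeff)
    moreover have "poly.coeff p 0 \<noteq> 0" using calculation(1) less.prems(2) by (metis pCons_0_0)
    ultimately show ?thesis by (intro exI[of _ "poly.coeff p 0"] exI[of _ "[]"]) auto
  next
    case False
    then obtain a where a: "a \<in> C" "poly p a = 0" using closed[OF less.prems(1)] by auto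
    have l: "[:-a, 1:] \<in> polys C" using C a(1) by simp
    obtain q r where qr: "q \<in> polys C" "p = q * [:-a, 1:] + r" "r = 0 \<or> Polynomial.degree r < Polynomial.degree [:-a, 1:]"
      using polys_division[OF C less.prems(1) l] by auto
    have "r = 0"
    proof (rule ccontr)
      assume "r \<noteq> 0"
      then have "Polynomial.degree r = 0" using qr(3) by simp
      then obtain c where "r = [:c:]" by (rule degree_eq_zeroE)
      then show False using \<open>r \<noteq> 0\<close> qr(2) a(2) by simp
    qed
    then have p: "p = q * [:-a, 1:]" using qr(2) by simp
    have q0: "q \<noteq> 0" using less.prems(2) p by auto
    then have "Polynomial.degree q < Polynomial.degree p"
      unfolding p by (subst Polynomial.degree_mult_eq) (auto simp del: mult_pCons_right)
    then obtain c as where c: "c \<in> C - {0}" "set as \<subseteq> C" "q = smult c (\<Prod>a\<leftarrow>as. [:-a, 1:])"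
      using less.hyps[OF _ qr(1) q0] by blast
    then have "p = smult c (\<Prod>a\<leftarrow>a # as. [:-a, 1:])" using p by (simp add: mult.commute)
    then show ?thesis using c a(1) by (intro exI[of _ c] exI[of _ "a # as"]) auto
  qed
qed

text \<open>\<open>V_ideals\<close> expresses domination: nonzero elements of either maximal ideal
  stay non-units in \<open>V\<close>.\<close>

locale dominating_ring = compositum C D w v \<sigma> \<pi> K L
  for C D :: "'o::field set" and w :: "'o \<Rightarrow> 'h::linordered_ab_group_add" and v :: "'o \<Rightarrow> 'g::linordered_ab_group_add"
    and \<sigma> :: "'o \<Rightarrow> 's::field" and \<pi> :: "'o \<Rightarrow> 'r::field" and K L +
  fixes V
  assumes V: "subring V amb" "C.R \<subseteq> V" "D.R \<subseteq> V" "u \<noteq> 0 \<Longrightarrow> u \<in> V \<or> inverse u \<in> V"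
    and V_ideals: "c \<in> C.R \<Longrightarrow> c \<noteq> 0 \<Longrightarrow> \<sigma> c = 0 \<Longrightarrow> inverse c \<notin> V"
      "d \<in> D.R \<Longrightarrow> d \<noteq> 0 \<Longrightarrow> \<pi> d = 0 \<Longrightarrow> inverse d \<notin> V"
begin

lemmas V_closed [simp] = sr_1[OF V(1)] sr_0[OF V(1)] sr_add[OF V(1)] sr_diff[OF V(1)] sr_mult[OF V(1)] sr_uminus[OF V(1)]
  sr_power[OF V(1)] sr_sum[OF V(1)]

text \<open>The maximal ideal of the valuation ring \<open>V\<close>; \<open>U\<close> below is its
  unit group.\<close>

definition "N = {a \<in> V. a = 0 \<or> inverse a \<notin> V}"

definition "U = {a. a \<noteq> 0 \<and> a \<in> V \<and> inverse a \<in> V}"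

lemma N_V: "a \<in> N \<Longrightarrow> a \<in> V" by (simp add: N_def)

lemma N_0 [simp]: "0 \<in> N" and one_notin_N: "1 \<notin> N" by (auto simp: N_def)

lemma V_cases: "a \<in> V \<longleftrightarrow> a \<in> N \<or> a \<in> U" by (auto simp: N_def U_def)

lemma U_notin_N: "a \<in> U \<Longrightarrow> a \<notin> N" by (auto simp: N_def U_def)

lemma notin_V: "a \<notin> V \<Longrightarrow> a \<noteq> 0 \<and> inverse a \<in> N" using V(4)[of a] by (cases "a = 0") (auto simp: N_def)

lemma U_mult [simp]: "a \<in> U \<Longrightarrow> b \<in> U \<Longrightarrow> a * b \<in> U"
  and U_inverse [simp]: "a \<in> U \<Longrightarrow> inverse a \<in> U"
  and U_1 [simp]: "1 \<in> U"
  by (auto simp: U_def)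

lemma U_divide [simp]: "a \<in> U \<Longrightarrow> b \<in> U \<Longrightarrow> a / b \<in> U" by (simp add: divide_inverse)

lemma U_power [simp]: "a \<in> U \<Longrightarrow> a ^ n \<in> U" by (induction n) auto

lemma N_mult:
  assumes "a \<in> N" "r \<in> V"
  shows "r * a \<in> N"
proof (rule ccontr)
  assume n: "r * a \<notin> N"
  then have "r * a \<in> U" using V_cases[of "r * a"] assms N_V by simp
  then have u: "r * a \<noteq> 0" "inverse (r * a) \<in> V" by (auto simp: U_def)
  then have "r * inverse (r * a) \<in> V" using assms(2) by simp
  moreover have "r * inverse (r * a) = inverse a" using u(1) by (simp add: field_simps)
  ultimately have "inverse a \<in> V" by metis
  then show False using assms(1) u(1) by (simp add: N_def)
qed

lemma N_add [simp]:
  assumes "a \<in> N" "b \<in> N"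
  shows "a + b \<in> N"
proof -
  have *: "a + b \<in> N" if "b \<noteq> 0" "b \<in> N" "a / b \<in> V" for a b
  proof -
    have "(a / b + 1) * b \<in> N" using that by (intro N_mult) auto
    moreover have "(a / b + 1) * b = a + b" using that(1) by (simp add: distrib_right)
    ultimately show ?thesis by metis
  qed
  show ?thesis
  proof (cases "a = 0 \<or> b = 0")
    case False
    then have "a / b \<in> V \<or> b / a \<in> V" using V(4)[of "a / b"] by (simp add: field_simps)
    then show ?thesis using *[of b a] *[of a b] assms False by (auto simp: add.commute)
  qed (use assms in auto)
qed

lemma N_uminus [simp]: "a \<in> N \<Longrightarrow> - a \<in> N" using N_mult[of a "- 1"] by simp

lemma N_diff [simp]: "a \<in> N \<Longrightarrow> b \<in> N \<Longrightarrow> a - b \<in> N" using N_add[of a "- b"] by simp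

lemma N_sum: "(\<And>i. i \<in> I \<Longrightarrow> f i \<in> N) \<Longrightarrow> sum f I \<in> N"
  by (induction I rule: infinite_finite_induct) auto

lemma N_power: "a \<in> N \<Longrightarrow> 1 \<le> n \<Longrightarrow> a ^ n \<in> N"
  using N_mult[of a "a ^ (n - 1)"] N_V[of a] by (cases n) (simp_all add: mult.commute)

text \<open>If \<open>a\<close> is not a unit, then \<open>a\<close> or its inverse lies in the
  maximal ideal, and so do the powers of that element.\<close>

lemma power_U:
  assumes "a ^ n \<in> U" "1 \<le> n"
  shows "a \<in> U"
proof (rule ccontr)
  assume "a \<notin> U"
  then have "a \<in> N \<or> inverse a \<in> N" using V_cases[of a] notin_V[of a] by blast
  then have "a ^ n \<in> N \<or> inverse (a ^ n) \<in> N" using N_power[OF _ assms(2)] by (auto simp flip: power_inverse)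
  then show False using assms(1) U_notin_N U_inverse by blast
qed

lemma prod_list_in_N: "\<forall>a\<in>set as. a \<in> V \<Longrightarrow> prod_list as \<in> N \<Longrightarrow> \<exists>a\<in>set as. a \<in> N"
proof (induction as)
  case Nil
  then show ?case using one_notin_N by simp
next
  case (Cons a as)
  show ?case
  proof (cases "a \<in> N")
    case False
    then have u: "a \<in> U" using Cons.prems V_cases by simp
    then have "inverse a \<in> V" by (simp add: U_def)
    have "a * prod_list as \<in> N" using Cons.prems(2) by simp
    from N_mult[OF this \<open>inverse a \<in> V\<close>] have "inverse a * (a * prod_list as) \<in> N" .
    moreover have "inverse a * (a * prod_list as) = prod_list as" using u by (simp add: U_def)
    ultimately have "prod_list as \<in> N" by metis
    then show ?thesis using Cons.IH Cons.prems(1) by auto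
  qed simp
qed

lemma C_N_iff:
  assumes c: "c \<in> C.R"
  shows "c \<in> N \<longleftrightarrow> \<sigma> c = 0"
proof
  assume n: "c \<in> N"
  show "\<sigma> c = 0"
  proof (rule ccontr)
    assume "\<sigma> c \<noteq> 0"
    then have "c \<in> C" "c \<noteq> 0" "w c = 0" using C.unit_iff[of c] c by auto
    then have "inverse c \<in> C.R" by (auto simp: C.R_iff C.v_inverse)
    then show False using n \<open>c \<noteq> 0\<close> V(2) by (auto simp: N_def)
  qed
next
  assume "\<sigma> c = 0"
  then show "c \<in> N" using V_ideals(1)[OF c] c V(2) by (auto simp: N_def)
qed

lemma C_V_iff:
  assumes c: "c \<in> C"
  shows "c \<in> V \<longleftrightarrow> c \<in> C.R"
proof
  assume n: "c \<in> V"
  show "c \<in> C.R"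
  proof (rule ccontr)
    assume "c \<notin> C.R"
    then have c0: "c \<noteq> 0" "w c < 0" using c by (auto simp: C.R_iff)
    then have i: "inverse c \<in> C.R" "\<sigma> (inverse c) = 0" using c by (auto simp: C.R_iff C.v_inverse C.pi_eq_0_iff)
    show False using V_ideals(1)[OF i(1) _ i(2)] c0 n by simp
  qed
qed (use V(2) in auto)

lemma C_U_iff: "c \<in> C \<Longrightarrow> c \<noteq> 0 \<Longrightarrow> c \<in> U \<longleftrightarrow> w c = 0"
  using C_V_iff[of c] C_V_iff[of "inverse c"] by (auto simp: U_def C.R_iff C.v_inverse)

lemma D_N: "d \<in> D.R \<Longrightarrow> \<pi> d = 0 \<Longrightarrow> d \<in> N"
  using V_ideals(2)[of d] V(3) by (auto simp: N_def)

lemma D_U: "d \<in> D.R \<Longrightarrow> \<pi> d \<noteq> 0 \<Longrightarrow> d \<in> U"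
proof -
  assume d: "d \<in> D.R" "\<pi> d \<noteq> 0"
  then have u: "d \<in> D" "d \<noteq> 0" "v d = 0" using D.unit_iff[of d] by auto
  then have "inverse d \<in> D.R" by (auto simp: D.R_iff D.v_inverse)
  then show ?thesis using V(3) d(1) u(2) by (auto simp: U_def)
qed

text \<open>Divisibility in a valuation ring is total; \<open>t k\<close> plays the role of a term
  of least value.\<close>

lemma ex_dominant:
  assumes "finite I" "I \<noteq> {}" "\<And>i. i \<in> I \<Longrightarrow> t i \<noteq> 0"
  shows "\<exists>k\<in>I. \<forall>i\<in>I. t i / t k \<in> V"
  using assms
proof (induction rule: finite_ne_induct)
  case (singleton i)
  then show ?case by simp
next
  case (insert j I)
  then obtain k where k: "k \<in> I" "\<And>i. i \<in> I \<Longrightarrow> t i / t k \<in> V" by auto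
  show ?case
  proof (cases "t j / t k \<in> V")
    case True
    then show ?thesis using k by (intro bexI[of _ k]) auto
  next
    case False
    then have "t k / t j \<in> V" using notin_V[OF False] N_V[of "inverse (t j / t k)"] by simp
    then have "(t i / t k) * (t k / t j) \<in> V" if "i \<in> I" for i using k(2)[OF that] by (intro V_closed)
    moreover have "(t i / t k) * (t k / t j) = t i / t j" for i using insert.prems[of k] k(1) by simp
    ultimately show ?thesis using insert.prems[of j] by (intro bexI[of _ j]) auto
  qed
qed

text \<open>Two terms of an algebraic relation of \<open>f\<close> over \<open>D\<close> must have equal value.\<close>

lemma ex_power_in_D:
  assumes f: "f \<in> L" "f \<noteq> 0"
  shows "\<exists>m\<ge>1. \<exists>d\<in>D - {0}. f ^ m * d \<in> U"
proof -
  obtain p where p: "p \<in> polys D" "p \<noteq> 0" "poly p f = 0" using L(4)[OF f(1)] by (auto simp: alg_def)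
  define t where "t i = poly.coeff p i * f ^ i" for i
  define I where "I = {i. i \<le> Polynomial.degree p \<and> poly.coeff p i \<noteq> 0}"
  have I: "finite I" "I \<noteq> {}" using p(2) by (auto simp: I_def intro!: exI[of _ "Polynomial.degree p"])
  have t0: "t i \<noteq> 0" if "i \<in> I" for i using that f by (simp add: t_def I_def)
  have bD: "poly.coeff p i \<in> D" for i using p(1) by (rule polys_coeff)
  obtain k where k: "k \<in> I" "\<And>i. i \<in> I \<Longrightarrow> t i / t k \<in> V" using ex_dominant[OF I, of t] t0 by blast
  have "(\<Sum>i\<in>I. t i) = poly p f" unfolding poly_altdef I_def t_def by (rule sum.mono_neutral_left) auto
  then have "t k + (\<Sum>i\<in>I - {k}. t i) = 0" using p(3) sum.remove[OF I(1) k(1), of t] by simp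
  then have "(t k + (\<Sum>i\<in>I - {k}. t i)) / t k = 0" by simp
  then have "1 + (\<Sum>i\<in>I - {k}. t i / t k) = 0" using t0[OF k(1)] by (simp add: add_divide_distrib sum_divide_distrib)
  then have s: "(\<Sum>i\<in>I - {k}. t i / t k) = - 1" by (simp add: eq_neg_iff_add_eq_0 add.commute)
  \<comment> \<open>Otherwise \<open>-1\<close>, being the sum of these quotients, would lie in the
    maximal ideal.\<close>
  have "\<exists>i\<in>I - {k}. t i / t k \<notin> N"
  proof (rule ccontr)
    assume "\<not> ?thesis"
    then have "(\<Sum>i\<in>I - {k}. t i / t k) \<in> N" by (intro N_sum) blast
    then show False using s N_uminus[of "- 1"] one_notin_N by simp
  qed
  then obtain i where i: "i \<in> I" "i \<noteq> k" "t i / t k \<in> U" using k(2) V_cases by blast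
  have *: "\<exists>m\<ge>1. \<exists>d\<in>D - {0}. f ^ m * d \<in> U" if "i \<in> I" "k \<in> I" "k < i" "t i / t k \<in> U" for i k
  proof -
    have e: "f ^ i = f ^ (i - k) * f ^ k" using that(3) by (simp flip: power_add)
    have "t i / t k = f ^ (i - k) * (poly.coeff p i / poly.coeff p k)"
      unfolding t_def e using f(2) by simp
    then show ?thesis using that bD by (intro exI[of _ "i - k"] conjI bexI[of _ "poly.coeff p i / poly.coeff p k"]) (auto simp: I_def)
  qed
  have "t k / t i \<in> U" using U_inverse[OF i(3)] by simp
  then show ?thesis using *[OF i(1) k(1) _ i(3)] *[OF k(1) i(1)] i(2) by (meson linorder_neqE_nat)
qed

text \<open>Some \<open>f^m d\<close> with \<open>d\<close> in \<open>D\<close> is a unit, and by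
  torsion some \<open>c d^e\<close> with \<open>c\<close> in \<open>K\<close> is one, hence also
  \<open>f^(m e) / c\<close>. As \<open>C\<close> is closed, \<open>c\<close> is the
  \<open>m e\<close>-th power of some \<open>z\<close> in \<open>C\<close>, and \<open>f / z\<close>
  is a unit because a power of it is.\<close>

lemma ex_same_value:
  assumes f: "f \<in> L" "f \<noteq> 0"
  shows "\<exists>a\<in>C - {0}. f / a \<in> U"
proof -
  obtain m d where m: "1 \<le> m" "d \<in> D" "d \<noteq> 0" "f ^ m * d \<in> U" using ex_power_in_D[OF f] by blast
  obtain e c where e: "1 \<le> e" "c \<in> K" "c \<noteq> 0" "v (c * d ^ e) = 0" using torsion[OF m(2,3)] by blast
  have cd: "c * d ^ e \<in> D" "c * d ^ e \<noteq> 0" using e m K_closed by auto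
  then have "c * d ^ e \<in> U" using D.unit_iff[of "c * d ^ e"] e(4) D_U by blast
  moreover have "(f ^ m * d) ^ e \<in> U" using m(4) by simp
  ultimately have "(f ^ m * d) ^ e / (c * d ^ e) \<in> U" by (intro U_divide)
  moreover have "(f ^ m * d) ^ e / (c * d ^ e) = f ^ (m * e) / c" using m(3) by (simp add: power_mult_distrib power_mult)
  ultimately have fc: "f ^ (m * e) / c \<in> U" by simp
  have n: "1 \<le> m * e" using m(1) e(1) by simp
  have cC: "c \<in> C" using e(2) K_closed by blast
  let ?p = "Polynomial.monom 1 (m * e) - [:c:]"
  have "poly.coeff ?p (m * e) = 1" using n by (auto simp: coeff_pCons split: nat.split)
  then have "m * e \<le> Polynomial.degree ?p" by (intro le_degree) simp
  then have "1 \<le> Polynomial.degree ?p" using n by linarith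
  moreover have "?p \<in> polys C" using cC by simp
  ultimately obtain z where z: "z \<in> C" "poly ?p z = 0" using closed by blast
  then have zc: "z ^ (m * e) = c" by (simp add: poly_monom)
  then have "(f / z) ^ (m * e) \<in> U" using fc by (simp add: power_divide)
  then have "f / z \<in> U" using n by (rule power_U)
  moreover have "z \<noteq> 0" using zc e(3) n by (auto simp: power_0_left)
  ultimately show ?thesis using z(1) by blast
qed

text \<open>Valuation rings are integrally closed: for a non-integral \<open>a\<close>, dividing the
  equation by the top power of \<open>a\<close> would put \<open>1\<close> into the maximal
  ideal.\<close>

lemma integral_root:
  assumes a: "a \<in> C" "poly p a = 0" and p: "p \<in> polys C.R" "poly.coeff p (Polynomial.degree p) = 1"
  shows "a \<in> C.R"
proof (rule ccontr)
  assume "a \<notin> C.R"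
  then have n: "a \<noteq> 0" "inverse a \<in> N" using C_V_iff[OF a(1)] notin_V[of a] by auto
  let ?d = "Polynomial.degree p"
  have "poly p a = a ^ ?d + (\<Sum>i<?d. poly.coeff p i * a ^ i)"
    unfolding poly_altdef using p(2) by (simp add: lessThan_Suc_atMost[symmetric])
  then have "(a ^ ?d + (\<Sum>i<?d. poly.coeff p i * a ^ i)) / a ^ ?d = 0" using a(2) by simp
  then have "1 + (\<Sum>i<?d. poly.coeff p i * a ^ i / a ^ ?d) = 0" using n(1) by (simp add: add_divide_distrib sum_divide_distrib)
  then have "1 = - (\<Sum>i<?d. poly.coeff p i * a ^ i / a ^ ?d)" by (simp add: eq_neg_iff_add_eq_0)
  moreover have "(\<Sum>i<?d. poly.coeff p i * a ^ i / a ^ ?d) \<in> N"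
  proof (rule N_sum)
    fix i assume "i \<in> {..<?d}"
    then have i: "i < ?d" by simp
    have "a ^ ?d = a ^ i * a ^ (?d - i)" using i by (simp flip: power_add)
    then have "poly.coeff p i * a ^ i / a ^ ?d = poly.coeff p i * inverse a ^ (?d - i)"
      using n(1) by (simp add: divide_inverse power_inverse)
    moreover have "poly.coeff p i \<in> V" using polys_coeff[OF p(1)] V(2) by blast
    then have "poly.coeff p i * inverse a ^ (?d - i) \<in> N" using i n(2) by (intro N_mult N_power) auto
    ultimately show "poly.coeff p i * a ^ i / a ^ ?d \<in> N" by simp
  qed
  ultimately show False using one_notin_N N_uminus by metis
qed

text \<open>Coefficients beyond the last one with nonzero residue are dropped and the rest is made
  monic. The resulting \<open>q\<close> splits over \<open>C\<close> with roots in
  \<open>C.R\<close>, and \<open>q(f)\<close> is a product of differences \<open>f - a\<close> lying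
  in the maximal ideal, which is prime.\<close>

lemma ex_same_residue_poly:
  assumes p: "p \<in> polys C.R" "\<exists>i. \<sigma> (poly.coeff p i) \<noteq> 0" and f: "f \<in> V" "poly p f \<in> N"
  shows "\<exists>a\<in>C.R. f - a \<in> N"
proof -
  let ?c = "poly.coeff p"
  have cR: "?c i \<in> C.R" for i using polys_coeff[OF p(1)] .
  have cV: "?c i \<in> V" for i using cR V(2) by blast
  define I where "I = {i. \<sigma> (?c i) \<noteq> 0}"
  have I: "I \<subseteq> {..Polynomial.degree p}" using le_degree[of p] by (force simp: I_def)
  then have fin: "finite I" by (rule finite_subset) simp
  define m where "m = Max I"
  have mI: "m \<in> I" unfolding m_def by (rule Max_in[OF fin]) (use p(2) in \<open>auto simp: I_def\<close>)
  have big: "\<sigma> (?c i) = 0" if "m < i" for i using that Max_ge[OF fin, of i] by (force simp: I_def m_def)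
  have mu: "?c m \<in> C" "?c m \<noteq> 0" "w (?c m) = 0" using C.unit_iff[of "?c m"] mI cR by (auto simp: I_def)
  have md: "m \<le> Polynomial.degree p" using mI I by auto
  define q where "q = (\<Sum>i\<le>m. Polynomial.monom (?c i / ?c m) i)"
  have cq: "poly.coeff q i = (if i \<le> m then ?c i / ?c m else 0)" for i by (simp add: q_def coeff_sum)
  have qR: "q \<in> polys C.R" using C.R_div[OF cR mu] by (auto simp: polys_def cq)
  have qd: "Polynomial.degree q = m"
    by (rule antisym; (rule degree_le | rule le_degree)) (use mu in \<open>auto simp: cq\<close>)
  have q1: "poly.coeff q (Polynomial.degree q) = 1" using mu qd by (simp add: cq)
  have "poly p f = (\<Sum>i\<le>m. ?c i * f ^ i) + (\<Sum>i\<in>{m<..Polynomial.degree p}. ?c i * f ^ i)"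
    unfolding poly_altdef using md by (subst sum.union_disjoint[symmetric]) (auto intro!: sum.cong)
  moreover have "(\<Sum>i\<in>{m<..Polynomial.degree p}. ?c i * f ^ i) \<in> N"
  proof (rule N_sum)
    fix i assume "i \<in> {m<..Polynomial.degree p}"
    then have "?c i \<in> N" using big[of i] C_N_iff[OF cR] by simp
    then have "f ^ i * ?c i \<in> N" using f(1) by (intro N_mult) auto
    then show "?c i * f ^ i \<in> N" by (simp add: mult.commute)
  qed
  ultimately have "(\<Sum>i\<le>m. ?c i * f ^ i) \<in> N" using f(2) N_diff[of "poly p f"] by (metis add_diff_cancel_right')
  moreover have "inverse (?c m) \<in> V" using C_U_iff[OF mu(1,2)] mu(3) by (simp add: U_def)
  ultimately have "inverse (?c m) * (\<Sum>i\<le>m. ?c i * f ^ i) \<in> N" by (rule N_mult)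
  moreover have "inverse (?c m) * (\<Sum>i\<le>m. ?c i * f ^ i) = poly q f"
    by (simp add: q_def poly_sum poly_monom sum_distrib_left divide_inverse mult_ac)
  ultimately have qN: "poly q f \<in> N" by simp
  have "q \<in> polys C" using qR polys_mono[of C.R C] C.RF by blast
  moreover have q0: "q \<noteq> 0" using q1 by auto
  ultimately obtain c as where c: "c \<in> C - {0}" "set as \<subseteq> C" "q = smult c (\<Prod>a\<leftarrow>as. [:-a, 1:])"
    using split_over_closed[OF C.F_sf closed] by blast
  have "poly.coeff q (Polynomial.degree q) = c * lead_coeff (\<Prod>a\<leftarrow>as. [:-a, 1:])"
    unfolding c(3) by (rule lead_coeff_smult)
  also have "lead_coeff (\<Prod>a\<leftarrow>as. [:-a, 1::'o:]) = 1" by (induction as) (simp_all only: list.map prod_list.Nil prod_list.Cons lead_coeff_mult, simp_all)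
  finally have "c = 1" using q1 by simp
  have asR: "a \<in> C.R" if a: "a \<in> set as" for a
  proof (rule integral_root[OF _ _ qR q1])
    show "a \<in> C" using a c(2) by blast
    have "poly (\<Prod>a\<leftarrow>as. [:-a, 1:]) a = 0" using a by (induction as) auto
    then show "poly q a = 0" using c(3) by simp
  qed
  have "poly q f = prod_list (map (\<lambda>a. f - a) as)"
    unfolding c(3) \<open>c = 1\<close> by (induction as) (auto simp: algebra_simps)
  then have "prod_list (map (\<lambda>a. f - a) as) \<in> N" using qN by simp
  moreover have "\<forall>b\<in>set (map (\<lambda>a. f - a) as). b \<in> V" using asR V(2) f(1) by (auto intro!: V_closed(4) intro: subsetD)
  ultimately obtain b where "b \<in> set (map (\<lambda>a. f - a) as)" "b \<in> N" using prod_list_in_N by blast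
  then show ?thesis using asR by auto
qed

text \<open>An equation of the residue of \<open>b\<close> over the residue field of
  \<open>K\<close> lifts to coefficients in \<open>K\<close>, which are integral for
  \<open>w\<close> as well.\<close>

lemma D_same_residue:
  assumes b: "b \<in> D.R"
  shows "\<exists>a\<in>C.R. b - a \<in> N"
proof -
  obtain P where P: "P \<in> polys (D.res K)" "P \<noteq> 0" "poly P (\<pi> b) = 0" using residue_alg[OF b] by (auto simp: alg_def)
  obtain Q where Q: "Q \<in> polys (K \<inter> D.R)" "map_poly \<pi> Q = P"
    using D.lift_poly[OF K(3) P(1)] K(1) by auto
  have QR: "Q \<in> polys D.R" using polys_mono[of "K \<inter> D.R" D.R] Q(1) by blast
  have cK: "poly.coeff Q i \<in> K" "poly.coeff Q i \<in> C.R" for i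
    using polys_coeff[OF Q(1), of i] K_R_iff[of "poly.coeff Q i"] by auto
  show ?thesis
  proof (rule ex_same_residue_poly)
    show "Q \<in> polys C.R" using cK by (simp add: polys_def)
    obtain i where "poly.coeff P i \<noteq> 0" using P(2) by (meson leading_coeff_neq_0)
    then have "\<pi> (poly.coeff Q i) \<noteq> 0" using Q(2) by (auto simp: coeff_map_poly)
    then show "\<exists>i. \<sigma> (poly.coeff Q i) \<noteq> 0" using K_unit_iff[OF cK] by blast
    show "b \<in> V" using b V(3) by blast
    show "poly Q b \<in> N" using D.pi_poly[OF QR b] Q(2) P(3) by (intro D_N) simp_all
  qed
qed

text \<open>An equation of \<open>f\<close> over \<open>D\<close> is scaled to integral coefficients
  with nonzero reduction. Replacing each coefficient by an element of \<open>C.R\<close> congruent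
  to it changes the value at \<open>f\<close> only within the maximal ideal.\<close>

lemma ex_same_residue:
  assumes f: "f \<in> L" "f \<in> V"
  shows "\<exists>a\<in>C.R. f - a \<in> N"
proof -
  obtain p where p: "p \<in> polys D" "p \<noteq> 0" "poly p f = 0" using L(4)[OF f(1)] by (auto simp: alg_def)
  obtain c where c: "smult c p \<in> polys (D \<inter> D.R)" "map_poly \<pi> (smult c p) \<noteq> 0"
    using D.scale_poly[OF D.F_sf order.refl p(1,2)] by blast
  let ?q = "smult c p"
  have qR: "poly.coeff ?q i \<in> D.R" for i using polys_coeff[OF c(1), of i] by blast
  have "\<forall>i. \<exists>a. a \<in> C.R \<and> poly.coeff ?q i - a \<in> N" using D_same_residue[OF qR] by blast
  from choice[OF this] obtain a where a: "\<And>i. a i \<in> C.R" "\<And>i. poly.coeff ?q i - a i \<in> N" by blast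
  let ?d = "Polynomial.degree ?q"
  define r where "r = (\<Sum>i\<le>?d. Polynomial.monom (a i) i)"
  have cr: "poly.coeff r i = (if i \<le> ?d then a i else 0)" for i by (simp add: r_def coeff_sum)
  show ?thesis
  proof (rule ex_same_residue_poly)
    show "r \<in> polys C.R" using a(1) by (simp add: polys_def cr)
    obtain i where "poly.coeff (map_poly \<pi> ?q) i \<noteq> 0" using c(2) by (meson leading_coeff_neq_0)
    then have i: "\<pi> (poly.coeff ?q i) \<noteq> 0" by (simp add: coeff_map_poly)
    then have "poly.coeff ?q i \<noteq> 0" by auto
    then have id: "i \<le> ?d" by (rule le_degree)
    have "poly.coeff ?q i \<in> U" using qR i by (rule D_U)
    then have "a i \<notin> N" using N_add[OF a(2)[of i], of "a i"] U_notin_N by auto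
    then show "\<exists>i. \<sigma> (poly.coeff r i) \<noteq> 0" using C_N_iff[OF a(1)] id by (intro exI[of _ i]) (simp add: cr)
    show "f \<in> V" by (rule f(2))
    have "poly ?q f - poly r f = (\<Sum>i\<le>?d. f ^ i * (poly.coeff ?q i - a i))"
      unfolding poly_altdef[of ?q] r_def poly_sum poly_monom
      by (simp add: right_diff_distrib sum_subtractf mult.commute del: coeff_smult)
    also have "\<dots> \<in> N" using a(2) f(2) by (intro N_sum N_mult) auto
    finally have "- (poly ?q f - poly r f) \<in> N" by (rule N_uminus)
    then show "poly r f \<in> N" using p(3) by simp
  qed
qed

lemma same_value_unique:
  assumes "a \<in> C" "b \<in> C" "a \<noteq> 0" "b \<noteq> 0" "f / a \<in> U" "f / b \<in> U"
  shows "w a = w b"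
proof -
  have "f \<noteq> 0" using assms(5) by (auto simp: U_def)
  then have "(f / b) / (f / a) = a / b" using assms(3,4) by simp
  then have "a / b \<in> U" using U_divide[OF assms(6,5)] by simp
  then show ?thesis using C_U_iff[of "a / b"] assms by (simp add: C.v_divide)
qed

lemma same_residue_unique:
  assumes "a \<in> C.R" "b \<in> C.R" "f - a \<in> N" "f - b \<in> N"
  shows "\<sigma> a = \<sigma> b"
proof -
  have "a - b \<in> N" using N_diff[OF assms(4,3)] by simp
  then show ?thesis using C_N_iff[of "a - b"] assms(1,2) by (simp add: C.pi_diff)
qed

text \<open>An element \<open>f\<close> of \<open>L\<close> gets the value of any \<open>a\<close>
  in \<open>C\<close> with \<open>f / a\<close> a unit, and an integral \<open>f\<close> the residue
  of any \<open>a\<close> congruent to it; both are independent of the choice. Comparison of values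
  then amounts to divisibility in \<open>V\<close>, and neither values nor residues are new.\<close>

theorem ex_immediate:
  "\<exists>(w' :: _ \<Rightarrow> 'h) (\<pi>' :: _ \<Rightarrow> 's). valued_field L w' \<and> residue_map w' L \<pi>' \<and> (\<forall>a\<in>C - {0}. w' a = w a) \<and>
    (\<forall>a\<in>C.R. \<pi>' a = \<sigma> a) \<and> immediate w' \<pi>' C L"
proof -
  define val where "val f = w (SOME a. a \<in> C \<and> a \<noteq> 0 \<and> f / a \<in> U)" for f
  define \<rho> where "\<rho> f = \<sigma> (SOME a. a \<in> C.R \<and> f - a \<in> N)" for f
  have val: "val f = w a" if "a \<in> C" "a \<noteq> 0" "f / a \<in> U" for f a
    using someI[of "\<lambda>a. a \<in> C \<and> a \<noteq> 0 \<and> f / a \<in> U" a] that unfolding val_def by (intro same_value_unique) auto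
  have rho: "\<rho> f = \<sigma> a" if "a \<in> C.R" "f - a \<in> N" for f a
    using someI[of "\<lambda>a. a \<in> C.R \<and> f - a \<in> N" a] that unfolding \<rho>_def by (intro same_residue_unique[of _ _ f]) auto
  have valC: "val a = w a" if "a \<in> C" "a \<noteq> 0" for a using that by (intro val) auto
  have rhoC: "\<rho> a = \<sigma> a" if "a \<in> C.R" for a using that by (intro rho) auto
  have le: "val f \<le> val g \<longleftrightarrow> g / f \<in> V" if fg: "f \<in> L" "f \<noteq> 0" "g \<in> L" "g \<noteq> 0" for f g
  proof -
    obtain a b where ab: "a \<in> C" "a \<noteq> 0" "f / a \<in> U" "b \<in> C" "b \<noteq> 0" "g / b \<in> U"
      using ex_same_value[OF fg(1,2)] ex_same_value[OF fg(3,4)] by blast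
    let ?u = "(g / b) / (f / a)"
    have u: "?u \<in> U" by (rule U_divide[OF ab(6,3)])
    have e: "g / f = (b / a) * ?u" "b / a = (g / f) * inverse ?u" using ab fg by (simp_all add: field_simps)
    have uV: "?u \<in> V" "inverse ?u \<in> V" using u unfolding U_def by auto
    have "g / f \<in> V \<longleftrightarrow> b / a \<in> V"
      using sr_mult[OF V(1) _ uV(1), of "b / a"] sr_mult[OF V(1) _ uV(2), of "g / f"] unfolding e(1)[symmetric] e(2)[symmetric] by blast
    also have "\<dots> \<longleftrightarrow> b / a \<in> C.R" using ab by (intro C_V_iff) auto
    also have "\<dots> \<longleftrightarrow> w a \<le> w b" using ab by (auto simp: C.R_iff C.v_divide)
    finally show ?thesis using val[OF ab(1-3)] val[OF ab(4-6)] by simp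
  qed
  have LF: "1 \<in> L" "a \<in> L \<Longrightarrow> b \<in> L \<Longrightarrow> a + b \<in> L" for a b using L(1) by auto
  have v1: "val 1 = 0" using valC[of 1] by simp
  have VR: "valuation_ring val L = V \<inter> L"
  proof (rule Set.set_eqI)
    show "f \<in> valuation_ring val L \<longleftrightarrow> f \<in> V \<inter> L" for f
      using le[of 1 f] v1 LF(1) by (cases "f = 0") (auto simp: valuation_ring_def)
  qed
  have VI: "valuation_ideal val L = N \<inter> L"
  proof (rule Set.set_eqI)
    fix f
    have "0 < val f \<longleftrightarrow> f \<in> N" if "f \<in> L" "f \<noteq> 0"
      using le[of f 1] v1 LF(1) that V(4)[of f] by (auto simp: N_def not_le[symmetric] divide_inverse)
    then show "f \<in> valuation_ideal val L \<longleftrightarrow> f \<in> N \<inter> L" by (cases "f = 0") (auto simp: valuation_ideal_def)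
  qed
  have "valued_field L val"
    unfolding valued_field_def
  proof (intro conjI ballI impI)
    fix f g assume fg: "f \<in> L - {0}" "g \<in> L - {0}"
    then obtain a b where ab: "a \<in> C" "a \<noteq> 0" "f / a \<in> U" "b \<in> C" "b \<noteq> 0" "g / b \<in> U"
      using ex_same_value[of f] ex_same_value[of g] by blast
    have "f * g / (a * b) \<in> U" using U_mult[OF ab(3,6)] by simp
    then have "val (f * g) = w (a * b)" using ab by (intro val) auto
    then show "val (f * g) = val f + val g" using val[OF ab(1-3)] val[OF ab(4-6)] ab by (simp add: C.v_mult)
    assume s: "f + g \<noteq> 0"
    have *: "val f \<le> val (f + g)" if "val f \<le> val g" "f \<in> L" "g \<in> L" "f \<noteq> 0" "g \<noteq> 0" "f + g \<noteq> 0" for f g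
    proof -
      have "1 + g / f \<in> V" using le[of f g] that by simp
      then have "(f + g) / f \<in> V" using that(4) by (simp add: add_divide_distrib)
      then show ?thesis using le[of f "f + g"] that LF by simp
    qed
    show "min (val f) (val g) \<le> val (f + g)"
      using *[of f g] *[of g f] fg s by (cases "val f \<le> val g") (auto simp: min_def add.commute)
  qed (rule L(1))
  moreover have "residue_map val L \<rho>"
    unfolding residue_map_def
  proof
    show "\<rho> \<in> ring_hom (amb\<lparr>carrier := valuation_ring val L\<rparr>) amb"
    proof (rule ring_hom_memI)
      fix f g assume "f \<in> carrier (amb\<lparr>carrier := valuation_ring val L\<rparr>)" "g \<in> carrier (amb\<lparr>carrier := valuation_ring val L\<rparr>)"
      then have fg: "f \<in> L" "f \<in> V" "g \<in> L" "g \<in> V" by (auto simp: VR)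
      obtain a b where ab: "a \<in> C.R" "f - a \<in> N" "b \<in> C.R" "g - b \<in> N"
        using ex_same_residue[OF fg(1,2)] ex_same_residue[OF fg(3,4)] by blast
      have "f + g - (a + b) \<in> N" using N_add[OF ab(2,4)] by (simp add: algebra_simps)
      then have "\<rho> (f + g) = \<sigma> (a + b)" using ab by (intro rho) auto
      then show "\<rho> (f \<oplus>\<^bsub>amb\<lparr>carrier := valuation_ring val L\<rparr>\<^esub> g) = \<rho> f \<oplus>\<^bsub>amb\<^esub> \<rho> g"
        using rho[OF ab(1,2)] rho[OF ab(3,4)] ab by (simp add: C.pi_add)
      have "b \<in> V" using ab(3) V(2) by blast
      then have "f * (g - b) + b * (f - a) \<in> N" using ab fg by (intro N_add N_mult)
      then have "f * g - a * b \<in> N" by (simp add: algebra_simps)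
      then have "\<rho> (f * g) = \<sigma> (a * b)" using ab by (intro rho) auto
      then show "\<rho> (f \<otimes>\<^bsub>amb\<lparr>carrier := valuation_ring val L\<rparr>\<^esub> g) = \<rho> f \<otimes>\<^bsub>amb\<^esub> \<rho> g"
        using rho[OF ab(1,2)] rho[OF ab(3,4)] ab by (simp add: C.pi_mult)
    qed (use rhoC[of 1] in \<open>simp_all add: C.pi_1\<close>)
    have "\<rho> f = 0 \<longleftrightarrow> f \<in> N" if fg: "f \<in> L" "f \<in> V" for f
    proof -
      obtain a where a: "a \<in> C.R" "f - a \<in> N" using ex_same_residue[OF fg] by blast
      have "f \<in> N \<longleftrightarrow> a \<in> N" using N_diff[OF _ a(2), of f] N_add[OF a(2), of a] by auto
      then show ?thesis using rho[OF a] C_N_iff[OF a(1)] by simp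
    qed
    then show "a_kernel (amb\<lparr>carrier := valuation_ring val L\<rparr>) amb \<rho> = valuation_ideal val L"
      unfolding VI a_kernel_def kernel_def using N_V by (auto simp: VR)
  qed
  moreover have "immediate val \<rho> C L"
    unfolding immediate_def
  proof
    have "val f \<in> val ` (C - {0})" if "f \<in> L - {0}" for f
      using ex_same_value[of f] that val[of _ f] valC by fastforce
    then show "value_set val L = value_set val C" using L(2) unfolding value_set_def by blast
    have VC: "valuation_ring val C = C.R"
    proof (rule Set.set_eqI)
      show "f \<in> valuation_ring val C \<longleftrightarrow> f \<in> C.R" for f
        using valC[of f] by (cases "f = 0") (auto simp: valuation_ring_def)
    qed
    have "\<rho> f \<in> \<rho> ` C.R" if "f \<in> L \<inter> V" for f
      using ex_same_residue[of f] that rho[of _ f] rhoC by fastforce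
    moreover have "C.R \<subseteq> V \<inter> L" using V(2) L(2) C.RF by blast
    ultimately show "residue_field val \<rho> L = residue_field val \<rho> C" unfolding residue_field_def VR VC by blast
  qed
  moreover have "\<forall>a\<in>C - {0}. val a = w a" using valC by blast
  moreover have "\<forall>a\<in>C.R. \<rho> a = \<sigma> a" using rhoC by blast
  ultimately show ?thesis by blast
qed

end

section \<open>Existence of the dominating ring\<close>

lemma idl_subring:
  assumes A: "subring A amb" and B: "subring B amb"
  shows "subring (idl A B) amb" "A \<subseteq> idl A B" "B \<subseteq> idl A B"
proof -
  have mB: "d * s \<in> idl A B" if "d \<in> B" "s \<in> idl A B" for d s
    using that(2)
  proof (induction rule: idl.induct)
    case (idl_step r y s)
    then have "r * (d * y) + d * s \<in> idl A B" using B that(1) by (intro idl.idl_step) auto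
    then show ?case by (simp add: algebra_simps)
  qed simp
  have m: "a * b \<in> idl A B" if "a \<in> idl A B" "b \<in> idl A B" for a b
    using that(1)
  proof (induction rule: idl.induct)
    case (idl_step r y s)
    have "r * (y * b) + s * b \<in> idl A B"
      by (rule idl_add[OF idl_mult[OF A mB[OF idl_step.hyps(2) that(2)] idl_step.hyps(1)] idl_step.IH])
    then show ?case by (simp add: algebra_simps)
  qed simp
  show sub: "A \<subseteq> idl A B" "B \<subseteq> idl A B"
    using idl_step[of _ A 1 B 0] idl_step[of 1 A _ B 0] A B by auto
  have "a - b \<in> idl A B" if "a \<in> idl A B" "b \<in> idl A B" for a b
    using idl_add[OF that(1) idl_mult[OF A that(2), of "- 1"]] A by simp
  moreover have "1 \<in> idl A B" using sub(1) sr_1[OF A] by blast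
  ultimately show "subring (idl A B) amb" unfolding subring_amb_iff using m by blast
qed

text \<open>The shape to which \<open>sum_products_neq_1\<close> applies; with \<open>P\<close> the
  pairs having a factor of residue \<open>0\<close>, it will contain the ideal generated by both
  maximal ideals.\<close>

inductive_set product_sums :: "('a::field \<times> 'a) set \<Rightarrow> 'a set" for P where
  product_sums_0 [simp]: "0 \<in> product_sums P"
| product_sums_step: "(c, d) \<in> P \<Longrightarrow> s \<in> product_sums P \<Longrightarrow> c * d + s \<in> product_sums P"

lemma product_sums_add: "a \<in> product_sums P \<Longrightarrow> b \<in> product_sums P \<Longrightarrow> a + b \<in> product_sums P"
  by (induction rule: product_sums.induct) (auto simp: add.assoc intro: product_sums_step)

lemma product_sums_sum:
  "s \<in> product_sums P \<Longrightarrow> \<exists>(m::nat) c d. (\<forall>i<m. (c i, d i) \<in> P) \<and> s = (\<Sum>i<m. c i * d i)"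
proof (induction rule: product_sums.induct)
  case product_sums_0
  show ?case by (intro exI[of _ 0]) simp
next
  case (product_sums_step c d s)
  then obtain m :: nat and c' d' where "\<forall>i<m. (c' i, d' i) \<in> P" "s = (\<Sum>i<m. c' i * d' i)" by blast
  then show ?case using product_sums_step.hyps(1)
    by (intro exI[of _ "Suc m"] exI[of _ "c'(m := c)"] exI[of _ "d'(m := d)"]) (auto simp: less_Suc_eq)
qed

context compositum
begin

text \<open>In the ring generated by both valuation rings, elements of the ideal generated by the
  two maximal ideals are sums of products with a factor of residue \<open>0\<close>. So
  \<open>1\<close> is not among them, and the valuation ring that
  \<open>exists_valuation_ring\<close> provides dominates both.\<close>

theorem immediate_on_compositum:
  "\<exists>(w' :: _ \<Rightarrow> 'h) (\<pi>' :: _ \<Rightarrow> 's). valued_field L w' \<and> residue_map w' L \<pi>' \<and> (\<forall>a\<in>C - {0}. w' a = w a) \<and>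
    (\<forall>a\<in>C.R. \<pi>' a = \<sigma> a) \<and> immediate w' \<pi>' C L"
proof -
  have CR: "subring C.R amb" and DR: "subring D.R amb" by (auto simp: subring_amb_iff)
  let ?R = "idl C.R D.R" \<comment> \<open>the ring generated by \<open>C.R\<close> and \<open>D.R\<close>\<close>
  let ?Y = "{c \<in> C.R. \<sigma> c = 0} \<union> {d \<in> D.R. \<pi> d = 0}"
  let ?P = "{(c, d). c \<in> C.R \<and> d \<in> D.R \<and> (\<sigma> c = 0 \<or> \<pi> d = 0)}"
  note R = idl_subring[OF CR DR]
  have ry: "r * y \<in> product_sums ?P" if "r \<in> ?R" "y \<in> ?Y" for r y
    using that(1)
  proof (induction rule: idl.induct)
    case (idl_step c d s)
    have "c * y * d + s * y \<in> product_sums ?P"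
      using that(2)
    proof
      assume "y \<in> {c \<in> C.R. \<sigma> c = 0}"
      then show ?thesis using idl_step by (intro product_sums_step) (auto simp: C.pi_mult)
    next
      assume "y \<in> {d \<in> D.R. \<pi> d = 0}"
      then have "c * (d * y) + s * y \<in> product_sums ?P"
        using idl_step by (intro product_sums_step) (auto simp: D.pi_mult)
      then show ?thesis by (simp add: ac_simps)
    qed
    then show ?case by (simp add: algebra_simps)
  qed simp
  have "idl ?R ?Y \<subseteq> product_sums ?P"
  proof
    show "a \<in> product_sums ?P" if "a \<in> idl ?R ?Y" for a
      using that by (induction rule: idl.induct) (auto intro!: product_sums_add ry simp del: Un_iff)
  qed
  moreover have "1 \<notin> product_sums ?P"
  proof
    assume "1 \<in> product_sums ?P"
    then obtain m :: nat and c d where "\<forall>i<m. (c i, d i) \<in> ?P" "1 = (\<Sum>i<m. c i * d i)"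
      using product_sums_sum[of 1 ?P] by blast
    then show False using sum_products_neq_1[of "{..<m}" c d] by auto
  qed
  ultimately have "1 \<notin> idl ?R ?Y" by blast
  moreover have "?Y \<subseteq> ?R" using R(2,3) by blast
  ultimately obtain V where V: "subring V amb" "?R \<subseteq> V" "1 \<notin> idl V ?Y" "\<And>u. u \<noteq> 0 \<Longrightarrow> u \<in> V \<or> inverse u \<in> V"
    using exists_valuation_ring[OF R(1)] by blast
  have n: "inverse y \<notin> V" if "y \<in> ?Y" "y \<noteq> 0" for y
    using idl_step[of "inverse y" V y ?Y 0] V(3) that by auto
  interpret dominating_ring C D w v \<sigma> \<pi> K L V
  proof (intro dominating_ring.intro dominating_ring_axioms.intro compositum_axioms)
    show "C.R \<subseteq> V" "D.R \<subseteq> V" using R(2,3) V(2) by blast+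
  qed (use V n in auto)
  show ?thesis by (rule ex_immediate)
qed

end

section \<open>Field homomorphisms\<close>

locale field_hom =
  fixes F :: "'a::field set" and \<phi> :: "'a \<Rightarrow> 'b::field"
  assumes F: "subfield F amb" and hom: "\<phi> \<in> ring_hom (amb\<lparr>carrier := F\<rparr>) amb"
begin

lemma hom_add: "a \<in> F \<Longrightarrow> b \<in> F \<Longrightarrow> \<phi> (a + b) = \<phi> a + \<phi> b"
  and hom_mult: "a \<in> F \<Longrightarrow> b \<in> F \<Longrightarrow> \<phi> (a * b) = \<phi> a * \<phi> b"
  and hom_1 [simp]: "\<phi> 1 = 1"
  using ring_hom_add[OF hom, of a b] ring_hom_mult[OF hom, of a b] ring_hom_one[OF hom] by simp_all

lemma hom_0 [simp]: "\<phi> 0 = 0"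
  using hom_add[of 0 0] F by (metis add.right_neutral add_left_cancel sf_0)

lemma hom_uminus: "a \<in> F \<Longrightarrow> \<phi> (- a) = - \<phi> a"
  using hom_add[of a "- a"] F by (simp add: eq_neg_iff_add_eq_0 add.commute)

lemma hom_diff: "a \<in> F \<Longrightarrow> b \<in> F \<Longrightarrow> \<phi> (a - b) = \<phi> a - \<phi> b"
  using hom_add[of a "- b"] F by (simp add: hom_uminus)

lemma hom_eq_0_iff: "a \<in> F \<Longrightarrow> \<phi> a = 0 \<longleftrightarrow> a = 0"
  using hom_mult[of a "inverse a"] F by (cases "a = 0") auto

lemma hom_eq_iff: "a \<in> F \<Longrightarrow> b \<in> F \<Longrightarrow> \<phi> a = \<phi> b \<longleftrightarrow> a = b"
  using hom_diff[of a b] hom_eq_0_iff[of "a - b"] F by auto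

lemma hom_inj: "inj_on \<phi> F" by (auto simp: inj_on_def hom_eq_iff)

lemma hom_inverse: "a \<in> F \<Longrightarrow> \<phi> (inverse a) = inverse (\<phi> a)"
  using hom_mult[of a "inverse a"] F by (cases "a = 0") (auto simp: inverse_unique)

lemma hom_power: "a \<in> F \<Longrightarrow> \<phi> (a ^ n) = \<phi> a ^ n"
  using F by (induction n) (auto simp: hom_mult)

lemma hom_sum: "(\<And>i. i \<in> I \<Longrightarrow> f i \<in> F) \<Longrightarrow> \<phi> (sum f I) = (\<Sum>i\<in>I. \<phi> (f i))"
  using F by (induction I rule: infinite_finite_induct) (auto simp: hom_add)

lemma hom_subfield: "subfield L amb \<Longrightarrow> L \<subseteq> F \<Longrightarrow> subfield (\<phi> ` L) amb"
proof (rule subfield_ambI)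
  assume L: "subfield L amb" "L \<subseteq> F"
  show "1 \<in> \<phi> ` L" using L hom_1 by (metis imageI sf_1)
  fix x y assume "x \<in> \<phi> ` L" "y \<in> \<phi> ` L"
  then obtain a b where ab: "a \<in> L" "b \<in> L" "x = \<phi> a" "y = \<phi> b" by blast
  then have F: "a \<in> F" "b \<in> F" using L by auto
  show "x - y \<in> \<phi> ` L" using ab F L by (auto simp flip: hom_diff)
  show "x * y \<in> \<phi> ` L" using ab F L by (auto simp flip: hom_mult)
  show "inverse x \<in> \<phi> ` L" using ab F L by (auto simp flip: hom_inverse)
qed

lemma hom_poly: "p \<in> polys F \<Longrightarrow> a \<in> F \<Longrightarrow> \<phi> (poly p a) = poly (map_poly \<phi> p) (\<phi> a)"
proof -
  assume p: "p \<in> polys F" "a \<in> F"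
  have c: "poly.coeff p i \<in> F" for i using p(1) by (rule polys_coeff)
  have "\<phi> (poly p a) = (\<Sum>i\<le>Polynomial.degree p. \<phi> (poly.coeff p i) * \<phi> a ^ i)"
    unfolding poly_altdef using c p(2) F by (subst hom_sum) (auto simp: hom_mult hom_power)
  also have "\<dots> = poly (\<Sum>i\<le>Polynomial.degree p. Polynomial.monom (\<phi> (poly.coeff p i)) i) (\<phi> a)"
    by (simp add: poly_sum poly_monom)
  also have "(\<Sum>i\<le>Polynomial.degree p. Polynomial.monom (\<phi> (poly.coeff p i)) i) = map_poly \<phi> p"
    by (rule poly_eqI) (simp add: coeff_sum coeff_map_poly coeff_eq_0)
  finally show ?thesis .
qed

lemma map_poly_polys: "p \<in> polys L \<Longrightarrow> map_poly \<phi> p \<in> polys (\<phi> ` L)"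
  by (auto simp: polys_def coeff_map_poly)

lemma map_poly_hom_eq_0: "p \<in> polys F \<Longrightarrow> map_poly \<phi> p = 0 \<longleftrightarrow> p = 0"
  using hom_eq_0_iff[OF polys_coeff] by (auto simp: poly_eq_iff coeff_map_poly)

lemma map_poly_hom_add: "p \<in> polys F \<Longrightarrow> q \<in> polys F \<Longrightarrow> map_poly \<phi> (p + q) = map_poly \<phi> p + map_poly \<phi> q"
  by (rule poly_eqI) (simp add: coeff_map_poly hom_add polys_coeff)

lemma map_poly_hom_mult: "p \<in> polys F \<Longrightarrow> q \<in> polys F \<Longrightarrow> map_poly \<phi> (p * q) = map_poly \<phi> p * map_poly \<phi> q"
  using F by (intro poly_eqI) (simp add: coeff_map_poly coeff_mult hom_sum hom_mult polys_coeff)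

lemma alg_image:
  assumes L: "L \<subseteq> F" and a: "alg L a" "a \<in> F"
  shows "alg (\<phi> ` L) (\<phi> a)"
proof -
  obtain p where p: "p \<in> polys L" "p \<noteq> 0" "poly p a = 0" using a(1) by (auto simp: alg_def)
  then have pF: "p \<in> polys F" using polys_mono[OF L] by blast
  show ?thesis
    using hom_poly[OF pF a(2)] p map_poly_hom_eq_0[OF pF] map_poly_polys[OF p(1)]
    by (intro algI[of "map_poly \<phi> p"]) auto
qed

lemma image_adjoin: "F = adjoin L S \<Longrightarrow> \<phi> ` F \<subseteq> adjoin (\<phi> ` L) (\<phi> ` S)"
proof -
  assume eq: "F = adjoin L S"
  let ?A = "adjoin (\<phi> ` L) (\<phi> ` S)"
  let ?T = "{a \<in> F. \<phi> a \<in> ?A}"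
  have "subfield ?T amb"
    using F by (intro subfield_ambI) (auto simp: hom_diff hom_mult hom_inverse)
  moreover have "L \<subseteq> ?T" "S \<subseteq> ?T"
    using eq adjoin_base[of L S] adjoin_gen[of S L] adjoin_base[of "\<phi> ` L" "\<phi> ` S"] adjoin_gen[of "\<phi> ` S" "\<phi> ` L"] by blast+
  ultimately have "adjoin L S \<subseteq> ?T" by (rule adjoin_least)
  then show ?thesis using eq by blast
qed

text \<open>\<open>p(a) / q(a)\<close> is sent to the quotient of the transported polynomials at
  \<open>b\<close>: transcendence of \<open>a\<close> makes this independent of the representation,
  and transcendence of \<open>b\<close> keeps denominators nonzero.\<close>

lemma extend_transcendental:
  assumes a: "\<not> alg F a" and b: "\<not> alg (\<phi> ` F) b"
  shows "\<exists>\<psi>. field_hom (adjoin F {a}) \<psi> \<and> (\<forall>c\<in>F. \<psi> c = \<phi> c) \<and> \<psi> a = b"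
proof -
  let ?m = "map_poly \<phi>"
  define rep where "rep y p q \<longleftrightarrow> p \<in> polys F \<and> q \<in> polys F \<and> q \<noteq> 0 \<and> y = poly p a / poly q a" for y p q
  have nz: "poly q a \<noteq> 0" "poly (?m q) b \<noteq> 0" if "q \<in> polys F" "q \<noteq> 0" for q
    using a b algI[of q F a] algI[of "?m q" "\<phi> ` F" b] map_poly_polys[of q F] map_poly_hom_eq_0[of q] that by blast+
  define \<psi> where "\<psi> y = (SOME z. \<exists>p q. rep y p q \<and> z = poly (?m p) b / poly (?m q) b)" for y
  have unique: "poly (?m p) b / poly (?m q) b = poly (?m p') b / poly (?m q') b" if "rep y p q" "rep y p' q'" for y p q p' q'
  proof -
    have P: "p \<in> polys F" "q \<in> polys F" "q \<noteq> 0" "p' \<in> polys F" "q' \<in> polys F" "q' \<noteq> 0"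
      "poly p a / poly q a = poly p' a / poly q' a" using that by (auto simp: rep_def)
    have "poly (p * q' - p' * q) a = 0" using P(7) nz(1)[OF P(2,3)] nz(1)[OF P(5,6)] by (simp add: field_simps)
    moreover have "p * q' - p' * q \<in> polys F" using P F by simp
    ultimately have "p * q' = p' * q" using a algI[of "p * q' - p' * q" F a] by auto
    then have "?m p * ?m q' = ?m p' * ?m q" using P by (metis map_poly_hom_mult)
    then have "poly (?m p) b * poly (?m q') b = poly (?m p') b * poly (?m q) b" by (metis poly_mult)
    then show ?thesis using nz(2)[OF P(2,3)] nz(2)[OF P(5,6)] by (simp add: field_simps)
  qed
  have psi: "\<psi> y = poly (?m p) b / poly (?m q) b" if "rep y p q" for y p q
    unfolding \<psi>_def
  proof (rule some_equality)
    fix z assume "\<exists>p q. rep y p q \<and> z = poly (?m p) b / poly (?m q) b"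
    then show "z = poly (?m p) b / poly (?m q) b" using unique that by blast
  qed (use that in blast)
  have ex: "\<exists>p q. rep y p q" if "y \<in> adjoin F {a}" for y
    using that unfolding adjoin_singleton[OF F] rep_def by fastforce
  have c: "\<psi> c = \<phi> c" if "c \<in> F" for c
    using psi[of c "[:c:]" 1] that F by (simp add: rep_def map_poly_pCons map_poly_1)
  have "\<psi> a = b"
    using psi[of a "[:0, 1:]" 1] F by (simp add: rep_def map_poly_pCons map_poly_1)
  moreover have "field_hom (adjoin F {a}) \<psi>"
  proof (rule field_hom.intro)
    show "\<psi> \<in> ring_hom (amb\<lparr>carrier := adjoin F {a}\<rparr>) amb"
    proof (rule ring_hom_memI)
      fix y z assume "y \<in> carrier (amb\<lparr>carrier := adjoin F {a}\<rparr>)" "z \<in> carrier (amb\<lparr>carrier := adjoin F {a}\<rparr>)"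
      then obtain p q p' q' where r: "rep y p q" "rep z p' q'" using ex by fastforce
      then have P: "p \<in> polys F" "q \<in> polys F" "q \<noteq> 0" "p' \<in> polys F" "q' \<in> polys F" "q' \<noteq> 0" by (auto simp: rep_def)
      note nn = nz[OF P(2,3)] nz[OF P(5,6)]
      have "rep (y * z) (p * p') (q * q')" using r F by (auto simp: rep_def)
      then show "\<psi> (y \<otimes>\<^bsub>amb\<lparr>carrier := adjoin F {a}\<rparr>\<^esub> z) = \<psi> y \<otimes>\<^bsub>amb\<^esub> \<psi> z"
        using psi r P by (simp add: map_poly_hom_mult)
      have "rep (y + z) (p * q' + p' * q) (q * q')" using r F nn by (auto simp: rep_def add_frac_eq)
      then have "\<psi> (y + z) = poly (?m (p * q' + p' * q)) b / poly (?m (q * q')) b" by (rule psi)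
      also have "?m (p * q' + p' * q) = ?m p * ?m q' + ?m p' * ?m q"
        using P F by (simp add: map_poly_hom_add map_poly_hom_mult)
      also have "?m (q * q') = ?m q * ?m q'" using P by (simp add: map_poly_hom_mult)
      finally show "\<psi> (y \<oplus>\<^bsub>amb\<lparr>carrier := adjoin F {a}\<rparr>\<^esub> z) = \<psi> y \<oplus>\<^bsub>amb\<^esub> \<psi> z"
        using psi[OF r(1)] psi[OF r(2)] nn by (simp add: add_frac_eq)
    qed (use c[of 1] F in simp_all)
  qed simp
  ultimately show ?thesis using c by blast
qed

end

lemma field_hom_extension:
  assumes \<phi>: "field_hom K \<phi>" and a: "tind K n a" and b: "tind (\<phi> ` K) n b"
  shows "\<exists>\<psi>. field_hom (adjoin K (a ` {..<n})) \<psi> \<and> (\<forall>c\<in>K. \<psi> c = \<phi> c) \<and> (\<forall>i<n. \<psi> (a i) = b i)"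
  using a b
proof (induction n)
  case 0
  have "adjoin K {} = K" using \<phi> by (simp add: field_hom_def adjoin_eq_base)
  then show ?case using \<phi> by auto
next
  case (Suc n)
  then have ab: "tind K n a" "tind (\<phi> ` K) n b" "\<not> alg (adjoin K (a ` {..<n})) (a n)" "\<not> alg (adjoin (\<phi> ` K) (b ` {..<n})) (b n)"
    by (auto simp: tind_def)
  obtain \<psi> where \<psi>: "field_hom (adjoin K (a ` {..<n})) \<psi>" "\<And>c. c \<in> K \<Longrightarrow> \<psi> c = \<phi> c" "\<And>i. i < n \<Longrightarrow> \<psi> (a i) = b i"
    using Suc.IH[OF ab(1,2)] by blast
  interpret field_hom "adjoin K (a ` {..<n})" \<psi> by (rule \<psi>(1))
  have "\<psi> ` K = \<phi> ` K" "\<psi> ` (a ` {..<n}) = b ` {..<n}" using \<psi> by (auto simp: image_image)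
  then have "\<psi> ` adjoin K (a ` {..<n}) \<subseteq> adjoin (\<phi> ` K) (b ` {..<n})"
    using image_adjoin[OF refl] by metis
  then have "\<not> alg (\<psi> ` adjoin K (a ` {..<n})) (b n)" using ab(4) alg_mono by blast
  then obtain \<psi>' where \<psi>': "field_hom (adjoin (adjoin K (a ` {..<n})) {a n}) \<psi>'"
    "\<And>c. c \<in> adjoin K (a ` {..<n}) \<Longrightarrow> \<psi>' c = \<psi> c" "\<psi>' (a n) = b n"
    using extend_transcendental[OF ab(3)] by blast
  have "a i \<in> adjoin K (a ` {..<n})" if "i < n" for i using that adjoin_gen[of "a ` {..<n}" K] by blast
  moreover have "c \<in> adjoin K (a ` {..<n})" if "c \<in> K" for c using that adjoin_base by blast
  moreover have "adjoin K (a ` {..<Suc n}) = adjoin (adjoin K (a ` {..<n})) {a n}"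
    unfolding lessThan_Suc image_insert by (rule adjoin_insert)
  ultimately have "field_hom (adjoin K (a ` {..<Suc n})) \<psi>'" "\<forall>c\<in>K. \<psi>' c = \<phi> c" "\<forall>i<Suc n. \<psi>' (a i) = b i"
    using \<psi>(2,3) \<psi>' by (simp_all add: less_Suc_eq)
  then show ?case by blast
qed

text \<open>Transport of structure; it moves valued fields into the common field in which the
  compositum is formed.\<close>

lemma (in valued) valued_image:
  assumes "field_hom F \<phi>"
  defines "g \<equiv> inv_into F \<phi>"
  shows "valued (\<phi> ` F) (v \<circ> g) (\<pi> \<circ> g)"
    and "\<And>L. L \<subseteq> F \<Longrightarrow> valuation_ring (v \<circ> g) (\<phi> ` L) = \<phi> ` valuation_ring v L"
    and "\<And>L. L \<subseteq> F \<Longrightarrow> residue_field (v \<circ> g) (\<pi> \<circ> g) (\<phi> ` L) = res L"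
    and "\<And>a. a \<in> F \<Longrightarrow> g (\<phi> a) = a"
proof -
  interpret h: field_hom F \<phi> by fact
  show g: "g (\<phi> a) = a" if "a \<in> F" for a using h.hom_inj that by (simp add: g_def)
  show VR: "valuation_ring (v \<circ> g) (\<phi> ` L) = \<phi> ` valuation_ring v L" if "L \<subseteq> F" for L
    using that g h.hom_eq_0_iff by (force simp: valuation_ring_def)
  show "residue_field (v \<circ> g) (\<pi> \<circ> g) (\<phi> ` L) = res L" if "L \<subseteq> F" for L
  proof -
    have "valuation_ring v L \<subseteq> F" using that by (auto simp: valuation_ring_def)
    then have "\<pi> (g (\<phi> a)) = \<pi> a" if "a \<in> valuation_ring v L" for a using that g by auto
    then show ?thesis unfolding residue_field_def VR[OF that] image_image by auto
  qed
  have VI: "valuation_ideal (v \<circ> g) (\<phi> ` F) = \<phi> ` valuation_ideal v F"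
    using g h.hom_eq_0_iff by (force simp: valuation_ideal_def)
  have k: "{a \<in> R. \<pi> a = 0} = valuation_ideal v F"
    using rm unfolding residue_map_def by (simp add: a_kernel_def kernel_def)
  show "valued (\<phi> ` F) (v \<circ> g) (\<pi> \<circ> g)"
  proof
    show "valued_field (\<phi> ` F) (v \<circ> g)"
      unfolding valued_field_def
    proof (intro conjI ballI impI)
      show "subfield (\<phi> ` F) amb" by (rule h.hom_subfield) auto
      fix x y assume xy: "x \<in> \<phi> ` F - {0}" "y \<in> \<phi> ` F - {0}"
      then obtain a b where ab: "a \<in> F" "b \<in> F" "x = \<phi> a" "y = \<phi> b" by auto
      then have ab0: "a \<noteq> 0" "b \<noteq> 0" using xy by auto
      have "g (x * y) = a * b" unfolding ab(3,4) h.hom_mult[OF ab(1,2), symmetric] by (rule g) (use ab in simp)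
      then show "(v \<circ> g) (x * y) = (v \<circ> g) x + (v \<circ> g) y" using ab ab0 g by (simp add: v_mult)
      assume "x + y \<noteq> 0"
      then have n: "a + b \<noteq> 0" using ab h.hom_add[of a b] by auto
      have "g (x + y) = a + b" unfolding ab(3,4) h.hom_add[OF ab(1,2), symmetric] by (rule g) (use ab in simp)
      then show "min ((v \<circ> g) x) ((v \<circ> g) y) \<le> (v \<circ> g) (x + y)" using ab ab0 g n v_add[of a b] by simp
    qed
    show "residue_map (v \<circ> g) (\<phi> ` F) (\<pi> \<circ> g)"
      unfolding residue_map_def VR[OF order.refl] VI
    proof
      show "\<pi> \<circ> g \<in> ring_hom (amb\<lparr>carrier := \<phi> ` R\<rparr>) amb"
      proof (rule ring_hom_memI)
        fix x y assume "x \<in> carrier (amb\<lparr>carrier := \<phi> ` R\<rparr>)" "y \<in> carrier (amb\<lparr>carrier := \<phi> ` R\<rparr>)"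
        then obtain a b where ab: "a \<in> R" "b \<in> R" "x = \<phi> a" "y = \<phi> b" by auto
        then have F: "a \<in> F" "b \<in> F" using RF by auto
        have "g (x * y) = a * b" unfolding ab(3,4) h.hom_mult[OF F, symmetric] by (rule g) (use F in simp)
        then show "(\<pi> \<circ> g) (x \<otimes>\<^bsub>amb\<lparr>carrier := \<phi> ` R\<rparr>\<^esub> y) = (\<pi> \<circ> g) x \<otimes>\<^bsub>amb\<^esub> (\<pi> \<circ> g) y"
          using ab g F by (simp add: pi_mult)
        have "g (x + y) = a + b" unfolding ab(3,4) h.hom_add[OF F, symmetric] by (rule g) (use F in simp)
        then show "(\<pi> \<circ> g) (x \<oplus>\<^bsub>amb\<lparr>carrier := \<phi> ` R\<rparr>\<^esub> y) = (\<pi> \<circ> g) x \<oplus>\<^bsub>amb\<^esub> (\<pi> \<circ> g) y"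
          using ab g F by (simp add: pi_add)
      qed (use g[of 1] in \<open>simp_all add: pi_1\<close>)
      have "{x \<in> \<phi> ` R. (\<pi> \<circ> g) x = 0} = \<phi> ` {a \<in> R. \<pi> a = 0}"
        using g RF by fastforce
      then show "a_kernel (amb\<lparr>carrier := \<phi> ` R\<rparr>) amb (\<pi> \<circ> g) = \<phi> ` valuation_ideal v F"
        unfolding k by (simp add: a_kernel_def kernel_def)
    qed
  qed
qed

lemma algebraic_closure_root:
  assumes "algebraic_closure (amb :: 'a::field ring) K" and p: "1 \<le> Polynomial.degree p"
  shows "\<exists>a. poly p (a :: 'a) = 0"
proof -
  interpret algebraic_closure "amb :: 'a ring" K by fact
  let ?xs = "rev (coeffs p)"
  have p0: "p \<noteq> 0" using p by auto
  then have "hd ?xs \<noteq> 0" by (simp add: hd_rev last_coeffs_eq_coeff_degree)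
  then have xs: "?xs \<in> carrier (poly_ring amb)" by (auto simp: univ_poly_def polynomial_def)
  have "size (roots ?xs) = length ?xs - 1" using roots_over_carrier[OF xs] by (simp add: splitted_def)
  then have "size (roots ?xs) \<noteq> 0" using p p0 by (simp add: length_coeffs)
  then have "roots ?xs \<noteq> {#}" by auto
  then obtain a where "a \<in># roots ?xs" by (meson multiset_nonemptyE)
  then have "is_root ?xs a" using roots_mem_iff_is_root[OF xs] by simp
  then have "poly p a = 0" by (simp add: is_root_def eval_amb)
  then show ?thesis ..
qed

section \<open>The field of rational functions over a closed field\<close>

definition const_fract :: "'a::field \<Rightarrow> ((nat \<Rightarrow>\<^sub>0 nat) \<Rightarrow>\<^sub>0 'a) fract"
  where "const_fract a = to_fract (single 0 a)"

definition var_fract :: "nat \<Rightarrow> ((nat \<Rightarrow>\<^sub>0 nat) \<Rightarrow>\<^sub>0 'a::field) fract"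
  where "var_fract i = to_fract (single (single i 1) 1)"

lemma const_fract_hom: "field_hom UNIV const_fract"
proof (rule field_hom.intro)
  show "subfield (UNIV :: 'a set) amb" by (intro subfield_ambI) auto
  show "const_fract \<in> ring_hom (amb\<lparr>carrier := UNIV :: 'a set\<rparr>) amb"
    by (rule ring_hom_memI) (simp_all add: const_fract_def Poly_Mapping.single_add mult_single flip: to_fract_add to_fract_mult)
qed

interpretation const_fract: field_hom UNIV const_fract by (rule const_fract_hom)

lemma var_fract_power: "var_fract i ^ k = to_fract (single (single i k) (1 :: 'a::field))"
proof (induction k)
  case (Suc k)
  have "single i 1 + single i k = (single i (Suc k) :: nat \<Rightarrow>\<^sub>0 nat)" by (simp flip: Poly_Mapping.single_add)
  then show ?case using Suc by (simp add: var_fract_def mult_single flip: to_fract_mult)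
qed simp

lemma monomial_var_fract: "monomial var_fract m = to_fract (single m (1 :: 'a::field))"
proof -
  have step: "finite I \<Longrightarrow> (\<Prod>i\<in>I. var_fract i ^ lookup m i) = to_fract (single (\<Sum>i\<in>I. single i (lookup m i)) (1 :: 'a))" for I
    by (induction I rule: finite_induct) (simp_all add: var_fract_power mult_single flip: to_fract_mult)
  have "(\<Sum>i\<in>keys m. single i (lookup m i)) = m" by (rule mpoly_as_sum[symmetric])
  then show ?thesis unfolding monomial_def using step[OF finite_keys[of m]] by metis
qed

lemma var_fract_independent: "alg_independent (range const_fract) n (var_fract :: nat \<Rightarrow> ((nat \<Rightarrow>\<^sub>0 nat) \<Rightarrow>\<^sub>0 'a::field) fract)"
  unfolding alg_independent_iff
proof (intro ballI impI)
  fix p :: "(nat \<Rightarrow>\<^sub>0 nat) \<Rightarrow>\<^sub>0 ((nat \<Rightarrow>\<^sub>0 nat) \<Rightarrow>\<^sub>0 'a) fract"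
  assume p: "p \<in> mpolys (range const_fract) n" "mpoly_eval p var_fract = 0"
  have "\<forall>m. \<exists>a. lookup p m = const_fract a" using mpolys_lookup[OF p(1)] by blast
  from choice[OF this] obtain a where a: "\<And>m. lookup p m = const_fract (a m)" by blast
  have "0 = (\<Sum>m\<in>keys p. const_fract (a m) * monomial var_fract m)"
    using p(2) unfolding mpoly_eval_def monomial_def a by simp
  also have "\<dots> = to_fract (\<Sum>m\<in>keys p. single m (a m))"
    by (simp add: const_fract_def monomial_var_fract mult_single flip: to_fract_mult)
  finally have s: "(\<Sum>m\<in>keys p. single m (a m)) = 0" by (metis to_fract_eq_0_iff)
  have "keys p = {}"
  proof (rule ccontr)
    assume "keys p \<noteq> {}"
    then obtain m where m: "m \<in> keys p" by blast
    then have "a m = 0" using lookup_sum_single[OF finite_keys, of id p m a] s by simp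
    then have "lookup p m = 0" using a const_fract.hom_0 by simp
    then show False using m by (simp add: in_keys_iff)
  qed
  then show "p = 0" by simp
qed

text \<open>With the denominators of the \<open>b i\<close> cleared, the relation says that a
  polynomial over \<open>C\<close> vanishes at the independent \<open>y\<close>, so all its
  coefficients are zero. The coefficient at a monomial occurring in some \<open>p i\<close> is a
  nontrivial combination of the \<open>c i\<close> over \<open>K\<close>.\<close>

lemma linearly_disjoint:
  assumes C: "subfield C amb" and K: "subfield K amb" "K \<subseteq> C" and y: "alg_independent C n y"
    and I: "finite I" "\<And>i. i \<in> I \<Longrightarrow> c i \<in> C" "\<And>i. i \<in> I \<Longrightarrow> b i \<in> adjoin K (y ` {..<n})"
    and s: "(\<Sum>i\<in>I. c i * b i) = 0" "\<exists>i\<in>I. b i \<noteq> 0"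
  shows "\<exists>k. (\<forall>i\<in>I. k i \<in> K) \<and> (\<exists>i\<in>I. k i \<noteq> 0) \<and> (\<Sum>i\<in>I. k i * c i) = 0"
proof -
  let ?V = "(\<lambda>p. mpoly_eval p y) ` mpolys K n"
  have mult: "a * b \<in> ?V" if ab: "a \<in> ?V" "b \<in> ?V" for a b
  proof -
    obtain p q where pq: "p \<in> mpolys K n" "q \<in> mpolys K n" "a = mpoly_eval p y" "b = mpoly_eval q y" using ab by blast
    obtain r where "r \<in> mpolys K n" "mpoly_eval r y = mpoly_eval p y * mpoly_eval q y"
      using mpoly_values_mult[OF K(1) pq(1,2)] by blast
    then show ?thesis using pq by (intro image_eqI[of _ _ r]) auto
  qed
  have "\<exists>d\<in>?V. d \<noteq> 0 \<and> (\<forall>i\<in>I. b i * d \<in> ?V)"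
    using I(1,3)
  proof (induction I rule: finite_induct)
    case empty
    have "mpoly_eval (single 0 1) y \<in> ?V" using K(1) by (intro imageI mpolys_single) auto
    moreover have "mpoly_eval (single 0 1) y = 1" unfolding mpoly_eval_single by simp
    ultimately have "1 \<in> ?V" by metis
    then show ?case by (intro bexI[of _ 1]) auto
  next
    case (insert i I)
    then obtain d where d: "d \<in> ?V" "d \<noteq> 0" "\<And>i. i \<in> I \<Longrightarrow> b i * d \<in> ?V" by auto
    obtain p q where pq: "p \<in> ?V" "q \<in> ?V" "q \<noteq> 0" "b i = p / q"
      using adjoin_mpoly[OF K(1), of y n] insert.prems[of i] by fastforce
    have "b j * (d * q) \<in> ?V" if "j \<in> insert i I" for j
    proof (cases "j = i")
      case True
      then have "b j * (d * q) = p * d" using pq(3,4) by simp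
      then show ?thesis using mult[OF pq(1) d(1)] by metis
    next
      case False
      then have "b j * d * q \<in> ?V" using that by (intro mult d(3) pq(2)) auto
      then show ?thesis by (metis mult.assoc)
    qed
    then show ?case using mult[OF d(1) pq(2)] d(2) pq(3) by (intro bexI[of _ "d * q"]) auto
  qed
  then obtain d where d: "d \<noteq> 0" "\<And>i. i \<in> I \<Longrightarrow> b i * d \<in> ?V" by blast
  then have "\<forall>i\<in>I. \<exists>p. p \<in> mpolys K n \<and> b i * d = mpoly_eval p y" by blast
  from bchoice[OF this] obtain p where p: "\<And>i. i \<in> I \<Longrightarrow> p i \<in> mpolys K n" "\<And>i. i \<in> I \<Longrightarrow> b i * d = mpoly_eval (p i) y"
    by blast
  define P where "P = (\<Sum>i\<in>I. \<Sum>m\<in>keys (p i). single m (c i * lookup (p i) m))"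
  have km: "keys m \<subseteq> {..<n}" if "i \<in> I" "m \<in> keys (p i)" for i m
    using p(1)[OF that(1)] that(2) mpolys_keys by blast
  have "c i * lookup (p i) m \<in> C" if "i \<in> I" for i m
    using C I(2)[OF that] mpolys_lookup[OF p(1)[OF that], of m] K(2) by auto
  then have "P \<in> mpolys C n" unfolding P_def using C km by simp
  moreover have "mpoly_eval P y = (\<Sum>i\<in>I. c i * mpoly_eval (p i) y)"
    unfolding P_def mpoly_eval_sum mpoly_eval_single
    by (simp add: mpoly_eval_def monomial_def sum_distrib_left mult.assoc)
  moreover have "\<dots> = (\<Sum>i\<in>I. c i * b i) * d"
    unfolding sum_distrib_right by (intro sum.cong refl) (simp add: p(2)[symmetric])
  ultimately have P0: "P = 0" using y s(1) unfolding alg_independent_iff by simp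
  have lk: "lookup P m = (\<Sum>i\<in>I. lookup (p i) m * c i)" for m
  proof -
    have "lookup (\<Sum>k\<in>keys (p i). single k (c i * lookup (p i) k)) m = lookup (p i) m * c i" for i
    proof (cases "m \<in> keys (p i)")
      case True
      then show ?thesis using lookup_sum_single[OF finite_keys, of id "p i" m "\<lambda>k. c i * lookup (p i) k"] by (simp add: mult.commute)
    next
      case False
      then have "lookup (\<Sum>k\<in>keys (p i). single k (c i * lookup (p i) k)) m = 0"
        unfolding lookup_sum by (intro sum.neutral) (auto simp: lookup_single when_def)
      then show ?thesis using False by (simp add: in_keys_iff)
    qed
    then show ?thesis unfolding P_def by (simp add: lookup_sum)
  qed
  obtain i where i: "i \<in> I" "b i \<noteq> 0" using s(2) by blast
  then have "mpoly_eval (p i) y \<noteq> 0" using p(2)[of i] d(1) by (metis mult_eq_0_iff)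
  then have "p i \<noteq> 0" by auto
  then obtain m where "lookup (p i) m \<noteq> 0" by (metis poly_mapping_eqI lookup_zero)
  then show ?thesis using i(1) lk[of m] P0 mpolys_lookup[OF p(1)]
    by (intro exI[of _ "\<lambda>i. lookup (p i) m"]) auto
qed

section \<open>The immediate extension of the algebraic closure\<close>

lemma field_hom_comp: "field_hom K \<iota> \<Longrightarrow> field_hom UNIV \<phi> \<Longrightarrow> field_hom K (\<phi> \<circ> \<iota>)"
proof (rule field_hom.intro)
  assume "field_hom K \<iota>" "field_hom UNIV \<phi>"
  then interpret i: field_hom K \<iota> + p: field_hom UNIV \<phi> .
  show "\<phi> \<circ> \<iota> \<in> ring_hom (amb\<lparr>carrier := K\<rparr>) amb"
    by (rule ring_hom_memI) (simp_all add: i.hom_add i.hom_mult p.hom_add p.hom_mult)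
qed (simp add: field_hom_def)

lemma tind_antimono: "tind L n x \<Longrightarrow> K \<subseteq> L \<Longrightarrow> tind K n x"
  unfolding tind_def using alg_mono[OF _ adjoin_mono[OF _ order.refl]] by blast

lemma (in valued) residues_algebraic_of_trdeg_0:
  assumes K: "subfield K amb" "K \<subseteq> F" and 0: "trdeg (res K) (res F) = 0" and b: "b \<in> res F"
  shows "alg (res K) b"
proof (rule ccontr)
  assume "\<not> alg (res K) b"
  moreover have sK: "subfield (res K) amb" by (rule res_subfield[OF K])
  ultimately have "tind (res K) 1 (\<lambda>_. b)" by (simp add: tind_def adjoin_eq_base)
  then have "enat 1 \<le> trdeg (res K) (res F)" using b by (intro trdeg_ge[OF sK]) auto
  then show False using 0 by (simp add: zero_enat_def)
qed

text \<open>The embedding \<open>e\<close> of value groups is additive, hence fixes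
  \<open>0\<close>, and being strictly increasing it preserves signs.\<close>

lemma extends_valuation_nonneg_iff:
  assumes "extends_valuation \<iota> K v w" "valued_field F v" "subfield K amb" "K \<subseteq> F" "a \<in> K" "a \<noteq> 0"
  shows "0 \<le> w (\<iota> a) \<longleftrightarrow> 0 \<le> v a"
proof -
  obtain e where e: "\<And>g h. g \<in> value_set v K \<Longrightarrow> h \<in> value_set v K \<Longrightarrow> e (g + h) = e g + e h"
    "strict_mono_on (value_set v K) e" "\<And>a. a \<in> K - {0} \<Longrightarrow> w (\<iota> a) = e (v a)"
    using assms(1) by (auto simp: extends_valuation_def)
  have one: "1 \<in> K" "1 \<in> F" using assms(3,4) by auto
  then have "v (1 * 1) = v 1 + v 1" using assms(2) by (metis DiffI singletonD valued_field_def zero_neq_one)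
  then have v1: "v 1 = 0" by simp
  then have 0: "0 \<in> value_set v K" using one unfolding value_set_def by force
  then have e0: "e 0 = 0" using e(1)[OF 0 0] by simp
  have va: "v a \<in> value_set v K" using assms(5,6) unfolding value_set_def by blast
  have "e 0 \<le> e (v a) \<longleftrightarrow> 0 \<le> v a"
    using strict_mono_onD[OF e(2) 0 va] strict_mono_onD[OF e(2) va 0] by (metis leD leI order.strict_iff_order)
  then show ?thesis using e(3)[of a] assms(5,6) e0 by simp
qed

text \<open>The closure is embedded as the constants, and \<open>F\<close> by sending
  \<open>x i\<close> to the \<open>i\<close>-th variable, compatibly on \<open>K\<close>. The
  variables are independent over the constants, which gives linear disjointness over the image of
  \<open>K\<close> and the transcendence degree \<open>n\<close> of \<open>L\<close>.\<close>

lemma (in valued) immediate_extension_of_closure: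
  fixes \<iota> :: "'f \<Rightarrow> 'c::field" and w :: "'c \<Rightarrow> 'h::linordered_ab_group_add" and \<sigma> :: "'c \<Rightarrow> 's::field"
  assumes K: "subfield K amb" and rff: "rational_function_field K n x F"
    and rank: "rational_rank (value_quotient v F K) = 0" "trdeg (res K) (res F) = 0"
    and \<iota>: "\<iota> \<in> ring_hom (amb\<lparr>carrier := K\<rparr>) amb" "algebraic_closure amb (\<iota> ` K)"
    and w: "valued_field UNIV w" "extends_valuation \<iota> K v w" "residue_map w UNIV \<sigma>"
  shows "has_immediate_extension w \<sigma> n"
proof -
  let ?j = "const_fract :: 'c \<Rightarrow> _" and ?X = "var_fract :: nat \<Rightarrow> ((nat \<Rightarrow>\<^sub>0 nat) \<Rightarrow>\<^sub>0 'c) fract"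
  interpret W: valued UNIV w \<sigma> by (rule valued.intro[OF w(1,3)])
  interpret i: field_hom K \<iota> by (rule field_hom.intro[OF K \<iota>(1)])
  have ji: "field_hom K (?j \<circ> \<iota>)" by (rule field_hom_comp[OF i.field_hom_axioms const_fract_hom])
  have F: "F = adjoin K (x ` {..<n})" "tind K n x"
    using rff alg_independent_iff_tind[OF K] by (auto simp: rational_function_field_def)
  have KF: "K \<subseteq> F" unfolding F(1) by (rule adjoin_base)
  define C where "C = range ?j"
  define K0 where "K0 = (?j \<circ> \<iota>) ` K"
  have C: "subfield C amb" unfolding C_def by (rule const_fract.hom_subfield) (auto intro: const_fract.F)
  have K0C: "K0 \<subseteq> C" by (auto simp: K0_def C_def)
  have X: "alg_independent C n ?X" unfolding C_def by (rule var_fract_independent)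
  then have tX: "tind C n ?X" by (simp add: alg_independent_iff_tind[OF C])
  obtain \<phi> where "field_hom (adjoin K (x ` {..<n})) \<phi>" and \<phi>: "\<And>c. c \<in> K \<Longrightarrow> \<phi> c = ?j (\<iota> c)" "\<And>i. i < n \<Longrightarrow> \<phi> (x i) = ?X i"
    using field_hom_extension[OF ji F(2) tind_antimono[OF tX K0C, unfolded K0_def]] by auto
  then have pF: "field_hom F \<phi>" by (simp add: F(1))
  interpret p: field_hom F \<phi> by (rule pF)
  have K0: "\<phi> ` K = K0" using \<phi>(1) by (auto simp: K0_def image_iff)
  have sK0: "subfield K0 amb" unfolding K0[symmetric] by (rule p.hom_subfield[OF K KF])
  define D where "D = \<phi> ` F"
  have D: "subfield D amb" unfolding D_def by (rule p.hom_subfield) auto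
  have K0D: "K0 \<subseteq> D" unfolding D_def K0[symmetric] using KF by blast
  have "x i \<in> F" if "i < n" for i using that adjoin_gen[of "x ` {..<n}" K] unfolding F(1) by blast
  then have XD: "?X ` {..<n} \<subseteq> D" unfolding D_def using \<phi>(2) by (metis (no_types, lifting) image_eqI image_subsetI lessThan_iff)
  have "\<phi> ` (x ` {..<n}) = ?X ` {..<n}" using \<phi>(2) by (auto simp: image_image)
  then have DX: "D \<subseteq> adjoin K0 (?X ` {..<n})" using p.image_adjoin[OF F(1)] unfolding D_def K0 by simp
  define L where "L = adjoin C (?X ` {..<n})"
  have CL: "C \<subseteq> L" unfolding L_def by (rule adjoin_base)
  have DL: "D \<subseteq> L" using DX adjoin_mono[OF K0C order.refl] unfolding L_def by blast
  let ?g = "inv_into F \<phi>" and ?h = "inv_into UNIV ?j"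
  note vD = valued_image[OF pF] and vC = W.valued_image[OF const_fract_hom]
  have K0E: "\<exists>k\<in>K. a = \<phi> k \<and> a = ?j (\<iota> k)" if "a \<in> K0" for a using that \<phi>(1) by (auto simp: K0_def)
  interpret compositum C D "w \<circ> ?h" "v \<circ> ?g" "\<sigma> \<circ> ?h" "\<pi> \<circ> ?g" K0 L
  proof (intro compositum.intro compositum_axioms.intro)
    show "valued C (w \<circ> ?h) (\<sigma> \<circ> ?h)" "valued D (v \<circ> ?g) (\<pi> \<circ> ?g)" unfolding C_def D_def by (rule vC(1), rule vD(1))
    show "subfield K0 amb" "K0 \<subseteq> C" "K0 \<subseteq> D" by fact+
    show "subfield L amb" "C \<subseteq> L" "D \<subseteq> L" by (simp add: L_def, fact+)
  next
    fix a assume a: "a \<in> K0" "a \<noteq> 0"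
    then obtain k where k: "k \<in> K" "a = \<phi> k" "a = ?j (\<iota> k)" using K0E by blast
    then have "k \<noteq> 0" using a(2) by auto
    moreover have "?h a = \<iota> k" unfolding k(3) by (rule vC(4)) simp
    moreover have "?g a = k" unfolding k(2) using k(1) KF by (intro vD(4)) auto
    ultimately show "0 \<le> (w \<circ> ?h) a \<longleftrightarrow> 0 \<le> (v \<circ> ?g) a"
      using extends_valuation_nonneg_iff[OF w(2) vf K KF k(1)] by simp
  next
    fix I :: "nat set" and c b
    assume "finite I" "\<And>i. i \<in> I \<Longrightarrow> c i \<in> C" "\<And>i. i \<in> I \<Longrightarrow> b i \<in> D" "(\<Sum>i\<in>I. c i * b i) = 0" "\<exists>i\<in>I. b i \<noteq> 0"
    then show "\<exists>k. (\<forall>i\<in>I. k i \<in> K0) \<and> (\<exists>i\<in>I. k i \<noteq> 0) \<and> (\<Sum>i\<in>I. k i * c i) = 0"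
      using DX by (intro linearly_disjoint[OF C sK0 K0C X, of I c b]) auto
  next
    fix a assume a: "a \<in> D" "a \<noteq> 0"
    then obtain f where f: "f \<in> F" "a = \<phi> f" by (auto simp: D_def)
    then have "f \<noteq> 0" using a(2) by auto
    then obtain e c where e: "e \<ge> 1" "c \<in> K" "c \<noteq> 0" "v (c * f ^ e) = 0"
      using torsion_of_rank_0[OF K KF rank(1) f(1)] by blast
    have c: "c \<in> F" using e(2) KF by blast
    have "\<phi> c * a ^ e = \<phi> (c * f ^ e)" using c f by (simp add: p.hom_mult p.hom_power)
    moreover have "?g (\<phi> (c * f ^ e)) = c * f ^ e" using c f by (intro vD(4)) simp
    ultimately have "(v \<circ> ?g) (\<phi> c * a ^ e) = 0" using e(4) by simp
    moreover have "\<phi> c \<in> K0 - {0}" using e(2,3) K0 c p.hom_eq_0_iff[of c] by blast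
    ultimately show "\<exists>e\<ge>1. \<exists>c\<in>K0 - {0}. (v \<circ> ?g) (c * a ^ e) = 0" using e(1) by blast
  next
    fix b assume "b \<in> valuation_ring (v \<circ> ?g) D"
    then obtain f where f: "f \<in> R" "b = \<phi> f" unfolding D_def vD(2)[OF order.refl] by blast
    then have "?g b = f" using vD(4)[of f] RF by simp
    moreover have "alg (res K) (\<pi> f)"
      using resI[OF RF[OF f(1)] f(1)] by (rule residues_algebraic_of_trdeg_0[OF K KF rank(2)])
    ultimately show "alg (residue_field (v \<circ> ?g) (\<pi> \<circ> ?g) K0) ((\<pi> \<circ> ?g) b)"
      unfolding K0[symmetric] vD(3)[OF KF] by simp
  next
    fix p :: "((nat \<Rightarrow>\<^sub>0 nat) \<Rightarrow>\<^sub>0 'c) fract poly"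
    assume p: "p \<in> polys C" "1 \<le> Polynomial.degree p"
    \<comment> \<open>Roots are found in the closure itself, so \<open>p\<close> is pulled back
      along the embedding of the constants.\<close>
    define q where "q = map_poly ?h p"
    have h: "?j (?h a) = a" if "a \<in> C" for a using that unfolding C_def by (rule f_inv_into_f)
    have h0: "?h 0 = 0" using vC(4)[of 0] by simp
    have pq: "p = map_poly ?j q"
      using h polys_coeff[OF p(1)] h0 by (intro poly_eqI) (simp add: q_def coeff_map_poly)
    have qU: "q \<in> polys UNIV" by (simp add: polys_def)
    have "poly.coeff q (Polynomial.degree p) \<noteq> 0"
    proof
      assume "poly.coeff q (Polynomial.degree p) = 0"
      then have "poly.coeff p (Polynomial.degree p) = 0" using pq by (metis coeff_map_poly const_fract.hom_0)
      then show False using p(2) by auto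
    qed
    then have "1 \<le> Polynomial.degree q" using p(2) le_degree by (meson le_trans)
    then obtain a where "poly q a = 0" using algebraic_closure_root[OF \<iota>(2)] by blast
    then have "poly p (?j a) = 0" using const_fract.hom_poly[OF qU, of a] pq by simp
    then show "\<exists>a\<in>C. poly p a = 0" unfolding C_def by blast
  next
    fix f assume f: "f \<in> L"
    \<comment> \<open>Constants are algebraic over the image of \<open>K\<close>, which lies in
      \<open>D\<close>, and the variables lie in \<open>D\<close>.\<close>
    have "alg D d" if "d \<in> C \<union> ?X ` {..<n}" for d
      using that
    proof
      assume "d \<in> C"
      then obtain c where c: "d = ?j c" by (auto simp: C_def)
      have sK: "subfield (\<iota> ` K) amb" by (rule i.hom_subfield[OF K order.refl])
      have "(ring.algebraic amb over (\<iota> ` K)) c"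
        using algebraic_closure.algebraic_extension[OF \<iota>(2), of c] by simp
      then have "alg (\<iota> ` K) c" by (simp add: over_def algebraic_amb_iff[OF sK])
      then have "alg (?j ` \<iota> ` K) d" unfolding c by (intro const_fract.alg_image) auto
      then show ?thesis using K0D by (auto simp: K0_def image_comp intro: alg_mono)
    qed (use XD D in \<open>auto intro: alg_base\<close>)
    moreover have "f \<in> adjoin D (C \<union> ?X ` {..<n})"
    proof -
      have g: "C \<union> ?X ` {..<n} \<subseteq> adjoin D (C \<union> ?X ` {..<n})" by (rule adjoin_gen)
      have "L \<subseteq> adjoin D (C \<union> ?X ` {..<n})"
        unfolding L_def by (rule adjoin_least[OF adjoin_subfield]) (use g in blast)+
      then show ?thesis using f by blast
    qed
    ultimately show "alg D f" by (rule alg_adjoin[OF D])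
  qed
  obtain w' :: "_ \<Rightarrow> 'h" and \<pi>' :: "_ \<Rightarrow> 's" where w': "valued_field L w'" "residue_map w' L \<pi>'"
    "\<forall>a\<in>C - {0}. w' a = (w \<circ> ?h) a" "\<forall>a\<in>C.R. \<pi>' a = (\<sigma> \<circ> ?h) a" "immediate w' \<pi>' C L"
    using immediate_on_compositum by blast
  have h: "?h (?j a) = a" for a by (rule vC(4)) simp
  have "w' (?j a) = w a" if "a \<noteq> 0" for a
  proof -
    have "?j a \<in> C - {0}" using that const_fract.hom_eq_0_iff[of a] by (simp add: C_def)
    then show ?thesis using w'(3) h by simp
  qed
  moreover have "\<pi>' (?j a) = \<sigma> a" if "a \<in> valuation_ring w UNIV" for a
  proof -
    have "?j a \<in> valuation_ring (w \<circ> ?h) C" unfolding C_def vC(2)[OF order.refl] using that by blast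
    then show ?thesis using w'(4) h by simp
  qed
  moreover have "?j \<in> ring_hom amb amb" using const_fract.hom by (simp add: ring_of_type_algebra_def)
  moreover have "trdeg C L = enat n"
  proof (rule antisym)
    have "trdeg C L \<le> enat (card (?X ` {..<n}))"
      unfolding L_def by (rule trdeg_adjoin_le[OF C]) (auto intro: alg_base)
    also have "\<dots> \<le> enat n" using card_image_le[of "{..<n}" ?X] by simp
    finally show "trdeg C L \<le> enat n" .
    show "enat n \<le> trdeg C L" unfolding L_def by (rule trdeg_ge[OF C adjoin_gen tX])
  qed
  ultimately show ?thesis
    using w'(1,2,5) CL unfolding has_immediate_extension_def C_def
    by (intro exI[of _ ?j] exI[of _ L] exI[of _ w'] exI[of _ \<pi>']) blast
qed

theorem theorem1p7:
  fixes K F :: "'f::field set"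
    and n :: nat
    and x :: "nat \<Rightarrow> 'f"
    and v :: "'f \<Rightarrow> 'g::linordered_ab_group_add"
    and \<pi> :: "'f \<Rightarrow> 'r::field"
    and \<rho> \<tau> :: enat
  assumes "n \<ge> 1"
    and "subfield K amb"
    and "rational_function_field K n x F"
    and "valued_field F v"
    and "residue_map v F \<pi>"
  defines "Kv \<equiv> residue_field v \<pi> K"
    and "Fv \<equiv> residue_field v \<pi> F"
  defines "\<rho> \<equiv> rational_rank (value_quotient v F K)"
    and "\<tau> \<equiv> trdeg Kv Fv"
  shows "enat n \<ge> \<rho> + \<tau> \<and>
    countable (carrier (value_quotient v F K)) \<and>
    countably_generated_ext Kv Fv \<and>
    (enat n = \<rho> + \<tau> \<longrightarrow>
       finitely_generated_group (value_quotient v F K) \<and>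
       finitely_generated_ext Kv Fv \<and>
       ((\<forall>a\<in>K - {0}. v a = 0) \<and> \<rho> = 1 \<longrightarrow>
          (\<exists>t y R a. \<tau> = enat t \<and> rational_function_field Kv t y R \<and>
             ring.algebraic amb R a \<and> Fv = adjoin R {a}) \<or>
          (\<exists>E y. finitely_generated_ext Kv E \<and> trdeg Kv E + 1 = \<tau> \<and>
             rational_function_field E 1 y Fv)) \<and>
       (enat n = \<tau> \<longrightarrow>
          (\<exists>E y. finitely_generated_ext Kv E \<and> trdeg Kv E + 1 = \<tau> \<and>
             rational_function_field E 1 y Fv))) \<and>
    (\<rho> = 0 \<and> \<tau> = 0 \<longrightarrow>
       (\<forall>(\<iota> :: 'f \<Rightarrow> 'a::field) (w :: 'a \<Rightarrow> 'h::linordered_ab_group_add) (\<sigma> :: 'a \<Rightarrow> 's::field).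
          \<iota> \<in> ring_hom (amb\<lparr>carrier := K\<rparr>) amb \<and>
          algebraic_closure amb (\<iota> ` K) \<and>
          valued_field UNIV w \<and> extends_valuation \<iota> K v w \<and>
          residue_map w UNIV \<sigma> \<longrightarrow>
          has_immediate_extension w \<sigma> n))"
proof -
  interpret valued F v \<pi> by (rule valued.intro[OF assms(4,5)])
  note s = structure_of_extension[OF assms(1-3)]
  show ?thesis
    unfolding \<rho>_def \<tau>_def Kv_def Fv_def
  proof (intro conjI impI allI)
    fix \<iota> :: "'f \<Rightarrow> 'a" and w :: "'a \<Rightarrow> 'h" and \<sigma> :: "'a \<Rightarrow> 's"
    assume "rational_rank (value_quotient v F K) = 0 \<and> trdeg (res K) (res F) = 0"
      "\<iota> \<in> ring_hom (amb\<lparr>carrier := K\<rparr>) amb \<and> algebraic_closure amb (\<iota> ` K) \<and> valued_field UNIV w \<and>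
        extends_valuation \<iota> K v w \<and> residue_map w UNIV \<sigma>"
    then show "has_immediate_extension w \<sigma> n"
      by (elim conjE) (rule immediate_extension_of_closure[OF assms(2,3)])
  qed (use s in blast)+
qed

end
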